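(* Let $p\ge 1$ and $n_1,\dots,n_p\ge 1$ be integers, $N:=\prod_{i=1}^p n_i$, $n:=\sum_{i=1}^p n_i$, and $V:=\mathbb{R}^{n_1}\otimes\cdots\otimes\mathbb{R}^{n_p}$. Let $X\subset V$ be the manifold of non-zero rank-one tensors. Suppose that $v\in V$ is drawn from the standard multivariate Gaussian distribution with density $$\omega(v)=\frac{1}{(2\pi)^{N/2}}e^{-(\sum_\alpha v_\alpha^2)/2},$$ where $\alpha$ runs over $\{1,\dots,n_1\}\times\cdots\times\{1,\dots,n_p\}$. Then the expected number of critical points on $X$ of the function $d_v(x)=\sum_\alpha (v_\alpha-x_\alpha)^2$ equals $$\frac{(2\pi)^{p/2}}{2^{n/2}}\,\frac{1}{\prod_{i=1}^p\Gamma\left(\frac{n_i}{2}\right)}\int_{W_1}|\det C(w_1)|\,d\mu_{W_1}.$$ Here $W_1$ is the real vector space of dimension $1+\sum_{i<j}(n_i-1)(n_j-1)$ with coordinates $w_0\in\mathbb{R}$ and $C_{i,j}\in\mathbb{R}^{(n_i-1)\times(n_j-1)}$ for $1\le i<j\le p$; for $w_1=(w_0,(C_{i,j})_{i<j})\in W_1$, $C(w_1)$ is the symmetric $(n-p)\times(n-p)$ matrix of block shape $$C(w_1)=\begin{bmatrix} w_0I_{n_1-1} & C_{1,2} & \cdots & C_{1,p}\\ C_{1,2}^T & w_0I_{n_2-1} & \cdots & C_{2,p}\\ \vdots&\vdots&&\vdots\\ C_{1,p}^T & C_{2,p}^T&\cdots& w_0I_{n_p-1}\end{bmatrix};$$ and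 $\mu_{W_1}$ is the probability measure on $W_1$ making $w_0$ and all the entries of the matrices $C_{i,j}$ ($i<j$) into independent standard normal variables.
   Context: A rank-one tensor is one of the form $x_1\otimes\cdots\otimes x_p$ with $x_i\in\mathbb{R}^{n_i}$; $X$ is the set of those that are non-zero, which is a smooth submanifold of $V$. A point $x\in X$ is a critical point of $d_v$ on $X$ if $v-x\perp T_xX$ with respect to the standard inner product on $V$ (in which the coordinates $v_\alpha$ are with respect to an orthonormal basis). The expected number is $\int_V \#\{\text{critical points of } d_v \text{ on } X\}\,\omega(v)\,dv$. $\Gamma$ is Euler's gamma function. The determinant of a $0\times 0$ matrix is $1$. *)

theory Defs
  imports "HOL-Probability.Probability" "Jordan_Normal_Form.Determinant"
begin

text \<open>
  A format is given by \<open>p\<close> and \<open>n 1, \<dots>, n p\<close>; the values of \<open>n\<close> outside \<open>{1..p}\<close> are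
  irrelevant.  A tensor is its coordinate array, a function on multi-indices that is
  \<open>undefined\<close> outside the finite index set, so that the tensors form the space of the product
  measure \<open>\<Pi>\<^sub>M \<alpha>\<in>multi_index p n. lborel\<close>.
\<close>

definition multi_index :: "nat \<Rightarrow> (nat \<Rightarrow> nat) \<Rightarrow> (nat \<Rightarrow> nat) set" where
  "multi_index p n = (\<Pi>\<^sub>E i\<in>{1..p}. {1..n i})"

type_synonym tensor = "(nat \<Rightarrow> nat) \<Rightarrow> real"

definition tensor_space :: "nat \<Rightarrow> (nat \<Rightarrow> nat) \<Rightarrow> tensor set" where
  "tensor_space p n = (\<Pi>\<^sub>E \<alpha>\<in>multi_index p n. UNIV)"

definition tensor_inner :: "nat \<Rightarrow> (nat \<Rightarrow> nat) \<Rightarrow> tensor \<Rightarrow> tensor \<Rightarrow> real" where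
  "tensor_inner p n u v = (\<Sum>\<alpha>\<in>multi_index p n. u \<alpha> * v \<alpha>)"

text \<open>The vector \<open>x i\<close> has coordinates \<open>x i 1, \<dots>, x i (n i)\<close>; other values are not used.\<close>

definition rank_one :: "nat \<Rightarrow> (nat \<Rightarrow> nat) \<Rightarrow> (nat \<Rightarrow> nat \<Rightarrow> real) \<Rightarrow> tensor" where
  "rank_one p n x = (\<lambda>\<alpha>\<in>multi_index p n. \<Prod>i=1..p. x i (\<alpha> i))"

definition rank_one_manifold :: "nat \<Rightarrow> (nat \<Rightarrow> nat) \<Rightarrow> tensor set" where
  "rank_one_manifold p n = range (rank_one p n) - {\<lambda>\<alpha>\<in>multi_index p n. 0}"

definition smooth_near_0 :: "real \<Rightarrow> (real \<Rightarrow> real) \<Rightarrow> bool" where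
  "smooth_near_0 e f \<longleftrightarrow>
     (\<forall>k. \<forall>t\<in>{-e<..<e}. (deriv ^^ k) f differentiable (at t))"

text \<open>
  The tangent space at \<open>x\<close> of a smooth submanifold \<open>X\<close>: the velocities at time \<open>0\<close> of the
  smooth curves in \<open>X\<close> that pass through \<open>x\<close> at time \<open>0\<close>.
\<close>

definition tangent_space ::
    "nat \<Rightarrow> (nat \<Rightarrow> nat) \<Rightarrow> tensor set \<Rightarrow> tensor \<Rightarrow> tensor set" where
  "tangent_space p n X x =
     {u \<in> tensor_space p n. \<exists>(\<gamma> :: real \<Rightarrow> tensor) e. e > 0 \<and> \<gamma> 0 = x \<and>
        (\<forall>t\<in>{-e<..<e}. \<gamma> t \<in> X) \<and>
        (\<forall>\<alpha>\<in>multi_index p n. smooth_near_0 e (\<lambda>t. \<gamma> t \<alpha>)) \<and>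
        (\<forall>\<alpha>\<in>multi_index p n. u \<alpha> = deriv (\<lambda>t. \<gamma> t \<alpha>) 0)}"

text \<open>
  The critical points on \<open>X\<close> of the squared distance \<open>d_v\<close>: \<open>v - x\<close> is orthogonal to the
  tangent space of \<open>X\<close> at \<open>x\<close>.
\<close>

definition critical_points ::
    "nat \<Rightarrow> (nat \<Rightarrow> nat) \<Rightarrow> tensor set \<Rightarrow> tensor \<Rightarrow> tensor set" where
  "critical_points p n X v =
     {x \<in> X. \<forall>u\<in>tangent_space p n X x. tensor_inner p n (\<lambda>\<alpha>. v \<alpha> - x \<alpha>) u = 0}"

text \<open>
  The number of critical points as an extended number: \<open>\<infinity>\<close> if there are infinitely many,
  which does occur for exceptional \<open>v\<close>.
\<close>

definition num_critical_points :: "nat \<Rightarrow> (nat \<Rightarrow> nat) \<Rightarrow> tensor \<Rightarrow> ennreal" where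
  "num_critical_points p n v =
     emeasure (count_space UNIV) (critical_points p n (rank_one_manifold p n) v)"

definition gaussian_density :: "nat \<Rightarrow> (nat \<Rightarrow> nat) \<Rightarrow> tensor \<Rightarrow> real" where
  "gaussian_density p n v =
     1 / (2 * pi) powr (real (\<Prod>i=1..p. n i) / 2) *
     exp (- (\<Sum>\<alpha>\<in>multi_index p n. (v \<alpha>)\<^sup>2) / 2)"

definition gaussian_tensor :: "nat \<Rightarrow> (nat \<Rightarrow> nat) \<Rightarrow> tensor measure" where
  "gaussian_tensor p n =
     density (\<Pi>\<^sub>M \<alpha>\<in>multi_index p n. lborel) (\<lambda>v. ennreal (gaussian_density p n v))"

text \<open>
  A point of \<open>W\<^sub>1\<close> is a pair \<open>(w0, c)\<close>, where \<open>c (i, j, a, b)\<close> is the \<open>(a, b)\<close> entry of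
  \<open>C\<^sub>i\<^sub>,\<^sub>j\<close> for \<open>i < j\<close>.
\<close>

type_synonym w1_point = "real \<times> (nat \<times> nat \<times> nat \<times> nat \<Rightarrow> real)"

definition block_entries :: "nat \<Rightarrow> (nat \<Rightarrow> nat) \<Rightarrow> (nat \<times> nat \<times> nat \<times> nat) set" where
  "block_entries p n =
     {(i, j, a, b). 1 \<le> i \<and> i < j \<and> j \<le> p \<and> a \<in> {1..n i - 1} \<and> b \<in> {1..n j - 1}}"

definition mu_W1 :: "nat \<Rightarrow> (nat \<Rightarrow> nat) \<Rightarrow> w1_point measure" where
  "mu_W1 p n =
     density lborel (\<lambda>t. ennreal (std_normal_density t)) \<Otimes>\<^sub>M
     (\<Pi>\<^sub>M k\<in>block_entries p n. density lborel (\<lambda>t. ennreal (std_normal_density t)))"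

text \<open>
  Rows and columns of \<open>C(w\<^sub>1)\<close> are labelled by pairs (block \<open>i\<close>, position \<open>a\<close> inside the
  block), listed in lexicographic order.
\<close>

definition row_labels :: "nat \<Rightarrow> (nat \<Rightarrow> nat) \<Rightarrow> (nat \<times> nat) list" where
  "row_labels p n = concat (map (\<lambda>i. map (\<lambda>a. (i, a)) [1..<n i]) [1..<Suc p])"

lemma length_row_labels:
  assumes "\<And>i. i \<in> {1..p} \<Longrightarrow> n i \<ge> 1"
  shows "length (row_labels p n) = (\<Sum>i=1..p. n i) - p"
  using assms
proof (induction p)
  case (Suc p)
  have "p \<le> (\<Sum>i=1..p. n i)"
    using sum_bounded_below[of "{1..p}" 1 n] Suc.prems by simp
  moreover have "n (Suc p) \<ge> 1" using Suc.prems by simp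
  ultimately show ?case using Suc by (simp add: row_labels_def)
qed (simp add: row_labels_def)

fun block_matrix_entry :: "w1_point \<Rightarrow> nat \<times> nat \<Rightarrow> nat \<times> nat \<Rightarrow> real" where
  "block_matrix_entry (w0, c) (i, a) (j, b) =
     (if i = j then (if a = b then w0 else 0)
      else if i < j then c (i, j, a, b)
      else c (j, i, b, a))"

definition block_matrix :: "nat \<Rightarrow> (nat \<Rightarrow> nat) \<Rightarrow> w1_point \<Rightarrow> real mat" where
  "block_matrix p n w =
     (let m = (\<Sum>i=1..p. n i) - p in
      mat m m (\<lambda>(r, s). block_matrix_entry w (row_labels p n ! r) (row_labels p n ! s)))"

end

theory Submission
  imports Defs
begin

text \<open>
  In the chart where the entry at \<open>(1, \<dots>, 1)\<close> does not vanish, a non-zero rank-one tensor is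
  \<open>t u\<^sub>1 \<otimes> \<dots> \<otimes> u\<^sub>p\<close> with \<open>u\<^sub>i\<close> the normalisation of \<open>(1, y\<^sub>i)\<close>, and \<open>u\<^sub>i\<close> is the first column of an
  orthogonal matrix depending smoothly on \<open>y\<^sub>i\<close>.  It is critical for \<open>d_v\<close> iff the coordinates of \<open>v\<close>
  in the tensor product of these frames vanish at the multi-indices with exactly one entry
  different from 1, and equal \<open>t\<close> at \<open>(1, \<dots>, 1)\<close>.  So the critical points in the chart are the
  preimages of \<open>v\<close> under the map \<open>\<Phi>\<close> that sends the \<open>y\<^sub>i\<close> and the remaining coordinates \<open>w\<close> to \<open>v\<close>.
  The map \<open>\<Phi>\<close> is isometric in \<open>w\<close>, and in the rotated frame its derivative is block triangular
  with determinant \<open>\<plusminus>det C(-w\<^sub>0, (C\<^sub>i\<^sub>j)) \<Prod>\<^sub>i (1 + |y\<^sub>i|\<^sup>2) powr (-n\<^sub>i/2)\<close>.  The area formula for \<open>\<Phi>\<close> turns the expected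
  number of critical points into a product of Cauchy integrals in the \<open>y\<^sub>i\<close> and a Gaussian integral
  of \<open>|det C(w\<^sub>1)|\<close>.  Exchanging coordinates carries the other charts to this one, and the critical points
  outside of it then correspond to parameters in a union of coordinate hyperplanes, which contribute
  nothing.

  The dimension of the tensor space is a term, so the area formula is proved here for maps on
  the product measure spaces \<open>\<Pi>\<^sub>M i\<in>{..<m}. lborel\<close>, by induction on \<open>m\<close>.
\<close>

subsection \<open>Counting preimages\<close>

text \<open>Continuous images of Borel sets need not be Borel, which threatens the measurability of
  every count of preimages. All parameter sets are therefore sigma-compact: this class is stable
  under continuous images and under intersection with open and with closed sets, and it contains the
  loci that occur, where some continuous functions vanish and others do not. The area formula counts
  in [0, infinity] and gives no weight to zeros of the Jacobian, so exceptional \<open>v\<close>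
  with infinitely many critical points are absorbed by it. The matrix \<open>C\<close> comes from
  infinitesimal rotations. For \<open>v = P w\<close> with \<open>P\<close> orthogonal, a derivative
  in a direction coordinate of slot \<open>i\<close> becomes \<open>P^T (dP) w\<close> in the
  rotated frame, and \<open>P^T dP\<close> acts on slot \<open>i\<close> alone, by an antisymmetric
  matrix. In the row of a multi-index whose only entry different from 1 sits in slot
  \<open>j\<close>, it reaches in \<open>w\<close> the entry at (1, ..., 1) if \<open>i = j\<close>,
  and otherwise entries with two indices different from 1. Antisymmetry gives the two cases opposite
  signs, whence \<open>-w_0\<close> on the diagonal.\<close>

definition sigma_compact :: "'a::topological_space set \<Rightarrow> bool" where
  "sigma_compact S \<longleftrightarrow> (\<exists>K::nat \<Rightarrow> 'a set. (\<forall>n. compact (K n)) \<and> S = (\<Union>n. K n))"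

lemma compact_imp_sigma_compact: "compact K \<Longrightarrow> sigma_compact K"
  unfolding sigma_compact_def by (rule exI[of _ "\<lambda>_. K"]) auto

lemma sigma_compact_countable_Union:
  assumes "countable \<C>" "\<And>C. C \<in> \<C> \<Longrightarrow> sigma_compact C"
  shows "sigma_compact (\<Union>\<C>)"
proof (cases "\<C> = {}")
  case True
  then show ?thesis using compact_imp_sigma_compact[OF compact_empty] by simp
next
  case False
  obtain K where K: "\<And>C. C \<in> \<C> \<Longrightarrow> (\<forall>n::nat. compact (K C n)) \<and> C = (\<Union>n. K C n)"
    using assms(2) unfolding sigma_compact_def by metis
  define L where "L = (\<lambda>k. case prod_decode k of (i, n) \<Rightarrow> K (from_nat_into \<C> i) n)"
  have "compact (L k)" for k
    using K from_nat_into[OF False] by (auto simp: L_def split: prod.split)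
  moreover have "\<Union>\<C> = (\<Union>k. L k)"
  proof safe
    fix x C assume x: "C \<in> \<C>" "x \<in> C"
    then obtain n where "x \<in> K C n" using K by blast
    moreover obtain i where "C = from_nat_into \<C> i"
      using from_nat_into_surj[OF assms(1) x(1)] by metis
    ultimately have "x \<in> L (prod_encode (i, n))" by (simp add: L_def)
    then show "x \<in> (\<Union>k. L k)" by blast
  next
    fix x k assume "x \<in> L k"
    then obtain i n where "x \<in> K (from_nat_into \<C> i) n" by (auto simp: L_def split: prod.splits)
    moreover have "from_nat_into \<C> i \<in> \<C>" using False by (rule from_nat_into)
    ultimately show "x \<in> \<Union>\<C>" using K by blast
  qed
  ultimately show ?thesis unfolding sigma_compact_def by blast
qed

lemma sigma_compact_UN:
  fixes A :: "nat \<Rightarrow> 'a::topological_space set"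
  assumes "\<And>k. sigma_compact (A k)" shows "sigma_compact (\<Union>k. A k)"
  by (rule sigma_compact_countable_Union) (use assms in auto)

lemma sigma_compact_Int_closed:
  assumes "sigma_compact S" "closed T" shows "sigma_compact (S \<inter> T)"
proof -
  obtain K where K: "\<And>n::nat. compact (K n)" "S = (\<Union>n. K n)"
    using assms(1) unfolding sigma_compact_def by blast
  have "S \<inter> T = (\<Union>n. K n \<inter> T)" using K by blast
  then show ?thesis unfolding sigma_compact_def
    using compact_Int_closed[OF K(1) assms(2)] by (intro exI[of _ "\<lambda>n. K n \<inter> T"]) auto
qed

lemma open_as_Union_closed:
  fixes W :: "'a::metric_space set"
  assumes "open W"
  obtains T :: "nat \<Rightarrow> 'a set" where "\<And>n. closed (T n)" "W = (\<Union>n. T n)"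
\<comment> \<open>\<open>infdist\<close> to the empty set is 0 by convention, so the description of
  \<open>W\<close> by the distance to its complement fails for the whole space.\<close>
proof (cases "W = UNIV")
  case True
  then show ?thesis using that[of "\<lambda>_. UNIV"] by simp
next
  case False
  define T where "T n = {x. infdist x (- W) \<ge> inverse (real (Suc n))}" for n
  have c: "closed (T n)" for n
    unfolding T_def by (intro closed_Collect_le continuous_intros)
  have "W = (\<Union>n. T n)"
  proof safe
    fix x assume "x \<in> W"
    then have "infdist x (- W) > 0"
      using assms False by (metis Compl_UNIV_eq ComplD boolean_algebra.compl_zero closed_Compl double_complement in_closed_iff_infdist_zero infdist_nonneg less_eq_real_def)
    then obtain n where "inverse (real (Suc n)) < infdist x (- W)" using reals_Archimedean by blast
    then show "x \<in> (\<Union>n. T n)" by (auto simp: T_def intro!: exI[of _ n])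
  next
    fix x n assume "x \<in> T n"
    then have *: "infdist x (- W) > 0" by (auto simp: T_def intro: less_le_trans[rotated])
    show "x \<in> W"
    proof (rule ccontr)
      assume "x \<notin> W" then have "infdist x (- W) = 0" by (intro infdist_zero) auto
      with * show False by simp
    qed
  qed
  with c show ?thesis using that by blast
qed

lemma sigma_compact_Int_open:
  fixes S :: "'a::metric_space set"
  assumes "sigma_compact S" "open T" shows "sigma_compact (S \<inter> T)"
proof -
  obtain C :: "nat \<Rightarrow> 'a set" where C: "\<And>n. closed (C n)" "T = (\<Union>n. C n)"
    using open_as_Union_closed[OF assms(2)] by metis
  have "S \<inter> T = (\<Union>n. S \<inter> C n)" using C by blast
  also have "sigma_compact \<dots>" by (intro sigma_compact_UN sigma_compact_Int_closed assms C)
  finally show ?thesis .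
qed

lemma sigma_compact_Int_openin:
  fixes S :: "'a::metric_space set"
  assumes "sigma_compact S" "S \<subseteq> E" "openin (top_of_set E) T" shows "sigma_compact (S \<inter> T)"
proof -
  obtain W where "open W" "T = E \<inter> W" using assms(3) by (auto simp: openin_open)
  moreover from this have "S \<inter> T = S \<inter> W" using assms(2) by blast
  ultimately show ?thesis using sigma_compact_Int_open[OF assms(1)] by simp
qed

lemma sigma_compact_image:
  assumes "sigma_compact S" "continuous_on S f" shows "sigma_compact (f ` S)"
proof -
  obtain K where K: "\<And>n::nat. compact (K n)" "S = (\<Union>n. K n)"
    using assms(1) unfolding sigma_compact_def by blast
  have "f ` S = (\<Union>n. f ` K n)" using K by blast
  moreover have "compact (f ` K n)" for n
    using K assms(2) by (intro compact_continuous_image) (auto intro: continuous_on_subset)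
  ultimately show ?thesis unfolding sigma_compact_def by (intro exI[of _ "\<lambda>n. f ` K n"]) simp
qed

lemma sigma_compact_borel:
  fixes S :: "'a::t2_space set"
  assumes "sigma_compact S" shows "S \<in> sets borel"
proof -
  obtain K where K: "\<And>n::nat. compact (K n)" "S = (\<Union>n. K n)"
    using assms unfolding sigma_compact_def by blast
  show ?thesis unfolding K(2) using K(1)
    by (intro sets.countable_UN) (auto intro!: borel_closed compact_imp_closed)
qed

text \<open>The multiplicity function (Banach indicatrix) of \<open>F\<close> on \<open>B\<close>.
  Infinite fibres get the value infinity, so that the counts over disjoint pieces always add
  up.\<close>

definition count_preimages :: "('a \<Rightarrow> 'b) \<Rightarrow> 'a set \<Rightarrow> 'b \<Rightarrow> ennreal" where
  "count_preimages F B z = emeasure (count_space UNIV) {y \<in> B. F y = z}"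

text \<open>
  The count is the supremum, over the countably many finite disjoint families of basic open sets,
  of the number of members of the family whose image contains the point.
\<close>

lemma borel_measurable_count_preimages:
  fixes F :: "'a::{metric_space, second_countable_topology} \<Rightarrow> 'b::t2_space"
  assumes B: "sigma_compact B" and F: "continuous_on B F"
  shows "count_preimages F B \<in> borel_measurable borel"
proof -
  obtain \<B> :: "'a set set" where \<B>: "countable \<B>" "topological_basis \<B>"
    using ex_countable_basis by blast
  define \<D> where "\<D> = {D. finite D \<and> D \<subseteq> \<B> \<and> disjoint D}"
  have cD: "countable \<D>"
    unfolding \<D>_def by (rule countable_subset[OF _ countable_Collect_finite_subset[OF \<B>(1)]]) auto
  define g where "g D z = (\<Sum>V\<in>D. indicator (F ` (B \<inter> V)) z :: ennreal)" for D z
  \<comment> \<open>Disjoint sets whose images contain \<open>z\<close> supply distinct preimages of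
    \<open>z\<close>.\<close>
  have le: "g D z \<le> count_preimages F B z" if "D \<in> \<D>" for D z
  proof -
    define D' where "D' = {V \<in> D. z \<in> F ` (B \<inter> V)}"
    have fin: "finite D" "finite D'" using that by (auto simp: \<D>_def D'_def)
    obtain y where y: "\<And>V. V \<in> D' \<Longrightarrow> y V \<in> B \<inter> V \<and> F (y V) = z"
    proof -
      have "\<forall>V\<in>D'. \<exists>y. y \<in> B \<inter> V \<and> F y = z" by (auto simp: D'_def)
      then show ?thesis using that by metis
    qed
    have inj: "inj_on y D'"
    proof (rule inj_onI)
      fix V W assume VW: "V \<in> D'" "W \<in> D'" "y V = y W"
      show "V = W"
      proof (rule ccontr)
        assume "V \<noteq> W"
        then have "V \<inter> W = {}" using that VW by (auto simp: \<D>_def D'_def disjoint_def)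
        then show False using y VW by fastforce
      qed
    qed
    have "g D z = (\<Sum>V\<in>D. if V \<in> D' then 1 else 0)"
      unfolding g_def by (intro sum.cong) (auto simp: D'_def indicator_def)
    also have "\<dots> = of_nat (card D')"
    proof -
      have "D \<inter> {V. V \<in> D'} = D'" by (auto simp: D'_def)
      then show ?thesis using fin by (simp add: sum.If_cases)
    qed
    also have "\<dots> = of_nat (card (y ` D'))" using inj by (simp add: card_image)
    also have "\<dots> = emeasure (count_space UNIV) (y ` D')"
      using fin by (simp add: emeasure_count_space_finite)
    also have "\<dots> \<le> count_preimages F B z"
      unfolding count_preimages_def using y by (intro emeasure_mono) auto
    finally show ?thesis .
  qed
  \<comment> \<open>Conversely, finitely many preimages lie in pairwise disjoint basic open sets,
    one for each of them.\<close>
  have ge: "of_nat (card A) \<le> (SUP D\<in>\<D>. g D z)"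
    if A: "finite A" "A \<subseteq> {y \<in> B. F y = z}" for A z
  proof -
    obtain V where V: "\<And>x. x \<in> A \<Longrightarrow> V x \<in> \<B> \<and> x \<in> V x"
      "\<And>x y. x \<in> A \<Longrightarrow> y \<in> A \<Longrightarrow> x \<noteq> y \<Longrightarrow> V x \<inter> V y = {}"
    proof -
      obtain e where e: "e > 0" "\<And>x y. x \<in> A \<Longrightarrow> y \<in> A \<Longrightarrow> x \<noteq> y \<Longrightarrow> e \<le> dist x y"
      proof -
        \<comment> \<open>The element 1 keeps \<open>S\<close> non-empty, and its minimum
          meaningful, when \<open>A\<close> has at most one point.\<close>
        define S where "S = insert 1 ((\<lambda>(x, y). dist x y) ` {(x, y) \<in> A \<times> A. x \<noteq> y})"
        have "finite S" unfolding S_def using A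
          by (intro finite.insertI finite_imageI finite_subset[of "{(x, y) \<in> A \<times> A. x \<noteq> y}" "A \<times> A"]) auto
        moreover have "\<And>s. s \<in> S \<Longrightarrow> s > 0" by (auto simp: S_def)
        moreover have "S \<noteq> {}" by (simp add: S_def)
        ultimately have "Min S > 0" by simp
        moreover have "Min S \<le> dist x y" if "x \<in> A" "y \<in> A" "x \<noteq> y" for x y
          using \<open>finite S\<close> that by (intro Min_le) (auto simp: S_def)
        ultimately show ?thesis using that by blast
      qed
      have "\<forall>x::'a. \<exists>V. V \<in> \<B> \<and> x \<in> V \<and> V \<subseteq> ball x (e/2)"
      proof
        fix x :: 'a
        have "x \<in> ball x (e/2)" using e(1) by simp
        then show "\<exists>V. V \<in> \<B> \<and> x \<in> V \<and> V \<subseteq> ball x (e/2)"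
          using topological_basisE[OF \<B>(2) open_ball, of x x "e/2"] by metis
      qed
      from choice[OF this] obtain V where V: "\<And>x. V x \<in> \<B> \<and> x \<in> V x \<and> V x \<subseteq> ball x (e/2)" by blast
      have "V x \<inter> V y = {}" if "x \<in> A" "y \<in> A" "x \<noteq> y" for x y
      proof (rule ccontr)
        assume "V x \<inter> V y \<noteq> {}"
        then obtain w where "w \<in> V x" "w \<in> V y" by blast
        then have "dist x w < e/2" "dist y w < e/2" using V[of x] V[of y] by (meson mem_ball subsetD)+
        then have "dist x y < e" using dist_triangle2[of x y w] by simp
        then show False using e(2)[OF that] by simp
      qed
      then show ?thesis using V that by blast
    qed
    have "inj_on V A"
      using V by (intro inj_onI) (metis disjoint_iff)
    have "disjoint (V ` A)"
    proof (rule disjointI)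
      fix P Q assume "P \<in> V ` A" "Q \<in> V ` A" "P \<noteq> Q"
      then obtain x y where "x \<in> A" "y \<in> A" "P = V x" "Q = V y" "x \<noteq> y" by blast
      then show "P \<inter> Q = {}" using V(2) by simp
    qed
    then have "V ` A \<in> \<D>" using A V(1) by (auto simp: \<D>_def)
    moreover have "of_nat (card A) = g (V ` A) z"
    proof -
      have "g (V ` A) z = (\<Sum>x\<in>A. indicator (F ` (B \<inter> V x)) z)"
        unfolding g_def by (subst sum.reindex[OF \<open>inj_on V A\<close>]) simp
      also have "\<dots> = (\<Sum>x\<in>A. 1)"
      proof (rule sum.cong[OF refl])
        fix x assume x: "x \<in> A"
        then have "z \<in> F ` (B \<inter> V x)" using A(2) V(1)[OF x] by blast
        then show "indicator (F ` (B \<inter> V x)) z = (1 :: ennreal)" by simp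
      qed
      finally show ?thesis by simp
    qed
    ultimately show ?thesis using SUP_upper[of "V ` A" \<D> "\<lambda>D. g D z"] by simp
  qed
  have sup_eq: "count_preimages F B z = (SUP D\<in>\<D>. g D z)" for z
  proof (rule antisym)
    show "(SUP D\<in>\<D>. g D z) \<le> count_preimages F B z" by (intro SUP_least le)
    show "count_preimages F B z \<le> (SUP D\<in>\<D>. g D z)"
    proof (cases "finite {y \<in> B. F y = z}")
      case True
      then show ?thesis using ge[OF True] by (simp add: count_preimages_def emeasure_count_space_finite)
    next
      case False
      have "of_nat k \<le> (SUP D\<in>\<D>. g D z)" for k
      proof -
        obtain A where "finite A" "card A = k" "A \<subseteq> {y \<in> B. F y = z}"
          using infinite_arbitrarily_large[OF False, of k] by blast
        then show ?thesis using ge[of A z] by simp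
      qed
      then have "(SUP k. of_nat k) \<le> (SUP D\<in>\<D>. g D z)" by (rule SUP_least)
      then have "(Orderings.top :: ennreal) \<le> (SUP D\<in>\<D>. g D z)" by (simp only: ennreal_SUP_of_nat_eq_top)
      then show ?thesis using top_greatest order_trans by blast
    qed
  qed
  moreover have "(\<lambda>z. SUP D\<in>\<D>. g D z) \<in> borel_measurable borel"
  proof (rule borel_measurable_SUP[OF cD])
    fix D assume D: "D \<in> \<D>"
    \<comment> \<open>Here sigma-compactness pays off: the image of a relatively open part of
      \<open>B\<close> is again sigma-compact, hence Borel.\<close>
    have "F ` (B \<inter> V) \<in> sets borel" if "V \<in> D" for V
    proof -
      have "open V" using that D \<B>(2) by (auto simp: \<D>_def topological_basis_open)
      then show ?thesis
        using B F continuous_on_subset[of B F "B \<inter> V"]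
        by (intro sigma_compact_borel sigma_compact_image sigma_compact_Int_open) auto
    qed
    then show "g D \<in> borel_measurable borel"
      unfolding g_def by (intro borel_measurable_sum borel_measurable_indicator) auto
  qed
  moreover have "count_preimages F B = (\<lambda>z. SUP D\<in>\<D>. g D z)" by (rule ext) (rule sup_eq)
  ultimately show ?thesis by simp
qed

lemma count_preimages_UN_disjoint:
  fixes A :: "nat \<Rightarrow> 'a set"
  assumes "disjoint_family A"
  shows "count_preimages F (\<Union>k. A k) z = (\<Sum>k. count_preimages F (A k) z)"
proof -
  have "{y \<in> (\<Union>k. A k). F y = z} = (\<Union>k. {y \<in> A k. F y = z})" by blast
  moreover have "disjoint_family (\<lambda>k. {y \<in> A k. F y = z})"
    using assms by (auto simp: disjoint_family_on_def)
  ultimately show ?thesis unfolding count_preimages_def by (simp add: suminf_emeasure)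
qed

lemma emeasure_count_space_bij:
  assumes "bij_betw h A A'"
  shows "emeasure (count_space UNIV) A = emeasure (count_space UNIV) A'"
  using assms by (cases "finite A") (auto simp: emeasure_count_space bij_betw_finite bij_betw_same_card)

lemma count_preimages_cong_bij:
  assumes "bij_betw h {y \<in> B. F y = z} {y' \<in> B'. F' y' = z'}"
  shows "count_preimages F B z = count_preimages F' B' z'"
  unfolding count_preimages_def by (rule emeasure_count_space_bij[OF assms])

subsection \<open>Area formula for continuously differentiable maps\<close>

text \<open>Points are functions on all natural numbers with value \<open>undefined\<close> from
  \<open>m\<close> on. So every dimension shares the topology and the metric of one function space,
  and a coordinate is added or removed by a single update.\<close>

definition Rn :: "nat \<Rightarrow> (nat \<Rightarrow> real) set" where
  "Rn m = (\<Pi>\<^sub>E i\<in>{..<m}. UNIV)"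

definition Leb :: "nat \<Rightarrow> (nat \<Rightarrow> real) measure" where
  "Leb m = (\<Pi>\<^sub>M i\<in>{..<m}. lborel)"

interpretation lborel_product: product_sigma_finite "\<lambda>_::'i. lborel :: real measure"
  by standard

lemma space_Leb [simp]: "space (Leb m) = Rn m"
  by (simp add: Leb_def Rn_def space_PiM)

lemma Rn_iff: "x \<in> Rn m \<longleftrightarrow> (\<forall>i\<ge>m. x i = undefined)"
  by (auto simp: Rn_def PiE_iff extensional_def not_less)

lemma sigma_finite_Leb: "sigma_finite_measure (Leb m)"
  unfolding Leb_def by (rule lborel_product.sigma_finite) simp

lemma compact_PiE_UNIV:
  fixes S :: "'i \<Rightarrow> 'a::topological_space set"
  assumes "\<And>i. compact (S i)" shows "compact (PiE UNIV S)"
  using assms compactin_PiE[of "\<lambda>_::'i. euclidean :: 'a topology" UNIV S]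
  by (simp add: euclidean_product_topology)

lemma compact_box_Rn: "compact {x \<in> Rn m. \<forall>i<m. a i \<le> x i \<and> x i \<le> b i}"
proof -
  have "{x \<in> Rn m. \<forall>i<m. a i \<le> x i \<and> x i \<le> b i} = (\<Pi>\<^sub>E i\<in>UNIV. if i < m then {a i..b i} else {undefined})"
    by (force simp: Rn_iff PiE_iff not_less split: if_splits)
  then show ?thesis by (simp add: compact_PiE_UNIV)
qed

lemma sigma_compact_Rn: "sigma_compact (Rn m)"
proof -
  have "Rn m = (\<Union>k::nat. {x \<in> Rn m. \<forall>i<m. - real k \<le> x i \<and> x i \<le> real k})"
  proof safe
    fix x assume x: "x \<in> Rn m"
    obtain k :: nat where k: "(\<Sum>i<m. \<bar>x i\<bar>) \<le> real k" using real_arch_simple by blast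
    have "\<bar>x i\<bar> \<le> real k" if "i < m" for i
      using that k member_le_sum[of i "{..<m}" "\<lambda>i. \<bar>x i\<bar>"] by simp
    then have "\<forall>i<m. - real k \<le> x i \<and> x i \<le> real k" by (simp add: abs_le_iff minus_le_iff)
    then show "x \<in> (\<Union>k::nat. {x \<in> Rn m. \<forall>i<m. - real k \<le> x i \<and> x i \<le> real k})" using x by blast
  qed
  moreover have "sigma_compact (\<Union>k::nat. {x \<in> Rn m. \<forall>i<m. - real k \<le> x i \<and> x i \<le> real k})"
    by (intro sigma_compact_UN compact_imp_sigma_compact compact_box_Rn)
  ultimately show ?thesis by simp
qed

text \<open>The link between topology and measure: through it, Borel sets and Borel functions on the
  function space become measurable for \<open>Leb m\<close>.\<close>

lemma measurable_id_Leb [measurable]: "(\<lambda>x. x) \<in> Leb m \<rightarrow>\<^sub>M borel"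
proof (rule measurable_coordinatewise_then_product)
  fix i
  show "(\<lambda>x. x i) \<in> borel_measurable (Leb m)"
  proof (cases "i < m")
    case True
    then have "(\<lambda>x. x i) \<in> measurable (Leb m) lborel"
      unfolding Leb_def by (intro measurable_component_singleton) simp
    then show ?thesis by simp
  next
    case False
    have "(\<lambda>x. undefined::real) \<in> borel_measurable (Leb m)" by simp
    then show ?thesis by (subst measurable_cong[of _ _ "\<lambda>_. undefined"]) (use False in \<open>auto simp: Rn_iff\<close>)
  qed
qed

lemma borel_measurable_Leb: "f \<in> borel_measurable borel \<Longrightarrow> f \<in> borel_measurable (Leb m)"
  using measurable_compose[OF measurable_id_Leb] .

lemma sigma_compact_sets_Leb:
  assumes "sigma_compact S" "S \<subseteq> Rn m" shows "S \<in> sets (Leb m)"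
proof -
  have "(\<lambda>x. x) -` S \<inter> space (Leb m) \<in> sets (Leb m)"
    using measurable_sets[OF measurable_id_Leb sigma_compact_borel[OF assms(1)]] .
  moreover have "(\<lambda>x. x) -` S \<inter> space (Leb m) = S" using assms(2) by auto
  ultimately show ?thesis by simp
qed

lemma borel_measurable_count_Leb:
  fixes F :: "(nat \<Rightarrow> real) \<Rightarrow> nat \<Rightarrow> real"
  assumes "sigma_compact B" "continuous_on B F"
  shows "count_preimages F B \<in> borel_measurable (Leb m)"
  by (intro borel_measurable_Leb borel_measurable_count_preimages assms)

lemma borel_measurable_indicator_continuous:
  fixes f :: "(nat \<Rightarrow> real) \<Rightarrow> real"
  assumes "sigma_compact B" "continuous_on B f"
  shows "(\<lambda>x. indicator B x * ennreal (f x)) \<in> borel_measurable borel"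
proof -
  have "(\<lambda>x. indicator B x *\<^sub>R f x) \<in> borel_measurable borel"
    by (rule borel_measurable_continuous_on_indicator[OF sigma_compact_borel]) (use assms in auto)
  then have "(\<lambda>x. ennreal (indicator B x *\<^sub>R f x)) \<in> borel_measurable borel" by measurable
  moreover have "ennreal (indicator B x *\<^sub>R f x) = indicator B x * ennreal (f x)" for x
    by (auto simp: indicator_def)
  ultimately show ?thesis by simp
qed

text \<open>Tonelli's theorem for the last coordinate in both orders: the induction on the dimension
  works on the slices with fixed \<open>t\<close>, the substitution on the lines with fixed
  \<open>x\<close>.\<close>

lemma nn_integral_Leb_Suc:
  assumes "f \<in> borel_measurable (Leb (Suc l))"
  shows "(\<integral>\<^sup>+x. f x \<partial>Leb (Suc l)) = (\<integral>\<^sup>+x. (\<integral>\<^sup>+t. f (x(l := t)) \<partial>lborel) \<partial>Leb l)"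
    and "(\<integral>\<^sup>+x. f x \<partial>Leb (Suc l)) = (\<integral>\<^sup>+t. (\<integral>\<^sup>+x. f (x(l := t)) \<partial>Leb l) \<partial>lborel)"
proof -
  note f = assms[unfolded Leb_def lessThan_Suc]
  show "(\<integral>\<^sup>+x. f x \<partial>Leb (Suc l)) = (\<integral>\<^sup>+x. (\<integral>\<^sup>+t. f (x(l := t)) \<partial>lborel) \<partial>Leb l)"
    unfolding Leb_def lessThan_Suc by (rule lborel_product.product_nn_integral_insert[OF _ _ f]) auto
  show "(\<integral>\<^sup>+x. f x \<partial>Leb (Suc l)) = (\<integral>\<^sup>+t. (\<integral>\<^sup>+x. f (x(l := t)) \<partial>Leb l) \<partial>lborel)"
    unfolding Leb_def lessThan_Suc by (rule lborel_product.product_nn_integral_insert_rev[OF _ _ f]) auto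
qed

section \<open>Relabelling the coordinates of a product measure\<close>

lemma distr_PiM_bij:
  fixes h :: "'i \<Rightarrow> 'j"
  assumes N: "sigma_finite_measure N" and "finite I" and h: "bij_betw h I J"
  shows "distr (\<Pi>\<^sub>M j\<in>J. N) (\<Pi>\<^sub>M i\<in>I. N) (\<lambda>\<omega>. \<lambda>i\<in>I. \<omega> (h i)) = (\<Pi>\<^sub>M i\<in>I. N)"
proof -
  interpret I: product_sigma_finite "\<lambda>_::'i. N" using N by (simp add: product_sigma_finite_def)
  interpret J: product_sigma_finite "\<lambda>_::'j. N" using N by (simp add: product_sigma_finite_def)
  have finJ: "finite J" using assms bij_betw_finite by blast
  have meas: "(\<lambda>\<omega>. \<lambda>i\<in>I. \<omega> (h i)) \<in> (\<Pi>\<^sub>M j\<in>J. N) \<rightarrow>\<^sub>M (\<Pi>\<^sub>M i\<in>I. N)"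
    using h by (intro measurable_restrict measurable_component_singleton) (auto simp: bij_betw_def)
  show ?thesis
  proof (rule I.PiM_eqI)
    show "finite I" by fact
    fix A assume A: "\<And>i. i \<in> I \<Longrightarrow> A i \<in> sets N"
    define g where "g = the_inv_into I h"
    have g: "\<And>i. i \<in> I \<Longrightarrow> g (h i) = i" "\<And>j. j \<in> J \<Longrightarrow> g j \<in> I \<and> h (g j) = j"
      using h unfolding g_def bij_betw_def
      by (auto simp: the_inv_into_f_f f_the_inv_into_f intro: the_inv_into_into)
    have hJ: "\<And>i. i \<in> I \<Longrightarrow> h i \<in> J" using h by (auto simp: bij_betw_def)
    have "emeasure (distr (\<Pi>\<^sub>M j\<in>J. N) (\<Pi>\<^sub>M i\<in>I. N) (\<lambda>\<omega>. \<lambda>i\<in>I. \<omega> (h i))) (Pi\<^sub>E I A)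
       = emeasure (\<Pi>\<^sub>M j\<in>J. N) ((\<lambda>\<omega>. \<lambda>i\<in>I. \<omega> (h i)) -` Pi\<^sub>E I A \<inter> space (\<Pi>\<^sub>M j\<in>J. N))"
      using A \<open>finite I\<close> by (intro emeasure_distr meas sets_PiM_I_finite) auto
    also have "(\<lambda>\<omega>. \<lambda>i\<in>I. \<omega> (h i)) -` Pi\<^sub>E I A \<inter> space (\<Pi>\<^sub>M j\<in>J. N) = Pi\<^sub>E J (\<lambda>j. A (g j))"
    proof (rule Set.set_eqI)
      fix \<omega>
      have "(\<forall>i\<in>I. \<omega> (h i) \<in> A i) \<longleftrightarrow> (\<forall>j\<in>J. \<omega> j \<in> A (g j))"
        using g hJ by metis
      moreover have "A (g j) \<subseteq> space N" if "j \<in> J" for j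
        using A g that sets.sets_into_space by blast
      ultimately show "\<omega> \<in> (\<lambda>\<omega>. \<lambda>i\<in>I. \<omega> (h i)) -` Pi\<^sub>E I A \<inter> space (\<Pi>\<^sub>M j\<in>J. N) \<longleftrightarrow> \<omega> \<in> Pi\<^sub>E J (\<lambda>j. A (g j))"
        by (auto simp: space_PiM PiE_iff)
    qed
    also have "emeasure (\<Pi>\<^sub>M j\<in>J. N) \<dots> = (\<Prod>j\<in>J. emeasure N (A (g j)))"
      using A g finJ by (intro J.emeasure_PiM) auto
    also have "\<dots> = (\<Prod>i\<in>I. emeasure N (A i))"
      using prod.reindex_bij_betw[OF h, of "\<lambda>j. emeasure N (A (g j))"] g(1) by simp
    finally show "emeasure (distr (\<Pi>\<^sub>M j\<in>J. N) (\<Pi>\<^sub>M i\<in>I. N) (\<lambda>\<omega>. \<lambda>i\<in>I. \<omega> (h i))) (Pi\<^sub>E I A) = (\<Prod>i\<in>I. emeasure N (A i))" .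
  qed simp
qed

lemma nn_integral_PiM_bij:
  fixes h :: "'i \<Rightarrow> 'j"
  assumes N: "sigma_finite_measure N" and "finite I" and h: "bij_betw h I J"
    and f: "f \<in> borel_measurable (\<Pi>\<^sub>M i\<in>I. N)"
  shows "(\<integral>\<^sup>+\<omega>. f (\<lambda>i\<in>I. \<omega> (h i)) \<partial>(\<Pi>\<^sub>M j\<in>J. N)) = (\<integral>\<^sup>+x. f x \<partial>(\<Pi>\<^sub>M i\<in>I. N))"
proof -
  have "(\<lambda>\<omega>. \<lambda>i\<in>I. \<omega> (h i)) \<in> (\<Pi>\<^sub>M j\<in>J. N) \<rightarrow>\<^sub>M (\<Pi>\<^sub>M i\<in>I. N)"
    using h by (intro measurable_restrict measurable_component_singleton) (auto simp: bij_betw_def)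
  from nn_integral_distr[OF this, of f] f show ?thesis
    unfolding distr_PiM_bij[OF N \<open>finite I\<close> h] by simp
qed

lemma nn_integral_Leb_permute:
  assumes p: "\<pi> permutes {..<m}" and f: "f \<in> borel_measurable (Leb m)"
  shows "(\<integral>\<^sup>+x. f (x \<circ> \<pi>) \<partial>Leb m) = (\<integral>\<^sup>+x. f x \<partial>Leb m)"
proof -
  have "(\<integral>\<^sup>+x. f (\<lambda>i\<in>{..<m}. x (\<pi> i)) \<partial>Leb m) = (\<integral>\<^sup>+x. f x \<partial>Leb m)"
    unfolding Leb_def using permutes_imp_bij[OF p] f
    by (intro nn_integral_PiM_bij) (auto simp: Leb_def intro: sigma_finite_lborel)
  moreover have "(\<lambda>i\<in>{..<m}. x (\<pi> i)) = x \<circ> \<pi>" if "x \<in> Rn m" for x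
    using that p by (auto simp: Rn_iff fun_eq_iff permutes_def not_less)
  then have "(\<integral>\<^sup>+x. f (\<lambda>i\<in>{..<m}. x (\<pi> i)) \<partial>Leb m) = (\<integral>\<^sup>+x. f (x \<circ> \<pi>) \<partial>Leb m)"
    by (intro nn_integral_cong) simp
  ultimately show ?thesis by simp
qed

text \<open>Differentiability is expressed by partial derivatives along coordinate lines, which
  makes sense for a dimension that is a term. Openness is relative to \<open>Rn m\<close>, because
  \<open>Rn m\<close> fixes infinitely many coordinates and is not open in the function
  space.\<close>

definition C1_map :: "nat \<Rightarrow> (nat \<Rightarrow> real) set \<Rightarrow> ((nat \<Rightarrow> real) \<Rightarrow> nat \<Rightarrow> real) \<Rightarrow>
    (nat \<Rightarrow> nat \<Rightarrow> (nat \<Rightarrow> real) \<Rightarrow> real) \<Rightarrow> bool" where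
  "C1_map m U F D \<longleftrightarrow> openin (top_of_set (Rn m)) U \<and> F ` U \<subseteq> Rn m \<and> continuous_on U F \<and>
     (\<forall>i<m. \<forall>j<m. continuous_on U (D i j)) \<and>
     (\<forall>y\<in>U. \<forall>i<m. \<forall>j<m. ((\<lambda>t. F (y(j := t)) i) has_real_derivative D i j y) (at (y j)))"

definition jacobian :: "nat \<Rightarrow> (nat \<Rightarrow> nat \<Rightarrow> (nat \<Rightarrow> real) \<Rightarrow> real) \<Rightarrow> (nat \<Rightarrow> real) \<Rightarrow> real" where
  "jacobian m D y = Determinant.det (mat m m (\<lambda>(i, j). D i j y))"

text \<open>The area formula as a property of the piece \<open>B\<close>, so that it can be
  established on small pieces and added up.\<close>

definition area_on :: "nat \<Rightarrow> ((nat \<Rightarrow> real) \<Rightarrow> nat \<Rightarrow> real) \<Rightarrow>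
    (nat \<Rightarrow> nat \<Rightarrow> (nat \<Rightarrow> real) \<Rightarrow> real) \<Rightarrow> (nat \<Rightarrow> real) set \<Rightarrow> bool" where
  "area_on m F D B \<longleftrightarrow> (\<integral>\<^sup>+z. count_preimages F B z \<partial>Leb m) =
     (\<integral>\<^sup>+y. indicator B y * ennreal \<bar>jacobian m D y\<bar> \<partial>Leb m)"

lemma det_mat_eq_sum:
  "Determinant.det (mat m m (\<lambda>(i, j). A i j)) =
    (\<Sum>p | p permutes {0..<m}. signof p * (\<Prod>i = 0..<m. A i (p i)))"
  by (subst Determinant.det_def'[of _ m]) (auto intro!: sum.cong prod.cong dest: permutes_in_image)

lemma continuous_on_det_mat:
  fixes D :: "nat \<Rightarrow> nat \<Rightarrow> 'a::topological_space \<Rightarrow> real"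
  assumes "\<And>i j. i < m \<Longrightarrow> j < m \<Longrightarrow> continuous_on U (D i j)"
  shows "continuous_on U (\<lambda>y. Determinant.det (mat m m (\<lambda>(i, j). D i j y)))"
proof -
  have "continuous_on U (\<lambda>y. D i (p i) y)" if "p permutes {0..<m}" "i \<in> {0..<m}" for p i
    using assms that permutes_in_image[OF that(1), of i] by auto
  then show ?thesis unfolding det_mat_eq_sum by (auto intro!: continuous_intros)
qed

lemma continuous_on_jacobian:
  assumes "\<And>i j. i < m \<Longrightarrow> j < m \<Longrightarrow> continuous_on U (D i j)"
  shows "continuous_on U (jacobian m D)"
  using continuous_on_det_mat[OF assms] unfolding jacobian_def .

lemma measurable_indicator_jacobian:
  assumes "sigma_compact B" "\<And>i j. i < m \<Longrightarrow> j < m \<Longrightarrow> continuous_on B (D i j)"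
  shows "(\<lambda>y. indicator B y * ennreal \<bar>jacobian m D y\<bar>) \<in> borel_measurable (Leb m)"
  by (intro borel_measurable_Leb borel_measurable_indicator_continuous assms continuous_on_rabs continuous_on_jacobian)

lemma area_on_UN:
  fixes A :: "nat \<Rightarrow> (nat \<Rightarrow> real) set"
  assumes dis: "disjoint_family A" and A: "\<And>k. sigma_compact (A k)" "\<And>k. area_on m F D (A k)"
    and F: "\<And>k. continuous_on (A k) F"
    and D: "\<And>i j k. i < m \<Longrightarrow> j < m \<Longrightarrow> continuous_on (A k) (D i j)"
  shows "area_on m F D (\<Union>k. A k)"
proof -
  have "(\<integral>\<^sup>+z. count_preimages F (\<Union>k. A k) z \<partial>Leb m) = (\<Sum>k. \<integral>\<^sup>+z. count_preimages F (A k) z \<partial>Leb m)"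
    using A F by (simp add: count_preimages_UN_disjoint[OF dis] nn_integral_suminf borel_measurable_count_Leb)
  also have "\<dots> = (\<Sum>k. \<integral>\<^sup>+y. indicator (A k) y * ennreal \<bar>jacobian m D y\<bar> \<partial>Leb m)"
    using A(2) by (simp add: area_on_def)
  also have "\<dots> = (\<integral>\<^sup>+y. (\<Sum>k. indicator (A k) y * ennreal \<bar>jacobian m D y\<bar>) \<partial>Leb m)"
    by (rule nn_integral_suminf[symmetric]) (intro measurable_indicator_jacobian A D)
  also have "\<dots> = (\<integral>\<^sup>+y. indicator (\<Union>k. A k) y * ennreal \<bar>jacobian m D y\<bar> \<partial>Leb m)"
    by (simp add: ennreal_suminf_multc suminf_indicator[OF dis])
  finally show ?thesis by (simp add: area_on_def)
qed

text \<open>Both sides are countably additive in \<open>B\<close>. Countably many good open sets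
  cover \<open>B\<close> by Lindelof's theorem, and removing the earlier ones makes the pieces
  disjoint while keeping them sigma-compact. The local hypothesis speaks of all sigma-compact
  subsets because such a cut piece may be any of them.\<close>

lemma area_on_local:
  assumes B: "sigma_compact B" and F: "continuous_on B F"
    and D: "\<And>i j. i < m \<Longrightarrow> j < m \<Longrightarrow> continuous_on B (D i j)"
    and loc: "\<And>y. y \<in> B \<Longrightarrow> \<exists>V. open V \<and> y \<in> V \<and> (\<forall>C. sigma_compact C \<longrightarrow> C \<subseteq> B \<inter> V \<longrightarrow> area_on m F D C)"
  shows "area_on m F D B"
proof -
  define \<V> where "\<V> = {V. open V \<and> (\<forall>C. sigma_compact C \<longrightarrow> C \<subseteq> B \<inter> V \<longrightarrow> area_on m F D C)}"
  obtain \<W> where \<W>: "\<W> \<subseteq> \<V>" "countable \<W>" "\<Union>\<W> = \<Union>\<V>"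
    using Lindelof[of \<V>] by (auto simp: \<V>_def)
  \<comment> \<open>Adjoining the empty set makes the family non-empty, as its enumeration by the
    natural numbers requires.\<close>
  define W where "W = from_nat_into (insert {} \<W>)"
  have cW: "countable (insert {} \<W>)" using \<W>(2) by simp
  have rW: "range W = insert {} \<W>"
    unfolding W_def by (rule range_from_nat_into[OF _ cW]) simp
  have "{} \<in> \<V>" unfolding \<V>_def
    by (auto simp: area_on_def count_preimages_def)
  have W: "W k \<in> \<V>" for k
  proof -
    have "W k \<in> insert {} \<W>" unfolding rW[symmetric] by simp
    then show ?thesis
    proof
      assume "W k = {}" then show ?thesis using \<open>{} \<in> \<V>\<close> by simp
    next
      assume "W k \<in> \<W>" with \<W>(1) show ?thesis by (rule subsetD)
    qed
  qed
  define A where "A k = B \<inter> W k \<inter> (\<Inter>j<k. - W j)" for k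
  have op: "open (W k)" for k using W[of k] by (simp add: \<V>_def)
  have sc: "sigma_compact (A k)" for k unfolding A_def
    using op by (intro sigma_compact_Int_closed sigma_compact_Int_open B) auto
  have sub: "A k \<subseteq> B" for k by (auto simp: A_def)
  have UA: "(\<Union>k. A k) = B"
  proof
    show "B \<subseteq> (\<Union>k. A k)"
    proof
      fix y assume y: "y \<in> B"
      from loc[OF this] have "y \<in> \<Union>\<V>" by (auto simp: \<V>_def)
      then have "y \<in> \<Union>(range W)" using \<W>(3) rW by auto
      then have ex: "\<exists>k. y \<in> W k" by auto
      define k where "k = (LEAST k. y \<in> W k)"
      have "y \<in> W k" "\<And>j. j < k \<Longrightarrow> y \<notin> W j"
        unfolding k_def using ex by (auto intro: LeastI_ex dest: not_less_Least)
      then show "y \<in> (\<Union>k. A k)" using y by (auto simp: A_def intro!: exI[of _ k])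
    qed
  qed (use sub in auto)
  have "disjoint_family A"
    unfolding disjoint_family_on_def
  proof safe
    fix i j x assume "i \<noteq> j" "x \<in> A i" "x \<in> A j"
    then show "x \<in> {}" by (cases i j rule: linorder_cases) (auto simp: A_def)
  qed
  then have "area_on m F D (\<Union>k. A k)"
  proof (rule area_on_UN)
    show "area_on m F D (A k)" for k
      using W[of k] sc[of k] by (auto simp: \<V>_def A_def)
    show "continuous_on (A k) F" for k using F sub by (rule continuous_on_subset)
    show "continuous_on (A k) (D i j)" if "i < m" "j < m" for i j k
      using D[OF that] sub by (rule continuous_on_subset)
  qed (rule sc)
  then show ?thesis by (simp add: UA)
qed

lemma C1_mapD:
  assumes "C1_map m U F D"
  shows "openin (top_of_set (Rn m)) U" "U \<subseteq> Rn m" "\<And>y. y \<in> U \<Longrightarrow> F y \<in> Rn m" "continuous_on U F"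
    "\<And>i j. i < m \<Longrightarrow> j < m \<Longrightarrow> continuous_on U (D i j)"
    "\<And>y i j. y \<in> U \<Longrightarrow> i < m \<Longrightarrow> j < m \<Longrightarrow> ((\<lambda>t. F (y(j := t)) i) has_real_derivative D i j y) (at (y j))"
  using assms unfolding C1_map_def by (auto dest: openin_imp_subset)

text \<open>Permuting the coordinates of source and target preserves the measure and changes the
  Jacobian by a sign only. The permutations will be transpositions that move a non-zero partial
  derivative to the corner, so they can be taken to be involutions.\<close>

lemma area_on_permute:
  assumes C1: "C1_map m U F D" and B: "sigma_compact B" "B \<subseteq> U"
    and p: "\<pi> permutes {..<m}" "\<pi> \<circ> \<pi> = id" and s: "\<sigma> permutes {..<m}" "\<sigma> \<circ> \<sigma> = id"
    and ar: "area_on m (\<lambda>y. F (y \<circ> \<pi>) \<circ> \<sigma>) (\<lambda>i j y. D (\<sigma> i) (\<pi> j) (y \<circ> \<pi>)) {y. y \<circ> \<pi> \<in> B}"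
  shows "area_on m F D B"
proof -
  note C = C1_mapD[OF C1]
  have pp: "y \<circ> \<pi> \<circ> \<pi> = y" for y :: "nat \<Rightarrow> real" using p(2) by (metis comp_assoc comp_id)
  have ss: "y \<circ> \<sigma> \<circ> \<sigma> = y" for y :: "nat \<Rightarrow> real" using s(2) by (metis comp_assoc comp_id)
  have FB: "continuous_on B F" "\<And>i j. i < m \<Longrightarrow> j < m \<Longrightarrow> continuous_on B (D i j)"
    using C(4,5) B(2) by (auto intro: continuous_on_subset)
  have "count_preimages (\<lambda>y. F (y \<circ> \<pi>) \<circ> \<sigma>) {y. y \<circ> \<pi> \<in> B} z = count_preimages F B (z \<circ> \<sigma>)" for z
  proof (rule count_preimages_cong_bij)
    show "bij_betw (\<lambda>y. y \<circ> \<pi>) {y \<in> {y. y \<circ> \<pi> \<in> B}. F (y \<circ> \<pi>) \<circ> \<sigma> = z} {y \<in> B. F y = z \<circ> \<sigma>}"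
      by (rule bij_betw_byWitness[of _ "\<lambda>y. y \<circ> \<pi>"]) (use pp ss in auto)
  qed
  then have 1: "(\<integral>\<^sup>+z. count_preimages (\<lambda>y. F (y \<circ> \<pi>) \<circ> \<sigma>) {y. y \<circ> \<pi> \<in> B} z \<partial>Leb m) =
     (\<integral>\<^sup>+z. count_preimages F B z \<partial>Leb m)"
    using nn_integral_Leb_permute[OF s(1) borel_measurable_count_Leb[OF B(1) FB(1)]] by simp
  have j: "\<bar>jacobian m (\<lambda>i j y. D (\<sigma> i) (\<pi> j) (y \<circ> \<pi>)) y\<bar> = \<bar>jacobian m D (y \<circ> \<pi>)\<bar>" for y
  proof -
    let ?A = "mat m m (\<lambda>(i, j). D i j (y \<circ> \<pi>))"
    have \<pi>: "\<pi> permutes {0..<m}" and \<sigma>: "\<sigma> permutes {0..<m}" using p s by (simp_all add: lessThan_atLeast0)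
    have in_s: "\<sigma> i < m" if "i < m" for i using permutes_in_image[OF s(1), of i] that by simp
    have in_p: "\<pi> i < m" if "i < m" for i using permutes_in_image[OF p(1), of i] that by simp
    have sg: "\<bar>signof q :: real\<bar> = 1" for q :: "nat \<Rightarrow> nat" by (simp add: sign_def)
    \<comment> \<open>Rows are permuted directly, columns by permuting the rows of the
      transpose.\<close>
    let ?A1 = "mat m m (\<lambda>(i, j). ?A $$ (\<sigma> i, j))"
    have d1: "Determinant.det ?A1 = signof \<sigma> * Determinant.det ?A" by (rule det_permute_rows[OF _ \<sigma>]) simp
    let ?A2 = "mat m m (\<lambda>(i, j). transpose_mat ?A1 $$ (\<pi> i, j))"
    have d2: "Determinant.det ?A2 = signof \<pi> * Determinant.det (transpose_mat ?A1)" by (rule det_permute_rows[OF _ \<pi>]) simp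
    have e: "transpose_mat ?A2 = mat m m (\<lambda>(i, j). D (\<sigma> i) (\<pi> j) (y \<circ> \<pi>))"
      using in_s in_p by (intro eq_matI) auto
    have "jacobian m (\<lambda>i j y. D (\<sigma> i) (\<pi> j) (y \<circ> \<pi>)) y = Determinant.det ?A2"
      unfolding jacobian_def e[symmetric] by (rule Determinant.det_transpose) auto
    also have "\<dots> = signof \<pi> * (signof \<sigma> * Determinant.det ?A)"
      using d1 d2 Determinant.det_transpose[of ?A1 m] by simp
    finally show ?thesis by (simp add: abs_mult sg jacobian_def)
  qed
  have 2: "(\<integral>\<^sup>+y. indicator {y. y \<circ> \<pi> \<in> B} y * ennreal \<bar>jacobian m (\<lambda>i j y. D (\<sigma> i) (\<pi> j) (y \<circ> \<pi>)) y\<bar> \<partial>Leb m)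
     = (\<integral>\<^sup>+y. indicator B y * ennreal \<bar>jacobian m D y\<bar> \<partial>Leb m)"
    using nn_integral_Leb_permute[OF p(1) measurable_indicator_jacobian[OF B(1) FB(2)]]
    by (simp add: j indicator_def)
  show ?thesis using ar unfolding area_on_def 1 2 .
qed

lemma C1_map_permute:
  assumes C1: "C1_map m U F D"
    and p: "\<pi> permutes {..<m}" "\<pi> \<circ> \<pi> = id" and s: "\<sigma> permutes {..<m}"
  shows "C1_map m {y. y \<circ> \<pi> \<in> U} (\<lambda>y. F (y \<circ> \<pi>) \<circ> \<sigma>) (\<lambda>i j y. D (\<sigma> i) (\<pi> j) (y \<circ> \<pi>))"
proof -
  note C = C1_mapD[OF C1]
  have in_s: "\<sigma> i < m" if "i < m" for i using permutes_in_image[OF s(1), of i] that by simp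
  have in_p: "\<pi> i < m" if "i < m" for i using permutes_in_image[OF p(1), of i] that by simp
  have pid: "\<pi> (\<pi> i) = i" for i using p(2) by (metis comp_apply id_apply)
  have Rn: "y \<circ> \<pi> \<in> Rn m \<longleftrightarrow> y \<in> Rn m" for y
    using p by (auto simp: Rn_iff permutes_def not_less)
  have cont: "continuous_on A (\<lambda>y::nat \<Rightarrow> real. y \<circ> \<rho>)" for \<rho> :: "nat \<Rightarrow> nat" and A
    by (intro continuous_on_coordinatewise_then_product)
       (auto intro: continuous_on_subset[OF continuous_on_product_coordinates])
  let ?U = "{y. y \<circ> \<pi> \<in> U}"
  have upd: "y(j := t) \<circ> \<pi> = (y \<circ> \<pi>)(\<pi> j := t)" for y :: "nat \<Rightarrow> real" and j t
    using pid by (auto simp: fun_eq_iff)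
  obtain W where W: "open W" "U = Rn m \<inter> W" using C(1) by (auto simp: openin_open)
  have "open ((\<lambda>y. y \<circ> \<pi>) -` W)" using W(1) cont by (intro open_vimage) auto
  moreover have "?U = Rn m \<inter> (\<lambda>y. y \<circ> \<pi>) -` W" using W(2) Rn by auto
  ultimately have "openin (top_of_set (Rn m)) ?U" by (auto simp: openin_open)
  moreover have "(\<lambda>y. F (y \<circ> \<pi>) \<circ> \<sigma>) ` ?U \<subseteq> Rn m"
    using C(3) s by (auto simp: Rn_iff permutes_def not_less)
  moreover have "continuous_on ?U (\<lambda>y. F (y \<circ> \<pi>))"
    by (rule continuous_on_compose2[OF C(4) cont]) auto
  then have "continuous_on ?U (\<lambda>y. F (y \<circ> \<pi>) \<circ> \<sigma>)"
    by (rule continuous_on_compose2[OF cont[of UNIV]]) auto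
  moreover have "continuous_on ?U (\<lambda>y. D (\<sigma> i) (\<pi> j) (y \<circ> \<pi>))" if "i < m" "j < m" for i j
    by (rule continuous_on_compose2[OF C(5)[OF in_s[OF that(1)] in_p[OF that(2)]] cont]) auto
  moreover have "((\<lambda>t. (F (y(j := t) \<circ> \<pi>) \<circ> \<sigma>) i) has_real_derivative D (\<sigma> i) (\<pi> j) (y \<circ> \<pi>)) (at (y j))"
    if "y \<in> ?U" "i < m" "j < m" for y i j
    using C(6)[of "y \<circ> \<pi>" "\<sigma> i" "\<pi> j"] that in_s in_p by (simp add: upd pid)
  ultimately show ?thesis unfolding C1_map_def by blast
qed


section \<open>Substitution on the line with values in [0, infinity]\<close>

lemma nn_integral_eq_absolutely_integrable:
  fixes g :: "real \<Rightarrow> real"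
  assumes "A \<in> sets borel" and g: "(\<lambda>x. indicator A x * g x) \<in> borel_measurable borel"
    and pos: "\<And>x. x \<in> A \<Longrightarrow> 0 \<le> g x"
  shows "g absolutely_integrable_on A \<longleftrightarrow> (\<integral>\<^sup>+x. indicator A x * ennreal (g x) \<partial>lborel) < \<infinity>"
    and "g absolutely_integrable_on A \<Longrightarrow>
      (\<integral>\<^sup>+x. indicator A x * ennreal (g x) \<partial>lborel) = ennreal (integral A g)"
proof -
  let ?h = "\<lambda>x. indicator A x * g x"
  have m: "?h \<in> borel_measurable lborel" using g by simp
  have pos': "0 \<le> ?h x" for x using pos by (auto simp: indicator_def)
  have eq: "indicator A x * ennreal (g x) = ennreal (?h x)" for x by (auto simp: indicator_def)
  have i: "g absolutely_integrable_on A \<longleftrightarrow> integrable lborel ?h"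
    unfolding set_integrable_def using integrable_completion[OF m] by simp
  show "g absolutely_integrable_on A \<longleftrightarrow> (\<integral>\<^sup>+x. indicator A x * ennreal (g x) \<partial>lborel) < \<infinity>"
    unfolding i integrable_iff_bounded using m pos' by (simp add: eq)
  assume ab: "g absolutely_integrable_on A"
  have "(\<integral>\<^sup>+x. indicator A x * ennreal (g x) \<partial>lborel) = ennreal (integral\<^sup>L lborel ?h)"
    unfolding eq using ab i pos' by (intro nn_integral_eq_integral) auto
  also have "integral\<^sup>L lborel ?h = integral A g"
    using set_lebesgue_integral_eq_integral(2)[OF ab] integral_completion[OF m]
    by (simp add: set_lebesgue_integral_def)
  finally show "(\<integral>\<^sup>+x. indicator A x * ennreal (g x) \<partial>lborel) = ennreal (integral A g)" .
qed

text \<open>The change of variables theorem for absolutely integrable functions says in particular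
  that integrability of one side is equivalent to that of the other. For non-negative integrands
  this becomes an equality in [0, infinity]: in the non-integrable case both sides are
  infinite.\<close>

lemma nn_integral_substitution_inj:
  fixes f f' H :: "real \<Rightarrow> real"
  assumes S: "S \<in> sets borel" and fS: "f ` S \<in> sets borel" and inj: "inj_on f S"
    and d: "\<And>x. x \<in> S \<Longrightarrow> (f has_real_derivative f' x) (at x)"
    and H: "(\<lambda>x. indicator (f ` S) x * H x) \<in> borel_measurable borel"
    and Hf: "(\<lambda>x. indicator S x * (\<bar>f' x\<bar> * H (f x))) \<in> borel_measurable borel"
    and pos: "\<And>x. 0 \<le> H x"
  shows "(\<integral>\<^sup>+t. indicator (f ` S) t * ennreal (H t) \<partial>lborel) =
    (\<integral>\<^sup>+x. indicator S x * ennreal (\<bar>f' x\<bar> * H (f x)) \<partial>lborel)" (is "?L = ?R")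
proof -
  note L = nn_integral_eq_absolutely_integrable[OF fS H pos]
  have pos': "\<And>x. x \<in> S \<Longrightarrow> 0 \<le> \<bar>f' x\<bar> * H (f x)" using pos by simp
  note R = nn_integral_eq_absolutely_integrable[OF S Hf pos']
  have S': "S \<in> sets lebesgue" using S by simp
  have ch: "(\<lambda>x. \<bar>f' x\<bar> * H (f x)) absolutely_integrable_on S \<and> integral S (\<lambda>x. \<bar>f' x\<bar> * H (f x)) = b
     \<longleftrightarrow> H absolutely_integrable_on (f ` S) \<and> integral (f ` S) H = b" for b
    by (rule has_absolute_integral_change_of_variables_1'[OF S' _ inj])
       (use d has_field_derivative_at_within in blast)
  show ?thesis
  proof (cases "H absolutely_integrable_on (f ` S)")
    case True
    with ch[of "integral (f ` S) H"] L(2) R(2) show ?thesis by simp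
  next
    case False
    with ch[of "integral S (\<lambda>x. \<bar>f' x\<bar> * H (f x))"] have "\<not> (\<lambda>x. \<bar>f' x\<bar> * H (f x)) absolutely_integrable_on S"
      by simp
    with False have "\<not> ?L < \<infinity>" "\<not> ?R < \<infinity>" using L(1) R(1) by simp_all
    then have "?L = Orderings.top" "?R = Orderings.top" by (simp_all add: less_top[symmetric])
    then show ?thesis by simp
  qed
qed

section \<open>The part of the domain where the whole derivative vanishes\<close>

lemma dist_Rn_le:
  assumes "x \<in> Rn m" "y \<in> Rn m" "\<And>i. i < m \<Longrightarrow> \<bar>x i - y i\<bar> \<le> r" "0 \<le> r"
  shows "dist x y \<le> 2 * r"
proof -
  have le: "dist (x i) (y i) \<le> r" for i
    using assms by (cases "i < m") (auto simp: Rn_iff dist_real_def)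
  \<comment> \<open>The metric of the function space weights the coordinates by powers of 1/2, whose
    sum is 2; this is the factor in the bound.\<close>
  have "dist x y = (\<Sum>n. (1/2)^n * min (dist (x (from_nat n)) (y (from_nat n))) 1)"
    by (simp add: dist_fun_def)
  also have "\<dots> \<le> (\<Sum>n. (1/2)^n * r)"
  proof (rule suminf_le)
    show "(1/2)^n * min (dist (x (from_nat n)) (y (from_nat n))) 1 \<le> (1/2)^n * r" for n :: nat
      using le[of "from_nat n"] by (intro mult_left_mono) auto
    show "summable (\<lambda>n. (1/2)^n * r)" by (intro summable_mult2 summable_geometric) simp
    show "summable (\<lambda>n. (1/2)^n * min (dist (x (from_nat n)) (y (from_nat n))) 1)"
      by (rule summable_comparison_test'[of "\<lambda>n. (1/2)^n"])
         (auto simp: summable_geometric_iff mult_left_le)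
  qed
  also have "\<dots> = 2 * r" by (subst suminf_mult2[symmetric]) (simp_all add: suminf_geometric)
  finally show ?thesis .
qed

lemma box_in_openin:
  assumes "openin (top_of_set (Rn m)) U" "a \<in> U"
  obtains r where "r > 0" "{x \<in> Rn m. \<forall>i<m. \<bar>x i - a i\<bar> \<le> r} \<subseteq> U"
proof -
  obtain W where W: "open W" "U = Rn m \<inter> W" using assms(1) by (auto simp: openin_open)
  then obtain e where e: "e > 0" "ball a e \<subseteq> W" using assms(2) by (meson IntE open_contains_ball)
  have "{x \<in> Rn m. \<forall>i<m. \<bar>x i - a i\<bar> \<le> e / 4} \<subseteq> U"
  proof safe
    fix x assume x: "x \<in> Rn m" "\<forall>i<m. \<bar>x i - a i\<bar> \<le> e / 4"
    have "dist x a \<le> 2 * (e / 4)" using x assms(2) W(2) e(1) by (intro dist_Rn_le) auto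
    then have "x \<in> ball a e" using e(1) by (simp add: dist_commute)
    then show "x \<in> U" using x W(2) e(2) by blast
  qed
  then show ?thesis using that[of "e / 4"] e(1) by simp
qed

lemma Rn_upd: "y \<in> Rn m \<Longrightarrow> j < m \<Longrightarrow> y(j := t) \<in> Rn m"
  by (auto simp: Rn_iff)

lemma continuous_on_upd [continuous_intros]:
  fixes f :: "'b::topological_space \<Rightarrow> nat \<Rightarrow> real"
  assumes "continuous_on A f" "continuous_on A g"
  shows "continuous_on A (\<lambda>x. (f x)(j := g x))"
proof (rule continuous_on_coordinatewise_then_product)
  fix i
  show "continuous_on A (\<lambda>x. ((f x)(j := g x)) i)"
    using assms continuous_on_product_then_coordinatewise[of A f i] by (cases "i = j") auto
qed

lemma continuous_on_coord [continuous_intros]: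
  "continuous_on A (\<lambda>x :: nat \<Rightarrow> real. x i)"
  by (rule continuous_on_subset[OF continuous_on_product_coordinates]) simp

text \<open>Mean value estimates along a staircase from \<open>x\<close> to \<open>x'\<close> that
  changes one coordinate at a time. All points visited have their coordinates between those of
  \<open>x\<close> and \<open>x'\<close>, which is where the bound on the derivative is
  required.\<close>

lemma C1_map_diff_bound:
  assumes C1: "C1_map m U F D" and x: "x \<in> Rn m" "x' \<in> Rn m" and i: "i < m"
    and e: "\<And>z j. z \<in> Rn m \<Longrightarrow> (\<forall>k<m. z k \<in> closed_segment (x k) (x' k)) \<Longrightarrow> j < m \<Longrightarrow> z \<in> U \<and> \<bar>D i j z\<bar> \<le> e"
  shows "\<bar>F x' i - F x i\<bar> \<le> e * (\<Sum>j<m. \<bar>x' j - x j\<bar>)"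
proof -
  define y where "y j = (\<lambda>k. if k < j then x' k else x k)" for j :: nat
  have step: "\<bar>F (y n) i - F x i\<bar> \<le> e * (\<Sum>j<n. \<bar>x' j - x j\<bar>)" if "n \<le> m" for n
    using that
  proof (induction n)
    case 0
    then show ?case by (simp add: y_def)
  next
    case (Suc n)
    have yS: "y (Suc n) = (y n)(n := x' n)" by (auto simp: y_def fun_eq_iff)
    have yn: "y n = (y n)(n := x n)" by (auto simp: y_def fun_eq_iff)
    have in_z: "(y n)(n := t) \<in> U \<and> \<bar>D i n ((y n)(n := t))\<bar> \<le> e" if "t \<in> closed_segment (x n) (x' n)" for t
      using that Suc.prems x by (intro e) (auto simp: Rn_iff y_def)
    have "norm (F ((y n)(n := x' n)) i - F ((y n)(n := x n)) i) \<le> e * norm (x' n - x n)"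
    proof (rule field_differentiable_bound[of "closed_segment (x n) (x' n)" "\<lambda>t. F ((y n)(n := t)) i" "\<lambda>t. D i n ((y n)(n := t))"])
      fix t assume t: "t \<in> closed_segment (x n) (x' n)"
      have "((\<lambda>t'. F ((y n)(n := t, n := t')) i) has_real_derivative D i n ((y n)(n := t))) (at (((y n)(n := t)) n))"
        using in_z[OF t] i Suc.prems by (intro C1_mapD(6)[OF C1]) auto
      then show "((\<lambda>t. F ((y n)(n := t)) i) has_field_derivative D i n ((y n)(n := t))) (at t within closed_segment (x n) (x' n))"
        by (simp add: has_field_derivative_at_within)
      show "norm (D i n ((y n)(n := t))) \<le> e" using in_z[OF t] by simp
    qed auto
    then have "\<bar>F (y (Suc n)) i - F (y n) i\<bar> \<le> e * \<bar>x' n - x n\<bar>"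
      using yS yn by simp
    then show ?case using Suc by (simp add: distrib_left)
  qed
  have "y m = x'" using x by (auto simp: y_def fun_eq_iff Rn_iff)
  then show ?thesis using step[of m] by simp
qed

text \<open>
  The set is cut into \<open>(k + 1) ^ m\<close> cells of width \<open>2 * r / k\<close>; as the derivative is at most \<open>e\<close> near it,
  the image of a cell lies in a cube of half-width \<open>m * e * (2 * r / k)\<close>.
\<close>

lemma null_image_zero_derivative:
  assumes C1: "C1_map m U F D" and m: "m > 0" and r: "r > 0"
    and Q: "{x \<in> Rn m. \<forall>i<m. \<bar>x i - a i\<bar> \<le> r} \<subseteq> U" (is "?Q \<subseteq> U")
    and C: "sigma_compact C" "C \<subseteq> {x \<in> Rn m. \<forall>i<m. \<bar>x i - a i\<bar> \<le> r}"
      "\<And>y i j. y \<in> C \<Longrightarrow> i < m \<Longrightarrow> j < m \<Longrightarrow> D i j y = 0"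
  shows "emeasure (Leb m) (F ` C) = 0"
proof -
  note C1' = C1_mapD[OF C1]
  have Qbox: "?Q = {x \<in> Rn m. \<forall>i<m. a i - r \<le> x i \<and> x i \<le> a i + r}"
  proof -
    have "\<bar>x i - a i\<bar> \<le> r \<longleftrightarrow> a i - r \<le> x i \<and> x i \<le> a i + r" for x :: "nat \<Rightarrow> real" and i by arith
    then show ?thesis by simp
  qed
  have cQ: "compact ?Q" unfolding Qbox by (rule compact_box_Rn)
  have small: "emeasure (Leb m) (F ` C) \<le> ennreal ((8 * real m * r * e) ^ m)" if e: "e > 0" for e
  proof -
    have "\<exists>d>0. \<forall>x\<in>?Q. \<forall>x'\<in>?Q. dist x' x < d \<longrightarrow> dist (D i j x') (D i j x) < e" if "i < m" "j < m" for i j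
      using compact_uniformly_continuous[OF continuous_on_subset[OF C1'(5)[OF that] Q] cQ] e
      unfolding uniformly_continuous_on_def by blast
    then have "\<forall>q\<in>{..<m}\<times>{..<m}. \<exists>d>0. \<forall>x\<in>?Q. \<forall>x'\<in>?Q. dist x' x < d \<longrightarrow> dist (D (fst q) (snd q) x') (D (fst q) (snd q) x) < e"
      by auto
    from bchoice[OF this] obtain dd where dd_all: "\<forall>q\<in>{..<m}\<times>{..<m}. dd q > 0 \<and>
      (\<forall>x\<in>?Q. \<forall>x'\<in>?Q. dist x' x < dd q \<longrightarrow> dist (D (fst q) (snd q) x') (D (fst q) (snd q) x) < e)"
      by (elim exE)
    note dd = bspec[OF dd_all]
    define d where "d = Min (dd ` ({..<m}\<times>{..<m}))"
    have fin: "finite (dd ` ({..<m}\<times>{..<m}))" "dd ` ({..<m}\<times>{..<m}) \<noteq> {}" using m by auto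
    have "d > 0" unfolding d_def using fin dd by (subst Min_gr_iff) auto
    have d: "\<bar>D i j x' - D i j x\<bar> < e" if "i < m" "j < m" "x \<in> ?Q" "x' \<in> ?Q" "dist x' x < d" for i j x x'
    proof -
      have "d \<le> dd (i, j)" unfolding d_def using fin that by (intro Min_le) auto
      then show ?thesis using dd[of "(i, j)"] that by (auto simp: dist_real_def)
    qed
    \<comment> \<open>Points of a cell of width \<open>h = 2 * r / k\<close> are at distance at most
      \<open>2 * h\<close> by \<open>dist_Rn_le\<close>; the choice of \<open>k\<close> makes this
      smaller than \<open>d\<close>, the distance that uniform continuity allows.\<close>
    obtain k :: nat where k: "k > 4 * r / d" using reals_Archimedean2 by blast
    moreover have "4 * r / d > 0" using r \<open>d > 0\<close> by simp
    ultimately have k0: "k > 0" using of_nat_0_less_iff by (metis less_trans)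
    define h where "h = 2 * r / k"
    have h: "h > 0" "2 * h < d"
      using r k0 k \<open>d > 0\<close> by (simp_all add: h_def field_simps)
    \<comment> \<open>The number of the cell in each coordinate. The right end of the interval gets
      the number \<open>k\<close>, which is why there are \<open>k + 1\<close> cells per
      coordinate.\<close>
    define c where "c x = (\<lambda>i\<in>{..<m}. nat \<lfloor>(x i - a i + r) / h\<rfloor>)" for x :: "nat \<Rightarrow> real"
    define I where "I = (\<Pi>\<^sub>E i\<in>{..<m}. {..k})"
    have cI: "c x \<in> I" if "x \<in> C" for x
    proof -
      have "nat \<lfloor>(x i - a i + r) / h\<rfloor> \<le> k" if "i < m" for i
      proof -
        have "x \<in> ?Q" using C(2) \<open>x \<in> C\<close> by blast
        then have "\<bar>x i - a i\<bar> \<le> r" using that by blast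
        then have "(x i - a i + r) / h \<le> 2 * r / h" using h(1) by (intro divide_right_mono) auto
        also have "\<dots> = k" using r k0 by (simp add: h_def)
        finally have "\<lfloor>(x i - a i + r) / h\<rfloor> \<le> int k" by linarith
        then show ?thesis by simp
      qed
      then show ?thesis by (auto simp: c_def I_def)
    qed
    have cell: "\<bar>x' i - x i\<bar> \<le> h" if x: "x \<in> C" "x' \<in> C" "c x = c x'" "i < m" for x x' i
    proof -
      have "x \<in> ?Q" "x' \<in> ?Q" using C(2) x by auto
      then have *: "\<bar>x i - a i\<bar> \<le> r" "\<bar>x' i - a i\<bar> \<le> r" using x(4) by auto
      then have "(x i - a i + r) / h \<ge> 0" "(x' i - a i + r) / h \<ge> 0" using h(1) by auto
      moreover have "nat \<lfloor>(x i - a i + r) / h\<rfloor> = nat \<lfloor>(x' i - a i + r) / h\<rfloor>"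
        using x(3,4) by (auto simp: c_def fun_eq_iff restrict_def split: if_splits)
      ultimately have "\<lfloor>(x i - a i + r) / h\<rfloor> = \<lfloor>(x' i - a i + r) / h\<rfloor>"
        by (meson eq_nat_nat_iff zero_le_floor)
      then have "\<bar>(x i - a i + r) / h - (x' i - a i + r) / h\<bar> \<le> 1" by linarith
      then have "\<bar>(x i - x' i) / h\<bar> \<le> 1" by (simp add: diff_divide_distrib add_divide_distrib)
      then show ?thesis using h(1) by (simp add: abs_minus_commute)
    qed
    have est: "\<bar>F x' i - F x i\<bar> \<le> real m * e * h" if x: "x \<in> C" "x' \<in> C" "c x = c x'" "i < m" for x x' i
    proof -
      have xQ: "x \<in> ?Q" "x' \<in> ?Q" using C(2) x by auto
      have "\<bar>F x' i - F x i\<bar> \<le> e * (\<Sum>j<m. \<bar>x' j - x j\<bar>)"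
      proof (rule C1_map_diff_bound[OF C1])
        fix z j assume z: "z \<in> Rn m" "\<forall>k<m. z k \<in> closed_segment (x k) (x' k)" and j: "j < m"
        have zk: "\<bar>z k - a k\<bar> \<le> r \<and> \<bar>z k - x k\<bar> \<le> h" if "k < m" for k
        proof -
          have "\<bar>x k - a k\<bar> \<le> r" "\<bar>x' k - a k\<bar> \<le> r" "\<bar>x' k - x k\<bar> \<le> h"
            using xQ that cell[OF x(1-3) that] by auto
          moreover have "z k \<in> closed_segment (x k) (x' k)" using z(2) that by blast
          ultimately show ?thesis by (auto simp: closed_segment_eq_real_ivl split: if_splits)
        qed
        then have zQ: "z \<in> ?Q" using z by auto
        moreover have "dist z x \<le> 2 * h" using z xQ zk h(1) by (intro dist_Rn_le) auto
        then have "\<bar>D i j z - D i j x\<bar> < e" using h(2) by (intro d x j xQ zQ) auto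
        ultimately show "z \<in> U \<and> \<bar>D i j z\<bar> \<le> e" using Q C(3)[OF x(1,4) j] by auto
      qed (use xQ x in auto)
      also have "\<dots> \<le> e * (\<Sum>j<m. h)"
        using e cell[OF x(1-3)] by (intro mult_left_mono sum_mono) auto
      finally show ?thesis by (simp add: mult_ac)
    qed
    define x where "x q = (SOME x. x \<in> C \<and> c x = q)" for q
    define R where "R q = (\<Pi>\<^sub>E i\<in>{..<m}. {F (x q) i - real m * e * h .. F (x q) i + real m * e * h})" for q
    have Rm: "R q \<in> sets (Leb m)" for q
      unfolding R_def Leb_def by (intro sets_PiM_I_finite) auto
    have Re: "emeasure (Leb m) (R q) = ennreal ((2 * (real m * e * h)) ^ m)" for q
    proof -
      have "emeasure (Leb m) (R q) = (\<Prod>i<m. emeasure lborel {F (x q) i - real m * e * h .. F (x q) i + real m * e * h})"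
        unfolding R_def Leb_def by (intro lborel_product.emeasure_PiM) auto
      also have "\<dots> = (\<Prod>i<m. ennreal (2 * (real m * e * h)))"
        using e h(1) by (intro prod.cong refl) simp
      finally show ?thesis using e h(1) by (simp add: ennreal_power)
    qed
    have "F ` C \<subseteq> (\<Union>q\<in>I. R q)"
    proof
      fix w assume "w \<in> F ` C"
      then obtain x' where x': "x' \<in> C" "w = F x'" by blast
      have xc: "x (c x') \<in> C \<and> c (x (c x')) = c x'"
        unfolding x_def by (rule someI[of _ x']) (use x' in simp)
      have "w \<in> R (c x')"
      proof -
        have "x' \<in> U" using x'(1) C(2) Q by blast
        then have "w \<in> Rn m" using x'(2) C1'(3) by simp
        moreover have "F (x (c x')) i - real m * e * h \<le> w i \<and> w i \<le> F (x (c x')) i + real m * e * h" if "i < m" for i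
          using est[of "x (c x')" x' i] xc x' that by (auto simp: abs_le_iff)
        ultimately show ?thesis by (auto simp: R_def Rn_def PiE_iff)
      qed
      then show "w \<in> (\<Union>q\<in>I. R q)" using cI[OF x'(1)] by blast
    qed
    moreover have finI: "finite I" by (auto simp: I_def intro: finite_PiE)
    ultimately have "emeasure (Leb m) (F ` C) \<le> emeasure (Leb m) (\<Union>q\<in>I. R q)"
      using Rm by (intro emeasure_mono sets.finite_UN) auto
    also have "\<dots> \<le> (\<Sum>q\<in>I. emeasure (Leb m) (R q))"
      using finI Rm by (intro emeasure_subadditive_finite) auto
    also have "\<dots> = of_nat (card I) * ennreal ((2 * (real m * e * h)) ^ m)"
      by (simp add: Re)
    also have "card I = (k + 1) ^ m" by (simp add: I_def card_PiE)
    also have "of_nat ((k + 1) ^ m) * ennreal ((2 * (real m * e * h)) ^ m) = ennreal ((real (k + 1) * (2 * (real m * e * h))) ^ m)"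
      using e h(1) by (simp add: ennreal_of_nat_eq_real_of_nat ennreal_mult[symmetric] power_mult_distrib)
    \<comment> \<open>Since \<open>(k + 1) * h \<le> 2 * k * h = 4 * r\<close>, the number of cells
      cancels against their size, and a bound in terms of \<open>e\<close> remains.\<close>
    also have "\<dots> \<le> ennreal ((8 * real m * r * e) ^ m)"
    proof (rule ennreal_leI, rule power_mono)
      have "real (k + 1) * h \<le> 4 * r"
        using k0 r by (simp add: h_def field_simps)
      then have "(2 * real m * e) * (real (k + 1) * h) \<le> (2 * real m * e) * (4 * r)"
        using e by (intro mult_left_mono) auto
      then show "real (k + 1) * (2 * (real m * e * h)) \<le> 8 * real m * r * e" by (simp add: mult_ac)
      show "0 \<le> real (k + 1) * (2 * (real m * e * h))" using e h(1) by simp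
    qed
    finally show ?thesis .
  qed
  have le: "emeasure (Leb m) (F ` C) \<le> ennreal \<epsilon>" if "0 < \<epsilon>" "\<epsilon> < 1" for \<epsilon>
  proof -
    \<comment> \<open>The choice of \<open>e\<close> makes the base of the power equal to
      \<open>\<epsilon>\<close>; then \<open>\<epsilon> ^ m \<le> \<epsilon>\<close> because
      \<open>m > 0\<close> and \<open>\<epsilon> < 1\<close>.\<close>
    have "emeasure (Leb m) (F ` C) \<le> ennreal ((8 * real m * r * (\<epsilon> / (8 * real m * r))) ^ m)"
      using that m r by (intro small) auto
    also have "8 * real m * r * (\<epsilon> / (8 * real m * r)) = \<epsilon>" using m r by simp
    also have "ennreal (\<epsilon> ^ m) \<le> ennreal \<epsilon>"
      using that m power_decreasing[of 1 m \<epsilon>] by (intro ennreal_leI) auto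
    finally show ?thesis .
  qed
  show ?thesis
  proof (rule ccontr)
    assume ne: "emeasure (Leb m) (F ` C) \<noteq> 0"
    have "emeasure (Leb m) (F ` C) \<le> ennreal (1/2)" by (rule le) auto
    then have "emeasure (Leb m) (F ` C) \<noteq> Orderings.top" using neq_top_trans ennreal_neq_top by blast
    then obtain \<rho> where \<rho>: "emeasure (Leb m) (F ` C) = ennreal \<rho>" "\<rho> \<ge> 0"
      using that by (cases "emeasure (Leb m) (F ` C)" rule: ennreal_cases) auto
    with ne have "\<rho> > 0" by (cases "\<rho> = 0") auto
    have "min (\<rho> / 2) (1/2) < 1" "0 < min (\<rho> / 2) (1/2)" using \<open>\<rho> > 0\<close> by linarith+
    from le[OF this(2,1)] have "\<rho> \<le> min (\<rho> / 2) (1/2)"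
      unfolding \<rho>(1) using \<open>\<rho> > 0\<close> by (subst (asm) ennreal_le_iff) auto
    with \<open>\<rho> > 0\<close> show False by linarith
  qed
qed

text \<open>Both sides are 0: the Jacobian matrix is zero of positive size, and the image is a null
  set, so that almost every point has an empty fibre. The covering estimate is the easy case of
  Sard's theorem.\<close>

lemma area_on_zero_derivative:
  assumes C1: "C1_map m U F D" and m: "m > 0" and B: "sigma_compact B" "B \<subseteq> U"
    and z: "\<And>y i j. y \<in> B \<Longrightarrow> i < m \<Longrightarrow> j < m \<Longrightarrow> D i j y = 0"
  shows "area_on m F D B"
proof (rule area_on_local[OF B(1)])
  note C1' = C1_mapD[OF C1]
  show "continuous_on B F" using C1'(4) B(2) by (rule continuous_on_subset)
  show "continuous_on B (D i j)" if "i < m" "j < m" for i j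
    using C1'(5)[OF that] B(2) by (rule continuous_on_subset)
  fix a assume "a \<in> B"
  then obtain r where r: "r > 0" "{x \<in> Rn m. \<forall>i<m. \<bar>x i - a i\<bar> \<le> r} \<subseteq> U"
    using box_in_openin[OF C1'(1)] B(2) by blast
  define V where "V = (\<Inter>i\<in>{..<m}. {x::nat \<Rightarrow> real. \<bar>x i - a i\<bar> < r})"
  have "open V" unfolding V_def
    by (intro open_INT finite_lessThan ballI open_Collect_less continuous_intros)
  moreover have "a \<in> V" using r by (simp add: V_def)
  moreover have "area_on m F D C" if C: "sigma_compact C" "C \<subseteq> B \<inter> V" for C
  proof -
    have CU: "C \<subseteq> U" using C(2) B(2) by blast
    have CQ: "C \<subseteq> {x \<in> Rn m. \<forall>i<m. \<bar>x i - a i\<bar> \<le> r}"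
    proof
      fix x assume "x \<in> C"
      then have "x \<in> Rn m" "x \<in> V" using C CU C1'(2) by blast+
      then show "x \<in> {x \<in> Rn m. \<forall>i<m. \<bar>x i - a i\<bar> \<le> r}" by (auto simp: V_def less_imp_le)
    qed
    have contC: "continuous_on C F" using C1'(4) CU by (rule continuous_on_subset)
    have "emeasure (Leb m) (F ` C) = 0"
      by (rule null_image_zero_derivative[OF C1 m r C(1) CQ]) (use z C(2) in blast)
    then have "F ` C \<in> null_sets (Leb m)"
      using C contC C1'(3) CU by (intro null_setsI sigma_compact_sets_Leb sigma_compact_image) auto
    then have "AE z in Leb m. count_preimages F C z = 0"
    proof (rule AE_I')
      show "{z \<in> space (Leb m). count_preimages F C z \<noteq> 0} \<subseteq> F ` C"
      proof
        fix z assume "z \<in> {z \<in> space (Leb m). count_preimages F C z \<noteq> 0}"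
        then have *: "count_preimages F C z \<noteq> 0" by simp
        show "z \<in> F ` C"
        proof (rule ccontr)
          assume "z \<notin> F ` C"
          then have "{y \<in> C. F y = z} = {}" by blast
          with * show False by (simp only: count_preimages_def emeasure_empty)
        qed
      qed
    qed
    then have "(\<integral>\<^sup>+z. count_preimages F C z \<partial>Leb m) = 0"
      using borel_measurable_count_Leb[OF C(1) contC] by (simp add: nn_integral_0_iff_AE)
    moreover have "jacobian m D y = 0" if "y \<in> C" for y
    proof -
      have "mat m m (\<lambda>(i, j). D i j y) = 0\<^sub>m m m"
        using z[of y] that C(2) by (intro eq_matI) auto
      then show ?thesis using m by (simp add: jacobian_def)
    qed
    then have "(\<integral>\<^sup>+y. indicator C y * ennreal \<bar>jacobian m D y\<bar> \<partial>Leb m) = (\<integral>\<^sup>+y. 0 \<partial>Leb m)"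
      by (intro nn_integral_cong) (auto simp: indicator_def)
    ultimately show ?thesis by (simp add: area_on_def)
  qed
  ultimately show "\<exists>V. open V \<and> a \<in> V \<and> (\<forall>C. sigma_compact C \<longrightarrow> C \<subseteq> B \<inter> V \<longrightarrow> area_on m F D C)"
    by blast
qed

section \<open>Reduction of the dimension at a non-zero partial derivative\<close>

lemma det_pivot_last:
  fixes A :: "nat \<Rightarrow> nat \<Rightarrow> real"
  assumes "A l l \<noteq> 0"
  shows "Determinant.det (mat (Suc l) (Suc l) (\<lambda>(i, j). A i j)) =
    A l l * Determinant.det (mat l l (\<lambda>(i, k). A i k - A i l * A l k / A l l))"
proof -
  let ?n = "Suc l"
  \<comment> \<open>The elimination matrix of determinant 1 that subtracts multiples of the last row
    so as to clear the last column above the corner. The block that is left is the Schur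
    complement.\<close>
  define P where "P = mat ?n ?n (\<lambda>(i, j). (if i = j then 1 else 0) + (if j = l then (if i = l then 0 else - A i l / A l l) else 0))"
  let ?A = "mat ?n ?n (\<lambda>(i, j). A i j)"
  let ?S = "mat l l (\<lambda>(i, k). A i k - A i l * A l k / A l l)"
  have PA: "P * ?A = four_block_mat ?S (0\<^sub>m l 1) (mat 1 l (\<lambda>(i, j). A l j)) (mat 1 1 (\<lambda>_. A l l))" (is "_ = ?B")
  proof (rule eq_matI)
    fix i j assume ij: "i < dim_row ?B" "j < dim_col ?B"
    then have ij': "i < ?n" "j < ?n" by auto
    have "(P * ?A) $$ (i, j) = (\<Sum>k = 0..<?n. ((if i = k then 1 else 0) + (if k = l then (if i = l then 0 else - A i l / A l l) else 0)) * A k j)"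
      using ij' by (simp add: P_def scalar_prod_def)
    also have "\<dots> = (\<Sum>k = 0..<?n. (if i = k then A k j else 0)) + (\<Sum>k = 0..<?n. if k = l then (if i = l then 0 else - A i l / A l l) * A k j else 0)"
      unfolding sum.distrib[symmetric] by (intro sum.cong) auto
    also have "\<dots> = A i j + (if i = l then 0 else - A i l / A l l) * A l j"
      using ij' by (simp add: sum.delta sum.delta')
    also have "\<dots> = ?B $$ (i, j)"
      using ij' assms by (auto simp: less_Suc_eq)
    finally show "(P * ?A) $$ (i, j) = ?B $$ (i, j)" .
  qed (auto simp: P_def)
  have "Determinant.det P = prod_list (diag_mat P)"
    by (rule det_upper_triangular[of _ ?n]) (auto simp: P_def upper_triangular_def)
  also have "diag_mat P = map (\<lambda>_. 1) [0..<?n]"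
    unfolding diag_mat_def by (intro map_cong) (auto simp: P_def)
  also have "prod_list (map (\<lambda>_. 1::real) xs) = 1" for xs :: "nat list" by (induction xs) auto
  finally have "Determinant.det P = 1" .
  then have "Determinant.det ?A = Determinant.det (P * ?A)"
    by (subst det_mult[of _ ?n]) (auto simp: P_def)
  also have "\<dots> = Determinant.det ?S * Determinant.det (mat 1 1 (\<lambda>_. A l l))"
    unfolding PA by (rule det_four_block_mat_upper_right_zero) auto
  finally show ?thesis by (simp add: det_single)
qed

text \<open>When \<open>\<phi>\<close> is inverted, varying the coordinate \<open>k\<close> makes
  the coordinate \<open>l\<close> move as well, so a joint derivative in two coordinates is
  required. It exists because the partial derivative in \<open>l\<close> is continuous.\<close>

lemma C1_map_pair_derivative:
  assumes C1: "C1_map m U F D" and y: "y \<in> U" and "i < m" "k < m" "l < m" "k \<noteq> l"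
  shows "((\<lambda>(\<tau>, \<sigma>). F (y(k := \<tau>, l := \<sigma>)) i) has_derivative (\<lambda>(u, v). D i k y * u + D i l y * v)) (at (y k, y l))"
proof -
  note C1' = C1_mapD[OF C1]
  obtain r where r: "r > 0" "{x \<in> Rn m. \<forall>i<m. \<bar>x i - y i\<bar> \<le> r} \<subseteq> U"
    using box_in_openin[OF C1'(1) y] by blast
  define X where "X = {y k - r <..< y k + r}"
  define Y where "Y = {y l - r <..< y l + r}"
  have inU: "y(k := \<tau>, l := \<sigma>) \<in> U" if "\<tau> \<in> X" "\<sigma> \<in> Y" for \<tau> \<sigma>
  proof -
    have "y \<in> Rn m" using y C1'(2) by blast
    then have "y(k := \<tau>, l := \<sigma>) \<in> {x \<in> Rn m. \<forall>i<m. \<bar>x i - y i\<bar> \<le> r}"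
      using that assms r(1) by (auto simp: Rn_iff X_def Y_def abs_le_iff)
    then show ?thesis using r(2) by blast
  qed
  let ?fy = "\<lambda>\<tau> \<sigma>. D i l (y(k := \<tau>, l := \<sigma>)) *\<^sub>R (id_blinfun :: real \<Rightarrow>\<^sub>L real)"
  have "((\<lambda>(\<tau>, \<sigma>). F (y(k := \<tau>, l := \<sigma>)) i) has_derivative
      (\<lambda>(u, v). D i k y * u + blinfun_apply (?fy (y k) (y l)) v)) (at (y k, y l) within X \<times> Y)"
  proof (rule has_derivative_partialsI)
    have "((\<lambda>\<tau>. F (y(k := \<tau>)) i) has_real_derivative D i k y) (at (y k))"
      using assms by (intro C1'(6))
    moreover have "y(k := \<tau>, l := y l) = y(k := \<tau>)" for \<tau> using \<open>k \<noteq> l\<close> by auto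
    ultimately have "((\<lambda>\<tau>. F (y(k := \<tau>, l := y l)) i) has_real_derivative D i k y) (at (y k))" by simp
    then show "((\<lambda>\<tau>. F (y(k := \<tau>, l := y l)) i) has_derivative (*) (D i k y)) (at (y k) within X)"
      unfolding has_field_derivative_def by (rule has_derivative_at_withinI)
    fix \<tau> \<sigma> assume ts: "\<tau> \<in> X" "\<sigma> \<in> Y"
    have "((\<lambda>\<sigma>'. F (y(k := \<tau>, l := \<sigma>, l := \<sigma>')) i) has_real_derivative D i l (y(k := \<tau>, l := \<sigma>))) (at ((y(k := \<tau>, l := \<sigma>)) l))"
      using assms by (intro C1'(6) inU ts)
    then have "((\<lambda>\<sigma>. F (y(k := \<tau>, l := \<sigma>)) i) has_real_derivative D i l (y(k := \<tau>, l := \<sigma>))) (at \<sigma>)"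
      unfolding fun_upd_upd fun_upd_same .
    then have "((\<lambda>\<sigma>. F (y(k := \<tau>, l := \<sigma>)) i) has_derivative (*) (D i l (y(k := \<tau>, l := \<sigma>)))) (at \<sigma> within Y)"
      unfolding has_field_derivative_def by (rule has_derivative_at_withinI)
    moreover have "(*) (D i l (y(k := \<tau>, l := \<sigma>))) = blinfun_apply (?fy \<tau> \<sigma>)"
      by (simp add: fun_eq_iff blinfun.scaleR_left id_blinfun.rep_eq)
    ultimately show "((\<lambda>\<sigma>. F (y(k := \<tau>, l := \<sigma>)) i) has_derivative blinfun_apply (?fy \<tau> \<sigma>)) (at \<sigma> within Y)"
      by simp
  next
    have "continuous_on (X \<times> Y) (\<lambda>q. y(k := fst q, l := snd q))"
      by (intro continuous_intros)
    then have "continuous_on (X \<times> Y) (\<lambda>q. D i l (y(k := fst q, l := snd q)))"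
      by (rule continuous_on_compose2[OF C1'(5)[OF \<open>i < m\<close> \<open>l < m\<close>]]) (auto simp: inU)
    then have "continuous_on (X \<times> Y) (\<lambda>(\<tau>, \<sigma>). ?fy \<tau> \<sigma>)"
      unfolding split_def by (intro continuous_on_scaleR continuous_on_const)
    then show "continuous (at (y k, y l) within X \<times> Y) (\<lambda>(\<tau>, \<sigma>). ?fy \<tau> \<sigma>)"
      using r(1) by (auto simp: continuous_on_eq_continuous_within X_def Y_def)
    show "y l \<in> Y" "convex Y" using r(1) by (auto simp: Y_def)
  qed
  moreover have "at (y k, y l) within X \<times> Y = at (y k, y l)"
    using r(1) by (intro at_within_open open_Times) (auto simp: X_def Y_def)
  ultimately show ?thesis by (simp add: blinfun.scaleR_left id_blinfun.rep_eq)
qed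


text \<open>
  Where the derivative of \<open>F\<close> has a non-zero entry, which exchanges of coordinates move to the
  corner \<open>(l, l)\<close>, \<open>F\<close> factors through the map \<open>\<phi>\<close> that replaces the coordinate \<open>l\<close> by \<open>F\<^sub>l\<close>.
  Substitution on lines handles \<open>\<phi>\<close>, and \<open>F \<circ> \<phi>\<^sup>-\<^sup>1\<close> preserves the coordinate \<open>l\<close>, so that Fubini's
  theorem reduces it to dimension \<open>l\<close>.
\<close>

locale pivot =
  fixes l :: nat and U :: "(nat \<Rightarrow> real) set" and F :: "(nat \<Rightarrow> real) \<Rightarrow> nat \<Rightarrow> real"
    and D :: "nat \<Rightarrow> nat \<Rightarrow> (nat \<Rightarrow> real) \<Rightarrow> real" and a :: "nat \<Rightarrow> real" and \<delta> s :: real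
  assumes C1: "C1_map (Suc l) U F D" and \<delta>: "\<delta> > 0"
    and QU: "{x \<in> Rn (Suc l). \<forall>i<Suc l. \<bar>x i - a i\<bar> < \<delta>} \<subseteq> U"
    and s: "s = 1 \<or> s = - 1"
    and pos: "\<And>x. x \<in> Rn (Suc l) \<Longrightarrow> (\<forall>i<Suc l. \<bar>x i - a i\<bar> < \<delta>) \<Longrightarrow> s * D l l x > 0"
begin

definition "Q = {x \<in> Rn (Suc l). \<forall>i<Suc l. \<bar>x i - a i\<bar> < \<delta>}"
definition "\<phi> y = y(l := F y l)"
definition "\<psi> = the_inv_into Q \<phi>"

lemmas C1' = C1_mapD[OF C1]

lemma Q_sub: "Q \<subseteq> U" using QU by (simp add: Q_def)
lemma Q_Rn: "y \<in> Q \<Longrightarrow> y \<in> Rn (Suc l)" by (simp add: Q_def)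
lemma Q_upd: "y \<in> Q \<Longrightarrow> \<bar>t - a l\<bar> < \<delta> \<Longrightarrow> y(l := t) \<in> Q"
  by (simp add: Q_def Rn_upd)
lemma Q_coord: "y \<in> Q \<Longrightarrow> \<bar>y l - a l\<bar> < \<delta>" by (simp add: Q_def)
lemma D_pos: "y \<in> Q \<Longrightarrow> s * D l l y > 0" using pos by (simp add: Q_def)
lemma D_nz: "y \<in> Q \<Longrightarrow> D l l y \<noteq> 0" using D_pos[of y] by auto

lemma openin_Q: "openin (top_of_set (Rn (Suc l))) Q"
proof -
  have "Q = Rn (Suc l) \<inter> (\<Inter>i\<in>{..<Suc l}. {x. \<bar>x i - a i\<bar> < \<delta>})" by (auto simp: Q_def)
  moreover have "open (\<Inter>i\<in>{..<Suc l}. {x::nat \<Rightarrow> real. \<bar>x i - a i\<bar> < \<delta>})"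
    by (intro open_INT finite_lessThan ballI open_Collect_less continuous_intros)
  ultimately show ?thesis by (auto simp: openin_open)
qed

lemma deriv_l:
  assumes "y \<in> Q" shows "((\<lambda>t. F (y(l := t)) l) has_real_derivative D l l y) (at (y l))"
  using C1'(6)[of y l l] subsetD[OF Q_sub assms] by blast

lemma deriv_l':
  assumes "y(l := t) \<in> Q" shows "((\<lambda>t. F (y(l := t)) l) has_real_derivative D l l (y(l := t))) (at t)"
  using deriv_l[OF assms] by simp

text \<open>The sign \<open>s\<close> turns the decreasing case into the increasing one.\<close>

lemma mono_l:
  assumes y: "y \<in> Q" and t: "\<bar>t - a l\<bar> < \<delta>" "\<bar>t' - a l\<bar> < \<delta>" "t < t'"
  shows "s * F (y(l := t)) l < s * F (y(l := t')) l"
proof (rule DERIV_pos_imp_increasing[OF t(3)])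
  fix x assume "t \<le> x" "x \<le> t'"
  then have Q: "y(l := x) \<in> Q" using t by (intro Q_upd y) linarith
  have "((\<lambda>t. s * F (y(l := t)) l) has_real_derivative s * D l l (y(l := x))) (at x)"
    by (rule DERIV_cmult[OF deriv_l'[OF Q]])
  then show "\<exists>d. ((\<lambda>t. s * F (y(l := t)) l) has_real_derivative d) (at x) \<and> d > 0"
    using D_pos[OF Q] by blast
qed

lemma inj_l:
  assumes y: "y \<in> Q" "y(l := t) \<in> Q" and "F (y(l := t)) l = F y l" shows "t = y l"
proof (rule ccontr)
  assume "t \<noteq> y l"
  moreover have "\<bar>t - a l\<bar> < \<delta>" using Q_coord[OF y(2)] by simp
  ultimately show False
    using mono_l[OF y(1), of t "y l"] mono_l[OF y(1), of "y l" t] Q_coord[OF y(1)] assms(3)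
    by (cases t "y l" rule: linorder_cases) auto
qed

lemma phi_other: "i \<noteq> l \<Longrightarrow> \<phi> y i = y i" by (simp add: \<phi>_def)
lemma phi_l: "\<phi> y l = F y l" by (simp add: \<phi>_def)
lemma phi_upd: "(\<phi> y)(l := t) = y(l := t)" by (simp add: \<phi>_def)
lemma phi_Rn: "y \<in> Q \<Longrightarrow> \<phi> y \<in> Rn (Suc l)"
  using Rn_upd[OF Q_Rn, of y l] by (simp add: \<phi>_def)

lemma inj_phi: "inj_on \<phi> Q"
proof (rule inj_onI)
  fix y y' assume y: "y \<in> Q" "y' \<in> Q" "\<phi> y = \<phi> y'"
  have y': "y' = y(l := y' l)"
    using y(3) phi_other by (metis fun_upd_triv phi_upd)
  have "F y' l = F y l" using y(3) by (metis phi_l)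
  then have "y' l = y l" using inj_l[of y "y' l"] y y' by simp
  then show "y = y'" using y' by simp
qed

lemma psi_phi: "y \<in> Q \<Longrightarrow> \<psi> (\<phi> y) = y"
  unfolding \<psi>_def by (rule the_inv_into_f_f[OF inj_phi])

lemma phi_psi: "z \<in> \<phi> ` Q \<Longrightarrow> \<psi> z \<in> Q \<and> \<phi> (\<psi> z) = z"
  using psi_phi by auto

lemma continuous_phi: "continuous_on Q \<phi>"
  unfolding \<phi>_def
  by (rule continuous_on_upd[OF continuous_on_id
      continuous_on_product_then_coordinatewise[OF continuous_on_subset[OF C1'(4) Q_sub]]])

text \<open>An inverse function theorem that rests on the intermediate value theorem. On the line
  through \<open>y\<close> in direction \<open>l\<close>, the values at \<open>t1\<close> and
  \<open>t2\<close> lie strictly on both sides of \<open>z l\<close> by monotonicity. These are open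
  conditions, so they persist for every \<open>w\<close> in a neighbourhood \<open>T\<close> of
  \<open>z\<close>, and the line through \<open>w\<close> then contains a preimage of
  \<open>w\<close>.\<close>

lemma openin_phi_image:
  assumes V: "openin (top_of_set (Rn (Suc l))) V" "V \<subseteq> Q"
  shows "openin (top_of_set (Rn (Suc l))) (\<phi> ` V)"
proof (subst openin_subopen, rule ballI)
  fix z assume "z \<in> \<phi> ` V"
  then obtain y where y: "y \<in> V" "z = \<phi> y" by blast
  obtain r where r: "r > 0" "{x \<in> Rn (Suc l). \<forall>i<Suc l. \<bar>x i - y i\<bar> \<le> r} \<subseteq> V"
    using box_in_openin[OF V(1) y(1)] by blast
  have yR: "y \<in> Rn (Suc l)" using y V Q_Rn by blast
  define T0 where "T0 = {z \<in> Rn (Suc l). \<forall>i<l. \<bar>z i - y i\<bar> < r}"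
  have boxV: "x(l := t) \<in> V" if "x \<in> T0" "\<bar>t - y l\<bar> \<le> r" for x t
  proof -
    have "x(l := t) \<in> {x \<in> Rn (Suc l). \<forall>i<Suc l. \<bar>x i - y i\<bar> \<le> r}"
      using that by (auto simp: T0_def less_Suc_eq less_imp_le Rn_iff)
    then show ?thesis using r(2) by blast
  qed
  have oT0: "openin (top_of_set (Rn (Suc l))) T0"
  proof -
    have "T0 = Rn (Suc l) \<inter> (\<Inter>i\<in>{..<l}. {x. \<bar>x i - y i\<bar> < r})" by (auto simp: T0_def)
    moreover have "open (\<Inter>i\<in>{..<l}. {x::nat \<Rightarrow> real. \<bar>x i - y i\<bar> < r})"
      by (intro open_INT finite_lessThan ballI open_Collect_less continuous_intros)
    ultimately show ?thesis by (auto simp: openin_open)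
  qed
  define g where "g t z = s * F (z(l := t)) l - s * z l" for t z
  have cg: "continuous_on T0 (g t)" if "\<bar>t - y l\<bar> \<le> r" for t
  proof -
    have "continuous_on T0 (\<lambda>z. z(l := t))" by (intro continuous_intros)
    then have "continuous_on T0 (\<lambda>z. F (z(l := t)))"
      by (rule continuous_on_compose2[OF C1'(4)]) (use boxV that V(2) Q_sub in blast)
    then have "continuous_on T0 (\<lambda>z. F (z(l := t)) l)" by (rule continuous_on_product_then_coordinatewise)
    then show ?thesis unfolding g_def by (intro continuous_on_diff continuous_on_mult_left continuous_intros)
  qed
  define t1 where "t1 = y l - r"
  define t2 where "t2 = y l + r"
  have t12: "\<bar>t1 - y l\<bar> \<le> r" "\<bar>t2 - y l\<bar> \<le> r" "t1 < y l" "y l < t2" "t1 \<le> t2"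
    using r(1) by (auto simp: t1_def t2_def)
  define T where "T = (T0 \<inter> g t1 -` {..<0}) \<inter> (T0 \<inter> g t2 -` {0<..})"
  have "openin (top_of_set T0) T"
    unfolding T_def by (intro openin_Int continuous_openin_preimage_gen cg t12) auto
  then have oT: "openin (top_of_set (Rn (Suc l))) T" using oT0 openin_trans by blast
  have yT0: "y \<in> T0" using yR r(1) by (simp add: T0_def)
  have yQ: "y \<in> Q" using y(1) V(2) by blast
  have inQ: "y(l := t1) \<in> Q" "y(l := t2) \<in> Q" using boxV[OF yT0] t12 V(2) by blast+
  have zT0: "z \<in> T0" using yT0 phi_Rn[OF yQ] by (auto simp: y(2) T0_def phi_other)
  have "s * F (y(l := t1)) l < s * F (y(l := y l)) l"
    using Q_coord[OF inQ(1)] Q_coord[OF yQ] t12 by (intro mono_l yQ) auto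
  moreover have "s * F (y(l := y l)) l < s * F (y(l := t2)) l"
    using Q_coord[OF inQ(2)] Q_coord[OF yQ] t12 by (intro mono_l yQ) auto
  ultimately have zT: "z \<in> T" using zT0 by (simp add: T_def g_def y(2) phi_upd phi_l)
  have "T \<subseteq> \<phi> ` V"
  proof
    fix w assume w: "w \<in> T"
    then have wT0: "w \<in> T0" by (simp add: T_def)
    have w1: "s * F (w(l := t1)) l \<le> s * w l" "s * w l \<le> s * F (w(l := t2)) l"
      using w by (auto simp: T_def g_def)
    have "continuous_on {t1..t2} (\<lambda>t. s * F (w(l := t)) l)"
    proof (intro continuous_on_mult_left DERIV_continuous_on)
      fix t assume "t \<in> {t1..t2}"
      then have "w(l := t) \<in> Q" using V(2) by (intro subsetD[OF V(2)] boxV[OF wT0]) (auto simp: t1_def t2_def)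
      then show "((\<lambda>t. F (w(l := t)) l) has_real_derivative D l l (w(l := t))) (at t within {t1..t2})"
        using deriv_l' has_field_derivative_at_within by blast
    qed
    then obtain t where t: "t1 \<le> t" "t \<le> t2" "s * F (w(l := t)) l = s * w l"
      using IVT'[of "\<lambda>t. s * F (w(l := t)) l" t1 "s * w l" t2] w1 t12 by blast
    then have "F (w(l := t)) l = w l" using s by auto
    then have "\<phi> (w(l := t)) = w" by (simp add: \<phi>_def)
    moreover have "w(l := t) \<in> V" using t by (intro boxV[OF wT0]) (auto simp: t1_def t2_def)
    ultimately show "w \<in> \<phi> ` V" by (metis imageI)
  qed
  with oT zT show "\<exists>T. openin (top_of_set (Rn (Suc l))) T \<and> z \<in> T \<and> T \<subseteq> \<phi> ` V" by blast
qed

lemma openin_phiQ: "openin (top_of_set (Rn (Suc l))) (\<phi> ` Q)"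
  by (rule openin_phi_image[OF openin_Q]) simp

lemma continuous_psi: "continuous_on (\<phi> ` Q) \<psi>"
proof (rule continuous_on_inverse_open_map[OF continuous_phi refl])
  show "\<And>x. x \<in> Q \<Longrightarrow> \<psi> (\<phi> x) = x" by (rule psi_phi)
  fix V assume "openin (top_of_set Q) V"
  then have "openin (top_of_set (Rn (Suc l))) V" "V \<subseteq> Q"
    using openin_Q openin_trans openin_imp_subset by blast+
  then have "openin (top_of_set (Rn (Suc l))) (\<phi> ` V)" by (rule openin_phi_image)
  then show "openin (top_of_set (\<phi> ` Q)) (\<phi> ` V)"
    by (rule openin_subset_trans) (use \<open>V \<subseteq> Q\<close> phi_Rn in auto)
qed

lemma psi_other: "z \<in> \<phi> ` Q \<Longrightarrow> \<psi> z = z(l := \<psi> z l)"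
  using phi_upd[of "\<psi> z" "\<psi> z l"] phi_psi[of z] by (simp only: fun_upd_triv)

lemma F_psi_l: "z \<in> \<phi> ` Q \<Longrightarrow> F (\<psi> z) l = z l"
  using phi_l[of "\<psi> z"] phi_psi[of z] by simp

text \<open>The derivative of the composition of \<open>F i\<close> with the inverse of
  \<open>\<phi>\<close> in the coordinate \<open>k\<close>, given by the implicit function rule. It
  is at the same time the entry of the Schur complement in \<open>det_pivot_last\<close>.\<close>

definition "Dt i k y = D i k y - D i l y * D l k y / D l l y"

lemma derivative_F_psi:
  assumes z: "z \<in> \<phi> ` Q" and i: "i < l" and k: "k < l"
  shows "((\<lambda>\<tau>. F (\<psi> (z(k := \<tau>))) i) has_real_derivative Dt i k (\<psi> z)) (at (z k))"
proof -
  define y where "y = \<psi> z"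
  have yQ: "y \<in> Q" and zy: "z = \<phi> y" using phi_psi[OF z] by (auto simp: y_def)
  have yU: "y \<in> U" and yR: "y \<in> Rn (Suc l)" using yQ Q_sub Q_Rn by auto
  have kl: "k \<noteq> l" "k < Suc l" "i < Suc l" using i k by auto
  have zk: "z k = y k" and zl: "z l = F y l" using kl by (simp_all add: zy phi_other phi_l)
  define T where "T = (\<lambda>(\<tau>, \<zeta>). y(k := \<tau>, l := \<zeta>)) -` (\<phi> ` Q)"
  have cupd: "continuous_on A (\<lambda>(\<tau>, \<zeta>). y(k := \<tau>, l := \<zeta>))" for A
    unfolding split_def by (intro continuous_intros)
  have oT: "open T"
  proof -
    obtain W where W: "open W" "\<phi> ` Q = Rn (Suc l) \<inter> W" using openin_phiQ by (auto simp: openin_open)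
    have "T = (\<lambda>(\<tau>, \<zeta>). y(k := \<tau>, l := \<zeta>)) -` W"
      unfolding T_def W(2) using yR kl by (auto simp: Rn_iff)
    then show ?thesis using open_vimage[OF W(1) cupd] by simp
  qed
  have upd_eq: "y(k := \<tau>, l := z l) = z(k := \<tau>)" for \<tau>
    using kl by (auto simp: zy \<phi>_def fun_eq_iff)
  have zT: "(z k, z l) \<in> T" using z upd_eq[of "z k"] by (simp add: T_def)
  \<comment> \<open>In the plane of the coordinates \<open>k\<close> and \<open>l\<close> the map
    \<open>\<phi>\<close> becomes \<open>?G\<close>, and \<open>?g\<close> is its inverse. As
    \<open>?g\<close> is known to be continuous, its derivative is the inverse of that of
    \<open>?G\<close>.\<close>
  let ?G = "\<lambda>p::real \<times> real. (fst p, F (y(k := fst p, l := snd p)) l)"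
  let ?g = "\<lambda>p::real \<times> real. (fst p, \<psi> (y(k := fst p, l := snd p)) l)"
  let ?G' = "\<lambda>p::real \<times> real. (fst p, D l k y * fst p + D l l y * snd p)"
  let ?g' = "\<lambda>p::real \<times> real. (fst p, (snd p - D l k y * fst p) / D l l y)"
  have "y(k := z k, l := z l) = z" using upd_eq[of "z k"] by (simp only: fun_upd_triv)
  then have gz: "?g (z k, z l) = (y k, y l)" by (simp only: fst_conv snd_conv zk y_def[symmetric])
  have pd: "((\<lambda>p. F (y(k := fst p, l := snd p)) j) has_derivative (\<lambda>p. D j k y * fst p + D j l y * snd p)) (at (y k, y l))"
    if "j < Suc l" for j
    using C1_map_pair_derivative[OF C1 yU that kl(2) lessI kl(1)] unfolding split_def .
  have "(?g has_derivative ?g') (at (z k, z l))"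
  proof (rule has_derivative_inverse_basic[where f="?G" and f'="?G'" and T=T])
    show "(?G has_derivative ?G') (at (?g (z k, z l)))"
      unfolding gz by (intro has_derivative_Pair has_derivative_fst has_derivative_ident pd) simp
    show "bounded_linear ?g'"
      by (intro bounded_linear_Pair bounded_linear_fst bounded_linear_divide[THEN bounded_linear_compose]
          bounded_linear_sub bounded_linear_snd bounded_linear_const_mult)
    show "?g' \<circ> ?G' = id" using D_nz[OF yQ] by (auto simp: fun_eq_iff)
    have "continuous_on T (\<lambda>p. \<psi> (y(k := fst p, l := snd p)))"
      using cupd[of T] by (intro continuous_on_compose2[OF continuous_psi]) (auto simp: split_def T_def)
    then have "continuous_on T ?g"
      by (rule continuous_on_Pair[OF continuous_on_fst[OF continuous_on_id] continuous_on_product_then_coordinatewise])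
    then show "isCont ?g (z k, z l)" using oT zT continuous_on_eq_continuous_at by blast
    show "open T" "(z k, z l) \<in> T" by fact+
    fix p assume "p \<in> T"
    then have p: "y(k := fst p, l := snd p) \<in> \<phi> ` Q" by (auto simp: T_def split_def)
    have "y(k := fst p, l := \<psi> (y(k := fst p, l := snd p)) l) = \<psi> (y(k := fst p, l := snd p))"
      using psi_other[OF p] by simp
    then show "?G (?g p) = p" using F_psi_l[OF p] by (simp add: prod_eq_iff)
  qed
  then have "(?g has_derivative ?g') (at (z k, z l))" .
  moreover have "((\<lambda>\<tau>. (\<tau>, z l)) has_derivative (\<lambda>h. (h, 0))) (at (z k))"
    by (intro has_derivative_Pair has_derivative_ident has_derivative_const)
  ultimately have "((\<lambda>\<tau>. ?g (\<tau>, z l)) has_derivative (\<lambda>h. ?g' (h, 0))) (at (z k))"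
    by (rule has_derivative_compose[rotated])
  then have d1: "((\<lambda>\<tau>. (\<tau>, \<psi> (z(k := \<tau>)) l)) has_derivative (\<lambda>h. (h, - (D l k y * h) / D l l y))) (at (z k))"
    by (simp add: upd_eq)
  have "\<psi> (z(k := z k)) l = y l" by (simp only: fun_upd_triv y_def)
  then have pz: "(z k, \<psi> (z(k := z k)) l) = (y k, y l)" by (intro arg_cong2[where f=Pair] zk)
  have pd': "((\<lambda>p. F (y(k := fst p, l := snd p)) i) has_derivative (\<lambda>p. D i k y * fst p + D i l y * snd p))
      (at (z k, \<psi> (z(k := z k)) l))"
    unfolding pz by (rule pd[OF kl(3)])
  have "((\<lambda>\<tau>. F (y(k := \<tau>, l := \<psi> (z(k := \<tau>)) l)) i) has_derivative
      (\<lambda>h. D i k y * h + D i l y * (- (D l k y * h) / D l l y))) (at (z k))"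
    using has_derivative_compose[OF d1 pd'] by (simp only: fst_conv snd_conv)
  then have d2: "((\<lambda>\<tau>. F (y(k := \<tau>, l := \<psi> (z(k := \<tau>)) l)) i) has_real_derivative Dt i k y) (at (z k))"
    unfolding has_field_derivative_def
    by (rule has_derivative_eq_rhs) (auto simp: Dt_def fun_eq_iff field_simps)
  have "\<forall>\<^sub>F \<tau> in nhds (z k). F (y(k := \<tau>, l := \<psi> (z(k := \<tau>)) l)) i = F (\<psi> (z(k := \<tau>))) i"
  proof -
    \<comment> \<open>The two functions of \<open>\<tau>\<close> agree only as long as
      \<open>z(k := \<tau>)\<close> stays in the domain of \<open>\<psi>\<close>, which is
      open.\<close>
    have "open ((\<lambda>\<tau>. (\<tau>, z l)) -` T)"
      by (intro open_vimage oT continuous_intros)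
    then have "\<forall>\<^sub>F \<tau> in nhds (z k). \<tau> \<in> (\<lambda>\<tau>. (\<tau>, z l)) -` T"
      using zT by (intro eventually_nhds_in_open) auto
    then show ?thesis
    proof eventually_elim
      case (elim \<tau>)
      then have "z(k := \<tau>) \<in> \<phi> ` Q" by (simp add: T_def upd_eq)
      from psi_other[OF this] have "\<psi> (z(k := \<tau>)) = y(k := \<tau>, l := \<psi> (z(k := \<tau>)) l)"
        using upd_eq[of \<tau>] by (metis fun_upd_upd)
      then show ?case by simp
    qed
  qed
  from DERIV_cong_ev[OF refl this refl]
  have "((\<lambda>\<tau>. F (y(k := \<tau>, l := \<psi> (z(k := \<tau>)) l)) i) has_real_derivative Dt i k y) (at (z k)) \<longleftrightarrow>
    ((\<lambda>\<tau>. F (\<psi> (z(k := \<tau>))) i) has_real_derivative Dt i k y) (at (z k))" .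
  with d2 show ?thesis unfolding y_def[symmetric] by (rule iffD1[rotated])
qed

text \<open>By \<open>F_psi_l\<close>, the map \<open>F \<circ> \<psi>\<close> preserves the
  coordinate \<open>l\<close>, so on each hyperplane with \<open>z l = t\<close> it is a map in
  \<open>l\<close> coordinates. The coordinate \<open>l\<close> is reset to \<open>undefined\<close>
  in order to land in \<open>Rn l\<close>.\<close>

definition "slice_dom t = {w \<in> Rn l. w(l := t) \<in> \<phi> ` Q}"
definition "slice t w = (F (\<psi> (w(l := t))))(l := undefined)"
definition "slice_D t i k w = Dt i k (\<psi> (w(l := t)))"

lemma Rn_l_upd: "w \<in> Rn l \<Longrightarrow> w(l := t) \<in> Rn (Suc l)" by (simp add: Rn_iff)
lemma Rn_Suc_upd: "w \<in> Rn (Suc l) \<Longrightarrow> w(l := undefined) \<in> Rn l" by (simp add: Rn_iff)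
lemma Rn_l_triv: "w \<in> Rn l \<Longrightarrow> w(l := undefined) = w" by (simp add: Rn_iff fun_upd_idem)

lemma continuous_Dt:
  assumes "i < Suc l" "k < Suc l" shows "continuous_on Q (Dt i k)"
proof -
  have "continuous_on Q (D i j)" if "i < Suc l" "j < Suc l" for i j
    using continuous_on_subset[OF C1'(5)[OF that] Q_sub] .
  then show ?thesis unfolding Dt_def using assms D_nz by (intro continuous_intros) auto
qed

lemma continuous_slice_psi: "continuous_on (slice_dom t) (\<lambda>w. \<psi> (w(l := t)))"
proof -
  have "continuous_on (slice_dom t) (\<lambda>w. w(l := t))" by (intro continuous_intros)
  then show ?thesis by (rule continuous_on_compose2[OF continuous_psi]) (auto simp: slice_dom_def)
qed

lemma C1_slice: "C1_map l (slice_dom t) (slice t) (slice_D t)"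
proof -
  have psiQ: "\<psi> (w(l := t)) \<in> Q" if "w \<in> slice_dom t" for w
    using that phi_psi by (auto simp: slice_dom_def)
  have "openin (top_of_set (Rn l)) (slice_dom t)"
  proof -
    obtain W where W: "open W" "\<phi> ` Q = Rn (Suc l) \<inter> W" using openin_phiQ by (auto simp: openin_open)
    have "open ((\<lambda>w. w(l := t)) -` W)"
      by (intro open_vimage W continuous_intros)
    moreover have "slice_dom t = Rn l \<inter> (\<lambda>w. w(l := t)) -` W"
      unfolding slice_dom_def W(2) using Rn_l_upd by auto
    ultimately show ?thesis by (auto simp: openin_open)
  qed
  moreover have "slice t ` slice_dom t \<subseteq> Rn l"
    using psiQ Q_sub C1'(3) by (auto simp: slice_def intro!: Rn_Suc_upd)
  moreover have "continuous_on (slice_dom t) (slice t)"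
  proof -
    have "continuous_on (slice_dom t) (\<lambda>w. F (\<psi> (w(l := t))))"
      by (rule continuous_on_compose2[OF C1'(4) continuous_slice_psi]) (use psiQ Q_sub in auto)
    then show ?thesis unfolding slice_def by (intro continuous_on_upd continuous_on_const)
  qed
  moreover have "continuous_on (slice_dom t) (slice_D t i k)" if "i < l" "k < l" for i k
    unfolding slice_D_def
    by (rule continuous_on_compose2[OF continuous_Dt continuous_slice_psi]) (use that psiQ in auto)
  moreover have "((\<lambda>\<tau>. slice t (w(k := \<tau>)) i) has_real_derivative slice_D t i k w) (at (w k))"
    if "w \<in> slice_dom t" "i < l" "k < l" for w i k
  proof -
    have "w(l := t) \<in> \<phi> ` Q" using that(1) by (simp add: slice_dom_def)
    from derivative_F_psi[OF this that(2,3)]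
    have "((\<lambda>\<tau>. F (\<psi> (w(l := t, k := \<tau>))) i) has_real_derivative slice_D t i k w) (at (w k))"
      using that(3) by (simp add: slice_D_def)
    moreover have "w(l := t, k := \<tau>) = w(k := \<tau>, l := t)" for \<tau> using that(3) by (simp add: fun_upd_twist)
    ultimately show ?thesis using that(2) by (simp add: slice_def)
  qed
  ultimately show ?thesis unfolding C1_map_def by blast
qed

definition "G y = \<bar>Determinant.det (mat l l (\<lambda>(i, k). Dt i k y))\<bar>"

lemma jacobian_slice: "\<bar>jacobian l (slice_D t) w\<bar> = G (\<psi> (w(l := t)))"
  by (simp add: jacobian_def G_def slice_D_def)

lemma jacobian_eq: "y \<in> Q \<Longrightarrow> \<bar>jacobian (Suc l) D y\<bar> = \<bar>D l l y\<bar> * G y"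
  unfolding jacobian_def G_def Dt_def using det_pivot_last[of "\<lambda>i j. D i j y" l] D_nz by (simp add: abs_mult)

lemma continuous_G: "continuous_on Q G"
  unfolding G_def by (intro continuous_on_rabs continuous_on_det_mat continuous_Dt) auto

lemma borel_upd: "(\<lambda>t. w(l := t)) \<in> borel_measurable borel" for w :: "nat \<Rightarrow> real"
  by (intro borel_measurable_continuous_onI continuous_intros)

text \<open>The Jacobian is \<open>\<bar>D l l\<bar> * G\<close> by \<open>jacobian_eq\<close>. The
  induction hypothesis for the slices of \<open>F \<circ> \<psi>\<close> produces the factor
  \<open>G\<close>; after Tonelli's theorem has passed from slices to lines, the substitution by
  \<open>F l\<close> along each line produces the factor \<open>\<bar>D l l\<bar>\<close>.\<close>

lemma area_on_Q:
  assumes IH: "\<And>U F D B. C1_map l U F D \<Longrightarrow> sigma_compact B \<Longrightarrow> B \<subseteq> U \<Longrightarrow> area_on l F D B"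
    and C: "sigma_compact C" "C \<subseteq> Q"
  shows "area_on (Suc l) F D C"
proof -
  have CU: "C \<subseteq> U" using C(2) Q_sub by blast
  have contF: "continuous_on C F" using C1'(4) CU by (rule continuous_on_subset)
  have sc: "sigma_compact (\<phi> ` C)"
    using C continuous_on_subset[OF continuous_phi] by (intro sigma_compact_image) auto
  define Ct where "Ct t = {w \<in> Rn l. w(l := t) \<in> \<phi> ` C}" for t
  have scCt: "sigma_compact (Ct t)" for t
  proof -
    \<comment> \<open>A slice is a continuous image of a closed section of a sigma-compact set,
      hence itself sigma-compact.\<close>
    have "Ct t = (\<lambda>z. z(l := undefined)) ` (\<phi> ` C \<inter> {z. z l = t})" (is "_ = ?R")
    proof
      show "Ct t \<subseteq> ?R"
      proof
        fix w assume "w \<in> Ct t"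
        then have "w = (w(l := t))(l := undefined)" "w(l := t) \<in> \<phi> ` C \<inter> {z. z l = t}"
          using Rn_l_triv by (auto simp: Ct_def)
        then show "w \<in> ?R" by (rule image_eqI)
      qed
      show "?R \<subseteq> Ct t"
      proof
        fix w assume "w \<in> ?R"
        then obtain z where z: "z \<in> \<phi> ` C" "z l = t" "w = z(l := undefined)" by blast
        then have "z \<in> Rn (Suc l)" using C(2) phi_Rn by blast
        then show "w \<in> Ct t" using z Rn_Suc_upd by (auto simp: Ct_def)
      qed
    qed
    moreover have "sigma_compact (\<phi> ` C \<inter> {z. z l = t})"
      by (intro sigma_compact_Int_closed sc closed_Collect_eq continuous_intros)
    then have "sigma_compact ((\<lambda>z. z(l := undefined)) ` (\<phi> ` C \<inter> {z. z l = t}))"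
      by (rule sigma_compact_image) (intro continuous_intros)
    ultimately show ?thesis by simp
  qed
  have CtU: "Ct t \<subseteq> slice_dom t" for t using C(2) by (auto simp: Ct_def slice_dom_def)
  have psiC: "z \<in> \<phi> ` C \<Longrightarrow> \<psi> z \<in> C \<and> \<phi> (\<psi> z) = z" for z using psi_phi C(2) by auto
  \<comment> \<open>If \<open>F y = w(l := t)\<close>, then the coordinate \<open>l\<close> of
    \<open>\<phi> y\<close> is \<open>t\<close>, so all preimages are sent by \<open>\<phi>\<close>
    to the same slice.\<close>
  have count: "count_preimages F C (w(l := t)) = count_preimages (slice t) (Ct t) w" if w: "w \<in> Rn l" for w t
  proof (rule count_preimages_cong_bij)
    show "bij_betw (\<lambda>y. y(l := undefined)) {y \<in> C. F y = w(l := t)} {u \<in> Ct t. slice t u = w}"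
    proof (rule bij_betw_byWitness[where f'="\<lambda>u. \<psi> (u(l := t))"])
      have A: "(y(l := undefined))(l := t) = \<phi> y" if "y \<in> C" "F y = w(l := t)" for y
        using that by (simp add: \<phi>_def)
      show "\<forall>y\<in>{y \<in> C. F y = w(l := t)}. \<psi> ((y(l := undefined))(l := t)) = y"
        using A psi_phi C(2) by auto
      show "(\<lambda>y. y(l := undefined)) ` {y \<in> C. F y = w(l := t)} \<subseteq> {u \<in> Ct t. slice t u = w}"
      proof safe
        fix y assume y: "y \<in> C" "F y = w(l := t)"
        have "y(l := undefined) \<in> Rn l" using y C(2) Q_Rn Rn_Suc_upd by blast
        then show "y(l := undefined) \<in> Ct t" using A[OF y] y by (auto simp: Ct_def)
        have "slice t (y(l := undefined)) = (F (\<psi> (\<phi> y)))(l := undefined)"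
          by (simp only: slice_def A[OF y])
        then show "slice t (y(l := undefined)) = w" using y C(2) psi_phi Rn_l_triv[OF w] by auto
      qed
      have B: "F (\<psi> (u(l := t))) = w(l := t)" if "u \<in> Ct t" "slice t u = w" for u
      proof -
        have "u(l := t) \<in> \<phi> ` Q" using that(1) C(2) by (auto simp: Ct_def)
        from F_psi_l[OF this] have "F (\<psi> (u(l := t))) l = t" by simp
        then show ?thesis using that(2) unfolding slice_def by (metis fun_upd_triv fun_upd_upd)
      qed
      show "\<forall>u\<in>{u \<in> Ct t. slice t u = w}. (\<psi> (u(l := t)))(l := undefined) = u"
      proof safe
        fix u assume u: "u \<in> Ct t"
        then have "u(l := t) \<in> \<phi> ` Q" using C(2) by (auto simp: Ct_def)
        from psi_other[OF this] have "(\<psi> (u(l := t)))(l := undefined) = u(l := undefined)"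
          by (metis fun_upd_upd)
        then show "(\<psi> (u(l := t)))(l := undefined) = u" using u Rn_l_triv by (simp add: Ct_def)
      qed
      show "(\<lambda>u. \<psi> (u(l := t))) ` {u \<in> Ct t. slice t u = w} \<subseteq> {y \<in> C. F y = w(l := t)}"
        using B psiC by (auto simp: Ct_def)
    qed
  qed
  let ?h = "\<lambda>z. indicator (\<phi> ` C) z * ennreal (G (\<psi> z))"
  have contGpsi: "continuous_on (\<phi> ` C) (\<lambda>z. G (\<psi> z))"
    by (rule continuous_on_compose2[OF continuous_G continuous_on_subset[OF continuous_psi]])
       (use C(2) phi_psi in auto)
  have hb: "?h \<in> borel_measurable borel"
    by (rule borel_measurable_indicator_continuous[OF sc contGpsi])
  have hm: "?h \<in> borel_measurable (Leb (Suc l))"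
    by (rule borel_measurable_Leb[OF hb])
  have "(\<integral>\<^sup>+z. count_preimages F C z \<partial>Leb (Suc l)) =
      (\<integral>\<^sup>+t. (\<integral>\<^sup>+w. count_preimages F C (w(l := t)) \<partial>Leb l) \<partial>lborel)"
    by (rule nn_integral_Leb_Suc(2)[OF borel_measurable_count_Leb[OF C(1) contF]])
  also have "\<dots> = (\<integral>\<^sup>+t. (\<integral>\<^sup>+w. count_preimages (slice t) (Ct t) w \<partial>Leb l) \<partial>lborel)"
    by (intro nn_integral_cong) (simp add: count)
  also have "\<dots> = (\<integral>\<^sup>+t. (\<integral>\<^sup>+w. indicator (Ct t) w * ennreal \<bar>jacobian l (slice_D t) w\<bar> \<partial>Leb l) \<partial>lborel)"
    using IH[OF C1_slice scCt CtU] by (simp add: area_on_def)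
  also have "\<dots> = (\<integral>\<^sup>+t. (\<integral>\<^sup>+w. ?h (w(l := t)) \<partial>Leb l) \<partial>lborel)"
    by (intro nn_integral_cong) (auto simp: jacobian_slice indicator_def Ct_def)
  also have "\<dots> = (\<integral>\<^sup>+w. (\<integral>\<^sup>+t. ?h (w(l := t)) \<partial>lborel) \<partial>Leb l)"
    using nn_integral_Leb_Suc[OF hm] by simp
  also have "\<dots> = (\<integral>\<^sup>+w. (\<integral>\<^sup>+t. indicator C (w(l := t)) * ennreal (\<bar>D l l (w(l := t))\<bar> * G (w(l := t))) \<partial>lborel) \<partial>Leb l)"
  proof (rule nn_integral_cong)
    fix w assume "w \<in> space (Leb l)"
    then have w: "w \<in> Rn l" by simp
    \<comment> \<open>On the line through \<open>w\<close> the map \<open>\<phi>\<close> is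
      \<open>f\<close>; it carries the section \<open>S\<close> of \<open>C\<close> bijectively to
      the section of the image of \<open>C\<close>.\<close>
    define S where "S = {t. w(l := t) \<in> C}"
    define f where "f t = F (w(l := t)) l" for t
    have SQ: "w(l := t) \<in> Q" if "t \<in> S" for t using that C(2) by (auto simp: S_def)
    have fS: "t \<in> f ` S \<longleftrightarrow> w(l := t) \<in> \<phi> ` C" for t
    proof
      assume "t \<in> f ` S"
      then obtain \<tau> where "\<tau> \<in> S" "t = f \<tau>" by blast
      then have "w(l := t) = \<phi> (w(l := \<tau>))" "w(l := \<tau>) \<in> C" by (simp_all add: \<phi>_def f_def S_def)
      then show "w(l := t) \<in> \<phi> ` C" by blast
    next
      assume "w(l := t) \<in> \<phi> ` C"
      then obtain y where y: "y \<in> C" "w(l := t) = \<phi> y" by blast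
      have "y = w(l := y l)" using y(2) by (metis fun_upd_triv fun_upd_upd phi_upd)
      moreover have "t = F y l" using y(2) by (metis fun_upd_same phi_l)
      ultimately have "y l \<in> S" "t = f (y l)" using y(1) by (simp_all add: S_def f_def)
      then show "t \<in> f ` S" by blast
    qed
    have psi: "\<psi> (w(l := f \<tau>)) = w(l := \<tau>)" if "\<tau> \<in> S" for \<tau>
      using psi_phi[OF SQ[OF that]] by (simp add: \<phi>_def f_def)
    have bS: "S \<in> sets borel"
      using measurable_sets[OF borel_upd[of w] sigma_compact_borel[OF C(1)]] by (simp add: S_def vimage_def)
    have bfS: "f ` S \<in> sets borel"
    proof -
      have "f ` S = (\<lambda>t. w(l := t)) -` (\<phi> ` C)" by (rule Set.set_eqI) (simp only: fS vimage_eq)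
      then show ?thesis using measurable_sets[OF borel_upd[of w] sigma_compact_borel[OF sc]] by simp
    qed
    have "(\<integral>\<^sup>+t. indicator (f ` S) t * ennreal (G (\<psi> (w(l := t)))) \<partial>lborel) =
      (\<integral>\<^sup>+t. indicator S t * ennreal (\<bar>D l l (w(l := t))\<bar> * G (\<psi> (w(l := f t)))) \<partial>lborel)"
    proof (rule nn_integral_substitution_inj[OF bS bfS])
      show "inj_on f S"
      proof (rule inj_onI)
        fix t t' assume "t \<in> S" "t' \<in> S" "f t = f t'"
        then show "t = t'" using inj_l[of "w(l := t')" t] SQ by (simp add: f_def)
      qed
      show "(f has_real_derivative D l l (w(l := t))) (at t)" if "t \<in> S" for t
        using deriv_l'[OF SQ[OF that]] by (simp add: f_def[abs_def])
      have "(\<lambda>z. indicator (\<phi> ` C) z *\<^sub>R G (\<psi> z)) \<in> borel_measurable borel"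
        by (rule borel_measurable_continuous_on_indicator[OF sigma_compact_borel[OF sc] contGpsi])
      from measurable_compose[OF borel_upd this, of w]
      show "(\<lambda>t. indicator (f ` S) t * G (\<psi> (w(l := t)))) \<in> borel_measurable borel"
        by (simp add: indicator_def fS)
      have "continuous_on C (\<lambda>y. \<bar>D l l y\<bar> * G y)"
        by (intro continuous_on_mult continuous_on_rabs continuous_on_subset[OF C1'(5) CU]
            continuous_on_subset[OF continuous_G C(2)]) auto
      then have "(\<lambda>z. indicator C z *\<^sub>R (\<bar>D l l z\<bar> * G z)) \<in> borel_measurable borel"
        by (rule borel_measurable_continuous_on_indicator[OF sigma_compact_borel[OF C(1)]])
      from measurable_compose[OF borel_upd this, of w]
      have "(\<lambda>t. indicator S t * (\<bar>D l l (w(l := t))\<bar> * G (w(l := t)))) \<in> borel_measurable borel"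
        by (simp add: indicator_def S_def)
      moreover have "indicator S t * (\<bar>D l l (w(l := t))\<bar> * G (\<psi> (w(l := f t)))) =
          indicator S t * (\<bar>D l l (w(l := t))\<bar> * G (w(l := t)))" for t :: real
        using psi by (cases "t \<in> S") auto
      ultimately show "(\<lambda>t. indicator S t * (\<bar>D l l (w(l := t))\<bar> * G (\<psi> (w(l := f t))))) \<in> borel_measurable borel"
        by (simp only:)
      show "0 \<le> G (\<psi> (w(l := t)))" for t by (simp add: G_def)
    qed
    also have "\<dots> = (\<integral>\<^sup>+t. indicator C (w(l := t)) * ennreal (\<bar>D l l (w(l := t))\<bar> * G (w(l := t))) \<partial>lborel)"
      by (intro nn_integral_cong) (auto simp: indicator_def psi, auto simp: S_def)
    finally show "(\<integral>\<^sup>+t. ?h (w(l := t)) \<partial>lborel) =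
      (\<integral>\<^sup>+t. indicator C (w(l := t)) * ennreal (\<bar>D l l (w(l := t))\<bar> * G (w(l := t))) \<partial>lborel)"
      by (simp add: indicator_def fS)
  qed
  also have "\<dots> = (\<integral>\<^sup>+w. (\<integral>\<^sup>+t. indicator C (w(l := t)) * ennreal \<bar>jacobian (Suc l) D (w(l := t))\<bar> \<partial>lborel) \<partial>Leb l)"
    using C(2) by (intro nn_integral_cong) (auto simp: indicator_def jacobian_eq)
  also have "\<dots> = (\<integral>\<^sup>+y. indicator C y * ennreal \<bar>jacobian (Suc l) D y\<bar> \<partial>Leb (Suc l))"
    using continuous_on_subset[OF C1'(5) CU]
    by (intro nn_integral_Leb_Suc(1)[symmetric] measurable_indicator_jacobian C) auto
  finally show ?thesis by (simp add: area_on_def)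
qed

end

text \<open>The zeros of all entries of the derivative form a relatively closed piece on which both
  sides are 0. Around any other point a pair of transpositions brings a non-zero entry to the
  corner, and continuity keeps its sign on a small box, as \<open>pivot\<close> demands.\<close>

theorem area_formula:
  assumes "C1_map m U F D" "sigma_compact B" "B \<subseteq> U"
  shows "area_on m F D B"
  using assms
proof (induction m arbitrary: U F D B)
  case 0
  have Rn0: "Rn 0 = {\<lambda>_. undefined}" by (auto simp: Rn_iff)
  have B: "B \<subseteq> {\<lambda>_. undefined}" using 0 C1_mapD(2)[OF 0(1)] Rn0 by blast
  \<comment> \<open>In dimension 0 there is a single point, and the empty determinant is 1.\<close>
  have "count_preimages F B (\<lambda>_. undefined) = indicator B (\<lambda>_. undefined)"
  proof (cases "(\<lambda>_. undefined) \<in> B")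
    case True
    then have "F (\<lambda>_. undefined) = (\<lambda>_. undefined)" using C1_mapD(3)[OF 0(1)] 0(3) Rn0 by blast
    then have "{y \<in> B. F y = (\<lambda>_. undefined)} = {\<lambda>_. undefined}" using B True by auto
    then show ?thesis using True by (simp add: count_preimages_def)
  next
    case False
    then have "B = {}" using B by auto
    then show ?thesis by (simp add: count_preimages_def)
  qed
  then have "count_preimages F B z = indicator B z * ennreal \<bar>jacobian 0 D z\<bar>" if "z \<in> space (Leb 0)" for z
    using that by (auto simp: Rn0 jacobian_def)
  then show ?case unfolding area_on_def by (intro nn_integral_cong)
next
  case (Suc l)
  note C1' = C1_mapD[OF Suc.prems(1)]
  let ?m = "Suc l"
  define W where "W = {y \<in> U. \<exists>i<?m. \<exists>j<?m. D i j y \<noteq> 0}"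
  have "openin (top_of_set U) (U \<inter> D i j -` (- {0}))" if "i < ?m" "j < ?m" for i j
    by (rule continuous_openin_preimage_gen[OF C1'(5)[OF that]]) auto
  then have "openin (top_of_set U) (\<Union>i\<in>{..<?m}. \<Union>j\<in>{..<?m}. U \<inter> D i j -` (- {0}))" by blast
  moreover have "(\<Union>i\<in>{..<?m}. \<Union>j\<in>{..<?m}. U \<inter> D i j -` (- {0})) = W" by (auto simp: W_def)
  ultimately have "openin (top_of_set U) W" by simp
  then have oW: "openin (top_of_set (Rn ?m)) W" using C1'(1) openin_trans by blast
  then obtain W' where W': "open W'" "W = Rn ?m \<inter> W'" by (auto simp: openin_open)
  have BR: "B \<subseteq> Rn ?m" using Suc.prems(3) C1'(2) by blast
  define B0 where "B0 = B \<inter> - W'"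
  define B1 where "B1 = B \<inter> W'"
  have B0: "sigma_compact B0" and B1: "sigma_compact B1"
    unfolding B0_def B1_def using W'(1) Suc.prems(2)
    by (auto intro: sigma_compact_Int_closed sigma_compact_Int_open)
  have subU: "B0 \<subseteq> U" "B1 \<subseteq> U" using Suc.prems(3) by (auto simp: B0_def B1_def)
  have a0: "area_on ?m F D B0"
  proof (rule area_on_zero_derivative[OF Suc.prems(1) _ B0 subU(1)])
    fix y i j assume y: "y \<in> B0" "i < ?m" "j < ?m"
    then have "y \<notin> W" using W'(2) by (auto simp: B0_def)
    then show "D i j y = 0" using y subU by (auto simp: W_def)
  qed simp
  have a1: "area_on ?m F D B1"
  proof (rule area_on_local[OF B1])
    show "continuous_on B1 F" using C1'(4) subU(2) by (rule continuous_on_subset)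
    show "continuous_on B1 (D i j)" if "i < ?m" "j < ?m" for i j
      using C1'(5)[OF that] subU(2) by (rule continuous_on_subset)
    fix y assume "y \<in> B1"
    then have "y \<in> W" and yU: "y \<in> U" using W'(2) BR subU by (auto simp: B1_def)
    then obtain i j where ij: "i < ?m" "j < ?m" "D i j y \<noteq> 0" by (auto simp: W_def)
    define \<pi> where "\<pi> = Transposition.transpose j l"
    define \<sigma> where "\<sigma> = Transposition.transpose i l"
    have \<pi>: "\<pi> permutes {..<?m}" "\<pi> \<circ> \<pi> = id" and \<sigma>: "\<sigma> permutes {..<?m}" "\<sigma> \<circ> \<sigma> = id"
      using ij by (auto simp: \<pi>_def \<sigma>_def intro: permutes_swap_id)
    define D' where "D' = (\<lambda>i j y. D (\<sigma> i) (\<pi> j) (y \<circ> \<pi>))"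
    define F' where "F' = (\<lambda>y. F (y \<circ> \<pi>) \<circ> \<sigma>)"
    define U' where "U' = {y. y \<circ> \<pi> \<in> U}"
    have C1p: "C1_map ?m U' F' D'"
      unfolding U'_def F'_def D'_def by (rule C1_map_permute[OF Suc.prems(1) \<pi> \<sigma>(1)])
    note C1p' = C1_mapD[OF C1p]
    define a where "a = y \<circ> \<pi>"
    have ya: "a \<circ> \<pi> = y" unfolding a_def using \<pi>(2) by (metis comp_assoc comp_id)
    have aU: "a \<in> U'" using yU by (simp add: U'_def ya)
    have Da: "D' l l a \<noteq> 0" using ij ya by (simp add: D'_def \<pi>_def \<sigma>_def)
    define s where "s = sgn (D' l l a)"
    have s: "s = 1 \<or> s = - 1" using Da by (auto simp: s_def sgn_if)
    have sa: "s * D' l l a > 0" using Da by (auto simp: s_def sgn_if)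
    have "openin (top_of_set U') (U' \<inter> (\<lambda>x. s * D' l l x) -` {0<..})"
      by (intro continuous_openin_preimage_gen continuous_on_mult_left C1p') auto
    then have "openin (top_of_set (Rn ?m)) (U' \<inter> (\<lambda>x. s * D' l l x) -` {0<..})"
      using C1p'(1) openin_trans by blast
    moreover have "a \<in> U' \<inter> (\<lambda>x. s * D' l l x) -` {0<..}" using aU sa by simp
    ultimately obtain r where r: "r > 0"
      "{x \<in> Rn ?m. \<forall>i<?m. \<bar>x i - a i\<bar> \<le> r} \<subseteq> U' \<inter> (\<lambda>x. s * D' l l x) -` {0<..}"
      using box_in_openin by blast
    interpret pivot l U' F' D' a r s
    proof
      show "{x \<in> Rn (Suc l). \<forall>i<Suc l. \<bar>x i - a i\<bar> < r} \<subseteq> U'"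
        using r(2) less_imp_le by blast
      show "s * D' l l x > 0" if "x \<in> Rn (Suc l)" "\<forall>i<Suc l. \<bar>x i - a i\<bar> < r" for x
      proof -
        have "x \<in> {x \<in> Rn ?m. \<forall>i<?m. \<bar>x i - a i\<bar> \<le> r}" using that less_imp_le by blast
        then show ?thesis using r(2) by blast
      qed
    qed (fact C1p r(1) s)+
    define V where "V = (\<Inter>i\<in>{..<?m}. {x::nat \<Rightarrow> real. \<bar>x (\<pi> i) - a i\<bar> < r})"
    have "open V" unfolding V_def
      by (intro open_INT finite_lessThan ballI open_Collect_less continuous_intros)
    moreover have "y \<in> V" using r(1) by (simp add: V_def a_def)
    moreover have "area_on ?m F D C" if C: "sigma_compact C" "C \<subseteq> B1 \<inter> V" for C
    proof (rule area_on_permute[OF Suc.prems(1) C(1) _ \<pi> \<sigma>])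
      show "C \<subseteq> U" using C(2) subU by blast
      have Ceq: "{y. y \<circ> \<pi> \<in> C} = (\<lambda>y. y \<circ> \<pi>) ` C"
      proof safe
        fix x assume "x \<circ> \<pi> \<in> C"
        moreover have "x = (x \<circ> \<pi>) \<circ> \<pi>" using \<pi>(2) by (metis comp_assoc comp_id)
        ultimately show "x \<in> (\<lambda>y. y \<circ> \<pi>) ` C" by blast
      next
        fix x assume "x \<in> C"
        moreover have "x = (x \<circ> \<pi>) \<circ> \<pi>" using \<pi>(2) by (metis comp_assoc comp_id)
        ultimately show "x \<circ> \<pi> \<circ> \<pi> \<in> C" by simp
      qed
      have X1: "sigma_compact {y. y \<circ> \<pi> \<in> C}"
        unfolding Ceq by (intro sigma_compact_image C continuous_on_coordinatewise_then_product)
          (auto intro: continuous_intros)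
      have X2: "{y. y \<circ> \<pi> \<in> C} \<subseteq> Q"
      proof
        fix x assume "x \<in> {y. y \<circ> \<pi> \<in> C}"
        then have x: "x \<circ> \<pi> \<in> B1" "x \<circ> \<pi> \<in> V" using C(2) by auto
        have pp: "\<pi> (\<pi> i) = i" for i using \<pi>(2) by (metis comp_apply id_apply)
        have "x \<circ> \<pi> \<in> U" using x(1) subU(2) by blast
        then have "x \<in> Rn ?m" using C1p'(2) by (auto simp: U'_def)
        then show "x \<in> Q" using x(2) by (simp add: Q_def V_def pp)
      qed
      have "area_on ?m F' D' {y. y \<circ> \<pi> \<in> C}"
      proof (rule area_on_Q[OF _ X1 X2])
        fix U F D B assume "C1_map l U F D" "sigma_compact B" "B \<subseteq> U"
        then show "area_on l F D B" by (rule Suc.IH)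
      qed
      then show "area_on ?m (\<lambda>y. F (y \<circ> \<pi>) \<circ> \<sigma>) (\<lambda>i j y. D (\<sigma> i) (\<pi> j) (y \<circ> \<pi>)) {y. y \<circ> \<pi> \<in> C}"
        unfolding F'_def D'_def .
    qed
    ultimately show "\<exists>V. open V \<and> y \<in> V \<and> (\<forall>C. sigma_compact C \<longrightarrow> C \<subseteq> B1 \<inter> V \<longrightarrow> area_on ?m F D C)"
      by blast
  qed
  define A where "A k = (if k = 0 then B0 else if k = Suc 0 then B1 else {})" for k :: nat
  have "area_on ?m F D {}" by (simp add: area_on_def count_preimages_def)
  then have A: "sigma_compact (A k)" "area_on ?m F D (A k)" "A k \<subseteq> U" for k
    using B0 B1 a0 a1 subU compact_imp_sigma_compact[OF compact_empty] by (auto simp: A_def)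
  have "area_on ?m F D (\<Union>k. A k)"
  proof (rule area_on_UN)
    show "disjoint_family A" by (auto simp: disjoint_family_on_def A_def B0_def B1_def)
    show "continuous_on (A k) F" for k by (rule continuous_on_subset[OF C1'(4) A(3)])
    show "continuous_on (A k) (D i j)" if "i < ?m" "j < ?m" for i j k
      by (rule continuous_on_subset[OF C1'(5)[OF that] A(3)])
  qed (fact A)+
  moreover have "(\<Union>k. A k) = B"
  proof
    show "B \<subseteq> (\<Union>k. A k)"
    proof
      fix x assume "x \<in> B"
      then have "x \<in> A 0 \<or> x \<in> A (Suc 0)" by (auto simp: A_def B0_def B1_def)
      then show "x \<in> (\<Union>k. A k)" by blast
    qed
  qed (auto simp: A_def B0_def B1_def split: if_splits)
  ultimately show ?case by simp
qed

subsection \<open>Critical points of the distance to a rank-one tensor\<close>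

text \<open>Layer cake: \<open>ennreal (h z)\<close> is the integral over \<open>t > 0\<close> of
  the indicator of \<open>t < h z\<close>. For each such \<open>t\<close> the area formula is
  applied to the part of \<open>B\<close> where \<open>h (F y) > t\<close>, which is sigma-compact
  because it is relatively open in \<open>B\<close>.\<close>

lemma area_formula_weighted:
  assumes C1: "C1_map m U F D" and B: "sigma_compact B" "B \<subseteq> U"
    and h: "continuous_on UNIV h"
  shows "(\<integral>\<^sup>+z. count_preimages F B z * ennreal (h z) \<partial>Leb m) =
    (\<integral>\<^sup>+y. indicator B y * ennreal \<bar>jacobian m D y\<bar> * ennreal (h (F y)) \<partial>Leb m)"
proof -
  note C = C1_mapD[OF C1]
  have FB: "continuous_on B F" and DB: "\<And>i j. i < m \<Longrightarrow> j < m \<Longrightarrow> continuous_on B (D i j)"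
    using C(4,5) B(2) by (auto intro: continuous_on_subset)
  have hm: "h \<in> borel_measurable borel" by (rule borel_measurable_continuous_onI[OF h])
  have layer: "ennreal u = (\<integral>\<^sup>+t. indicator {0<..<u} t \<partial>lborel)" for u :: real
  proof (cases "u > 0")
    case True
    then show ?thesis by simp
  next
    case False
    then have "{0<..<u} = {}" by auto
    then show ?thesis using False by (simp add: ennreal_neg)
  qed
  interpret L: sigma_finite_measure "Leb m" by (rule sigma_finite_Leb)
  interpret pair_sigma_finite "Leb m" "lborel :: real measure" by standard
  have swap: "(\<integral>\<^sup>+z. c z * ennreal (k z) \<partial>Leb m) = (\<integral>\<^sup>+t. (\<integral>\<^sup>+z. c z * indicator {0<..<k z} t \<partial>Leb m) \<partial>lborel)"
    if [measurable]: "c \<in> borel_measurable (Leb m)" "k \<in> borel_measurable (Leb m)" for c and k :: "_ \<Rightarrow> real"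
  proof -
    have "(\<integral>\<^sup>+z. c z * ennreal (k z) \<partial>Leb m) = (\<integral>\<^sup>+z. (\<integral>\<^sup>+t. c z * indicator {0<..<k z} t \<partial>lborel) \<partial>Leb m)"
      by (simp add: layer nn_integral_cmult)
    also have "\<dots> = (\<integral>\<^sup>+t. (\<integral>\<^sup>+z. c z * indicator {0<..<k z} t \<partial>Leb m) \<partial>lborel)"
    proof (rule Fubini'[symmetric])
      have "(\<lambda>(z, t). c z * (if 0 < t \<and> t < k z then 1 else 0)) \<in> borel_measurable (Leb m \<Otimes>\<^sub>M lborel)"
        by measurable
      moreover have "(\<lambda>(z, t). c z * (if 0 < t \<and> t < k z then 1 else 0)) = (\<lambda>(z, t). c z * indicator {0<..<k z} t)"
        by (auto simp: fun_eq_iff indicator_def)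
      ultimately show "(\<lambda>(z, t). c z * indicator {0<..<k z} t) \<in> borel_measurable (Leb m \<Otimes>\<^sub>M lborel)"
        by (simp only:)
    qed
    finally show ?thesis .
  qed
  define Bt where "Bt t = {y \<in> B. h (F y) > t}" for t
  have sc: "sigma_compact (Bt t)" for t
  proof -
    have "continuous_on B (\<lambda>y. h (F y))"
      by (rule continuous_on_compose2[OF h FB]) auto
    then have "openin (top_of_set B) (B \<inter> (\<lambda>y. h (F y)) -` {t<..})"
      by (rule continuous_openin_preimage_gen) auto
    from sigma_compact_Int_openin[OF B(1) subset_refl this] show ?thesis
      by (simp add: Bt_def Int_def)
  qed
  have key: "(\<integral>\<^sup>+z. count_preimages F B z * indicator {0<..<h z} t \<partial>Leb m) =
      (\<integral>\<^sup>+y. indicator B y * ennreal \<bar>jacobian m D y\<bar> * indicator {0<..<h (F y)} t \<partial>Leb m)" for t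
  proof (cases "t > 0")
    case True
    have "count_preimages F B z * indicator {0<..<h z} t = count_preimages F (Bt t) z" for z
    proof (cases "t < h z")
      case *: True
      then have "{y \<in> B. F y = z} = {y \<in> Bt t. F y = z}" by (auto simp: Bt_def)
      then show ?thesis using * True by (simp add: count_preimages_def)
    next
      case *: False
      then have "{y \<in> Bt t. F y = z} = {}" by (auto simp: Bt_def)
      then have "count_preimages F (Bt t) z = 0" by (simp only: count_preimages_def emeasure_empty)
      then show ?thesis using * by simp
    qed
    moreover have "indicator B y * ennreal \<bar>jacobian m D y\<bar> * indicator {0<..<h (F y)} t =
        indicator (Bt t) y * ennreal \<bar>jacobian m D y\<bar>" for y
      using True by (auto simp: Bt_def indicator_def)
    moreover have "area_on m F D (Bt t)"
      by (rule area_formula[OF C1 sc]) (use B(2) in \<open>auto simp: Bt_def\<close>)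
    ultimately show ?thesis by (simp add: area_on_def)
  next
    case False
    then show ?thesis by (simp add: indicator_def)
  qed
  have "(\<integral>\<^sup>+z. count_preimages F B z * ennreal (h z) \<partial>Leb m) =
      (\<integral>\<^sup>+t. (\<integral>\<^sup>+z. count_preimages F B z * indicator {0<..<h z} t \<partial>Leb m) \<partial>lborel)"
    by (rule swap[OF borel_measurable_count_Leb[OF B(1) FB] borel_measurable_Leb[OF hm]])
  also have "\<dots> = (\<integral>\<^sup>+t. (\<integral>\<^sup>+y. indicator B y * ennreal \<bar>jacobian m D y\<bar> * indicator {0<..<h (F y)} t \<partial>Leb m) \<partial>lborel)"
    by (simp only: key)
  \<comment> \<open>The composition of \<open>h\<close> and \<open>F\<close> is continuous on
    \<open>B\<close> only; cutting it off outside \<open>B\<close> makes it measurable on the whole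
    space.\<close>
  also have "\<dots> = (\<integral>\<^sup>+t. (\<integral>\<^sup>+y. indicator B y * ennreal \<bar>jacobian m D y\<bar> * indicator {0<..<indicator B y * h (F y)} t \<partial>Leb m) \<partial>lborel)"
    by (intro nn_integral_cong) (simp add: indicator_def)
  also have "\<dots> = (\<integral>\<^sup>+y. indicator B y * ennreal \<bar>jacobian m D y\<bar> * ennreal (indicator B y * h (F y)) \<partial>Leb m)"
  proof (rule swap[symmetric])
    show "(\<lambda>y. indicator B y * ennreal \<bar>jacobian m D y\<bar>) \<in> borel_measurable (Leb m)"
      by (rule measurable_indicator_jacobian[OF B(1) DB])
    have "(\<lambda>y. indicator B y *\<^sub>R h (F y)) \<in> borel_measurable borel"
      by (rule borel_measurable_continuous_on_indicator[OF sigma_compact_borel[OF B(1)] continuous_on_compose2[OF h FB]]) auto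
    then show "(\<lambda>y. indicator B y * h (F y)) \<in> borel_measurable (Leb m)"
      using borel_measurable_Leb by simp
  qed
  also have "\<dots> = (\<integral>\<^sup>+y. indicator B y * ennreal \<bar>jacobian m D y\<bar> * ennreal (h (F y)) \<partial>Leb m)"
    by (intro nn_integral_cong) (simp add: indicator_def)
  finally show ?thesis .
qed

section \<open>Rank-one tensors and their tangent spaces\<close>

lemma finite_multi_index: "finite (multi_index p n)"
  unfolding multi_index_def by (intro finite_PiE) auto

lemma multi_index_upd: "\<alpha> \<in> multi_index p n \<Longrightarrow> i \<in> {1..p} \<Longrightarrow> b \<in> {1..n i} \<Longrightarrow> \<alpha>(i := b) \<in> multi_index p n"
  by (auto simp: multi_index_def PiE_iff extensional_def)

lemma multi_indexD: "\<alpha> \<in> multi_index p n \<Longrightarrow> i \<in> {1..p} \<Longrightarrow> \<alpha> i \<in> {1..n i}"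
  by (auto simp: multi_index_def)

lemma rank_one_apply: "\<alpha> \<in> multi_index p n \<Longrightarrow> rank_one p n X \<alpha> = (\<Prod>i=1..p. X i (\<alpha> i))"
  by (simp add: rank_one_def)

lemma rank_one_upd:
  assumes "\<alpha> \<in> multi_index p n" "i \<in> {1..p}"
  shows "rank_one p n (X(i := w)) \<alpha> = w (\<alpha> i) * (\<Prod>j\<in>{1..p} - {i}. X j (\<alpha> j))"
proof -
  have "rank_one p n (X(i := w)) \<alpha> = (\<Prod>j=1..p. (X(i := w)) j (\<alpha> j))" using assms by (simp add: rank_one_apply)
  also have "\<dots> = w (\<alpha> i) * (\<Prod>j\<in>{1..p} - {i}. (X(i := w)) j (\<alpha> j))"
    using assms by (subst prod.remove[of _ i]) auto
  also have "(\<Prod>j\<in>{1..p} - {i}. (X(i := w)) j (\<alpha> j)) = (\<Prod>j\<in>{1..p} - {i}. X j (\<alpha> j))"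
    by (intro prod.cong) auto
  finally show ?thesis .
qed

lemma rank_one_scale:
  assumes "p \<ge> 1"
  shows "(\<lambda>\<alpha>\<in>multi_index p n. c * rank_one p n X \<alpha>) = rank_one p n (X(1 := \<lambda>b. c * X 1 b))"
proof
  fix \<alpha>
  show "(\<lambda>\<alpha>\<in>multi_index p n. c * rank_one p n X \<alpha>) \<alpha> = rank_one p n (X(1 := \<lambda>b. c * X 1 b)) \<alpha>"
  proof (cases "\<alpha> \<in> multi_index p n")
    case True
    have "rank_one p n X \<alpha> = X 1 (\<alpha> 1) * (\<Prod>j\<in>{1..p} - {1}. X j (\<alpha> j))"
      using True assms by (simp add: rank_one_apply prod.remove[of _ 1])
    then show ?thesis using True assms by (simp add: rank_one_upd mult_ac)
  qed (simp add: rank_one_def)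
qed

lemma rank_one_add:
  assumes "i \<in> {1..p}" "\<alpha> \<in> multi_index p n"
  shows "rank_one p n (X(i := \<lambda>b. X i b + s * w b)) \<alpha> = rank_one p n X \<alpha> + s * rank_one p n (X(i := w)) \<alpha>"
proof -
  have "rank_one p n X \<alpha> = rank_one p n (X(i := X i)) \<alpha>" by simp
  then show ?thesis using assms by (simp only: rank_one_upd) (simp add: algebra_simps)
qed

lemma tensor_inner_linear:
  "tensor_inner p n v (\<lambda>\<alpha>. \<Sum>i\<in>I. c i * f i \<alpha>) = (\<Sum>i\<in>I. c i * tensor_inner p n v (f i))"
proof -
  have "tensor_inner p n v (\<lambda>\<alpha>. \<Sum>i\<in>I. c i * f i \<alpha>) = (\<Sum>\<alpha>\<in>multi_index p n. \<Sum>i\<in>I. c i * (v \<alpha> * f i \<alpha>))"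
    unfolding tensor_inner_def by (intro sum.cong refl) (simp add: sum_distrib_left mult_ac)
  also have "\<dots> = (\<Sum>i\<in>I. c i * tensor_inner p n v (f i))"
    by (subst sum.swap) (simp add: tensor_inner_def sum_distrib_left)
  finally show ?thesis .
qed

lemma tensor_inner_cong:
  "(\<And>\<alpha>. \<alpha> \<in> multi_index p n \<Longrightarrow> u \<alpha> = u' \<alpha>) \<Longrightarrow> tensor_inner p n v u = tensor_inner p n v u'"
  unfolding tensor_inner_def by (intro sum.cong) auto

lemma smooth_near_0_affine: "smooth_near_0 e (\<lambda>t. a + t * b)"
proof -
  have d0: "deriv (\<lambda>t. a + t * b) = (\<lambda>_. b)" for a b :: real
    by (rule ext, rule DERIV_imp_deriv) (auto intro!: derivative_eq_intros)
  have dc: "deriv (\<lambda>_. b) = (\<lambda>_. 0)" for b :: real by (simp add: fun_eq_iff)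
  have ex: "\<exists>c d. (deriv ^^ k) (\<lambda>t. a + t * b) = (\<lambda>t. c + t * d)" for k
  proof (induction k)
    case 0
    then show ?case by (intro exI[of _ a] exI[of _ b]) simp
  next
    case (Suc k)
    then obtain c d where "(deriv ^^ k) (\<lambda>t. a + t * b) = (\<lambda>t. c + t * d)" by blast
    then have "(deriv ^^ Suc k) (\<lambda>t. a + t * b) = (\<lambda>t. d + t * 0)" by (simp add: d0)
    then show ?case by blast
  qed
  show ?thesis unfolding smooth_near_0_def
  proof (intro allI ballI)
    fix k t
    obtain c d where "(deriv ^^ k) (\<lambda>t. a + t * b) = (\<lambda>t. c + t * d)" using ex[of k] by blast
    then show "(deriv ^^ k) (\<lambda>t. a + t * b) differentiable (at t)" by (auto intro!: derivative_intros)
  qed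
qed

text \<open>By multilinearity the line from \<open>x\<close> in the direction of this tensor
  consists of rank-one tensors; the division of \<open>t\<close> by \<open>c\<close> compensates for
  the scalar in front of \<open>X\<close>. The interval is chosen so short that the entry at
  \<open>\<alpha>\<close> stays non-zero, which keeps the curve in the manifold.\<close>

lemma tangent_rank_one:
  assumes p: "p \<ge> 1" and i: "i \<in> {1..p}" and c: "c \<noteq> 0"
    and x: "x = (\<lambda>\<alpha>\<in>multi_index p n. c * rank_one p n X \<alpha>)" and \<alpha>: "\<alpha> \<in> multi_index p n" "x \<alpha> \<noteq> 0"
  shows "rank_one p n (X(i := w)) \<in> tangent_space p n (rank_one_manifold p n) x"
proof -
  let ?M = "multi_index p n"
  define u where "u = rank_one p n (X(i := w))"
  define \<gamma> where "\<gamma> t = (\<lambda>\<beta>\<in>?M. x \<beta> + t * u \<beta>)" for t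
  have \<gamma>_rank: "\<gamma> t = (\<lambda>\<beta>\<in>?M. c * rank_one p n (X(i := \<lambda>b. X i b + (t / c) * w b)) \<beta>)" for t
  proof
    fix \<beta>
    show "\<gamma> t \<beta> = (\<lambda>\<beta>\<in>?M. c * rank_one p n (X(i := \<lambda>b. X i b + (t / c) * w b)) \<beta>) \<beta>"
      using c rank_one_add[OF i, of \<beta> n X "t / c" w]
      by (cases "\<beta> \<in> ?M") (simp_all add: \<gamma>_def x u_def distrib_left)
  qed
  have range: "\<gamma> t \<in> range (rank_one p n)" for t
    unfolding \<gamma>_rank rank_one_scale[OF p] by (rule rangeI)
  define e where "e = \<bar>x \<alpha>\<bar> / (1 + \<bar>u \<alpha>\<bar>)"
  have e: "e > 0" using \<alpha>(2) by (simp add: e_def)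
  have nz: "\<gamma> t \<alpha> \<noteq> 0" if "t \<in> {-e<..<e}" for t
  proof -
    have "\<bar>t\<bar> * \<bar>u \<alpha>\<bar> \<le> e * \<bar>u \<alpha>\<bar>" using that by (intro mult_right_mono) auto
    also have "\<dots> < e * (1 + \<bar>u \<alpha>\<bar>)" using e by simp
    also have "\<dots> = \<bar>x \<alpha>\<bar>" by (simp add: e_def)
    finally have "\<bar>t * u \<alpha>\<bar> < \<bar>x \<alpha>\<bar>" by (simp add: abs_mult)
    then show ?thesis using \<alpha>(1) by (auto simp: \<gamma>_def)
  qed
  have "\<gamma> t \<in> rank_one_manifold p n" if "t \<in> {-e<..<e}" for t
  proof -
    have "\<gamma> t \<noteq> (\<lambda>\<beta>\<in>?M. 0)"
    proof
      assume "\<gamma> t = (\<lambda>\<beta>\<in>?M. 0)"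
      then have "\<gamma> t \<alpha> = 0" using \<alpha>(1) by simp
      then show False using nz[OF that] by simp
    qed
    then show ?thesis using range[of t] by (simp add: rank_one_manifold_def)
  qed
  moreover have "\<gamma> 0 = x" by (auto simp: \<gamma>_def x)
  moreover have "smooth_near_0 e (\<lambda>t. \<gamma> t \<beta>)" if "\<beta> \<in> ?M" for \<beta>
    using that smooth_near_0_affine by (simp add: \<gamma>_def)
  moreover have "u \<beta> = deriv (\<lambda>t. \<gamma> t \<beta>) 0" if "\<beta> \<in> ?M" for \<beta>
    using that by (intro DERIV_imp_deriv[symmetric]) (auto simp: \<gamma>_def intro!: derivative_eq_intros)
  moreover have "u \<in> tensor_space p n" by (simp add: u_def rank_one_def tensor_space_def)
  ultimately show ?thesis using e unfolding tangent_space_def u_def[symmetric] by blast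
qed

text \<open>
  A rank-one tensor with a non-zero entry at \<open>\<alpha>\<close> satisfies
  \<open>x \<beta> * x \<alpha> ^ (p - 1) = (\<Prod>i. x (\<alpha>(i := \<beta> i)))\<close>; differentiating this identity along a curve
  shows that its velocity lies in the span of the tensors obtained by changing one factor.
\<close>

lemma inner_tangent_eq_0:
  assumes p: "p \<ge> 1" and c: "c \<noteq> 0"
    and x: "x = (\<lambda>\<alpha>\<in>multi_index p n. c * rank_one p n X \<alpha>)" and \<alpha>: "\<alpha> \<in> multi_index p n" "x \<alpha> \<noteq> 0"
    and orth: "\<And>i w. i \<in> {1..p} \<Longrightarrow> tensor_inner p n v (rank_one p n (X(i := w))) = 0"
    and u: "u \<in> tangent_space p n (rank_one_manifold p n) x"
  shows "tensor_inner p n v u = 0"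
proof -
  let ?M = "multi_index p n"
  obtain \<gamma> e where e: "e > 0" and \<gamma>0: "\<gamma> 0 = x" and \<gamma>: "\<And>t. t \<in> {-e<..<e} \<Longrightarrow> \<gamma> t \<in> rank_one_manifold p n"
    and sm: "\<And>\<beta>. \<beta> \<in> ?M \<Longrightarrow> smooth_near_0 e (\<lambda>t. \<gamma> t \<beta>)"
    and du: "\<And>\<beta>. \<beta> \<in> ?M \<Longrightarrow> u \<beta> = deriv (\<lambda>t. \<gamma> t \<beta>) 0"
    using u unfolding tangent_space_def by blast
  have d: "((\<lambda>t. \<gamma> t \<beta>) has_real_derivative u \<beta>) (at 0)" if "\<beta> \<in> ?M" for \<beta>
  proof -
    have "(deriv ^^ 0) (\<lambda>t. \<gamma> t \<beta>) differentiable (at 0)"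
      using sm[OF that] e unfolding smooth_near_0_def by (metis greaterThanLessThan_iff neg_less_0_iff_less)
    then show ?thesis using du[OF that] by (simp add: DERIV_deriv_iff_real_differentiable)
  qed
  have up: "\<alpha>(i := \<beta> i) \<in> ?M" if "i \<in> {1..p}" "\<beta> \<in> ?M" for i \<beta>
    using multi_index_upd[OF \<alpha>(1) that(1)] multi_indexD[OF that(2,1)] by simp
  \<comment> \<open>After exchanging the two products, the factor of slot \<open>j\<close> is
    evaluated once at \<open>\<beta> j\<close> and \<open>p - 1\<close> times at
    \<open>\<alpha> j\<close>.\<close>
  have ident: "y \<beta> * y \<alpha> ^ (p - 1) = (\<Prod>i=1..p. y (\<alpha>(i := \<beta> i)))"
    if yM: "y \<in> rank_one_manifold p n" and \<beta>M: "\<beta> \<in> ?M" for y \<beta>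
  proof -
    obtain Y where y: "y = rank_one p n Y" using yM by (auto simp: rank_one_manifold_def)
    have "(\<Prod>i=1..p. y (\<alpha>(i := \<beta> i))) = (\<Prod>i=1..p. \<Prod>j=1..p. Y j (if j = i then \<beta> i else \<alpha> j))"
      unfolding y by (intro prod.cong refl) (auto simp: rank_one_apply[OF up[OF _ \<beta>M]] intro!: prod.cong)
    also have "\<dots> = (\<Prod>j=1..p. \<Prod>i=1..p. Y j (if j = i then \<beta> i else \<alpha> j))" by (rule prod.swap)
    also have "\<dots> = (\<Prod>j=1..p. Y j (\<beta> j) * Y j (\<alpha> j) ^ (p - 1))"
    proof (rule prod.cong[OF refl])
      fix j assume j: "j \<in> {1..p}"
      have "(\<Prod>i=1..p. Y j (if j = i then \<beta> i else \<alpha> j)) = Y j (\<beta> j) * (\<Prod>i\<in>{1..p} - {j}. Y j (if j = i then \<beta> i else \<alpha> j))"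
        using j by (subst prod.remove[of _ j]) auto
      also have "(\<Prod>i\<in>{1..p} - {j}. Y j (if j = i then \<beta> i else \<alpha> j)) = (\<Prod>i\<in>{1..p} - {j}. Y j (\<alpha> j))"
        by (intro prod.cong) auto
      finally show "(\<Prod>i=1..p. Y j (if j = i then \<beta> i else \<alpha> j)) = Y j (\<beta> j) * Y j (\<alpha> j) ^ (p - 1)"
        using j by (simp add: card_Diff_singleton)
    qed
    finally show ?thesis using \<beta>M \<alpha>(1) by (simp add: y rank_one_apply prod.distrib prod_power_distrib)
  qed
  define K where "K i = (\<Prod>j\<in>{1..p} - {i}. x \<alpha> / X j (\<alpha> j))" for i
  have xa: "x \<alpha> = c * (\<Prod>j=1..p. X j (\<alpha> j))" using \<alpha>(1) by (simp add: x rank_one_apply)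
  have Xnz: "X j (\<alpha> j) \<noteq> 0" if "j \<in> {1..p}" for j
    using \<alpha>(2) that unfolding xa by auto
  have xup: "x (\<alpha>(j := b)) = x \<alpha> / X j (\<alpha> j) * X j b" if j: "j \<in> {1..p}" "b \<in> {1..n j}" for j b
  proof -
    have "x (\<alpha>(j := b)) = c * rank_one p n (X(j := X j)) (\<alpha>(j := b))"
      using multi_index_upd[OF \<alpha>(1) j] by (simp add: x)
    also have "\<dots> = c * (X j b * (\<Prod>k\<in>{1..p} - {j}. X k ((\<alpha>(j := b)) k)))"
      using multi_index_upd[OF \<alpha>(1) j] j by (subst rank_one_upd) auto
    also have "(\<Prod>k\<in>{1..p} - {j}. X k ((\<alpha>(j := b)) k)) = (\<Prod>k\<in>{1..p} - {j}. X k (\<alpha> k))"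
      by (intro prod.cong) auto
    finally have 1: "x (\<alpha>(j := b)) = c * (X j b * (\<Prod>k\<in>{1..p} - {j}. X k (\<alpha> k)))" .
    have "x \<alpha> = c * (X j (\<alpha> j) * (\<Prod>k\<in>{1..p} - {j}. X k (\<alpha> k)))"
      unfolding xa using j by (subst prod.remove[of _ j]) auto
    then show ?thesis using 1 Xnz[OF j(1)] by simp
  qed
  \<comment> \<open>In the summand \<open>i\<close> of the product rule all slots but
    \<open>i\<close> carry multiples of the vectors \<open>X j\<close>, by \<open>xup\<close>;
    \<open>K i\<close> collects these multiples, and the velocity provides the vector in slot
    \<open>i\<close>.\<close>
  define w where "w i b = K i * u (\<alpha>(i := b))" for i b
  have main: "x \<alpha> ^ (p - 1) * u \<beta> = (\<Sum>i=1..p. rank_one p n (X(i := w i)) \<beta>) -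
      (real (p - 1) * x \<alpha> ^ (p - 2) * u \<alpha>) * x \<beta>" if \<beta>: "\<beta> \<in> ?M" for \<beta>
  proof -
    have d1: "((\<lambda>t. \<gamma> t \<beta> * \<gamma> t \<alpha> ^ (p - 1)) has_real_derivative
        u \<beta> * \<gamma> 0 \<alpha> ^ (p - 1) + (real (p - 1) * (u \<alpha> * \<gamma> 0 \<alpha> ^ (p - 1 - Suc 0))) * \<gamma> 0 \<beta>) (at 0)"
      by (intro DERIV_mult DERIV_power d \<beta> \<alpha>)
    have d2: "((\<lambda>t. \<Prod>i=1..p. \<gamma> t (\<alpha>(i := \<beta> i))) has_real_derivative
        (\<Sum>i=1..p. u (\<alpha>(i := \<beta> i)) * (\<Prod>j\<in>{1..p} - {i}. \<gamma> 0 (\<alpha>(j := \<beta> j))))) (at 0)"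
      by (rule has_field_derivative_prod) (intro d up \<beta>)
    have ev: "\<forall>\<^sub>F t in nhds 0. \<gamma> t \<beta> * \<gamma> t \<alpha> ^ (p - 1) = (\<Prod>i=1..p. \<gamma> t (\<alpha>(i := \<beta> i)))"
    proof (rule eventually_mono)
      show "\<forall>\<^sub>F t in nhds 0. t \<in> {-e<..<e}" using e by (intro eventually_nhds_in_open) auto
      show "\<gamma> t \<beta> * \<gamma> t \<alpha> ^ (p - 1) = (\<Prod>i=1..p. \<gamma> t (\<alpha>(i := \<beta> i)))" if "t \<in> {-e<..<e}" for t
        by (rule ident[OF \<gamma>[OF that] \<beta>])
    qed
    have "u \<beta> * \<gamma> 0 \<alpha> ^ (p - 1) + (real (p - 1) * (u \<alpha> * \<gamma> 0 \<alpha> ^ (p - 1 - Suc 0))) * \<gamma> 0 \<beta> =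
        (\<Sum>i=1..p. u (\<alpha>(i := \<beta> i)) * (\<Prod>j\<in>{1..p} - {i}. \<gamma> 0 (\<alpha>(j := \<beta> j))))"
      by (rule DERIV_unique[OF d1 DERIV_cong_ev[OF refl ev refl, THEN iffD2, OF d2]])
    also have "\<dots> = (\<Sum>i=1..p. rank_one p n (X(i := w i)) \<beta>)"
    proof (rule sum.cong[OF refl])
      fix i assume i: "i \<in> {1..p}"
      have "(\<Prod>j\<in>{1..p} - {i}. \<gamma> 0 (\<alpha>(j := \<beta> j))) = (\<Prod>j\<in>{1..p} - {i}. x \<alpha> / X j (\<alpha> j) * X j (\<beta> j))"
        unfolding \<gamma>0 using multi_indexD[OF \<beta>] by (intro prod.cong refl xup) auto
      also have "\<dots> = K i * (\<Prod>j\<in>{1..p} - {i}. X j (\<beta> j))" unfolding K_def by (rule prod.distrib)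
      finally show "u (\<alpha>(i := \<beta> i)) * (\<Prod>j\<in>{1..p} - {i}. \<gamma> 0 (\<alpha>(j := \<beta> j))) = rank_one p n (X(i := w i)) \<beta>"
        using rank_one_upd[OF \<beta> i, of X "w i"] by (simp add: w_def)
    qed
    finally show ?thesis by (simp add: \<gamma>0 algebra_simps numeral_2_eq_2)
  qed
  \<comment> \<open>The tensor \<open>x\<close> is itself obtained by replacing a factor by itself.
    Its orthogonality disposes of the term that comes from differentiating the power.\<close>
  have px: "tensor_inner p n v x = 0"
  proof -
    have "tensor_inner p n v x = tensor_inner p n v (\<lambda>\<beta>. \<Sum>i\<in>{1::nat}. c * rank_one p n (X(1 := X 1)) \<beta>)"
      by (rule tensor_inner_cong) (simp add: x)
    also have "\<dots> = 0" unfolding tensor_inner_linear using orth[of 1 "X 1"] p by simp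
    finally show ?thesis .
  qed
  have "x \<alpha> ^ (p - 1) * tensor_inner p n v u = tensor_inner p n v (\<lambda>\<beta>. \<Sum>i\<in>{1::nat}. x \<alpha> ^ (p - 1) * u \<beta>)"
    unfolding tensor_inner_linear by simp
  also have "\<dots> = tensor_inner p n v (\<lambda>\<beta>. (\<Sum>i=1..p. 1 * rank_one p n (X(i := w i)) \<beta>) -
      (real (p - 1) * x \<alpha> ^ (p - 2) * u \<alpha>) * x \<beta>)"
    by (rule tensor_inner_cong) (simp add: main[simplified])
  also have "\<dots> = tensor_inner p n v (\<lambda>\<beta>. \<Sum>i=1..p. 1 * rank_one p n (X(i := w i)) \<beta>) -
      (real (p - 1) * x \<alpha> ^ (p - 2) * u \<alpha>) * tensor_inner p n v x"
    unfolding tensor_inner_def by (simp add: right_diff_distrib sum_subtractf sum_distrib_left mult_ac)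
  also have "tensor_inner p n v (\<lambda>\<beta>. \<Sum>i=1..p. 1 * rank_one p n (X(i := w i)) \<beta>) = 0"
    unfolding tensor_inner_linear using orth by simp
  finally show ?thesis using px \<alpha>(2) by simp
qed

text \<open>The tangent space contains all tensors with one factor replaced and is contained in
  their span, so orthogonality to it can be tested on these tensors.\<close>

lemma critical_points_iff:
  assumes p: "p \<ge> 1" and c: "c \<noteq> 0"
    and x: "x = (\<lambda>\<alpha>\<in>multi_index p n. c * rank_one p n X \<alpha>)" and \<alpha>: "\<alpha> \<in> multi_index p n" "x \<alpha> \<noteq> 0"
  shows "x \<in> critical_points p n (rank_one_manifold p n) v \<longleftrightarrow>
    (\<forall>i\<in>{1..p}. \<forall>w. tensor_inner p n (\<lambda>\<alpha>. v \<alpha> - x \<alpha>) (rank_one p n (X(i := w))) = 0)"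
proof
  assume "x \<in> critical_points p n (rank_one_manifold p n) v"
  then show "\<forall>i\<in>{1..p}. \<forall>w. tensor_inner p n (\<lambda>\<alpha>. v \<alpha> - x \<alpha>) (rank_one p n (X(i := w))) = 0"
    using tangent_rank_one[OF p _ c x \<alpha>] unfolding critical_points_def by blast
next
  assume *: "\<forall>i\<in>{1..p}. \<forall>w. tensor_inner p n (\<lambda>\<alpha>. v \<alpha> - x \<alpha>) (rank_one p n (X(i := w))) = 0"
  have "x \<in> range (rank_one p n)" unfolding x rank_one_scale[OF p] by blast
  then have "x \<in> rank_one_manifold p n" using \<alpha> by (auto simp: rank_one_manifold_def)
  then show "x \<in> critical_points p n (rank_one_manifold p n) v"
    using inner_tangent_eq_0[OF p c x \<alpha>] * unfolding critical_points_def by blast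
qed

subsection \<open>Adapted frames\<close>

declare One_nat_def [simp del]

text \<open>The Euclidean norm of \<open>(1, y 2, ..., y k)\<close>, the representative of a line in
  the affine chart where the first coordinate is not 0.\<close>

definition frame_radius :: "nat \<Rightarrow> (nat \<Rightarrow> real) \<Rightarrow> real" where
  "frame_radius k y = sqrt (1 + (\<Sum>a=2..k. (y a)\<^sup>2))"

text \<open>
  The Householder reflection, up to sign, that exchanges the first basis vector and the
  normalisation of \<open>(1, y 2, \<dots>, y k)\<close>.
\<close>

definition frame :: "nat \<Rightarrow> (nat \<Rightarrow> real) \<Rightarrow> nat \<Rightarrow> nat \<Rightarrow> real" where
  "frame k y a b = (let r = frame_radius k y in
     if a = 1 then (if b = 1 then 1 else y b) / r
     else if b = 1 then y a / r
     else y a * y b / (r * (r + 1)) - (if a = b then 1 else 0))"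

lemma frame_radius_pos: "frame_radius k y > 0"
  unfolding frame_radius_def by (intro real_sqrt_gt_zero add_pos_nonneg sum_nonneg) auto

lemma frame_radius_sq: "(\<Sum>a=2..k. (y a)\<^sup>2) = (frame_radius k y)\<^sup>2 - 1"
  unfolding frame_radius_def by (subst real_sqrt_pow2) (auto intro!: add_nonneg_nonneg sum_nonneg)

lemma frame_sym: "frame k y a b = frame k y b a"
  by (simp add: frame_def Let_def)

text \<open>The columns are compared according to whether they are the first one, and each case
  becomes an identity in \<open>r\<close> by \<open>r\<^sup>2 - 1 = (r - 1) * (r + 1)\<close>, the
  left side being the sum of the squares of the \<open>y c\<close>. The denominators
  \<open>r\<close> and \<open>r + 1\<close> vanish nowhere, so this choice of frame is smooth on the
  whole chart.\<close>

lemma frame_orthogonal: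
  assumes k: "k \<ge> 1" and ab: "a \<in> {1..k}" "b \<in> {1..k}"
  shows "(\<Sum>c=1..k. frame k y c a * frame k y c b) = (if a = b then 1 else 0)"
proof -
  define r where "r = frame_radius k y"
  have r: "r > 0" using frame_radius_pos by (simp add: r_def)
  have sq: "(\<Sum>c=2..k. y c * y c) = r\<^sup>2 - 1"
    using frame_radius_sq[where k=k and y=y] by (simp add: r_def power2_eq_square)
  have set: "{1..k} = insert 1 {2..k}" using k by auto
  have split: "(\<Sum>c=1..k. f c) = f 1 + (\<Sum>c=2..k. f c)" for f :: "nat \<Rightarrow> real"
    unfolding set by (subst sum.insert) auto
  have f11: "frame k y 1 1 = 1 / r" by (simp add: frame_def r_def Let_def)
  have f1: "frame k y 1 b = y b / r" "frame k y b 1 = y b / r" if "b \<noteq> 1" for b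
    using that by (simp_all add: frame_def r_def Let_def)
  have ff: "frame k y a b = y a * y b / (r * (r + 1)) - (if a = b then 1 else 0)" if "a \<noteq> 1" "b \<noteq> 1" for a b
    using that by (simp add: frame_def r_def Let_def)
  have col: "(\<Sum>c=2..k. y c * frame k y c b) = y b * (r\<^sup>2 - 1) / (r * (r + 1)) - y b" if "b \<in> {2..k}" for b
  proof -
    have "(\<Sum>c=2..k. y c * frame k y c b) = (\<Sum>c=2..k. y b / (r * (r + 1)) * (y c * y c) - (if c = b then y c else 0))"
      using that by (intro sum.cong refl) (simp add: ff right_diff_distrib)
    also have "\<dots> = y b / (r * (r + 1)) * (r\<^sup>2 - 1) - y b"
      unfolding sum_subtractf sum_distrib_left[symmetric] sq using that by simp
    finally show ?thesis by simp
  qed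
  have col': "y b * (r\<^sup>2 - 1) / (r * (r + 1)) - y b = - y b / r" for b
  proof -
    have "r\<^sup>2 - 1 = (r - 1) * (r + 1)" by (simp add: power2_eq_square algebra_simps)
    then have "y b * (r\<^sup>2 - 1) / (r * (r + 1)) = y b * (r - 1) / r" using r by simp
    then show ?thesis using r by (simp add: field_simps)
  qed
  show ?thesis
  proof (cases "a = 1")
    case a: True
    show ?thesis
    proof (cases "b = 1")
      case True
      have "(\<Sum>c=1..k. frame k y c a * frame k y c b) = 1 / r * (1 / r) + (\<Sum>c=2..k. (y c / r) * (y c / r))"
        unfolding split a True f11 by (intro arg_cong2[where f="(+)"] refl sum.cong) (auto simp: f1)
      also have "(\<Sum>c=2..k. (y c / r) * (y c / r)) = (\<Sum>c=2..k. y c * y c) / r\<^sup>2"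
        unfolding sum_divide_distrib by (intro sum.cong refl) (simp add: power2_eq_square)
      also have "1 / r * (1 / r) + (\<Sum>c=2..k. y c * y c) / r\<^sup>2 = 1"
        using r by (simp add: sq field_simps power2_eq_square)
      finally show ?thesis using a True by simp
    next
      case False
      then have b: "b \<in> {2..k}" using ab by auto
      have "(\<Sum>c=1..k. frame k y c a * frame k y c b) = 1 / r * (y b / r) + (\<Sum>c=2..k. (1 / r) * (y c * frame k y c b))"
        unfolding split a f11 f1(1)[OF False] by (intro arg_cong2[where f="(+)"] refl sum.cong) (auto simp: f1)
      also have "\<dots> = 0"
        unfolding sum_distrib_left[symmetric] col[OF b] col' using r by (simp add: field_simps)
      finally show ?thesis using a False by simp
    qed
  next
    case a1: False
    then have a: "a \<in> {2..k}" using ab by auto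
    show ?thesis
    proof (cases "b = 1")
      case True
      have "(\<Sum>c=1..k. frame k y c a * frame k y c b) = (y a / r) * (1 / r) + (\<Sum>c=2..k. (1 / r) * (y c * frame k y c a))"
        unfolding split True f11 f1(1)[OF a1] by (intro arg_cong2[where f="(+)"] refl sum.cong) (auto simp: f1)
      also have "\<dots> = 0"
        unfolding sum_distrib_left[symmetric] col[OF a] col' using r by (simp add: field_simps)
      finally show ?thesis using a1 True by simp
    next
      case b1: False
      then have b: "b \<in> {2..k}" using ab by auto
      have "(\<Sum>c=2..k. frame k y c a * frame k y c b) =
          (\<Sum>c=2..k. y a / (r * (r + 1)) * (y c * frame k y c b) - (if c = a then frame k y c b else 0))"
        using a1 by (intro sum.cong refl) (simp add: ff[where b=a] left_diff_distrib)
      also have "\<dots> = y a / (r * (r + 1)) * (- y b / r) - frame k y a b"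
        unfolding sum_subtractf sum_distrib_left[symmetric] col[OF b] col' using a by simp
      also have "frame k y a b = y a * y b / (r * (r + 1)) - (if a = b then 1 else 0)" by (rule ff[OF a1 b1])
      finally have "(\<Sum>c=1..k. frame k y c a * frame k y c b) = (y a / r) * (y b / r) +
          (y a / (r * (r + 1)) * (- y b / r) - (y a * y b / (r * (r + 1)) - (if a = b then 1 else 0)))"
        unfolding split f1(1)[OF a1] f1(1)[OF b1] by simp
      also have "\<dots> = (if a = b then 1 else 0) + y a * y b * (1 / (r * r) - 1 / (r * r * (r + 1)) - 1 / (r * (r + 1)))"
        by (simp add: algebra_simps)
      also have "1 / (r * r) - 1 / (r * r * (r + 1)) - 1 / (r * (r + 1)) = 0"
        using r by (simp add: divide_simps)
      finally show ?thesis by simp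
    qed
  qed
qed

lemma frame_orthogonal':
  assumes "k \<ge> 1" "a \<in> {1..k}" "b \<in> {1..k}"
  shows "(\<Sum>c=1..k. frame k y a c * frame k y b c) = (if a = b then 1 else 0)"
proof -
  have "(\<Sum>c=1..k. frame k y a c * frame k y b c) = (\<Sum>c=1..k. frame k y c a * frame k y c b)"
    by (intro sum.cong refl arg_cong2[where f="(*)"] frame_sym)
  then show ?thesis using frame_orthogonal[OF assms] by simp
qed

lemma frame_cong:
  assumes "\<And>c. c \<in> {2..k} \<Longrightarrow> y c = y' c" "a \<in> {1..k}" "b \<in> {1..k}"
  shows "frame k y a b = frame k y' a b"
proof -
  have "frame_radius k y = frame_radius k y'" unfolding frame_radius_def using assms(1) by simp
  moreover have "a \<noteq> 1 \<Longrightarrow> y a = y' a" "b \<noteq> 1 \<Longrightarrow> y b = y' b" using assms by auto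
  ultimately show ?thesis by (simp add: frame_def Let_def)
qed

section \<open>Parametrisation of the critical points in one chart\<close>

locale tensor_format =
  fixes p :: nat and n :: "nat \<Rightarrow> nat"
  assumes p_pos: "p \<ge> 1" and n_pos: "\<And>i. i \<in> {1..p} \<Longrightarrow> n i \<ge> 1"
begin

abbreviation "MI \<equiv> multi_index p n"

definition "ones = (\<lambda>i\<in>{1..p}. 1 :: nat)"
text \<open>The multi-indices that differ from \<open>ones\<close> in at most one slot. All
  \<open>lead i 1\<close> coincide with \<open>ones\<close>, which is why \<open>leads\<close>
  starts at 2.\<close>

definition "lead i a = ones(i := a)"
definition "leads = {lead i a | i a. i \<in> {1..p} \<and> a \<in> {2..n i}}"

lemma finite_MI: "finite MI" by (rule finite_multi_index)

lemma ones_MI: "ones \<in> MI"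
  using n_pos by (auto simp: ones_def multi_index_def)

lemma lead_MI: "i \<in> {1..p} \<Longrightarrow> a \<in> {1..n i} \<Longrightarrow> lead i a \<in> MI"
  unfolding lead_def by (rule multi_index_upd[OF ones_MI])

lemma ones_apply: "i \<in> {1..p} \<Longrightarrow> ones i = 1" by (simp add: ones_def)

lemma lead_apply: "lead i a j = (if j = i then a else ones j)" by (simp add: lead_def)

lemma lead_1: "i \<in> {1..p} \<Longrightarrow> lead i 1 = ones" by (auto simp: lead_def ones_def)

lemma lead_neq_ones: "i \<in> {1..p} \<Longrightarrow> a \<noteq> 1 \<Longrightarrow> lead i a \<noteq> ones"
  using lead_apply[of i a i] ones_apply[of i] by auto

lemma lead_inj: "i \<in> {1..p} \<Longrightarrow> j \<in> {1..p} \<Longrightarrow> a \<noteq> 1 \<Longrightarrow> lead i a = lead j b \<longleftrightarrow> i = j \<and> a = b"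
proof
  assume *: "i \<in> {1..p}" "a \<noteq> 1" "lead i a = lead j b"
  from fun_cong[OF *(3), of i] have "a = (if i = j then b else 1)" using *(1) by (simp add: lead_apply ones_apply)
  then show "i = j \<and> a = b" using *(2) by (auto split: if_splits)
qed auto

lemma leads_MI: "leads \<subseteq> MI" unfolding leads_def using lead_MI by fastforce

lemma lead_leads: "i \<in> {1..p} \<Longrightarrow> a \<in> {2..n i} \<Longrightarrow> lead i a \<in> leads" unfolding leads_def by blast

lemma ones_notin_leads: "ones \<notin> leads"
proof
  assume "ones \<in> leads"
  then obtain i a where "i \<in> {1..p}" "a \<in> {2..n i}" "ones = lead i a" by (auto simp: leads_def)
  then show False using lead_neq_ones[of i a] by auto
qed

text \<open>
  A parameter \<open>q\<close> is again an array over the multi-indices: its entry at \<open>lead i a\<close> is the affine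
  coordinate \<open>a\<close> of the direction \<open>i\<close>, its other entries are coordinates of a tensor in the frame
  \<open>P q\<close> adapted to these directions.
\<close>

definition "dirs q i a = q (lead i a)" for q :: tensor
definition "P q \<alpha> \<beta> = (\<Prod>i=1..p. frame (n i) (dirs q i) (\<alpha> i) (\<beta> i))"
text \<open>The entries of \<open>q\<close> at the leads are spent on the directions. In their place
  the coordinate vector of the tensor has zeros: these are the orthogonality conditions of
  criticality.\<close>

definition "wt q \<beta> = (if \<beta> \<in> leads then 0 else q \<beta>)" for q :: tensor
definition "Phi q = (\<lambda>\<alpha>\<in>MI. \<Sum>\<beta>\<in>MI. P q \<alpha> \<beta> * wt q \<beta>)"
definition "Phi_adj q v \<beta> = (\<Sum>\<alpha>\<in>MI. P q \<alpha> \<beta> * v \<alpha>)" for v :: tensor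

lemma P_sym: "P q \<alpha> \<beta> = P q \<beta> \<alpha>"
  unfolding P_def by (intro prod.cong refl frame_sym)

lemma P_orthogonal:
  assumes "\<beta> \<in> MI" "\<gamma> \<in> MI"
  shows "(\<Sum>\<alpha>\<in>MI. P q \<alpha> \<beta> * P q \<alpha> \<gamma>) = (if \<beta> = \<gamma> then 1 else 0)"
proof -
  have "(\<Sum>\<alpha>\<in>MI. P q \<alpha> \<beta> * P q \<alpha> \<gamma>) =
      (\<Prod>i\<in>{1..p}. \<Sum>a\<in>{1..n i}. frame (n i) (dirs q i) a (\<beta> i) * frame (n i) (dirs q i) a (\<gamma> i))"
    unfolding P_def prod.distrib[symmetric] multi_index_def by (rule prod_sum_PiE[symmetric]) auto
  also have "\<dots> = (\<Prod>i\<in>{1..p}. if \<beta> i = \<gamma> i then 1 else 0)"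
    using multi_indexD[OF assms(1)] multi_indexD[OF assms(2)] n_pos
    by (intro prod.cong refl frame_orthogonal) auto
  also have "\<dots> = (if \<beta> = \<gamma> then 1 else 0)"
  proof (cases "\<beta> = \<gamma>")
    case False
    then obtain i where "\<beta> i \<noteq> \<gamma> i" by blast
    have "i \<in> {1..p}"
    proof (rule ccontr)
      assume "i \<notin> {1..p}"
      then have "\<beta> i = undefined" "\<gamma> i = undefined"
        using assms by (simp_all add: multi_index_def PiE_iff extensional_def)
      with \<open>\<beta> i \<noteq> \<gamma> i\<close> show False by simp
    qed
    then have "(\<Prod>i\<in>{1..p}. if \<beta> i = \<gamma> i then 1 else (0::real)) = 0"
      using \<open>\<beta> i \<noteq> \<gamma> i\<close> by (intro prod_zero) auto
    then show ?thesis using False by simp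
  qed simp
  finally show ?thesis .
qed

lemma P_orthogonal': "\<alpha> \<in> MI \<Longrightarrow> \<gamma> \<in> MI \<Longrightarrow> (\<Sum>\<beta>\<in>MI. P q \<alpha> \<beta> * P q \<gamma> \<beta>) = (if \<alpha> = \<gamma> then 1 else 0)"
proof -
  assume *: "\<alpha> \<in> MI" "\<gamma> \<in> MI"
  have "(\<Sum>\<beta>\<in>MI. P q \<alpha> \<beta> * P q \<gamma> \<beta>) = (\<Sum>\<beta>\<in>MI. P q \<beta> \<alpha> * P q \<beta> \<gamma>)"
    by (intro sum.cong refl arg_cong2[where f="(*)"] P_sym)
  then show ?thesis using P_orthogonal[OF *] by simp
qed

lemma P_cong:
  assumes "\<And>i a. i \<in> {1..p} \<Longrightarrow> a \<in> {2..n i} \<Longrightarrow> q (lead i a) = q' (lead i a)" "\<alpha> \<in> MI" "\<beta> \<in> MI"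
  shows "P q \<alpha> \<beta> = P q' \<alpha> \<beta>"
  unfolding P_def dirs_def using assms multi_indexD
  by (intro prod.cong refl frame_cong) auto

lemma Phi_adj_Phi:
  assumes "\<beta> \<in> MI" shows "Phi_adj q (Phi q) \<beta> = wt q \<beta>"
proof -
  have "Phi_adj q (Phi q) \<beta> = (\<Sum>\<alpha>\<in>MI. \<Sum>\<gamma>\<in>MI. P q \<alpha> \<beta> * P q \<alpha> \<gamma> * wt q \<gamma>)"
    unfolding Phi_adj_def Phi_def by (intro sum.cong refl) (simp add: sum_distrib_left mult_ac)
  also have "\<dots> = (\<Sum>\<gamma>\<in>MI. (\<Sum>\<alpha>\<in>MI. P q \<alpha> \<beta> * P q \<alpha> \<gamma>) * wt q \<gamma>)"
    by (subst sum.swap) (simp add: sum_distrib_right)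
  also have "\<dots> = (\<Sum>\<gamma>\<in>MI. if \<beta> = \<gamma> then wt q \<gamma> else 0)"
    using assms by (intro sum.cong refl) (simp add: P_orthogonal)
  finally show ?thesis using assms finite_MI by simp
qed

lemma Phi_eqI:
  assumes "v \<in> tensor_space p n" "\<And>\<beta>. \<beta> \<in> MI \<Longrightarrow> Phi_adj q v \<beta> = wt q \<beta>"
  shows "Phi q = v"
proof
  fix \<alpha>
  show "Phi q \<alpha> = v \<alpha>"
  proof (cases "\<alpha> \<in> MI")
    case True
    have "Phi q \<alpha> = (\<Sum>\<beta>\<in>MI. \<Sum>\<gamma>\<in>MI. P q \<alpha> \<beta> * P q \<gamma> \<beta> * v \<gamma>)"
      using True unfolding Phi_def
      by (simp add: assms(2)[symmetric] Phi_adj_def sum_distrib_left mult_ac)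
    also have "\<dots> = (\<Sum>\<gamma>\<in>MI. (\<Sum>\<beta>\<in>MI. P q \<alpha> \<beta> * P q \<gamma> \<beta>) * v \<gamma>)"
      by (subst sum.swap) (simp add: sum_distrib_right)
    also have "\<dots> = (\<Sum>\<gamma>\<in>MI. if \<alpha> = \<gamma> then v \<gamma> else 0)"
      using True by (intro sum.cong refl) (simp add: P_orthogonal')
    finally show ?thesis using True finite_MI by simp
  next
    case False
    then show ?thesis using assms(1) by (auto simp: Phi_def tensor_space_def)
  qed
qed

lemma sum_Phi_sq: "(\<Sum>\<alpha>\<in>MI. (Phi q \<alpha>)\<^sup>2) = (\<Sum>\<beta>\<in>MI. (wt q \<beta>)\<^sup>2)"
proof -
  have "(\<Sum>\<alpha>\<in>MI. (Phi q \<alpha>)\<^sup>2) = (\<Sum>\<alpha>\<in>MI. \<Sum>\<beta>\<in>MI. P q \<alpha> \<beta> * wt q \<beta> * Phi q \<alpha>)"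
    by (intro sum.cong refl) (simp add: power2_eq_square sum_distrib_right[symmetric] Phi_def)
  also have "\<dots> = (\<Sum>\<beta>\<in>MI. wt q \<beta> * Phi_adj q (Phi q) \<beta>)"
    by (subst sum.swap) (simp add: Phi_adj_def sum_distrib_left mult_ac)
  also have "\<dots> = (\<Sum>\<beta>\<in>MI. (wt q \<beta>)\<^sup>2)"
    by (intro sum.cong refl) (simp add: Phi_adj_Phi power2_eq_square)
  finally show ?thesis .
qed

definition "axes q i a = frame (n i) (dirs q i) a 1"
definition "crit_of q = (\<lambda>\<alpha>\<in>MI. q ones * rank_one p n (axes q) \<alpha>)"
text \<open>The parameter of a tensor \<open>v\<close> with critical point \<open>x\<close>. The
  ratios \<open>x \<beta> / x ones\<close> at the leads are the affine coordinates of the factors of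
  \<open>x\<close>. The whole array of ratios may stand for the parameter in \<open>Phi_adj\<close>,
  since the frame reads the entries at the leads alone.\<close>

definition "param_of v x = (\<lambda>\<beta>\<in>MI. if \<beta> \<in> leads then x \<beta> / x ones else Phi_adj (\<lambda>\<beta>. x \<beta> / x ones) v \<beta>)"

lemma P_lead:
  assumes "\<alpha> \<in> MI" "i \<in> {1..p}"
  shows "P q \<alpha> (lead i b) = rank_one p n ((axes q)(i := \<lambda>a. frame (n i) (dirs q i) a b)) \<alpha>"
proof -
  have "P q \<alpha> (lead i b) = frame (n i) (dirs q i) (\<alpha> i) b * (\<Prod>j\<in>{1..p} - {i}. frame (n j) (dirs q j) (\<alpha> j) (lead i b j))"
    unfolding P_def using assms(2) by (subst prod.remove[of _ i]) (auto simp: lead_apply)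
  also have "(\<Prod>j\<in>{1..p} - {i}. frame (n j) (dirs q j) (\<alpha> j) (lead i b j)) = (\<Prod>j\<in>{1..p} - {i}. axes q j (\<alpha> j))"
    by (intro prod.cong refl) (auto simp: lead_apply ones_apply axes_def)
  finally show ?thesis using assms by (simp add: rank_one_upd)
qed

lemma P_ones: "\<alpha> \<in> MI \<Longrightarrow> P q \<alpha> ones = rank_one p n (axes q) \<alpha>"
  by (simp add: P_def rank_one_apply axes_def ones_apply)

lemma axes_1: "axes q i 1 = 1 / frame_radius (n i) (dirs q i)"
  by (simp add: axes_def frame_def Let_def)

lemma axes_other: "a \<noteq> 1 \<Longrightarrow> axes q i a = q (lead i a) / frame_radius (n i) (dirs q i)"
  by (simp add: axes_def frame_def Let_def dirs_def)

lemma axes_1_nz: "axes q i 1 \<noteq> 0"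
  using frame_radius_pos[of "n i" "dirs q i"] by (simp add: axes_1)

lemma crit_of_ones: "crit_of q ones = q ones * (\<Prod>i=1..p. axes q i 1)"
  using ones_MI by (simp add: crit_of_def rank_one_apply ones_apply)

lemma crit_of_ones_nz: "q ones \<noteq> 0 \<Longrightarrow> crit_of q ones \<noteq> 0"
  using axes_1_nz by (simp add: crit_of_ones)

lemma crit_of_lead:
  assumes "i \<in> {1..p}" "a \<in> {2..n i}"
  shows "crit_of q (lead i a) = q (lead i a) * crit_of q ones"
proof -
  have "a \<noteq> 1" "lead i a \<in> MI" using assms lead_MI by auto
  have "rank_one p n (axes q) (lead i a) = axes q i a * (\<Prod>j\<in>{1..p} - {i}. axes q j (lead i a j))"
    using rank_one_upd[OF \<open>lead i a \<in> MI\<close> assms(1), of "axes q" "axes q i"] by (simp add: lead_apply)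
  also have "(\<Prod>j\<in>{1..p} - {i}. axes q j (lead i a j)) = (\<Prod>j\<in>{1..p} - {i}. axes q j 1)"
    by (intro prod.cong refl) (auto simp: lead_apply ones_apply)
  also have "axes q i a = q (lead i a) * axes q i 1" using \<open>a \<noteq> 1\<close> by (simp add: axes_1 axes_other)
  also have "q (lead i a) * axes q i 1 * (\<Prod>j\<in>{1..p} - {i}. axes q j 1) = q (lead i a) * (\<Prod>j=1..p. axes q j 1)"
    using assms(1) by (simp add: prod.remove[of _ i])
  finally show ?thesis using \<open>lead i a \<in> MI\<close> by (simp add: crit_of_ones) (simp add: crit_of_def)
qed

lemma inner_P: "tensor_inner p n u (\<lambda>\<alpha>. P q \<alpha> \<beta>) = Phi_adj q u \<beta>"
  unfolding tensor_inner_def Phi_adj_def by (simp add: mult.commute)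

lemma Phi_adj_crit_of:
  assumes "\<beta> \<in> MI" shows "Phi_adj q (crit_of q) \<beta> = (if \<beta> = ones then q ones else 0)"
proof -
  have "Phi_adj q (crit_of q) \<beta> = q ones * (\<Sum>\<alpha>\<in>MI. P q \<alpha> \<beta> * P q \<alpha> ones)"
    unfolding Phi_adj_def crit_of_def sum_distrib_left by (intro sum.cong refl) (simp add: P_ones mult_ac)
  then show ?thesis using P_orthogonal[OF assms ones_MI] by simp
qed

lemma Phi_adj_diff: "Phi_adj q (\<lambda>\<alpha>. v \<alpha> - x \<alpha>) \<beta> = Phi_adj q v \<beta> - Phi_adj q x \<beta>"
  unfolding Phi_adj_def by (simp add: right_diff_distrib sum_subtractf)

text \<open>The columns of the frame of slot \<open>i\<close> are a basis, so it is enough to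
  replace the factor \<open>i\<close> by these columns. This yields the column of \<open>P q\<close>
  at \<open>lead i b\<close>, and in the frame \<open>crit_of q\<close> has a single non-zero
  coordinate, at \<open>ones\<close>.\<close>

lemma crit_of_critical_iff:
  assumes q: "q ones \<noteq> 0"
  shows "crit_of q \<in> critical_points p n (rank_one_manifold p n) v \<longleftrightarrow>
    (\<forall>i\<in>{1..p}. \<forall>b\<in>{1..n i}. Phi_adj q v (lead i b) = (if lead i b = ones then q ones else 0))"
proof -
  let ?u = "\<lambda>\<alpha>. v \<alpha> - crit_of q \<alpha>"
  have crit: "crit_of q \<in> critical_points p n (rank_one_manifold p n) v \<longleftrightarrow>
    (\<forall>i\<in>{1..p}. \<forall>w. tensor_inner p n ?u (rank_one p n ((axes q)(i := w))) = 0)"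
    by (rule critical_points_iff[where c="q ones" and X="axes q" and x="crit_of q" and \<alpha>=ones, OF p_pos q crit_of_def ones_MI crit_of_ones_nz[of q, OF q]])
  have inner: "tensor_inner p n ?u (rank_one p n ((axes q)(i := \<lambda>a. frame (n i) (dirs q i) a b))) =
      Phi_adj q v (lead i b) - (if lead i b = ones then q ones else 0)" if ib: "i \<in> {1..p}" "b \<in> {1..n i}" for i b
  proof -
    have "tensor_inner p n ?u (rank_one p n ((axes q)(i := \<lambda>a. frame (n i) (dirs q i) a b))) =
        tensor_inner p n ?u (\<lambda>\<alpha>. P q \<alpha> (lead i b))"
    proof (rule tensor_inner_cong)
      fix \<alpha> assume "\<alpha> \<in> MI"
      then show "rank_one p n ((axes q)(i := \<lambda>a. frame (n i) (dirs q i) a b)) \<alpha> = P q \<alpha> (lead i b)"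
        by (rule P_lead[OF _ ib(1), symmetric])
    qed
    also have "\<dots> = Phi_adj q v (lead i b) - Phi_adj q (crit_of q) (lead i b)"
      unfolding inner_P Phi_adj_diff ..
    finally show ?thesis unfolding Phi_adj_crit_of[OF lead_MI[OF ib]] .
  qed
  have expand: "tensor_inner p n ?u (rank_one p n ((axes q)(i := w))) =
      (\<Sum>b=1..n i. (\<Sum>a=1..n i. frame (n i) (dirs q i) a b * w a) *
        (Phi_adj q v (lead i b) - (if lead i b = ones then q ones else 0)))" if i: "i \<in> {1..p}" for i w
  proof -
    define \<omega> where "\<omega> b = (\<Sum>a=1..n i. frame (n i) (dirs q i) a b * w a)" for b
    have w: "w a = (\<Sum>b=1..n i. \<omega> b * frame (n i) (dirs q i) a b)" if a: "a \<in> {1..n i}" for a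
    proof -
      have "(\<Sum>b=1..n i. \<omega> b * frame (n i) (dirs q i) a b) =
          (\<Sum>b=1..n i. \<Sum>c=1..n i. frame (n i) (dirs q i) a b * frame (n i) (dirs q i) c b * w c)"
        unfolding \<omega>_def sum_distrib_right by (intro sum.cong refl) (simp add: mult_ac)
      also have "\<dots> = (\<Sum>c=1..n i. (\<Sum>b=1..n i. frame (n i) (dirs q i) a b * frame (n i) (dirs q i) c b) * w c)"
        by (subst sum.swap) (simp add: sum_distrib_right)
      also have "\<dots> = (\<Sum>c=1..n i. if a = c then w c else 0)"
        using a n_pos[OF i] by (intro sum.cong refl) (simp add: frame_orthogonal' del: One_nat_def)
      finally show ?thesis using a by simp
    qed
    have "tensor_inner p n ?u (rank_one p n ((axes q)(i := w))) =
        tensor_inner p n ?u (\<lambda>\<alpha>. \<Sum>b=1..n i. \<omega> b * rank_one p n ((axes q)(i := \<lambda>a. frame (n i) (dirs q i) a b)) \<alpha>)"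
    proof (rule tensor_inner_cong)
      fix \<alpha> assume \<alpha>: "\<alpha> \<in> MI"
      show "rank_one p n ((axes q)(i := w)) \<alpha> =
          (\<Sum>b=1..n i. \<omega> b * rank_one p n ((axes q)(i := \<lambda>a. frame (n i) (dirs q i) a b)) \<alpha>)"
        unfolding rank_one_upd[OF \<alpha> i] w[OF multi_indexD[OF \<alpha> i]] sum_distrib_right
        by (intro sum.cong refl) (simp add: mult_ac)
    qed
    then show ?thesis unfolding tensor_inner_linear using inner[OF i] by (simp add: \<omega>_def)
  qed
  show ?thesis unfolding crit
  proof
    assume *: "\<forall>i\<in>{1..p}. \<forall>w. tensor_inner p n ?u (rank_one p n ((axes q)(i := w))) = 0"
    show "\<forall>i\<in>{1..p}. \<forall>b\<in>{1..n i}. Phi_adj q v (lead i b) = (if lead i b = ones then q ones else 0)"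
    proof (intro ballI)
      fix i b assume ib: "i \<in> {1..p}" "b \<in> {1..n i}"
      show "Phi_adj q v (lead i b) = (if lead i b = ones then q ones else 0)"
        using inner[OF ib] * ib(1) by simp
    qed
  next
    assume *: "\<forall>i\<in>{1..p}. \<forall>b\<in>{1..n i}. Phi_adj q v (lead i b) = (if lead i b = ones then q ones else 0)"
    show "\<forall>i\<in>{1..p}. \<forall>w. tensor_inner p n ?u (rank_one p n ((axes q)(i := w))) = 0"
    proof (intro ballI allI)
      fix i w assume i: "i \<in> {1..p}"
      show "tensor_inner p n ?u (rank_one p n ((axes q)(i := w))) = 0"
        unfolding expand[OF i] using * i by (intro sum.neutral) simp
    qed
  qed
qed

lemma Phi_critical:
  assumes q: "q ones \<noteq> 0" shows "crit_of q \<in> critical_points p n (rank_one_manifold p n) (Phi q)"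
  unfolding crit_of_critical_iff[of q, OF q]
proof (intro ballI)
  fix i b assume ib: "i \<in> {1..p}" "b \<in> {1..n i}"
  show "Phi_adj q (Phi q) (lead i b) = (if lead i b = ones then q ones else 0)"
  proof (cases "b = 1")
    case True
    then show ?thesis using ib ones_notin_leads ones_MI by (simp add: lead_1 Phi_adj_Phi wt_def del: One_nat_def)
  next
    case False
    then have "lead i b \<in> leads" using ib by (intro lead_leads) auto
    then show ?thesis using False ib lead_neq_ones[OF ib(1) False] lead_MI[OF ib] by (simp add: Phi_adj_Phi wt_def)
  qed
qed

lemma param_of_lead: "i \<in> {1..p} \<Longrightarrow> a \<in> {2..n i} \<Longrightarrow> param_of v x (lead i a) = x (lead i a) / x ones"
  using lead_leads leads_MI by (auto simp: param_of_def)

lemma param_of_crit_of: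
  assumes "q \<in> tensor_space p n" "q ones \<noteq> 0"
  shows "param_of (Phi q) (crit_of q) = q"
proof
  fix \<beta>
  have nz: "crit_of q ones \<noteq> 0" by (rule crit_of_ones_nz[of q, OF assms(2)])
  have l: "crit_of q (lead i a) / crit_of q ones = q (lead i a)" if "i \<in> {1..p}" "a \<in> {2..n i}" for i a
    using nz by (simp add: crit_of_lead[OF that])
  show "param_of (Phi q) (crit_of q) \<beta> = q \<beta>"
  proof (cases "\<beta> \<in> MI")
    case \<beta>: True
    show ?thesis
    proof (cases "\<beta> \<in> leads")
      case True
      then show ?thesis using l \<beta> by (auto simp: param_of_def leads_def)
    next
      case False
      have "Phi_adj (\<lambda>\<beta>. crit_of q \<beta> / crit_of q ones) (Phi q) \<beta> = Phi_adj q (Phi q) \<beta>"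
        unfolding Phi_adj_def using l \<beta> by (intro sum.cong refl arg_cong2[where f="(*)"] P_cong) auto
      then show ?thesis using \<beta> False by (simp add: param_of_def Phi_adj_Phi wt_def)
    qed
  next
    case False
    then show ?thesis using assms(1) by (auto simp: param_of_def tensor_space_def)
  qed
qed

lemma crit_of_param_of:
  assumes v: "v \<in> tensor_space p n" and x: "x \<in> critical_points p n (rank_one_manifold p n) v" "x ones \<noteq> 0"
  shows "crit_of (param_of v x) = x" "Phi (param_of v x) = v" "param_of v x ones \<noteq> 0"
proof -
  define q where "q = param_of v x"
  obtain X where X: "x = rank_one p n X" using x(1) by (auto simp: critical_points_def rank_one_manifold_def)
  have x1: "x ones = (\<Prod>i=1..p. X i 1)" unfolding X using ones_MI by (simp add: rank_one_apply ones_apply)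
  then have Xnz: "X i 1 \<noteq> 0" if "i \<in> {1..p}" for i using x(2) that by auto
  have xl: "x (lead i a) / x ones = X i a / X i 1" if ia: "i \<in> {1..p}" "a \<in> {1..n i}" for i a
  proof -
    have "x (lead i a) = X i a * (\<Prod>j\<in>{1..p} - {i}. X j (lead i a j))"
      unfolding X using rank_one_upd[OF lead_MI[OF ia] ia(1), of X "X i"] by (simp add: lead_apply)
    also have "(\<Prod>j\<in>{1..p} - {i}. X j (lead i a j)) = (\<Prod>j\<in>{1..p} - {i}. X j 1)"
      by (intro prod.cong refl) (auto simp: lead_apply ones_apply)
    finally have "x (lead i a) = X i a * (\<Prod>j\<in>{1..p} - {i}. X j 1)" .
    moreover have "x ones = X i 1 * (\<Prod>j\<in>{1..p} - {i}. X j 1)"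
      unfolding x1 using ia by (subst prod.remove[of _ i]) auto
    ultimately show ?thesis using x(2) by auto
  qed
  \<comment> \<open>Each factor \<open>X i\<close> is \<open>X i 1 * frame_radius\<close> times the
    unit vector \<open>axes q i\<close>; the product of these scalars is the scalar of
    \<open>x\<close>.\<close>
  define t where "t = (\<Prod>i=1..p. X i 1 * frame_radius (n i) (dirs q i))"
  have tnz: "t \<noteq> 0" unfolding t_def using Xnz frame_radius_pos by (simp add: less_imp_neq[symmetric] del: One_nat_def)
  have Xa: "X i a = X i 1 * frame_radius (n i) (dirs q i) * axes q i a" if ia: "i \<in> {1..p}" "a \<in> {1..n i}" for i a
  proof (cases "a = 1")
    case True
    then show ?thesis using frame_radius_pos[of "n i" "dirs q i"] axes_1[of q i] by simp
  next
    case False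
    then have "q (lead i a) = X i a / X i 1" unfolding q_def using ia by (subst param_of_lead) (auto simp: xl)
    then show ?thesis using frame_radius_pos[of "n i" "dirs q i"] axes_other[OF False] Xnz[OF ia(1)] by simp
  qed
  have xt: "x = (\<lambda>\<alpha>\<in>MI. t * rank_one p n (axes q) \<alpha>)"
  proof
    fix \<alpha>
    show "x \<alpha> = (\<lambda>\<alpha>\<in>MI. t * rank_one p n (axes q) \<alpha>) \<alpha>"
    proof (cases "\<alpha> \<in> MI")
      case True
      have "(\<Prod>i=1..p. X i (\<alpha> i)) = (\<Prod>i=1..p. X i 1 * frame_radius (n i) (dirs q i) * axes q i (\<alpha> i))"
        using multi_indexD[OF True] by (intro prod.cong refl Xa) auto
      then show ?thesis using True by (simp add: X rank_one_apply t_def prod.distrib)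
    qed (simp add: X rank_one_def)
  qed
  \<comment> \<open>It is not yet known that \<open>q ones\<close> equals the scalar
    \<open>t\<close> of \<open>x\<close>. Enforcing this makes the criterion applicable to
    \<open>q'\<close>, whose frame is that of \<open>q\<close>; the condition of the criterion at
    \<open>ones\<close> then says \<open>q ones = t\<close>, so that \<open>q' = q\<close>.\<close>
  define q' where "q' = q(ones := t)"
  have l': "q' (lead i a) = q (lead i a)" if "i \<in> {1..p}" "a \<in> {2..n i}" for i a
    using lead_neq_ones[of i a] that by (simp add: q'_def)
  have ax': "axes q' i a = axes q i a" if "i \<in> {1..p}" "a \<in> {1..n i}" for i a
    unfolding axes_def dirs_def using l' that n_pos by (intro frame_cong) auto
  have x': "crit_of q' = x"
  proof
    fix \<alpha>
    show "crit_of q' \<alpha> = x \<alpha>"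
    proof (cases "\<alpha> \<in> MI")
      case True
      have "rank_one p n (axes q') \<alpha> = rank_one p n (axes q) \<alpha>"
        unfolding rank_one_apply[OF True] using multi_indexD[OF True] by (intro prod.cong refl ax') auto
      then show ?thesis using True by (simp add: crit_of_def xt q'_def)
    qed (simp add: crit_of_def xt)
  qed
  have PP: "Phi_adj q' v \<beta> = Phi_adj q v \<beta>" if "\<beta> \<in> MI" for \<beta>
    unfolding Phi_adj_def using l' that by (intro sum.cong refl arg_cong2[where f="(*)"] P_cong) auto
  have "q' ones \<noteq> 0" using tnz by (simp add: q'_def)
  from crit_of_critical_iff[of q' v, OF this] x(1) x'
  have crit0: "\<forall>i\<in>{1..p}. \<forall>b\<in>{1..n i}. Phi_adj q' v (lead i b) = (if lead i b = ones then q' ones else 0)" by simp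
  have "q' ones = t" by (simp add: q'_def)
  then have crit: "Phi_adj q v (lead i b) = (if lead i b = ones then t else 0)" if ib: "i \<in> {1..p}" "b \<in> {1..n i}" for i b
    using trans[OF PP[OF lead_MI[OF ib], symmetric] bspec[OF bspec[OF crit0 ib(1)] ib(2)]] by (simp only:)
  have P2: "Phi_adj (\<lambda>\<beta>. x \<beta> / x ones) v \<beta> = Phi_adj q v \<beta>" if "\<beta> \<in> MI" for \<beta>
  proof -
    have "P (\<lambda>\<beta>. x \<beta> / x ones) \<alpha> \<beta> = P (param_of v x) \<alpha> \<beta>" if "\<alpha> \<in> MI" for \<alpha>
      by (rule P_cong) (simp_all add: param_of_lead that \<open>\<beta> \<in> MI\<close>)
    then show ?thesis unfolding Phi_adj_def q_def by simp
  qed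
  have one: "1 \<in> {1..p}" using p_pos by simp
  have qt: "q ones = t"
    using crit[OF one, of 1] n_pos[OF one] P2[OF ones_MI] ones_notin_leads ones_MI
    by (simp add: q_def param_of_def lead_1[OF one] del: One_nat_def)
  show "param_of v x ones \<noteq> 0" using tnz qt by (simp add: q_def)
  have "q' = q" using qt by (simp add: q'_def fun_upd_idem)
  then show "crit_of (param_of v x) = x" using x' by (simp add: q_def)
  have "Phi_adj q v \<beta> = wt q \<beta>" if \<beta>: "\<beta> \<in> MI" for \<beta>
  proof (cases "\<beta> \<in> leads")
    case True
    then obtain i a where ia: "i \<in> {1..p}" "a \<in> {2..n i}" "\<beta> = lead i a" by (auto simp: leads_def)
    then have "\<beta> \<noteq> ones" using lead_neq_ones[of i a] by auto
    then show ?thesis using crit[of i a] ia True by (simp add: wt_def)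
  next
    case False
    then show ?thesis using \<beta> P2[OF \<beta>] by (simp add: wt_def q_def param_of_def)
  qed
  then show "Phi (param_of v x) = v" unfolding q_def[symmetric] by (rule Phi_eqI[OF v])
qed

text \<open>The predicate \<open>R\<close> will prescribe coordinates of the critical point that
  have to vanish, so that critical points seen by several charts can be separated.\<close>

lemma bij_betw_crit_of:
  assumes v: "v \<in> tensor_space p n"
  shows "bij_betw crit_of {q \<in> {q \<in> tensor_space p n. q ones \<noteq> 0 \<and> R (crit_of q)}. Phi q = v}
    {x \<in> critical_points p n (rank_one_manifold p n) v. x ones \<noteq> 0 \<and> R x}"
proof (rule bij_betw_byWitness[where f'="param_of v"])
  show "\<forall>q\<in>{q \<in> {q \<in> tensor_space p n. q ones \<noteq> 0 \<and> R (crit_of q)}. Phi q = v}. param_of v (crit_of q) = q"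
    using param_of_crit_of by auto
  show "\<forall>x\<in>{x \<in> critical_points p n (rank_one_manifold p n) v. x ones \<noteq> 0 \<and> R x}. crit_of (param_of v x) = x"
    using crit_of_param_of(1)[OF v] by auto
  show "crit_of ` {q \<in> {q \<in> tensor_space p n. q ones \<noteq> 0 \<and> R (crit_of q)}. Phi q = v}
      \<subseteq> {x \<in> critical_points p n (rank_one_manifold p n) v. x ones \<noteq> 0 \<and> R x}"
    using Phi_critical crit_of_ones_nz by auto
  show "param_of v ` {x \<in> critical_points p n (rank_one_manifold p n) v. x ones \<noteq> 0 \<and> R x}
      \<subseteq> {q \<in> {q \<in> tensor_space p n. q ones \<noteq> 0 \<and> R (crit_of q)}. Phi q = v}"
    using crit_of_param_of[OF v] by (auto simp: param_of_def tensor_space_def)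
qed

end

subsection \<open>The Jacobian of the parametrisation\<close>

text \<open>A class of functions closed under the operations from which the frames are built.
  Continuity and existence of the entries of the Jacobian then follow from the shape of
  \<open>Phi\<close> alone.\<close>

definition C1_fun :: "((nat \<Rightarrow> real) \<Rightarrow> real) \<Rightarrow> bool" where
  "C1_fun f \<longleftrightarrow> continuous_on UNIV f \<and> (\<exists>df. \<forall>j. continuous_on UNIV (df j) \<and>
     (\<forall>z. ((\<lambda>t. f (z(j := t))) has_real_derivative df j z) (at (z j))))"

lemma C1_funI:
  assumes "continuous_on UNIV f" "\<And>j. continuous_on UNIV (df j)"
    "\<And>j z. ((\<lambda>t. f (z(j := t))) has_real_derivative df j z) (at (z j))"
  shows "C1_fun f"
  using assms unfolding C1_fun_def by blast

lemma C1_funE: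
  assumes "C1_fun f"
  obtains df where "continuous_on UNIV f" "\<And>j. continuous_on UNIV (df j)"
    "\<And>j z. ((\<lambda>t. f (z(j := t))) has_real_derivative df j z) (at (z j))"
  using assms unfolding C1_fun_def by blast

lemma C1_fun_deriv:
  assumes "C1_fun f"
  shows "continuous_on UNIV f" "continuous_on UNIV (\<lambda>z. deriv (\<lambda>t. f (z(j := t))) (z j))"
    "((\<lambda>t. f (z(j := t))) has_real_derivative deriv (\<lambda>t. f (z(j := t))) (z j)) (at (z j))"
proof -
  obtain df where df: "continuous_on UNIV f" "\<And>j. continuous_on UNIV (df j)"
    "\<And>j z. ((\<lambda>t. f (z(j := t))) has_real_derivative df j z) (at (z j))"
    using C1_funE[OF assms] by blast
  have eq: "deriv (\<lambda>t. f (z(j := t))) (z j) = df j z" for z by (rule DERIV_imp_deriv[OF df(3)])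
  show "continuous_on UNIV f" by (rule df(1))
  show "continuous_on UNIV (\<lambda>z. deriv (\<lambda>t. f (z(j := t))) (z j))" unfolding eq by (rule df(2))
  show "((\<lambda>t. f (z(j := t))) has_real_derivative deriv (\<lambda>t. f (z(j := t))) (z j)) (at (z j))"
    unfolding eq by (rule df(3))
qed

lemma C1_fun_const: "C1_fun (\<lambda>_. c)"
  by (rule C1_funI[where df="\<lambda>_ _. 0"]) auto

lemma C1_fun_coord: "C1_fun (\<lambda>z. z k)"
proof (rule C1_funI[where df="\<lambda>j _. if j = k then 1 else 0"])
  show "((\<lambda>t. (z(j := t)) k) has_real_derivative (if j = k then 1 else 0)) (at (z j))" for j and z :: "nat \<Rightarrow> real"
    by (cases "j = k") auto
qed (auto intro: continuous_intros)

lemma C1_fun_add: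
  assumes "C1_fun f" "C1_fun g" shows "C1_fun (\<lambda>z. f z + g z)"
proof -
  note f = C1_fun_deriv[OF assms(1)] and g = C1_fun_deriv[OF assms(2)]
  show ?thesis
    by (rule C1_funI[OF continuous_on_add[OF f(1) g(1)] continuous_on_add[OF f(2) g(2)] DERIV_add[OF f(3) g(3)]])
qed

lemma C1_fun_mult:
  assumes "C1_fun f" "C1_fun g" shows "C1_fun (\<lambda>z. f z * g z)"
proof -
  note f = C1_fun_deriv[OF assms(1)] and g = C1_fun_deriv[OF assms(2)]
  show ?thesis
  proof (rule C1_funI[where df="\<lambda>j z. deriv (\<lambda>t. f (z(j := t))) (z j) * g z + deriv (\<lambda>t. g (z(j := t))) (z j) * f z"])
    show "((\<lambda>t. f (z(j := t)) * g (z(j := t))) has_real_derivative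
      deriv (\<lambda>t. f (z(j := t))) (z j) * g z + deriv (\<lambda>t. g (z(j := t))) (z j) * f z) (at (z j))" for j z
      using DERIV_mult[OF f(3) g(3), where z2=z and j2=j and z1=z and j1=j] by simp
  qed (intro continuous_on_mult continuous_on_add f g)+
qed

lemma C1_fun_diff: "C1_fun f \<Longrightarrow> C1_fun g \<Longrightarrow> C1_fun (\<lambda>z. f z - g z)"
  using C1_fun_add[OF _ C1_fun_mult[OF C1_fun_const[of "-1"]], of f g] by simp

lemma C1_fun_compose:
  assumes "C1_fun f" and g: "\<And>z. (g has_real_derivative g' (f z)) (at (f z))"
    and g': "continuous_on (range f) g'"
  shows "C1_fun (\<lambda>z. g (f z))"
proof -
  note f = C1_fun_deriv[OF assms(1)]
  have "continuous_on (range f) g"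
    using g by (intro continuous_at_imp_continuous_on) (auto intro: DERIV_isCont)
  then have c: "continuous_on UNIV (\<lambda>z. g (f z))" by (rule continuous_on_compose2[OF _ f(1)]) auto
  have c': "continuous_on UNIV (\<lambda>z. g' (f z))" by (rule continuous_on_compose2[OF g' f(1)]) auto
  show ?thesis
  proof (rule C1_funI[OF c, where df="\<lambda>j z. g' (f z) * deriv (\<lambda>t. f (z(j := t))) (z j)"])
    show "((\<lambda>t. g (f (z(j := t)))) has_real_derivative g' (f z) * deriv (\<lambda>t. f (z(j := t))) (z j)) (at (z j))" for j z
      using g[of z] by (intro DERIV_chain2[OF _ f(3)]) simp
  qed (intro continuous_on_mult c' f)
qed

lemma C1_fun_inverse:
  assumes "C1_fun f" "\<And>z. f z \<noteq> 0" shows "C1_fun (\<lambda>z. inverse (f z))"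
proof (rule C1_fun_compose[OF assms(1), where g'="\<lambda>x. - (inverse (x ^ Suc (Suc 0)))"])
  show "(inverse has_real_derivative - inverse (f z ^ Suc (Suc 0))) (at (f z))" for z
    using DERIV_inverse[OF assms(2)] by simp
  show "continuous_on (range f) (\<lambda>x. - (inverse (x ^ Suc (Suc 0))))"
    using assms(2) by (intro continuous_intros) auto
qed

lemma C1_fun_divide: "C1_fun f \<Longrightarrow> C1_fun g \<Longrightarrow> (\<And>z. g z \<noteq> 0) \<Longrightarrow> C1_fun (\<lambda>z. f z / g z)"
  unfolding divide_inverse by (intro C1_fun_mult C1_fun_inverse)

lemma C1_fun_sqrt:
  assumes "C1_fun f" "\<And>z. f z > 0" shows "C1_fun (\<lambda>z. sqrt (f z))"
proof (rule C1_fun_compose[OF assms(1), where g'="\<lambda>x. inverse (sqrt x) / 2"])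
  show "(sqrt has_real_derivative inverse (sqrt (f z)) / 2) (at (f z))" for z
    using DERIV_real_sqrt[OF assms(2)] .
  show "continuous_on (range f) (\<lambda>x. inverse (sqrt x) / 2)"
    using assms(2) less_imp_neq by (intro continuous_intros) fastforce+
qed

lemma C1_fun_sum: "(\<And>i. i \<in> I \<Longrightarrow> C1_fun (f i)) \<Longrightarrow> C1_fun (\<lambda>z. \<Sum>i\<in>I. f i z)"
  by (induction I rule: infinite_finite_induct) (auto intro: C1_fun_const C1_fun_add)

lemma C1_fun_prod: "(\<And>i. i \<in> I \<Longrightarrow> C1_fun (f i)) \<Longrightarrow> C1_fun (\<lambda>z. \<Prod>i\<in>I. f i z)"
  by (induction I rule: infinite_finite_induct) (auto intro: C1_fun_const C1_fun_mult)

lemma C1_fun_frame_radius: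
  assumes "\<And>a. C1_fun (\<lambda>z. Y z a)" shows "C1_fun (\<lambda>z. frame_radius k (Y z))"
  unfolding frame_radius_def power2_eq_square
  by (intro C1_fun_sqrt C1_fun_add C1_fun_const C1_fun_sum C1_fun_mult assms add_pos_nonneg sum_nonneg) auto

lemma C1_fun_frame:
  assumes "\<And>a. C1_fun (\<lambda>z. Y z a)" shows "C1_fun (\<lambda>z. frame k (Y z) a b)"
proof -
  note r = C1_fun_frame_radius[OF assms, of k]
  have nz: "frame_radius k y \<noteq> 0" "frame_radius k y + 1 \<noteq> 0" for y
    using frame_radius_pos[of k y] by linarith+
  consider "a = 1" "b = 1" | "a = 1" "b \<noteq> 1" | "a \<noteq> 1" "b = 1" | "a \<noteq> 1" "b \<noteq> 1" by blast
  then show ?thesis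
  proof cases
    case 4
    have "C1_fun (\<lambda>z. Y z a * Y z b / (frame_radius k (Y z) * (frame_radius k (Y z) + 1)) - (if a = b then 1 else 0))"
      using nz by (intro C1_fun_diff C1_fun_divide C1_fun_mult C1_fun_add C1_fun_const assms r) simp
    then show ?thesis using 4 by (simp add: frame_def Let_def)
  qed (use nz in \<open>auto simp: frame_def Let_def intro!: C1_fun_divide C1_fun_const assms r\<close>)
qed

section \<open>Derivatives of the frame\<close>

definition "dframe k y a b c = deriv (\<lambda>t. frame k (y(a := t)) b c) (y a)"

lemma dframe: "((\<lambda>t. frame k (y(a := t)) b c) has_real_derivative dframe k y a b c) (at (y a))"
  unfolding dframe_def by (rule C1_fun_deriv(3)[OF C1_fun_frame[OF C1_fun_coord]])

text \<open>The derivative of the orthogonality relation \<open>frame_orthogonal\<close>, whose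
  right side is constant.\<close>

lemma dframe_antisym:
  assumes "k \<ge> 1" "b \<in> {1..k}" "c \<in> {1..k}"
  shows "(\<Sum>e=1..k. frame k y e b * dframe k y a e c) = - (\<Sum>e=1..k. frame k y e c * dframe k y a e b)"
proof -
  have d: "((\<lambda>t. \<Sum>e=1..k. frame k (y(a := t)) e b * frame k (y(a := t)) e c) has_real_derivative
      (\<Sum>e=1..k. dframe k y a e b * frame k (y(a := y a)) e c + dframe k y a e c * frame k (y(a := y a)) e b)) (at (y a))"
    by (intro DERIV_sum DERIV_mult dframe)
  have "((\<lambda>t. if b = c then 1 else (0::real)) has_real_derivative 0) (at (y a))" by simp
  with d have "(\<Sum>e=1..k. dframe k y a e b * frame k (y(a := y a)) e c + dframe k y a e c * frame k (y(a := y a)) e b) = 0"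
    unfolding frame_orthogonal[OF assms] by (rule DERIV_unique)
  then show ?thesis by (simp add: sum.distrib mult.commute)
qed

text \<open>The first column times the radius is \<open>(1, y)\<close>. Differentiating this in
  \<open>y a\<close> shows that the derivative of the column is the unit vector at \<open>a\<close>
  minus a multiple of the column, divided by the radius; the multiple is killed by the column
  \<open>c\<close>, which is orthogonal to the first.\<close>

lemma dframe_first_column:
  assumes "k \<ge> 1" "a \<in> {2..k}" "c \<in> {2..k}"
  shows "(\<Sum>e=1..k. frame k y e c * dframe k y a e 1) = frame k y a c / frame_radius k y"
proof -
  define \<rho> where "\<rho> = deriv (\<lambda>t. frame_radius k (y(a := t))) (y a)"
  have \<rho>: "((\<lambda>t. frame_radius k (y(a := t))) has_real_derivative \<rho>) (at (y a))"
    unfolding \<rho>_def by (rule C1_fun_deriv(3)[OF C1_fun_frame_radius[OF C1_fun_coord]])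
  have r: "frame_radius k y > 0" for y by (rule frame_radius_pos)
  have col: "frame k z e 1 * frame_radius k z = (if e = 1 then 1 else z e)" for z e
    using r[of z] by (simp add: frame_def Let_def)
  have d: "dframe k y a e 1 = ((if e = a then 1 else 0) - frame k y e 1 * \<rho>) / frame_radius k y" for e
  proof -
    have 1: "((\<lambda>t. frame k (y(a := t)) e 1 * frame_radius k (y(a := t))) has_real_derivative
        dframe k y a e 1 * frame_radius k (y(a := y a)) + \<rho> * frame k (y(a := y a)) e 1) (at (y a))"
      by (intro DERIV_mult dframe \<rho>)
    have "((\<lambda>t. if e = 1 then 1 else (y(a := t)) e) has_real_derivative (if e = a then 1 else 0)) (at (y a))"
    proof -
      have "(\<lambda>t. if e = 1 then 1 else (y(a := t)) e) = (\<lambda>t. if e = a then t else if e = 1 then 1 else y e)"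
        using assms(2) by (auto simp: fun_eq_iff)
      then show ?thesis by (cases "e = a") auto
    qed
    with 1 have "dframe k y a e 1 * frame_radius k (y(a := y a)) + \<rho> * frame k (y(a := y a)) e 1 = (if e = a then 1 else 0)"
      unfolding col by (rule DERIV_unique)
    then show ?thesis using r[of y] by (simp add: field_simps)
  qed
  have "(\<Sum>e=1..k. frame k y e c * dframe k y a e 1) =
      (\<Sum>e=1..k. ((if e = a then frame k y e c else 0) - \<rho> * (frame k y e c * frame k y e 1)) / frame_radius k y)"
    unfolding d by (intro sum.cong refl) (simp add: right_diff_distrib)
  also have "\<dots> = (frame k y a c - \<rho> * (\<Sum>e=1..k. frame k y e c * frame k y e 1)) / frame_radius k y"
    unfolding sum_divide_distrib[symmetric] sum_subtractf sum_distrib_left[symmetric] using assms(2) by simp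
  also have "(\<Sum>e=1..k. frame k y e c * frame k y e 1) = 0"
    using frame_orthogonal[of k c 1 y] assms by simp
  finally show ?thesis by simp
qed

text \<open>
  The determinant of the minor of the frame that omits the first row and column is, up to sign,
  the entry in the corner, because the frame \<open>S\<close> is orthogonal: replacing the last column of \<open>S\<close>
  by a unit vector gives \<open>T\<close>, and \<open>S * T\<close> is triangular.
\<close>

lemma det_frame_minor:
  assumes k: "k \<ge> 1"
  shows "\<bar>Determinant.det (mat (k - 1) (k - 1) (\<lambda>(c, a). frame k y (a + 2) (c + 2) / frame_radius k y))\<bar>
    = inverse (frame_radius k y) ^ k"
proof -
  define l where "l = k - 1"
  have kl: "k = Suc l" using k by (simp add: l_def)
  define r where "r = frame_radius k y"
  have r: "r > 0" by (simp add: r_def frame_radius_pos)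
  \<comment> \<open>The index 1 is listed last, so that the minor without the first row and column
    becomes the upper left block.\<close>
  define g where "g x = (if x < l then x + 2 else 1)" for x
  have g_in: "x < Suc l \<Longrightarrow> g x \<in> {1..k}" for x by (auto simp: g_def kl)
  have g_bij: "bij_betw g {0..<Suc l} {1..k}"
  proof (rule bij_betwI')
    show "(g x = g x') = (x = x')" if "x \<in> {0..<Suc l}" "x' \<in> {0..<Suc l}" for x x'
      using that by (auto simp: g_def)
    show "g x \<in> {1..k}" if "x \<in> {0..<Suc l}" for x using that g_in by auto
    show "\<exists>x\<in>{0..<Suc l}. c = g x" if "c \<in> {1..k}" for c
    proof (cases "c = 1")
      case True
      then show ?thesis by (intro bexI[of _ l]) (auto simp: g_def)
    next
      case False
      then have "c - 2 < l" "c = g (c - 2)" using that by (auto simp: g_def kl)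
      then show ?thesis by (intro bexI[of _ "c - 2"]) auto
    qed
  qed
  have g_inj: "x < Suc l \<Longrightarrow> x' < Suc l \<Longrightarrow> g x = g x' \<longleftrightarrow> x = x'" for x x' by (auto simp: g_def)
  have orth: "(\<Sum>x''=0..<Suc l. frame k y (g x) (g x'') * frame k y (g x'') (g x')) = (if x = x' then 1 else 0)"
    if "x < Suc l" "x' < Suc l" for x x'
  proof -
    have "(\<Sum>x''=0..<Suc l. frame k y (g x) (g x'') * frame k y (g x'') (g x')) =
        (\<Sum>c=1..k. frame k y (g x) c * frame k y c (g x'))"
      by (rule sum.reindex_bij_betw[OF g_bij, of "\<lambda>c. frame k y (g x) c * frame k y c (g x')"])
    also have "\<dots> = (\<Sum>c=1..k. frame k y c (g x) * frame k y c (g x'))"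
      by (intro sum.cong refl arg_cong2[where f="(*)"] frame_sym)
    also have "\<dots> = (if x = x' then 1 else 0)"
      using frame_orthogonal[OF k g_in[OF that(1)] g_in[OF that(2)]] g_inj[OF that] by simp
    finally show ?thesis .
  qed
  let ?n = "Suc l"
  define S where "S = mat ?n ?n (\<lambda>(x, x'). frame k y (g x) (g x'))"
  define T where "T = mat ?n ?n (\<lambda>(x, x'). if x' < l then frame k y (g x) (g x') else if x = l then 1 else 0)"
  define A where "A = mat l l (\<lambda>(x, x'). frame k y (g x) (g x'))"
  have SS: "S * S = 1\<^sub>m ?n"
    by (rule eq_matI) (auto simp: S_def scalar_prod_def orth simp del: sum.op_ivl_Suc)
  have "Determinant.det S * Determinant.det S = 1"
    using det_mult[of S ?n S] SS by (simp add: S_def)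
  then have detS: "\<bar>Determinant.det S\<bar> = 1"
    by (metis abs_mult_self_eq abs_1 abs_ge_zero abs_mult mult_cancel_right1 power2_eq_1_iff power2_eq_square abs_eq_iff')
  have ST: "S * T = four_block_mat (1\<^sub>m l) (mat l 1 (\<lambda>(x, _). frame k y (g x) 1)) (0\<^sub>m 1 l) (mat 1 1 (\<lambda>_. 1 / r))" (is "_ = ?B")
  proof (rule eq_matI)
    fix x x' assume "x < dim_row ?B" "x' < dim_col ?B"
    then have x: "x < ?n" "x' < ?n" by auto
    have 1: "(S * T) $$ (x, x') = (\<Sum>x''=0..<?n. frame k y (g x) (g x'') * (if x' < l then frame k y (g x'') (g x') else if x'' = l then 1 else 0))"
      using x by (simp add: S_def T_def scalar_prod_def)
    show "(S * T) $$ (x, x') = ?B $$ (x, x')"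
    proof (cases "x' < l")
      case True
      then show ?thesis unfolding 1 using x orth[OF x] by auto
    next
      case False
      then have "x' = l" using x by simp
      have "(S * T) $$ (x, x') = (\<Sum>x''=0..<?n. if x'' = l then frame k y (g x) (g x'') else 0)"
        unfolding 1 using False by (intro sum.cong refl) simp
      also have "\<dots> = frame k y (g x) 1" by (simp add: g_def)
      finally show ?thesis using x \<open>x' = l\<close> by (auto simp: less_Suc_eq g_def frame_def Let_def r_def)
    qed
  qed (auto simp: S_def T_def)
  have "Determinant.det (S * T) = Determinant.det (1\<^sub>m l) * Determinant.det (mat 1 1 (\<lambda>_. 1 / r))"
    unfolding ST by (rule det_four_block_mat_lower_left_zero) auto
  then have "Determinant.det S * Determinant.det T = 1 / r"
    using det_mult[of S ?n T] by (simp add: S_def T_def det_single)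
  then have detT: "\<bar>Determinant.det T\<bar> = 1 / r"
    using detS r by (metis abs_mult abs_of_pos mult_1 zero_less_divide_1_iff)
  have T4: "T = four_block_mat A (0\<^sub>m l 1) (mat 1 l (\<lambda>(_, x'). frame k y (g l) (g x'))) (1\<^sub>m 1)"
  proof (rule eq_matI)
    fix i j
    assume "i < dim_row (four_block_mat A (0\<^sub>m l 1) (mat 1 l (\<lambda>(_, x'). frame k y (g l) (g x'))) (1\<^sub>m 1))"
      "j < dim_col (four_block_mat A (0\<^sub>m l 1) (mat 1 l (\<lambda>(_, x'). frame k y (g l) (g x'))) (1\<^sub>m 1))"
    then have "i < l \<or> i = l" "j < l \<or> j = l" by (auto simp: A_def)
    then show "T $$ (i, j) = four_block_mat A (0\<^sub>m l 1) (mat 1 l (\<lambda>(_, x'). frame k y (g l) (g x'))) (1\<^sub>m 1) $$ (i, j)"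
      by (elim disjE) (simp_all add: T_def A_def)
  qed (auto simp: T_def A_def)
  have "Determinant.det T = Determinant.det A * Determinant.det (1\<^sub>m 1 :: real mat)"
    unfolding T4 by (rule det_four_block_mat_upper_right_zero) (auto simp: A_def)
  then have detA: "\<bar>Determinant.det A\<bar> = 1 / r" using detT by simp
  have "mat (k - 1) (k - 1) (\<lambda>(c, a). frame k y (a + 2) (c + 2) / r) = (1 / r) \<cdot>\<^sub>m A"
  proof (rule eq_matI)
    fix c a assume "c < dim_row ((1 / r) \<cdot>\<^sub>m A)" "a < dim_col ((1 / r) \<cdot>\<^sub>m A)"
    then have "c < l" "a < l" by (auto simp: A_def)
    then show "mat (k - 1) (k - 1) (\<lambda>(c, a). frame k y (a + 2) (c + 2) / r) $$ (c, a) = ((1 / r) \<cdot>\<^sub>m A) $$ (c, a)"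
      using frame_sym[of k y "a + 2" "c + 2"] by (simp add: A_def g_def l_def)
  qed (auto simp: A_def l_def)
  \<comment> \<open>The factor \<open>1 / r\<close> of each of the \<open>k - 1\<close> rows and the
    value \<open>1 / r\<close> of the minor make up the exponent \<open>k\<close>.\<close>
  then have "\<bar>Determinant.det (mat (k - 1) (k - 1) (\<lambda>(c, a). frame k y (a + 2) (c + 2) / r))\<bar> = (1 / r) ^ l * (1 / r)"
    using r detA by (simp add: abs_mult power_abs A_def)
  then show ?thesis unfolding r_def[symmetric] by (simp add: kl inverse_eq_divide mult.commute)
qed

section \<open>Row labels and block diagonal determinants\<close>

lemma row_labels_Suc: "row_labels (Suc p) n = row_labels p n @ map (\<lambda>a. (Suc p, a)) [1..<n (Suc p)]"
  by (simp add: row_labels_def)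

lemma set_row_labels: "set (row_labels p n) = {(i, a). i \<in> {1..p} \<and> a \<in> {1..<n i}}"
  by (auto simp: row_labels_def)

lemma distinct_row_labels: "distinct (row_labels p n)"
  by (induction p) (auto simp: row_labels_Suc distinct_map inj_on_def set_row_labels, simp add: row_labels_def)

lemma det_block_diagonal:
  fixes K :: "nat \<Rightarrow> nat \<Rightarrow> nat \<Rightarrow> real" and n :: "nat \<Rightarrow> nat"
  defines "L \<equiv> \<lambda>p. row_labels p n"
  shows "Determinant.det (mat (length (L p)) (length (L p)) (\<lambda>(r, s).
      if fst (L p ! r) = fst (L p ! s) then K (fst (L p ! r)) (snd (L p ! r)) (snd (L p ! s)) else 0)) =
    (\<Prod>i=1..p. Determinant.det (mat (n i - 1) (n i - 1) (\<lambda>(a, b). K i (a + 1) (b + 1))))"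
proof (induction p)
  case 0
  then show ?case by (simp add: L_def row_labels_def)
next
  case (Suc p)
  let ?e = "\<lambda>L r s. if fst (L ! r) = fst (L ! s) then K (fst (L ! r)) (snd (L ! r)) (snd (L ! s)) else (0::real)"
  let ?l = "length (L p)" and ?k = "n (Suc p) - 1"
  have LS: "L (Suc p) = L p @ map (\<lambda>a. (Suc p, a)) [1..<n (Suc p)]" by (simp add: L_def row_labels_Suc)
  have len: "length (L (Suc p)) = ?l + ?k" by (simp add: LS)
  have old: "L (Suc p) ! r = L p ! r" "fst (L p ! r) \<noteq> Suc p" if "r < ?l" for r
  proof -
    show "L (Suc p) ! r = L p ! r" using that by (simp add: LS nth_append)
    show "fst (L p ! r) \<noteq> Suc p" using nth_mem[OF that] by (auto simp: L_def set_row_labels)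
  qed
  have new: "L (Suc p) ! (r + ?l) = (Suc p, r + 1)" if "r < ?k" for r
    using that by (simp add: LS nth_append)
  have "mat (length (L (Suc p))) (length (L (Suc p))) (\<lambda>(r, s). ?e (L (Suc p)) r s) =
    four_block_mat (mat ?l ?l (\<lambda>(r, s). ?e (L p) r s)) (0\<^sub>m ?l ?k) (0\<^sub>m ?k ?l)
      (mat ?k ?k (\<lambda>(a, b). K (Suc p) (a + 1) (b + 1)))" (is "_ = ?B")
  proof (rule eq_matI)
    fix r s assume rs0: "r < dim_row ?B" "s < dim_col ?B"
    then have rs: "r < ?l + ?k" "s < ?l + ?k" by auto
    have new': "L (Suc p) ! r = (Suc p, r - ?l + 1)" if "\<not> r < ?l" "r < ?l + ?k" for r
      using new[of "r - ?l"] that by simp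
    show "mat (length (L (Suc p))) (length (L (Suc p))) (\<lambda>(r, s). ?e (L (Suc p)) r s) $$ (r, s) = ?B $$ (r, s)"
      using rs old old(2)[symmetric] new' by (cases "r < ?l"; cases "s < ?l") (simp_all add: len)
  qed (auto simp: len)
  then have "Determinant.det (mat (length (L (Suc p))) (length (L (Suc p))) (\<lambda>(r, s). ?e (L (Suc p)) r s)) =
    Determinant.det (mat ?l ?l (\<lambda>(r, s). ?e (L p) r s)) * Determinant.det (mat ?k ?k (\<lambda>(a, b). K (Suc p) (a + 1) (b + 1)))"
    by (simp only:) (rule det_four_block_mat_lower_left_zero, auto)
  then show ?case using Suc.IH by (simp add: case_prod_beta')
qed


section \<open>The Jacobian matrix in the rotated frame\<close>

context tensor_format
begin

abbreviation "N \<equiv> card MI"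
abbreviation "labels \<equiv> row_labels p n"
abbreviation "m \<equiv> length labels"

text \<open>Positions in block \<open>i\<close> run from 1 to \<open>n i - 1\<close>, while the
  coordinates of a direction are numbered from 2 because 1 is the normalised one; hence the
  shift.\<close>

definition "label_lead = (\<lambda>(i, a). lead i (Suc a))"

lemma inj_label_lead: "inj_on label_lead (set labels)"
  unfolding inj_on_def label_lead_def set_row_labels using lead_inj by (auto simp: split_def)

lemma label_lead_image: "label_lead ` set labels = leads"
proof
  show "label_lead ` set labels \<subseteq> leads" by (auto simp: label_lead_def set_row_labels intro!: lead_leads)
  show "leads \<subseteq> label_lead ` set labels"
  proof
    fix \<beta> assume "\<beta> \<in> leads"
    then obtain i a where ia: "i \<in> {1..p}" "a \<in> {2..n i}" "\<beta> = lead i a" by (auto simp: leads_def)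
    then have "(i, a - 1) \<in> set labels" "\<beta> = label_lead (i, a - 1)" by (auto simp: set_row_labels label_lead_def)
    then show "\<beta> \<in> label_lead ` set labels" by blast
  qed
qed

lemma card_leads: "card leads = m"
  using card_image[OF inj_label_lead] distinct_card[OF distinct_row_labels] by (simp add: label_lead_image)

lemma m_le_N: "m \<le> N"
  using card_mono[OF finite_MI leads_MI] by (simp add: card_leads)

text \<open>
  The leads come first, in the order of the row labels, so that the Jacobian splits into blocks.
\<close>

definition "idx = (SOME f. bij_betw f {..<N} MI \<and> (\<forall>k<m. f k = label_lead (labels ! k)))"

lemma idx: "bij_betw idx {..<N} MI" "k < m \<Longrightarrow> idx k = label_lead (labels ! k)"
proof -
  have "finite (MI - leads)" using finite_MI by simp
  then obtain h where h: "bij_betw h {0..<card (MI - leads)} (MI - leads)"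
    using ex_bij_betw_nat_finite by blast
  have card: "card (MI - leads) = N - m"
    using card_Diff_subset[OF finite_subset[OF leads_MI finite_MI] leads_MI] by (simp add: card_leads)
  define f where "f k = (if k < m then label_lead (labels ! k) else h (k - m))" for k
  have b1: "bij_betw (\<lambda>k. label_lead (labels ! k)) {..<m} leads"
    using bij_betw_trans[OF bij_betw_nth[OF distinct_row_labels refl refl] bij_betw_imageI[OF inj_label_lead label_lead_image]]
    by (simp add: o_def)
  have "bij_betw (\<lambda>k. k - m) {m..<N} {0..<N - m}"
    by (rule bij_betw_byWitness[where f'="\<lambda>k. k + m"]) auto
  from bij_betw_trans[OF this h[unfolded card]]
  have b2: "bij_betw (\<lambda>k. h (k - m)) {m..<N} (MI - leads)" by (simp add: o_def)
  have "bij_betw f ({..<m} \<union> {m..<N}) (leads \<union> (MI - leads))"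
  proof (rule bij_betw_combine)
    show "bij_betw f {..<m} leads" using b1 by (subst bij_betw_cong[of _ _ "\<lambda>k. label_lead (labels ! k)"]) (auto simp: f_def)
    show "bij_betw f {m..<N} (MI - leads)" using b2 by (subst bij_betw_cong[of _ _ "\<lambda>k. h (k - m)"]) (auto simp: f_def)
  qed auto
  moreover have "{..<m} \<union> {m..<N} = {..<N}" using m_le_N by auto
  moreover have "leads \<union> (MI - leads) = MI" using leads_MI by auto
  ultimately have "bij_betw f {..<N} MI \<and> (\<forall>k<m. f k = label_lead (labels ! k))" by (simp add: f_def)
  then have "bij_betw idx {..<N} MI \<and> (\<forall>k<m. idx k = label_lead (labels ! k))"    unfolding idx_def by (rule someI[of "\<lambda>f. bij_betw f {..<N} MI \<and> (\<forall>k<m. f k = label_lead (labels ! k))"])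
  then show "bij_betw idx {..<N} MI" "k < m \<Longrightarrow> idx k = label_lead (labels ! k)" by auto
qed

lemma idx_MI: "k < N \<Longrightarrow> idx k \<in> MI" using idx(1) by (auto simp: bij_betw_def)
lemma idx_inj: "k < N \<Longrightarrow> k' < N \<Longrightarrow> idx k = idx k' \<longleftrightarrow> k = k'"
  using idx(1) by (auto simp: bij_betw_def inj_on_def)
lemma idx_nonleads: "k < N \<Longrightarrow> \<not> k < m \<Longrightarrow> idx k \<notin> leads"
proof
  assume k: "k < N" "\<not> k < m" "idx k \<in> leads"
  then have "idx k \<in> label_lead ` set labels" by (simp only: label_lead_image)
  then obtain l where "l \<in> set labels" "idx k = label_lead l" by (rule imageE)
  then obtain k' where "k' < m" "idx k = idx k'" using idx(2) by (auto simp: in_set_conv_nth)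
  then show False using k idx_inj[of k k'] m_le_N by auto
qed

definition "tensor_of z = (\<lambda>\<alpha>\<in>MI. z (the_inv_into {..<N} idx \<alpha>))" for z :: "nat \<Rightarrow> real"
definition "coords_of q = (\<lambda>k\<in>{..<N}. q (idx k))" for q :: tensor

lemma tensor_of_idx: "k < N \<Longrightarrow> tensor_of z (idx k) = z k"
  using idx(1) idx_MI by (simp add: tensor_of_def bij_betw_def the_inv_into_f_f)

lemma coords_of_tensor_of: "z \<in> Rn N \<Longrightarrow> coords_of (tensor_of z) = z"
  by (auto simp: coords_of_def tensor_of_idx Rn_iff fun_eq_iff)

lemma MI_idx: "\<alpha> \<in> MI \<Longrightarrow> \<exists>k<N. \<alpha> = idx k" using idx(1) by (auto simp: bij_betw_def)

lemma tensor_of_coords_of: "q \<in> tensor_space p n \<Longrightarrow> tensor_of (coords_of q) = q"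
proof
  fix \<alpha> assume q: "q \<in> tensor_space p n"
  show "tensor_of (coords_of q) \<alpha> = q \<alpha>"
  proof (cases "\<alpha> \<in> MI")
    case True
    then obtain k where "k < N" "\<alpha> = idx k" using MI_idx by blast
    then show ?thesis by (simp add: tensor_of_idx coords_of_def)
  next
    case False
    then show ?thesis using q by (auto simp: tensor_of_def tensor_space_def)
  qed
qed

lemma tensor_of_space: "tensor_of z \<in> tensor_space p n" by (simp add: tensor_of_def tensor_space_def)
lemma coords_of_Rn: "coords_of q \<in> Rn N" by (simp add: coords_of_def Rn_iff)

lemma tensor_of_upd: "j < N \<Longrightarrow> tensor_of (z(j := t)) = (tensor_of z)(idx j := t)"
proof
  fix \<alpha> assume j: "j < N"
  show "tensor_of (z(j := t)) \<alpha> = ((tensor_of z)(idx j := t)) \<alpha>"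
  proof (cases "\<alpha> \<in> MI")
    case True
    then obtain k where k: "k < N" "\<alpha> = idx k" using MI_idx by blast
    then show ?thesis using j idx_inj[OF k(1) j] by (simp add: tensor_of_idx)
  next
    case False
    then have "\<alpha> \<noteq> idx j" using idx_MI[OF j] by auto
    then show ?thesis using False by (simp add: tensor_of_def)
  qed
qed

definition "Phi_coords z = coords_of (Phi (tensor_of z))"
definition "dPhi i j z = deriv (\<lambda>t. Phi_coords (z(j := t)) i) (z j)"

lemma C1_fun_tensor_of: "C1_fun (\<lambda>z. tensor_of z \<beta>)"
proof (cases "\<beta> \<in> MI")
  case True
  then show ?thesis by (simp add: tensor_of_def C1_fun_coord)
next
  case False
  then show ?thesis by (simp add: tensor_of_def C1_fun_const)
qed

lemma C1_fun_P: "C1_fun (\<lambda>z. P (tensor_of z) \<alpha> \<beta>)"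
  unfolding P_def by (intro C1_fun_prod C1_fun_frame) (simp add: dirs_def C1_fun_tensor_of)

lemma C1_fun_Phi_coords: "C1_fun (\<lambda>z. Phi_coords z i)"
proof -
  have w: "C1_fun (\<lambda>z. wt (tensor_of z) \<beta>)" for \<beta>
    unfolding wt_def by (cases "\<beta> \<in> leads") (simp_all add: C1_fun_const C1_fun_tensor_of)
  show ?thesis
  proof (cases "i < N")
    case True
    have "C1_fun (\<lambda>z. \<Sum>\<beta>\<in>MI. P (tensor_of z) (idx i) \<beta> * wt (tensor_of z) \<beta>)"
      by (intro C1_fun_sum C1_fun_mult C1_fun_P w)
    then show ?thesis using True idx_MI by (simp add: Phi_coords_def coords_of_def Phi_def)
  qed (simp add: Phi_coords_def coords_of_def C1_fun_const)
qed

lemma C1_map_Phi_coords: "C1_map N (Rn N) Phi_coords dPhi"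
  unfolding C1_map_def
proof (intro conjI allI ballI impI)
  show "Phi_coords ` Rn N \<subseteq> Rn N" by (auto simp: Phi_coords_def coords_of_Rn)
  show "continuous_on (Rn N) Phi_coords"
    by (rule continuous_on_coordinatewise_then_product)
       (rule continuous_on_subset[OF C1_fun_deriv(1)[OF C1_fun_Phi_coords]], simp)
  show "continuous_on (Rn N) (dPhi i j)" for i j
    unfolding dPhi_def by (rule continuous_on_subset[OF C1_fun_deriv(2)[OF C1_fun_Phi_coords]]) simp
  show "((\<lambda>t. Phi_coords (y(j := t)) i) has_real_derivative dPhi i j y) (at (y j))" for i j y
    unfolding dPhi_def by (rule C1_fun_deriv(3)[OF C1_fun_Phi_coords])
qed simp

text \<open>For fixed directions \<open>Phi\<close> is linear in the entries outside the leads, and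
  the columns of \<open>P\<close> are its coefficients.\<close>

lemma dPhi_nonlead:
  assumes k: "k < N" and j: "j < N" "\<not> j < m"
  shows "dPhi k j z = P (tensor_of z) (idx k) (idx j)"
proof -
  let ?q = "tensor_of z"
  have nl: "idx j \<notin> leads" using idx_nonleads[OF j] .
  have "Phi_coords (z(j := t)) k = (\<Sum>\<beta>\<in>MI. P ?q (idx k) \<beta> * (if \<beta> = idx j then t else wt ?q \<beta>))" for t
  proof -
    have "P (?q(idx j := t)) (idx k) \<beta> = P ?q (idx k) \<beta>" if "\<beta> \<in> MI" for \<beta>
    proof (rule P_cong)
      fix i a assume "i \<in> {1..p}" "a \<in> {2..n i}"
      then have "lead i a \<noteq> idx j" using nl lead_leads[of i a] by auto
      then show "(?q(idx j := t)) (lead i a) = ?q (lead i a)" by simp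
    qed (use that idx_MI[OF k] in auto)
    then show ?thesis using k nl idx_MI[OF k]
      by (auto simp: Phi_coords_def coords_of_def Phi_def tensor_of_upd[OF j(1)] wt_def intro!: sum.cong)
  qed
  moreover have "((\<lambda>t. \<Sum>\<beta>\<in>MI. P ?q (idx k) \<beta> * (if \<beta> = idx j then t else wt ?q \<beta>)) has_real_derivative
      (\<Sum>\<beta>\<in>MI. P ?q (idx k) \<beta> * (if \<beta> = idx j then 1 else 0))) (at (z j))"
  proof (intro DERIV_sum DERIV_cmult)
    fix \<beta> show "((\<lambda>t. if \<beta> = idx j then t else wt ?q \<beta>) has_real_derivative (if \<beta> = idx j then 1 else 0)) (at (z j))"
      by (cases "\<beta> = idx j") auto
  qed
  ultimately have "dPhi k j z = (\<Sum>\<beta>\<in>MI. P ?q (idx k) \<beta> * (if \<beta> = idx j then 1 else 0))"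
    unfolding dPhi_def by (simp add: DERIV_imp_deriv)
  also have "\<dots> = P ?q (idx k) (idx j)" using finite_MI idx_MI[OF j(1)] by (simp add: if_distrib sum.delta cong: if_cong)
  finally show ?thesis .
qed

text \<open>The derivative of \<open>P\<close> in the entry of \<open>q\<close> at
  \<open>lead i a\<close>: this entry affects the frame of slot \<open>i\<close> alone.\<close>

definition "P_deriv q i a \<alpha> \<beta> = dframe (n i) (dirs q i) a (\<alpha> i) (\<beta> i) *
  (\<Prod>i'\<in>{1..p} - {i}. frame (n i') (dirs q i') (\<alpha> i') (\<beta> i'))"

lemma dPhi_lead:
  assumes k: "k < N" and j: "j < N" "idx j = lead i a" and i: "i \<in> {1..p}" "a \<in> {2..n i}"
  shows "dPhi k j z = (\<Sum>\<beta>\<in>MI. P_deriv (tensor_of z) i a (idx k) \<beta> * wt (tensor_of z) \<beta>)"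
proof -
  let ?q = "tensor_of z"
  have zj: "z j = dirs ?q i a" using tensor_of_idx[OF j(1), of z] j(2) by (simp add: dirs_def)
  have dirs: "dirs (?q(idx j := t)) i' = (if i' = i then (dirs ?q i)(a := t) else dirs ?q i')" if "i' \<in> {1..p}" for t i'
  proof
    fix b
    have "lead i a = lead i' b \<longleftrightarrow> i = i' \<and> a = b" using i that by (intro lead_inj) auto
    then show "dirs (?q(idx j := t)) i' b = (if i' = i then (dirs ?q i)(a := t) else dirs ?q i') b"
      by (auto simp: dirs_def j(2))
  qed
  have Pt: "P (?q(idx j := t)) \<alpha> \<beta> = frame (n i) ((dirs ?q i)(a := t)) (\<alpha> i) (\<beta> i) *
      (\<Prod>i'\<in>{1..p} - {i}. frame (n i') (dirs ?q i') (\<alpha> i') (\<beta> i'))" for t \<alpha> \<beta>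
    unfolding P_def using i(1) dirs by (subst prod.remove[of _ i]) auto
  have wt: "wt (?q(idx j := t)) \<beta> = wt ?q \<beta>" for t \<beta>
    using lead_leads[OF i] by (simp add: wt_def j(2))
  have Phi_coords: "Phi_coords (z(j := t)) k = (\<Sum>\<beta>\<in>MI. frame (n i) ((dirs ?q i)(a := t)) (idx k i) (\<beta> i) *
      (\<Prod>i'\<in>{1..p} - {i}. frame (n i') (dirs ?q i') (idx k i') (\<beta> i')) * wt ?q \<beta>)" for t
    using k idx_MI[OF k] by (simp add: Phi_coords_def coords_of_def Phi_def tensor_of_upd[OF j(1)] Pt wt)
  have "((\<lambda>t. Phi_coords (z(j := t)) k) has_real_derivative (\<Sum>\<beta>\<in>MI. P_deriv ?q i a (idx k) \<beta> * wt ?q \<beta>)) (at (z j))"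
    unfolding Phi_coords P_deriv_def zj
    by (intro DERIV_sum DERIV_cmult_right dframe)
  then show ?thesis unfolding dPhi_def by (rule DERIV_imp_deriv)
qed

text \<open>The antisymmetric matrix \<open>S\<^sup>T \<partial>S\<close> of the frame \<open>S\<close>, for the derivative in the coordinate \<open>a\<close>.\<close>

definition "frame_rotation q i a b c = (\<Sum>e=1..n i. frame (n i) (dirs q i) e b * dframe (n i) (dirs q i) a e c)"

text \<open>The sum over multi-indices factors over the slots. Slot \<open>i\<close> contributes a
  frame rotation, all other slots contribute orthogonality relations, so only those
  \<open>\<beta>\<close> survive that differ from \<open>\<gamma>\<close> at most in slot
  \<open>i\<close>.\<close>

lemma sum_P_P_deriv:
  assumes i: "i \<in> {1..p}" and \<gamma>: "\<gamma> \<in> MI" and \<beta>: "\<beta> \<in> MI"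
  shows "(\<Sum>\<alpha>\<in>MI. P q \<alpha> \<gamma> * P_deriv q i a \<alpha> \<beta>) =
    (if \<gamma>(i := \<beta> i) = \<beta> then frame_rotation q i a (\<gamma> i) (\<beta> i) else 0)"
proof -
  let ?f = "\<lambda>i' e. frame (n i') (dirs q i') e (\<gamma> i') *
      (if i' = i then dframe (n i) (dirs q i) a e (\<beta> i) else frame (n i') (dirs q i') e (\<beta> i'))"
  have "P q \<alpha> \<gamma> * P_deriv q i a \<alpha> \<beta> = (\<Prod>i'\<in>{1..p}. ?f i' (\<alpha> i'))" for \<alpha>
  proof -
    have "(\<Prod>i'\<in>{1..p}. ?f i' (\<alpha> i')) = P q \<alpha> \<gamma> *
      (\<Prod>i'\<in>{1..p}. if i' = i then dframe (n i) (dirs q i) a (\<alpha> i) (\<beta> i) else frame (n i') (dirs q i') (\<alpha> i') (\<beta> i'))"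
      unfolding P_def prod.distrib[symmetric] by (intro prod.cong refl) auto
    also have "(\<Prod>i'\<in>{1..p}. if i' = i then dframe (n i) (dirs q i) a (\<alpha> i) (\<beta> i) else frame (n i') (dirs q i') (\<alpha> i') (\<beta> i'))
       = P_deriv q i a \<alpha> \<beta>"
      unfolding P_deriv_def using i by (subst prod.remove[of _ i]) auto
    finally show ?thesis by simp
  qed
  then have "(\<Sum>\<alpha>\<in>MI. P q \<alpha> \<gamma> * P_deriv q i a \<alpha> \<beta>) = (\<Sum>\<alpha>\<in>Pi\<^sub>E {1..p} (\<lambda>i. {1..n i}). \<Prod>i'\<in>{1..p}. ?f i' (\<alpha> i'))"
    by (simp add: multi_index_def)
  also have "\<dots> = (\<Prod>i'\<in>{1..p}. \<Sum>e\<in>{1..n i'}. ?f i' e)"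
    by (rule prod_sum_PiE[symmetric]) auto
  also have "\<dots> = frame_rotation q i a (\<gamma> i) (\<beta> i) * (\<Prod>i'\<in>{1..p} - {i}. \<Sum>e\<in>{1..n i'}. ?f i' e)"
    using i by (subst prod.remove[of _ i]) (auto simp: frame_rotation_def)
  also have "(\<Prod>i'\<in>{1..p} - {i}. \<Sum>e\<in>{1..n i'}. ?f i' e) = (\<Prod>i'\<in>{1..p} - {i}. if \<gamma> i' = \<beta> i' then 1 else 0)"
  proof (rule prod.cong[OF refl])
    fix i' assume i': "i' \<in> {1..p} - {i}"
    then have "(\<Sum>e\<in>{1..n i'}. ?f i' e) = (\<Sum>e\<in>{1..n i'}. frame (n i') (dirs q i') e (\<gamma> i') * frame (n i') (dirs q i') e (\<beta> i'))"
      by (intro sum.cong refl) auto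
    also have "\<dots> = (if \<gamma> i' = \<beta> i' then 1 else 0)"
      using i' n_pos multi_indexD[OF \<gamma>] multi_indexD[OF \<beta>] by (intro frame_orthogonal) auto
    finally show "(\<Sum>e\<in>{1..n i'}. ?f i' e) = (if \<gamma> i' = \<beta> i' then 1 else 0)" .
  qed
  also have "(\<Prod>i'\<in>{1..p} - {i}. if \<gamma> i' = \<beta> i' then 1 else (0::real)) = (if \<gamma>(i := \<beta> i) = \<beta> then 1 else 0)"
  proof (cases "\<gamma>(i := \<beta> i) = \<beta>")
    case True
    then have "\<gamma> i' = \<beta> i'" if "i' \<noteq> i" for i' using that by (metis fun_upd_other)
    then show ?thesis using True by simp
  next
    case False
    then obtain i' where "(\<gamma>(i := \<beta> i)) i' \<noteq> \<beta> i'" by (meson ext)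
    then have "i' \<noteq> i" "\<gamma> i' \<noteq> \<beta> i'" by (auto split: if_splits)
    moreover have "i' \<in> {1..p}"
    proof (rule ccontr)
      assume "i' \<notin> {1..p}"
      then have "\<beta> i' = undefined" "\<gamma> i' = undefined"
        using \<beta> \<gamma> by (simp_all add: multi_index_def PiE_iff extensional_def)
      with \<open>\<gamma> i' \<noteq> \<beta> i'\<close> show False by simp
    qed
    ultimately have "(\<Prod>i'\<in>{1..p} - {i}. if \<gamma> i' = \<beta> i' then 1 else (0::real)) = 0"
      by (intro prod_zero) auto
    then show ?thesis using False by simp
  qed
  finally show ?thesis by simp
qed

lemma sum_slot:
  assumes i: "i \<in> {1..p}" and \<gamma>: "\<gamma> \<in> MI"
  shows "(\<Sum>\<beta>\<in>MI. if \<gamma>(i := \<beta> i) = \<beta> then f \<beta> else (0::real)) = (\<Sum>c=1..n i. f (\<gamma>(i := c)))"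
proof -
  have "(\<Sum>\<beta>\<in>MI. if \<gamma>(i := \<beta> i) = \<beta> then f \<beta> else 0) = (\<Sum>\<beta>\<in>{\<beta> \<in> MI. \<gamma>(i := \<beta> i) = \<beta>}. f \<beta>)"
    using finite_MI by (simp add: sum.inter_filter)
  also have "\<dots> = (\<Sum>c=1..n i. f (\<gamma>(i := c)))"
  proof (rule sum.reindex_bij_witness[of _ "\<lambda>c. \<gamma>(i := c)" "\<lambda>\<beta>. \<beta> i"])
    fix \<beta> assume b: "\<beta> \<in> {\<beta> \<in> MI. \<gamma>(i := \<beta> i) = \<beta>}"
    then show "\<gamma>(i := \<beta> i) = \<beta>" by simp
    show "\<beta> i \<in> {1..n i}" using b multi_indexD i by blast
    show "f (\<gamma>(i := \<beta> i)) = f \<beta>" using b by simp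
  next
    fix c assume c: "c \<in> {1..n i}"
    show "(\<gamma>(i := c)) i = c" by simp
    show "\<gamma>(i := c) \<in> {\<beta> \<in> MI. \<gamma>(i := \<beta> i) = \<beta>}" using multi_index_upd[OF \<gamma> i c] by simp
  qed
  finally show ?thesis .
qed

lemma rotated_dPhi_lead:
  assumes j: "j < N" "idx j = lead i a" and i: "i \<in> {1..p}" "a \<in> {2..n i}" and \<gamma>: "\<gamma> \<in> MI"
  shows "(\<Sum>k<N. P (tensor_of z) (idx k) \<gamma> * dPhi k j z) =
    (\<Sum>c=1..n i. frame_rotation (tensor_of z) i a (\<gamma> i) c * wt (tensor_of z) (\<gamma>(i := c)))"
proof -
  let ?q = "tensor_of z"
  have "(\<Sum>k<N. P ?q (idx k) \<gamma> * dPhi k j z) =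
      (\<Sum>k<N. P ?q (idx k) \<gamma> * (\<Sum>\<beta>\<in>MI. P_deriv ?q i a (idx k) \<beta> * wt ?q \<beta>))"
    using dPhi_lead[OF _ j i] by (intro sum.cong) auto
  also have "\<dots> = (\<Sum>\<alpha>\<in>MI. P ?q \<alpha> \<gamma> * (\<Sum>\<beta>\<in>MI. P_deriv ?q i a \<alpha> \<beta> * wt ?q \<beta>))"
    by (rule sum.reindex_bij_betw[OF idx(1), of "\<lambda>\<alpha>. P ?q \<alpha> \<gamma> * (\<Sum>\<beta>\<in>MI. P_deriv ?q i a \<alpha> \<beta> * wt ?q \<beta>)"])
  also have "\<dots> = (\<Sum>\<alpha>\<in>MI. \<Sum>\<beta>\<in>MI. P ?q \<alpha> \<gamma> * P_deriv ?q i a \<alpha> \<beta> * wt ?q \<beta>)"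
    unfolding sum_distrib_left by (intro sum.cong refl) simp
  also have "\<dots> = (\<Sum>\<beta>\<in>MI. (\<Sum>\<alpha>\<in>MI. P ?q \<alpha> \<gamma> * P_deriv ?q i a \<alpha> \<beta>) * wt ?q \<beta>)"
    by (subst sum.swap) (simp add: sum_distrib_right)
  also have "\<dots> = (\<Sum>\<beta>\<in>MI. if \<gamma>(i := \<beta> i) = \<beta> then frame_rotation ?q i a (\<gamma> i) (\<beta> i) * wt ?q \<beta> else 0)"
    by (intro sum.cong refl) (simp add: sum_P_P_deriv[OF i(1) \<gamma>])
  also have "\<dots> = (\<Sum>c=1..n i. frame_rotation ?q i a (\<gamma> i) c * wt ?q (\<gamma>(i := c)))"
    by (subst sum_slot[OF i(1) \<gamma>]) simp
  finally show ?thesis .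
qed

text \<open>The entries of \<open>q\<close> at multi-indices with exactly two entries different from
  1 form the matrices \<open>C_{i,j}\<close>, with the same shift of positions as in
  \<open>label_lead\<close>.\<close>

definition "blocks q = (\<lambda>(i, j, a, b). q ((lead i (Suc a))(j := Suc b)))" for q :: tensor
text \<open>By \<open>dframe_first_column\<close> this is an entry of the first column of the frame
  rotation. For fixed \<open>i\<close> it forms the matrix whose determinant
  \<open>det_frame_minor\<close> computes.\<close>

definition "minor_entry q i c a = frame (n i) (dirs q i) (Suc a) (Suc c) / frame_radius (n i) (dirs q i)"

lemma frame_rotation_first:
  assumes "i \<in> {1..p}" "a \<in> {2..n i}" "c \<in> {2..n i}"
  shows "frame_rotation q i a c 1 = minor_entry q i (c - 1) (a - 1)" "frame_rotation q i a 1 c = - minor_entry q i (c - 1) (a - 1)"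
proof -
  show *: "frame_rotation q i a c 1 = minor_entry q i (c - 1) (a - 1)"
    unfolding frame_rotation_def using dframe_first_column[OF n_pos[OF assms(1)] assms(2,3)] assms by (simp add: minor_entry_def)
  have "frame_rotation q i a 1 c = - frame_rotation q i a c 1"
    unfolding frame_rotation_def using n_pos[OF assms(1)] assms by (intro dframe_antisym) auto
  then show "frame_rotation q i a 1 c = - minor_entry q i (c - 1) (a - 1)" using * by simp
qed

lemma not_lead_pair:
  assumes "i \<in> {1..p}" "j \<in> {1..p}" "i \<noteq> j" "a \<noteq> 1" "b \<noteq> 1"
  shows "(lead i a)(j := b) \<notin> leads"
proof
  assume "(lead i a)(j := b) \<in> leads"
  then obtain k c where kc: "k \<in> {1..p}" "(lead i a)(j := b) = lead k c" by (auto simp: leads_def)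
  from fun_cong[OF kc(2), of i] fun_cong[OF kc(2), of j] assms show False
    by (auto simp: lead_apply ones_apply split: if_splits)
qed

text \<open>The row belongs to a lead in slot \<open>j\<close>, the column to one in slot
  \<open>i\<close>, and the rotation runs over the entry of slot \<open>i\<close>. If
  \<open>i = j\<close>, only the entry 1 leads outside the leads, to \<open>ones\<close>, and the
  first column of the rotation appears. If \<open>i \<noteq> j\<close>, the entry 1 stays at a lead,
  all others give entries of the block of \<open>i\<close> and \<open>j\<close>, and the first row
  appears. First row and first column differ by a sign, hence the minus in front of the diagonal
  entry.\<close>

lemma rotated_dPhi_block:
  assumes r: "r < m" and s: "s < m"
  shows "(\<Sum>k<N. P (tensor_of z) (idx k) (idx r) * dPhi k s z) =
    - (\<Sum>t<m. block_matrix_entry (- tensor_of z ones, blocks (tensor_of z)) (labels ! r) (labels ! t) *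
      (if fst (labels ! t) = fst (labels ! s) then minor_entry (tensor_of z) (fst (labels ! t)) (snd (labels ! t)) (snd (labels ! s)) else 0))"
proof -
  let ?q = "tensor_of z"
  obtain j b where jb: "labels ! r = (j, b)" by fastforce
  obtain i a where ia: "labels ! s = (i, a)" by fastforce
  have j: "j \<in> {1..p}" "b \<in> {1..<n j}" using nth_mem[OF r] by (auto simp: jb set_row_labels)
  have i: "i \<in> {1..p}" "a \<in> {1..<n i}" using nth_mem[OF s] by (auto simp: ia set_row_labels)
  have ir: "idx r = lead j (Suc b)" using idx(2)[OF r] by (simp add: jb label_lead_def)
  have ix: "idx s = lead i (Suc a)" using idx(2)[OF s] by (simp add: ia label_lead_def)
  have rN: "r < N" "s < N" using r s m_le_N by auto
  have Sa: "Suc a \<in> {2..n i}" using i by auto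
  have one: "1 \<in> {1..n i}" using n_pos[OF i(1)] by simp
  have set: "{1..n i} = insert 1 {2..n i}" using n_pos[OF i(1)] by auto
  have split: "(\<Sum>c=1..n i. f c) = f 1 + (\<Sum>c=1..<n i. f (Suc c))" for f :: "nat \<Rightarrow> real"
  proof -
    have "(\<Sum>c=2..n i. f c) = (\<Sum>c=1..<n i. f (Suc c))"
      by (rule sum.reindex_bij_witness[of _ Suc "\<lambda>c. c - 1"]) auto
    then show ?thesis unfolding set by (subst sum.insert) auto
  qed
  have lhs: "(\<Sum>k<N. P ?q (idx k) (idx r) * dPhi k s z) =
      (\<Sum>c=1..n i. frame_rotation ?q i (Suc a) (lead j (Suc b) i) c * wt ?q ((lead j (Suc b))(i := c)))"
    using rotated_dPhi_lead[OF rN(2) ix i(1) Sa idx_MI[OF rN(1)]] by (simp add: ir)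
  let ?e = "\<lambda>l. block_matrix_entry (- ?q ones, blocks ?q) (j, b) l"
  have rhs: "(\<Sum>t<m. ?e (labels ! t) * (if fst (labels ! t) = i then minor_entry ?q (fst (labels ! t)) (snd (labels ! t)) a else 0))
      = (\<Sum>c=1..<n i. ?e (i, c) * minor_entry ?q i c a)"
  proof -
    have "(\<Sum>t<m. ?e (labels ! t) * (if fst (labels ! t) = i then minor_entry ?q (fst (labels ! t)) (snd (labels ! t)) a else 0))
      = (\<Sum>l\<in>set labels. ?e l * (if fst l = i then minor_entry ?q (fst l) (snd l) a else 0))"
      by (rule sum.reindex_bij_betw[OF bij_betw_nth[OF distinct_row_labels refl refl]])
    also have "\<dots> = (\<Sum>l\<in>(\<lambda>c. (i, c)) ` {1..<n i}. ?e l * (if fst l = i then minor_entry ?q (fst l) (snd l) a else 0))"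
    proof (rule sum.mono_neutral_right)
      show "finite (set labels)" by (rule finite_set)
    qed (use i(1) in \<open>auto simp: set_row_labels image_iff\<close>)
    also have "\<dots> = (\<Sum>c=1..<n i. ?e (i, c) * minor_entry ?q i c a)"
      by (subst sum.reindex) (auto simp: inj_on_def)
    finally show ?thesis .
  qed
  have "(\<Sum>c=1..n i. frame_rotation ?q i (Suc a) (lead j (Suc b) i) c * wt ?q ((lead j (Suc b))(i := c))) =
      - (\<Sum>c=1..<n i. ?e (i, c) * minor_entry ?q i c a)"
  proof (cases "i = j")
    case True
    have "wt ?q ((lead j (Suc b))(i := Suc c)) = 0" if "c \<in> {1..<n i}" for c
      using that True i(1) lead_leads[of i "Suc c"] by (simp add: lead_def wt_def)
    moreover have "wt ?q ((lead j (Suc b))(i := 1)) = ?q ones"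
      using True lead_1[OF i(1)] ones_notin_leads by (simp add: lead_def wt_def)
    ultimately have "(\<Sum>c=1..n i. frame_rotation ?q i (Suc a) (lead j (Suc b) i) c * wt ?q ((lead j (Suc b))(i := c))) =
        frame_rotation ?q i (Suc a) (Suc b) 1 * ?q ones"
      unfolding split using True by (simp add: lead_apply)
    also have "\<dots> = minor_entry ?q i b a * ?q ones"
      using frame_rotation_first(1)[OF i(1) Sa, of "Suc b"] j True by simp
    also have "\<dots> = - (\<Sum>c=1..<n i. ?e (i, c) * minor_entry ?q i c a)"
    proof -
      have "(\<Sum>c=1..<n i. ?e (i, c) * minor_entry ?q i c a) = (\<Sum>c=1..<n i. if b = c then - ?q ones * minor_entry ?q i c a else 0)"
        using True by (intro sum.cong refl) simp
      also have "\<dots> = - ?q ones * minor_entry ?q i b a" using j True by simp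
      finally show ?thesis by simp
    qed
    finally show ?thesis .
  next
    case False
    have li: "lead j (Suc b) i = 1" using False i(1) by (simp add: lead_apply ones_apply)
    have "(lead j (Suc b))(i := 1) = lead j (Suc b)" using li by (simp add: fun_upd_idem)
    then have "wt ?q ((lead j (Suc b))(i := 1)) = 0" using lead_leads[of j "Suc b"] j by (simp add: wt_def)
    moreover have "wt ?q ((lead j (Suc b))(i := Suc c)) = ?e (i, c)" if c: "c \<in> {1..<n i}" for c
    proof -
      have "(lead j (Suc b))(i := Suc c) \<notin> leads"
        using False i(1) j c by (intro not_lead_pair) auto
      moreover have "(lead i (Suc c))(j := Suc b) = (lead j (Suc b))(i := Suc c)"
        using False by (auto simp: lead_def fun_upd_twist)
      ultimately show ?thesis using False by (auto simp: wt_def blocks_def)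
    qed
    moreover have "frame_rotation ?q i (Suc a) 1 (Suc c) = - minor_entry ?q i c a" if "c \<in> {1..<n i}" for c
      using frame_rotation_first(2)[OF i(1) Sa, of "Suc c"] that by simp
    ultimately show ?thesis unfolding split li by (simp add: sum_negf mult.commute)
  qed
  then show ?thesis unfolding lhs jb ia fst_conv snd_conv rhs .
qed

lemma det_minor_entries: "\<bar>Determinant.det (mat m m (\<lambda>(t, s). if fst (labels ! t) = fst (labels ! s)
    then minor_entry q (fst (labels ! t)) (snd (labels ! t)) (snd (labels ! s)) else 0))\<bar> =
  (\<Prod>i=1..p. inverse (frame_radius (n i) (dirs q i)) ^ n i)"
proof -
  have "\<bar>Determinant.det (mat (n i - 1) (n i - 1) (\<lambda>(a, b). minor_entry q i (a + 1) (b + 1)))\<bar> =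
      inverse (frame_radius (n i) (dirs q i)) ^ n i" if "i \<in> {1..p}" for i
    using det_frame_minor[OF n_pos[OF that], of "dirs q i"] by (simp add: minor_entry_def Suc_eq_plus1[symmetric])
  then show ?thesis by (simp add: det_block_diagonal abs_prod)
qed

lemma m_eq: "m = (\<Sum>i=1..p. n i) - p"
  by (rule length_row_labels) (rule n_pos)

text \<open>Multiplication by the orthogonal matrix \<open>Q\<close> leaves the absolute value of
  the determinant and turns the columns outside the leads into unit vectors. The determinant is
  therefore that of the block of the leads, which factors as \<open>- (M * K)\<close> with
  \<open>K\<close> block diagonal.\<close>

lemma jacobian_Phi_coords:
  "\<bar>jacobian N dPhi z\<bar> = \<bar>Determinant.det (block_matrix p n (- tensor_of z ones, blocks (tensor_of z)))\<bar> *
     (\<Prod>i=1..p. inverse (frame_radius (n i) (dirs (tensor_of z) i)) ^ n i)"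
proof -
  let ?q = "tensor_of z"
  define Q where "Q = mat N N (\<lambda>(k, l). P ?q (idx l) (idx k))"
  define J where "J = mat N N (\<lambda>(k, l). dPhi k l z)"
  define M where "M = block_matrix p n (- ?q ones, blocks ?q)"
  define K where "K = mat m m (\<lambda>(t, s). if fst (labels ! t) = fst (labels ! s)
    then minor_entry ?q (fst (labels ! t)) (snd (labels ! t)) (snd (labels ! s)) else 0)"
  have M: "M \<in> carrier_mat m m" "M $$ (r, t) = block_matrix_entry (- ?q ones, blocks ?q) (labels ! r) (labels ! t)"
    if "r < m" "t < m" for r t
    using that by (auto simp: M_def block_matrix_def Let_def m_eq)
  have Mc: "M \<in> carrier_mat m m" by (auto simp: M_def block_matrix_def Let_def m_eq)
  have sum_idx: "(\<Sum>k<N. f (idx k)) = (\<Sum>\<alpha>\<in>MI. f \<alpha>)" for f :: "_ \<Rightarrow> real"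
    by (rule sum.reindex_bij_betw[OF idx(1)])
  have "Q * transpose_mat Q = 1\<^sub>m N"
  proof (rule eq_matI)
    fix k l assume "k < dim_row (1\<^sub>m N :: real mat)" "l < dim_col (1\<^sub>m N :: real mat)"
    then have kl: "k < N" "l < N" by auto
    have "(Q * transpose_mat Q) $$ (k, l) = (\<Sum>k'<N. P ?q (idx k') (idx k) * P ?q (idx k') (idx l))"
      using kl by (simp add: Q_def scalar_prod_def lessThan_atLeast0)
    also have "\<dots> = (\<Sum>\<alpha>\<in>MI. P ?q \<alpha> (idx k) * P ?q \<alpha> (idx l))"
      by (rule sum_idx)
    finally show "(Q * transpose_mat Q) $$ (k, l) = 1\<^sub>m N $$ (k, l)"
      using kl idx_MI idx_inj by (simp add: P_orthogonal)
  qed (auto simp: Q_def)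
  then have "Determinant.det Q * Determinant.det Q = 1"
    using det_mult[of Q N "transpose_mat Q"] Determinant.det_transpose[of Q N] by (simp add: Q_def)
  then have detQ: "\<bar>Determinant.det Q\<bar> = 1"
    by (metis abs_1 abs_minus_cancel square_eq_1_iff)
  have QJ: "Q * J = four_block_mat (- (M * K)) (0\<^sub>m m (N - m))
      (mat (N - m) m (\<lambda>(k, l). \<Sum>k'<N. P ?q (idx k') (idx (k + m)) * dPhi k' l z)) (1\<^sub>m (N - m))" (is "_ = ?B")
  proof (rule eq_matI)
    fix k l assume kl0: "k < dim_row ?B" "l < dim_col ?B"
    then have kl: "k < N" "l < N" using m_le_N Mc by (auto simp: K_def)
    have QJ: "(Q * J) $$ (k, l) = (\<Sum>k'<N. P ?q (idx k') (idx k) * dPhi k' l z)"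
      using kl by (simp add: Q_def J_def scalar_prod_def lessThan_atLeast0)
    show "(Q * J) $$ (k, l) = ?B $$ (k, l)"
    proof (cases "l < m")
      case l: True
      show ?thesis
      proof (cases "k < m")
        case k: True
        have "(M * K) $$ (k, l) = (\<Sum>t<m. M $$ (k, t) * K $$ (t, l))"
          using k l Mc by (simp add: K_def scalar_prod_def lessThan_atLeast0)
        also have "\<dots> = (\<Sum>t<m. block_matrix_entry (- ?q ones, blocks ?q) (labels ! k) (labels ! t) *
            (if fst (labels ! t) = fst (labels ! l) then minor_entry ?q (fst (labels ! t)) (snd (labels ! t)) (snd (labels ! l)) else 0))"
          using k l by (intro sum.cong refl) (simp add: M K_def)
        finally show ?thesis unfolding QJ rotated_dPhi_block[OF k l] using k l Mc by (simp add: K_def)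
      next
        case False
        then show ?thesis unfolding QJ using kl l Mc m_le_N by (simp add: K_def)
      qed
    next
      case l: False
      have "(Q * J) $$ (k, l) = (\<Sum>k'<N. P ?q (idx k') (idx k) * P ?q (idx k') (idx l))"
        unfolding QJ using l kl by (intro sum.cong refl) (simp add: dPhi_nonlead)
      also have "\<dots> = (\<Sum>\<alpha>\<in>MI. P ?q \<alpha> (idx k) * P ?q \<alpha> (idx l))"
        by (rule sum_idx)
      also have "\<dots> = (if k = l then 1 else 0)"
        using kl idx_MI idx_inj by (simp add: P_orthogonal)
      finally show ?thesis using l kl Mc by (cases "k < m") (auto simp: K_def)
    qed
  qed (use m_le_N Mc in \<open>auto simp: Q_def J_def K_def\<close>)
  have "Determinant.det (Q * J) = Determinant.det (- (M * K)) * Determinant.det (1\<^sub>m (N - m) :: real mat)"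
    unfolding QJ by (rule det_four_block_mat_upper_right_zero) (use Mc in \<open>auto simp: K_def\<close>)
  moreover have "Determinant.det (Q * J) = Determinant.det Q * Determinant.det J"
    by (rule det_mult) (auto simp: Q_def J_def)
  ultimately have "\<bar>Determinant.det J\<bar> = \<bar>Determinant.det (- (M * K))\<bar>"
    using detQ by (metis abs_mult det_one mult_1 mult.right_neutral)
  also have "- (M * K) = (- 1) \<cdot>\<^sub>m (M * K)" using Mc by (intro eq_matI) (auto simp: K_def)
  also have "\<bar>Determinant.det ((- 1) \<cdot>\<^sub>m (M * K))\<bar> = \<bar>Determinant.det (M * K)\<bar>"
    by (simp add: abs_mult power_abs)
  also have "Determinant.det (M * K) = Determinant.det M * Determinant.det K"
    by (rule det_mult[OF Mc]) (auto simp: K_def)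
  finally show ?thesis unfolding jacobian_def J_def[symmetric] M_def[symmetric] using det_minor_entries[of ?q]
    by (simp add: abs_mult K_def)
qed

end

subsection \<open>Gaussian integrals\<close>

lemma nn_integral_exp_square:
  assumes "\<tau> > 0"
  shows "(\<integral>\<^sup>+x. ennreal (exp (- \<tau> * x\<^sup>2)) \<partial>lborel) = ennreal (sqrt (pi / \<tau>))"
proof -
  define \<sigma> where "\<sigma> = sqrt (1 / (2 * \<tau>))"
  have \<sigma>: "\<sigma> > 0" "\<sigma>\<^sup>2 = 1 / (2 * \<tau>)" using assms by (simp_all add: \<sigma>_def)
  have "2 * pi * \<sigma>\<^sup>2 = pi / \<tau>" using assms by (simp add: \<sigma>(2) field_simps)
  then have e: "exp (- \<tau> * x\<^sup>2) = sqrt (pi / \<tau>) * normal_density 0 \<sigma> x" for x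
    using assms by (simp add: normal_density_def \<sigma>(2) field_simps)
  interpret prob_space "density lborel (\<lambda>x. ennreal (normal_density 0 \<sigma> x))"
    using prob_space_normal_density[OF \<sigma>(1), of 0] by simp
  have "(\<integral>\<^sup>+x. ennreal (normal_density 0 \<sigma> x) \<partial>lborel) = 1"
    using emeasure_space_1 by (simp add: emeasure_density)
  then show ?thesis
    unfolding e using assms by (subst ennreal_mult) (simp_all add: nn_integral_cmult)
qed

lemma nn_integral_Gamma_scaled:
  assumes s: "s > 0" and A: "A > 0"
  shows "(\<integral>\<^sup>+t. ennreal (indicator {0..} t * t powr (s - 1) * exp (- A * t)) \<partial>lborel) = ennreal (Gamma s * A powr - s)"
proof -
  have "ennreal (Gamma s) = (\<integral>\<^sup>+t. ennreal (indicator {0..} t * t powr (s - 1) / exp t) \<partial>lborel)"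
    by (rule Gamma_conv_nn_integral_real[OF s])
  also have "\<dots> = ennreal \<bar>A\<bar> * (\<integral>\<^sup>+t. ennreal (indicator {0..} (0 + A * t) * (0 + A * t) powr (s - 1) / exp (0 + A * t)) \<partial>lborel)"
    using A by (intro nn_integral_real_affine) auto
  also have "(\<lambda>t. ennreal (indicator {0..} (0 + A * t) * (0 + A * t) powr (s - 1) / exp (0 + A * t))) =
      (\<lambda>t. ennreal (A powr (s - 1)) * ennreal (indicator {0..} t * t powr (s - 1) * exp (- A * t)))"
    using A by (auto simp: fun_eq_iff indicator_def ennreal_mult[symmetric] powr_mult exp_minus field_simps zero_le_mult_iff)
  also have "(\<integral>\<^sup>+t. ennreal (A powr (s - 1)) * ennreal (indicator {0..} t * t powr (s - 1) * exp (- A * t)) \<partial>lborel) =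
      ennreal (A powr (s - 1)) * (\<integral>\<^sup>+t. ennreal (indicator {0..} t * t powr (s - 1) * exp (- A * t)) \<partial>lborel)"
    by (rule nn_integral_cmult) simp
  finally have "ennreal (Gamma s) = ennreal (A powr s) * (\<integral>\<^sup>+t. ennreal (indicator {0..} t * t powr (s - 1) * exp (- A * t)) \<partial>lborel)"
    using A by (simp add: mult.assoc[symmetric] ennreal_mult[symmetric] powr_mult_base)
  then have "ennreal (A powr - s) * ennreal (Gamma s) =
      ennreal (A powr - s * A powr s) * (\<integral>\<^sup>+t. ennreal (indicator {0..} t * t powr (s - 1) * exp (- A * t)) \<partial>lborel)"
    by (simp add: mult.assoc[symmetric] ennreal_mult[symmetric])
  moreover have "A powr - s * A powr s = 1" using A by (simp add: powr_minus)
  ultimately show ?thesis using s by (simp add: ennreal_mult[symmetric] Gamma_real_pos less_imp_le mult.commute)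
qed

text \<open>
  Writing the power as a Gamma integral in \<open>\<tau>\<close> turns the integrand into a product of Gaussians.
\<close>

lemma nn_integral_cauchy_PiM:
  fixes I :: "'i set"
  assumes I: "finite I"
  defines "s \<equiv> (real (card I) + 1) / 2"
  shows "(\<integral>\<^sup>+x. ennreal ((1 + (\<Sum>i\<in>I. (x i)\<^sup>2)) powr - s) \<partial>(\<Pi>\<^sub>M i\<in>I. lborel)) = ennreal (pi powr s / Gamma s)"
proof -
  let ?M = "\<Pi>\<^sub>M i\<in>I. (lborel :: real measure)"
  have s: "s > 0" by (simp add: s_def add_nonneg_pos)
  have G: "Gamma s > 0" using s by (rule Gamma_real_pos)
  interpret M: sigma_finite_measure ?M by (rule lborel_product.sigma_finite[OF I])
  interpret pair_sigma_finite ?M "lborel :: real measure" by standard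
  have [measurable]: "(\<lambda>x. x i) \<in> borel_measurable ?M" if "i \<in> I" for i
    using measurable_component_singleton[OF that, of "\<lambda>_. lborel"] by simp
  have [measurable]: "(\<lambda>x. \<Sum>i\<in>I. (x i)\<^sup>2) \<in> borel_measurable ?M"
    by (intro borel_measurable_sum) measurable
  let ?S = "\<lambda>x. \<Sum>i\<in>I. (x i)\<^sup>2"
  let ?k = "\<lambda>x t. ennreal (indicator {0..} t * t powr (s - 1) * exp (- (1 + ?S x) * t))"
  have pos: "1 + ?S x > 0" for x :: "'i \<Rightarrow> real" by (intro add_pos_nonneg sum_nonneg) auto
  have "ennreal (Gamma s) * (\<integral>\<^sup>+x. ennreal ((1 + ?S x) powr - s) \<partial>?M) =
      (\<integral>\<^sup>+x. ennreal (Gamma s * (1 + ?S x) powr - s) \<partial>?M)"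
    using G by (subst nn_integral_cmult[symmetric]) (auto simp: ennreal_mult)
  also have "\<dots> = (\<integral>\<^sup>+x. (\<integral>\<^sup>+t. ?k x t \<partial>lborel) \<partial>?M)"
    using nn_integral_Gamma_scaled[OF s pos] by simp
  also have "\<dots> = (\<integral>\<^sup>+t. (\<integral>\<^sup>+x. ?k x t \<partial>?M) \<partial>lborel)"
    by (rule Fubini'[symmetric]) measurable
  also have "\<dots> = (\<integral>\<^sup>+t. ennreal (pi powr (card I / 2)) * ennreal (indicator {0..} t * t powr (1/2 - 1) * exp (- 1 * t)) \<partial>lborel)"
  \<comment> \<open>The formula for the Gaussian integral is for \<open>t > 0\<close>; the point 0
    is discarded as a null set, and for negative \<open>t\<close> the indicator is 0.\<close>
  proof (rule nn_integral_cong_AE, rule AE_mp[OF AE_lborel_singleton[of 0]], rule AE_I2, rule impI)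
    fix t :: real assume "t \<noteq> 0"
    show "(\<integral>\<^sup>+x. ?k x t \<partial>?M) = ennreal (pi powr (card I / 2)) * ennreal (indicator {0..} t * t powr (1/2 - 1) * exp (- 1 * t))"
    proof (cases "t > 0")
      case t: True
      have "?k x t = ennreal (t powr (s - 1) * exp (- t)) * (\<Prod>i\<in>I. ennreal (exp (- t * (x i)\<^sup>2)))" for x :: "'i \<Rightarrow> real"
      proof -
        have "exp (- (1 + ?S x) * t) = exp (- t) * (\<Prod>i\<in>I. exp (- t * (x i)\<^sup>2))"
          using I by (simp add: exp_sum[symmetric] exp_add[symmetric] sum_distrib_left sum_negf algebra_simps)
        then show ?thesis using t by (simp add: prod_ennreal ennreal_mult[symmetric] prod_nonneg mult_ac)
      qed
      then have "(\<integral>\<^sup>+x. ?k x t \<partial>?M) = ennreal (t powr (s - 1) * exp (- t)) * (\<integral>\<^sup>+x. (\<Prod>i\<in>I. ennreal (exp (- t * (x i)\<^sup>2))) \<partial>?M)"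
        by (simp add: nn_integral_cmult)
      also have "(\<integral>\<^sup>+x. (\<Prod>i\<in>I. ennreal (exp (- t * (x i)\<^sup>2))) \<partial>?M) = (\<Prod>i\<in>I. ennreal (sqrt (pi / t)))"
        using lborel_product.product_nn_integral_prod[OF I, of "\<lambda>_ u. ennreal (exp (- t * u\<^sup>2))"]
        by (simp add: nn_integral_exp_square[OF t, simplified])
      also have "\<dots> = ennreal (pi powr (card I / 2) * t powr - (card I / 2))"
      proof -
        have "sqrt (pi / t) ^ card I = (pi / t) powr (card I / 2)"
          using t by (simp add: powr_half_sqrt[symmetric] powr_realpow[symmetric] powr_powr)
        also have "\<dots> = pi powr (card I / 2) * t powr - (card I / 2)"
          using t by (simp add: powr_divide powr_minus_divide)
        finally show ?thesis using t by (simp add: ennreal_power)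
      qed
      also have "ennreal (t powr (s - 1) * exp (- t)) * ennreal (pi powr (card I / 2) * t powr - (card I / 2)) =
          ennreal (pi powr (card I / 2)) * ennreal (t powr (s - 1 + - (card I / 2)) * exp (- t))"
        unfolding powr_add by (simp add: ennreal_mult[symmetric] mult_ac)
      \<comment> \<open>The exponent \<open>s\<close> exceeds half the number of Gaussian factors by
        exactly 1/2, so what remains is \<open>Gamma (1/2)\<close>, the square root of
        \<open>pi\<close>.\<close>
      also have "s - 1 + - (card I / 2) = 1/2 - 1" by (simp add: s_def field_simps)
      finally show ?thesis using t by simp
    next
      case False
      with \<open>t \<noteq> 0\<close> have "t < 0" by simp
      then show ?thesis by simp
    qed
  qed
  also have "\<dots> = ennreal (pi powr (card I / 2)) * ennreal (Gamma (1/2) * 1 powr - (1/2))"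
    by (subst nn_integral_cmult) (simp, subst nn_integral_Gamma_scaled, auto)
  also have "\<dots> = ennreal (pi powr s)"
    by (simp add: Gamma_one_half_real ennreal_mult[symmetric] powr_half_sqrt[symmetric] powr_add[symmetric] s_def add_divide_distrib)
  finally have *: "ennreal (Gamma s) * (\<integral>\<^sup>+x. ennreal ((1 + ?S x) powr - s) \<partial>?M) = ennreal (pi powr s)" .
  have "(\<integral>\<^sup>+x. ennreal ((1 + ?S x) powr - s) \<partial>?M) = ennreal (1 / Gamma s) * (ennreal (Gamma s) * (\<integral>\<^sup>+x. ennreal ((1 + ?S x) powr - s) \<partial>?M))"
    using G by (simp add: mult.assoc[symmetric] ennreal_mult[symmetric])
  then show ?thesis unfolding * using G by (simp add: ennreal_mult[symmetric])
qed

lemma inverse_frame_radius_power: "inverse (frame_radius k y) ^ k = (1 + (\<Sum>a=2..k. (y a)\<^sup>2)) powr - (real k / 2)"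
proof -
  let ?u = "1 + (\<Sum>a=2..k. (y a)\<^sup>2)"
  have u: "?u > 0" by (intro add_pos_nonneg sum_nonneg) auto
  have "inverse (frame_radius k y) = ?u powr - (1 / 2)"
    using u by (simp add: frame_radius_def powr_half_sqrt[symmetric] powr_minus)
  then show ?thesis using u by (simp add: powr_realpow[symmetric] powr_powr)
qed

lemma PiM_density_lborel:
  fixes \<phi> :: "real \<Rightarrow> real"
  assumes I: "finite I" and \<phi> [measurable]: "\<phi> \<in> borel_measurable borel"
    and sf: "sigma_finite_measure (density lborel (\<lambda>t. ennreal (\<phi> t)))"
  shows "density (\<Pi>\<^sub>M i\<in>I. lborel) (\<lambda>x. \<Prod>i\<in>I. ennreal (\<phi> (x i))) = (\<Pi>\<^sub>M i\<in>I. density lborel (\<lambda>t. ennreal (\<phi> t)))"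
proof -
  interpret D: product_sigma_finite "\<lambda>_. density lborel (\<lambda>t. ennreal (\<phi> t))"
    using sf by (simp add: product_sigma_finite_def)
  have [measurable]: "(\<lambda>x. x i) \<in> borel_measurable (\<Pi>\<^sub>M i\<in>I. (lborel :: real measure))" if "i \<in> I" for i
    using measurable_component_singleton[OF that, of "\<lambda>_. lborel"] by simp
  have m: "(\<lambda>x. \<Prod>i\<in>I. ennreal (\<phi> (x i))) \<in> borel_measurable (\<Pi>\<^sub>M i\<in>I. lborel)"
    by (intro borel_measurable_prod_ennreal) measurable
  show ?thesis
  proof (rule D.PiM_eqI)
    show "finite I" by fact
    show "sets (density (\<Pi>\<^sub>M i\<in>I. lborel) (\<lambda>x. \<Prod>i\<in>I. ennreal (\<phi> (x i)))) = sets (\<Pi>\<^sub>M i\<in>I. density lborel (\<lambda>t. ennreal (\<phi> t)))"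
      by (simp cong: sets_PiM_cong)
    fix A assume A: "\<And>i. i \<in> I \<Longrightarrow> A i \<in> sets (density lborel (\<lambda>t. ennreal (\<phi> t)))"
    then have A': "\<And>i. i \<in> I \<Longrightarrow> A i \<in> sets borel" by simp
    have "emeasure (density (\<Pi>\<^sub>M i\<in>I. lborel) (\<lambda>x. \<Prod>i\<in>I. ennreal (\<phi> (x i)))) (Pi\<^sub>E I A) =
        (\<integral>\<^sup>+x. (\<Prod>i\<in>I. ennreal (\<phi> (x i))) * indicator (Pi\<^sub>E I A) x \<partial>(\<Pi>\<^sub>M i\<in>I. lborel))"
      using A' I by (intro emeasure_density m sets_PiM_I_finite) auto
    also have "\<dots> = (\<integral>\<^sup>+x. (\<Prod>i\<in>I. ennreal (\<phi> (x i)) * indicator (A i) (x i)) \<partial>(\<Pi>\<^sub>M i\<in>I. lborel))"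
    proof (rule nn_integral_cong)
      fix x assume "x \<in> space (\<Pi>\<^sub>M i\<in>I. (lborel :: real measure))"
      then have "x \<in> extensional I" by (simp add: space_PiM PiE_def)
      then have "indicator (Pi\<^sub>E I A) x = (\<Prod>i\<in>I. indicator (A i) (x i) :: ennreal)"
      proof (cases "x \<in> Pi\<^sub>E I A")
        case False
        then obtain i where i: "i \<in> I" "x i \<notin> A i" using \<open>x \<in> extensional I\<close> by (auto simp: PiE_def)
        then have "(\<Prod>i\<in>I. indicator (A i) (x i) :: ennreal) = 0"
          by (intro prod_zero[OF I] bexI[of _ i]) auto
        then show ?thesis using False by simp
      next
        case True
        then have "(\<Prod>i\<in>I. indicator (A i) (x i) :: ennreal) = 1" by (intro prod.neutral ballI) (metis PiE_mem indicator_simps(1))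
        then show ?thesis using True by simp
      qed
      then show "(\<Prod>i\<in>I. ennreal (\<phi> (x i))) * indicator (Pi\<^sub>E I A) x = (\<Prod>i\<in>I. ennreal (\<phi> (x i)) * indicator (A i) (x i))"
        by (simp add: prod.distrib)
    qed
    also have "\<dots> = (\<Prod>i\<in>I. \<integral>\<^sup>+t. ennreal (\<phi> t) * indicator (A i) t \<partial>lborel)"
      using A' I by (intro lborel_product.product_nn_integral_prod) auto
    also have "\<dots> = (\<Prod>i\<in>I. emeasure (density lborel (\<lambda>t. ennreal (\<phi> t))) (A i))"
      using A' by (intro prod.cong refl emeasure_density[symmetric]) auto
    finally show "emeasure (density (\<Pi>\<^sub>M i\<in>I. lborel) (\<lambda>x. \<Prod>i\<in>I. ennreal (\<phi> (x i)))) (Pi\<^sub>E I A) =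
      (\<Prod>i\<in>I. emeasure (density lborel (\<lambda>t. ennreal (\<phi> t))) (A i))" .
  qed
qed

abbreviation "std_gauss \<equiv> density lborel (\<lambda>t. ennreal (std_normal_density t))"

lemma prob_std_gauss: "prob_space std_gauss"
  using prob_space_normal_density[of 1 0] by simp

lemma sigma_finite_std_gauss: "sigma_finite_measure std_gauss"
  using prob_std_gauss by (simp add: prob_space_imp_sigma_finite)

interpretation gauss_product: product_sigma_finite "\<lambda>_::'i. std_gauss"
  by (simp add: product_sigma_finite_def sigma_finite_std_gauss)

text \<open>Absorbs the minus sign of the diagonal entry in
  \<open>jacobian_Phi_coords\<close>.\<close>

lemma nn_integral_std_gauss_uminus:
  assumes [measurable]: "f \<in> borel_measurable borel"
  shows "(\<integral>\<^sup>+x. f (- x) \<partial>std_gauss) = (\<integral>\<^sup>+x. f x \<partial>std_gauss)"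
proof -
  have "(\<integral>\<^sup>+x. f x \<partial>std_gauss) = (\<integral>\<^sup>+x. ennreal (std_normal_density x) * f x \<partial>lborel)"
    by (simp add: nn_integral_density)
  also have "\<dots> = ennreal \<bar>- 1\<bar> * (\<integral>\<^sup>+x. ennreal (std_normal_density (0 + (- 1) * x)) * f (0 + (- 1) * x) \<partial>lborel)"
    by (rule nn_integral_real_affine) auto
  also have "\<dots> = (\<integral>\<^sup>+x. ennreal (std_normal_density x) * f (- x) \<partial>lborel)"
    by (simp add: std_normal_density_def)
  also have "\<dots> = (\<integral>\<^sup>+x. f (- x) \<partial>std_gauss)" by (simp add: nn_integral_density)
  finally show ?thesis by simp
qed

text \<open>The determinant will be bounded by products of powers of
  \<open>1 + \<bar>x\<bar>\<close> over the coordinates; these moments bound its integral.\<close>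

lemma std_gauss_moment_finite: "(\<integral>\<^sup>+x. ennreal ((1 + \<bar>x\<bar>) ^ k) \<partial>std_gauss) < \<infinity>"
proof -
  have "integrable lborel (\<lambda>x. \<Sum>j\<le>k. of_nat (k choose j) * (std_normal_density x * \<bar>x\<bar> ^ j))"
    by (intro Bochner_Integration.integrable_sum integrable_mult_right integrable_std_normal_moment_abs)
  moreover have "(\<Sum>j\<le>k. of_nat (k choose j) * (std_normal_density x * \<bar>x\<bar> ^ j)) = std_normal_density x * (1 + \<bar>x\<bar>) ^ k" for x
    using binomial_ring[of "\<bar>x\<bar>" 1 k] by (simp add: sum_distrib_left mult_ac add.commute)
  ultimately have "integrable lborel (\<lambda>x. std_normal_density x * (1 + \<bar>x\<bar>) ^ k)" by simp
  then have "(\<integral>\<^sup>+x. ennreal (norm (std_normal_density x * (1 + \<bar>x\<bar>) ^ k)) \<partial>lborel) < \<infinity>"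
    by (simp add: integrable_iff_bounded)
  then show ?thesis by (simp add: nn_integral_density ennreal_mult[symmetric] abs_mult power_abs)
qed

lemma borel_measurable_det_mat:
  fixes A :: "nat \<Rightarrow> nat \<Rightarrow> 'a \<Rightarrow> real"
  assumes "\<And>i j. i < m \<Longrightarrow> j < m \<Longrightarrow> A i j \<in> borel_measurable M"
  shows "(\<lambda>x. Determinant.det (mat m m (\<lambda>(i, j). A i j x))) \<in> borel_measurable M"
proof -
  have "(\<lambda>x. A i (p i) x) \<in> borel_measurable M" if "p permutes {0..<m}" "i \<in> {0..<m}" for p i
    using assms that permutes_in_image[OF that(1), of i] by auto
  then show ?thesis unfolding det_mat_eq_sum by (intro borel_measurable_sum borel_measurable_times borel_measurable_prod) auto
qed

lemma abs_det_mat_le: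
  fixes A :: "nat \<Rightarrow> nat \<Rightarrow> real"
  assumes "\<And>i j. i < m \<Longrightarrow> j < m \<Longrightarrow> \<bar>A i j\<bar> \<le> G"
  shows "\<bar>Determinant.det (mat m m (\<lambda>(i, j). A i j))\<bar> \<le> fact m * G ^ m"
proof -
  have "\<bar>Determinant.det (mat m m (\<lambda>(i, j). A i j))\<bar> =
    \<bar>\<Sum>p | p permutes {0..<m}. signof p * (\<Prod>i = 0..<m. A i (p i))\<bar>"
    by (simp add: det_mat_eq_sum)
  also have "\<dots> \<le> (\<Sum>p | p permutes {0..<m}. \<bar>signof p * (\<Prod>i = 0..<m. A i (p i))\<bar>)" by (rule sum_abs)
  also have "\<dots> \<le> (\<Sum>p | p permutes {0..<m}. G ^ m)"
  proof (rule sum_mono)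
    fix p assume p: "p \<in> {p. p permutes {0..<m}}"
    have sg: "\<bar>signof p :: real\<bar> = 1" by (simp add: sign_def)
    have "(\<Prod>i = 0..<m. \<bar>A i (p i)\<bar>) \<le> (\<Prod>i = 0..<m. G)"
      using assms permutes_in_image[of p "{0..<m}"] p by (intro prod_mono) auto
    then show "\<bar>signof p * (\<Prod>i = 0..<m. A i (p i))\<bar> \<le> G ^ m" by (simp add: abs_mult sg abs_prod)
  qed
  also have "\<dots> = fact m * G ^ m" by (simp add: card_permutations)
  finally show ?thesis .
qed

section \<open>The Gaussian integral of the block determinant\<close>

context tensor_format
begin

abbreviation "block_idx \<equiv> block_entries p n"

lemma finite_block_entries: "finite block_idx"
proof -
  have "block_idx \<subseteq> {1..p} \<times> {1..p} \<times> (\<Union>i\<in>{1..p}. {1..n i - 1}) \<times> (\<Union>i\<in>{1..p}. {1..n i - 1})"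
    by (auto simp: block_entries_def) force+
  then show ?thesis by (rule finite_subset) auto
qed

lemma block_matrix_eq:
  "block_matrix p n w = mat m m (\<lambda>(r, s). block_matrix_entry w (labels ! r) (labels ! s))"
  by (simp add: block_matrix_def Let_def m_eq)

lemma label_block_entries:
  assumes "r < m" "s < m" "labels ! r = (i, a)" "labels ! s = (j, b)"
  shows "i < j \<Longrightarrow> (i, j, a, b) \<in> block_idx" "j < i \<Longrightarrow> (j, i, b, a) \<in> block_idx"
  using nth_mem[OF assms(1)] nth_mem[OF assms(2)] assms(3,4) by (auto simp: set_row_labels block_entries_def)

lemma block_matrix_cong:
  assumes "\<And>k. k \<in> block_idx \<Longrightarrow> c k = c' k"
  shows "block_matrix p n (w0, c) = block_matrix p n (w0, c')"
  unfolding block_matrix_eq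
proof (rule eq_matI)
  fix r s assume "r < dim_row (mat m m (\<lambda>(r, s). block_matrix_entry (w0, c') (labels ! r) (labels ! s)))"
    "s < dim_col (mat m m (\<lambda>(r, s). block_matrix_entry (w0, c') (labels ! r) (labels ! s)))"
  then have rs: "r < m" "s < m" by auto
  obtain i a where ia: "labels ! r = (i, a)" by fastforce
  obtain j b where jb: "labels ! s = (j, b)" by fastforce
  show "mat m m (\<lambda>(r, s). block_matrix_entry (w0, c) (labels ! r) (labels ! s)) $$ (r, s) =
      mat m m (\<lambda>(r, s). block_matrix_entry (w0, c') (labels ! r) (labels ! s)) $$ (r, s)"
    using rs label_block_entries[OF rs ia jb] assms by (auto simp: ia jb)
qed auto

lemma sets_mu_W1: "sets (mu_W1 p n) = sets (borel \<Otimes>\<^sub>M (\<Pi>\<^sub>M k\<in>block_idx. borel))"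
  unfolding mu_W1_def by (intro sets_pair_measure_cong sets_PiM_cong) auto

lemma borel_measurable_det_block_matrix:
  "(\<lambda>w. Determinant.det (block_matrix p n w)) \<in> borel_measurable (borel \<Otimes>\<^sub>M (\<Pi>\<^sub>M k\<in>block_idx. borel))"
  unfolding block_matrix_eq
proof (rule borel_measurable_det_mat)
  fix r s assume rs: "r < m" "s < m"
  obtain i a where ia: "labels ! r = (i, a)" by fastforce
  obtain j b where jb: "labels ! s = (j, b)" by fastforce
  have c: "(\<lambda>w. snd w k) \<in> borel_measurable (borel \<Otimes>\<^sub>M (\<Pi>\<^sub>M k\<in>block_idx. (borel :: real measure)))" if "k \<in> block_idx" for k
    using measurable_compose[OF measurable_snd measurable_component_singleton[OF that]] .
  have eq: "block_matrix_entry w (i, a) (j, b) = (if i = j then (if a = b then fst w else 0)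
      else if i < j then snd w (i, j, a, b) else snd w (j, i, b, a))" for w
    by (cases w) simp
  show "(\<lambda>w. block_matrix_entry w (labels ! r) (labels ! s)) \<in> borel_measurable (borel \<Otimes>\<^sub>M (\<Pi>\<^sub>M k\<in>block_idx. borel))"
    unfolding ia jb eq using c[OF label_block_entries(1)[OF rs ia jb]] c[OF label_block_entries(2)[OF rs ia jb]]
    by (cases i j rule: linorder_cases) auto
qed

text \<open>Every entry of the matrix is at most the product \<open>?G\<close> of
  \<open>1 + \<bar>x\<bar>\<close> over all coordinates of the point. Leibniz's formula gives the
  bound \<open>fact m * ?G w ^ m\<close>, which is a product of functions of one coordinate each and
  so integrates to a product of moments.\<close>

lemma integrable_det_block_matrix: "integrable (mu_W1 p n) (\<lambda>w. \<bar>Determinant.det (block_matrix p n w)\<bar>)"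
proof (rule integrableI_bounded)
  have "(\<lambda>w. Determinant.det (block_matrix p n w)) \<in> borel_measurable (mu_W1 p n)"
    using borel_measurable_det_block_matrix measurable_cong_sets[OF sets_mu_W1 refl] by blast
  then show "(\<lambda>w. \<bar>Determinant.det (block_matrix p n w)\<bar>) \<in> borel_measurable (mu_W1 p n)" by measurable
  let ?G = "\<lambda>w::w1_point. (1 + \<bar>fst w\<bar>) * (\<Prod>k\<in>block_idx. 1 + \<bar>snd w k\<bar>)"
  have one: "1 \<le> (\<Prod>k\<in>block_idx. 1 + \<bar>c k\<bar>)" for c :: "_ \<Rightarrow> real" by (rule prod_ge_1) simp
  have le: "\<bar>Determinant.det (block_matrix p n w)\<bar> \<le> fact m * ?G w ^ m" for w
    unfolding block_matrix_eq
  proof (rule abs_det_mat_le)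
    fix r s assume rs: "r < m" "s < m"
    obtain i a where ia: "labels ! r = (i, a)" by fastforce
    obtain j b where jb: "labels ! s = (j, b)" by fastforce
    obtain w0 c where w: "w = (w0, c)" by fastforce
    have ck: "\<bar>c k\<bar> \<le> ?G w" if "k \<in> block_idx" for k
    proof -
      have "1 + \<bar>c k\<bar> \<le> (1 + \<bar>c k\<bar>) * (\<Prod>k\<in>block_idx - {k}. 1 + \<bar>c k\<bar>)"
        using prod_ge_1[of "block_idx - {k}" "\<lambda>k. 1 + \<bar>c k\<bar>"] by (simp add: mult_le_cancel_left1)
      also have "\<dots> = (\<Prod>k\<in>block_idx. 1 + \<bar>c k\<bar>)" using that finite_block_entries by (simp add: prod.remove[of _ k])
      also have "\<dots> \<le> ?G w" using one[of c] by (simp add: w mult_le_cancel_right1)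
      finally show ?thesis by simp
    qed
    have w0: "\<bar>w0\<bar> \<le> ?G w"
    proof -
      have "1 + \<bar>w0\<bar> \<le> ?G w" using one[of c] by (simp add: w mult_le_cancel_left1)
      then show ?thesis by simp
    qed
    then have "0 \<le> ?G w" by linarith
    then show "\<bar>block_matrix_entry w (labels ! r) (labels ! s)\<bar> \<le> ?G w"
      unfolding ia jb using w0 ck[OF label_block_entries(1)[OF rs ia jb]] ck[OF label_block_entries(2)[OF rs ia jb]]
      by (cases i j rule: linorder_cases) (auto simp: w)
  qed
  interpret P: sigma_finite_measure "\<Pi>\<^sub>M k\<in>block_idx. std_gauss" by (rule gauss_product.sigma_finite[OF finite_block_entries])
  have [measurable]: "(\<lambda>c. c k) \<in> borel_measurable (\<Pi>\<^sub>M k\<in>block_idx. std_gauss)" if "k \<in> block_idx" for k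
    using measurable_component_singleton[OF that, of "\<lambda>_. std_gauss"] by (simp add: measurable_cong_sets[OF refl sets_density])
  have "(\<integral>\<^sup>+w. ennreal (norm \<bar>Determinant.det (block_matrix p n w)\<bar>) \<partial>mu_W1 p n) \<le>
      (\<integral>\<^sup>+w. ennreal (fact m) * (ennreal ((1 + \<bar>fst w\<bar>) ^ m) * (\<Prod>k\<in>block_idx. ennreal ((1 + \<bar>snd w k\<bar>) ^ m))) \<partial>mu_W1 p n)"
  proof (rule nn_integral_mono)
    fix w :: w1_point
    have "ennreal (norm \<bar>Determinant.det (block_matrix p n w)\<bar>) \<le> ennreal (fact m * ?G w ^ m)"
      using le[of w] by (intro ennreal_leI) simp
    also have "\<dots> = ennreal (fact m) * (ennreal ((1 + \<bar>fst w\<bar>) ^ m) * (\<Prod>k\<in>block_idx. ennreal ((1 + \<bar>snd w k\<bar>) ^ m)))"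
      by (simp add: prod_ennreal ennreal_mult[symmetric] prod_nonneg power_mult_distrib prod_power_distrib)
    finally show "ennreal (norm \<bar>Determinant.det (block_matrix p n w)\<bar>) \<le>
      ennreal (fact m) * (ennreal ((1 + \<bar>fst w\<bar>) ^ m) * (\<Prod>k\<in>block_idx. ennreal ((1 + \<bar>snd w k\<bar>) ^ m)))" .
  qed
  also have "\<dots> = (\<integral>\<^sup>+y. (\<integral>\<^sup>+c. ennreal (fact m) * (ennreal ((1 + \<bar>y\<bar>) ^ m) * (\<Prod>k\<in>block_idx. ennreal ((1 + \<bar>c k\<bar>) ^ m))) \<partial>(\<Pi>\<^sub>M k\<in>block_idx. std_gauss)) \<partial>std_gauss)"
    unfolding mu_W1_def by (subst P.nn_integral_fst[symmetric]) simp_all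
  also have "\<dots> = (\<integral>\<^sup>+y. ennreal (fact m) * (ennreal ((1 + \<bar>y\<bar>) ^ m) * (\<Prod>k\<in>block_idx. \<integral>\<^sup>+t. ennreal ((1 + \<bar>t\<bar>) ^ m) \<partial>std_gauss)) \<partial>std_gauss)"
    using gauss_product.product_nn_integral_prod[OF finite_block_entries, of "\<lambda>_ t. ennreal ((1 + \<bar>t\<bar>) ^ m)"]
    by (simp add: nn_integral_cmult)
  also have "\<dots> = ennreal (fact m) * ((\<integral>\<^sup>+t. ennreal ((1 + \<bar>t\<bar>) ^ m) \<partial>std_gauss) * (\<Prod>k\<in>block_idx. \<integral>\<^sup>+t. ennreal ((1 + \<bar>t\<bar>) ^ m) \<partial>std_gauss))"
    by (simp add: nn_integral_cmult nn_integral_multc)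
  also have "\<dots> < \<infinity>"
    using std_gauss_moment_finite[of m] by (simp add: ennreal_mult_less_top power_less_top_ennreal)
  finally show "(\<integral>\<^sup>+w. ennreal (norm \<bar>Determinant.det (block_matrix p n w)\<bar>) \<partial>mu_W1 p n) < \<infinity>" .
qed

definition "pair_index = (\<lambda>(i, j, a, b). (lead i (Suc a))(j := Suc b))"

text \<open>The two slots with an entry different from 1 can be read off from the multi-index, and
  \<open>i < j\<close> fixes their order.\<close>

lemma inj_pair_index: "inj_on pair_index block_idx"
proof (rule inj_onI, safe)
  fix i j a b i' j' a' b'
  assume k: "(i, j, a, b) \<in> block_idx" "(i', j', a', b') \<in> block_idx" and eq: "pair_index (i, j, a, b) = pair_index (i', j', a', b')"
  have k1: "i \<in> {1..p}" "j \<in> {1..p}" "i < j" "a \<noteq> 0" "b \<noteq> 0" and k2: "i' \<in> {1..p}" "j' \<in> {1..p}" "i' < j'" "a' \<noteq> 0" "b' \<noteq> 0"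
    using k by (auto simp: block_entries_def)
  have v: "((lead i (Suc a))(j := Suc b)) l = (if l = j then Suc b else if l = i then Suc a else 1)"
    "((lead i' (Suc a'))(j' := Suc b')) l = (if l = j' then Suc b' else if l = i' then Suc a' else 1)" if "l \<in> {1..p}" for l
    using that by (auto simp: lead_apply ones_apply)
  have e: "(if l = j then Suc b else if l = i then Suc a else 1) = (if l = j' then Suc b' else if l = i' then Suc a' else 1)"
    if "l \<in> {1..p}" for l
    using fun_cong[OF eq, of l] v[OF that] by (simp only: pair_index_def prod.case)
  have ne: "Suc x \<noteq> 1 \<longleftrightarrow> x \<noteq> 0" for x by (simp add: One_nat_def)
  have "i = i' \<or> i = j'" using e[OF k1(1)] k1 by (auto simp: ne One_nat_def split: if_splits)
  moreover have "j = i' \<or> j = j'" using e[OF k1(2)] k1 by (auto simp: ne One_nat_def split: if_splits)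
  ultimately have ij: "i = i'" "j = j'" using k1 k2 by auto
  show "i = i'" "j = j'" by fact+
  show "a = a'" using e[OF k1(1)] ij k1 by simp
  show "b = b'" using e[OF k1(2)] ij k1 by simp
qed

lemma pair_index_mem:
  assumes "k \<in> block_idx" shows "pair_index k \<in> MI - leads - {ones}"
proof -
  obtain i j a b where k: "k = (i, j, a, b)" by (cases k) auto
  have h: "i \<in> {1..p}" "j \<in> {1..p}" "i \<noteq> j" "a \<in> {1..n i - 1}" "b \<in> {1..n j - 1}"
    using assms by (auto simp: k block_entries_def)
  have "pair_index k \<in> MI" unfolding k pair_index_def prod.case
    using h by (intro multi_index_upd lead_MI) auto
  moreover have "pair_index k \<notin> leads" unfolding k pair_index_def prod.case
    using h by (intro not_lead_pair) (auto simp: One_nat_def)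
  moreover have "pair_index k \<noteq> ones"
  proof
    assume "pair_index k = ones"
    from fun_cong[OF this, of j] h show False by (simp add: k pair_index_def ones_apply One_nat_def)
  qed
  ultimately show ?thesis by simp
qed

lemma blocks_eq: "blocks q k = q (pair_index k)"
  by (cases k) (simp add: blocks_def pair_index_def)

abbreviation "nonleads \<equiv> MI - leads"

text \<open>The matrix depends only on the entry at \<open>ones\<close> and on those in the range of
  \<open>pair_index\<close>. All other coordinates carry probability measures and integrate to 1,
  which is the content of projecting the product measure along the injection
  \<open>pair_index\<close>.\<close>

lemma nn_integral_det_nonleads:
  "(\<integral>\<^sup>+q. ennreal \<bar>Determinant.det (block_matrix p n (- q ones, blocks q))\<bar> \<partial>(\<Pi>\<^sub>M \<beta>\<in>nonleads. std_gauss)) =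
    ennreal (LINT w|mu_W1 p n. \<bar>Determinant.det (block_matrix p n w)\<bar>)"
proof -
  let ?f = "\<lambda>w. ennreal \<bar>Determinant.det (block_matrix p n w)\<bar>"
  let ?B = "\<Pi>\<^sub>M k\<in>block_idx. std_gauss"
  let ?NL' = "nonleads - {ones}"
  have ones_NL: "ones \<in> nonleads" using ones_MI ones_notin_leads by simp
  then have nonleads: "nonleads = insert ones ?NL'" by blast
  have fin: "finite ?NL'" using finite_MI by simp
  have setsB: "sets ?B = sets (\<Pi>\<^sub>M k\<in>block_idx. borel)" by (intro sets_PiM_cong) auto
  have fm: "?f \<in> borel_measurable (borel \<Otimes>\<^sub>M (\<Pi>\<^sub>M k\<in>block_idx. borel))"
    using borel_measurable_det_block_matrix by measurable
  have fm': "?f \<in> borel_measurable (std_gauss \<Otimes>\<^sub>M ?B)"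
    using fm measurable_cong_sets[OF sets_mu_W1 refl] unfolding mu_W1_def by blast
  have comp: "(\<lambda>x. x i) \<in> borel_measurable (\<Pi>\<^sub>M \<beta>\<in>K. std_gauss)" if "i \<in> K" for i and K :: "'z set"
    using measurable_component_singleton[OF that, of "\<lambda>_. std_gauss"] by (simp add: measurable_cong_sets[OF refl sets_density])
  let ?T = "\<lambda>x. \<lambda>k\<in>block_idx. x (pair_index k)"
  have T: "?T \<in> measurable (\<Pi>\<^sub>M \<beta>\<in>K. std_gauss) (\<Pi>\<^sub>M k\<in>block_idx. borel)" if "pair_index ` block_idx \<subseteq> K" for K
    using that by (intro measurable_restrict comp) auto
  have restr: "?f (y, blocks q) = ?f (y, ?T q)" for y q
    using block_matrix_cong[of "blocks q" "?T q" y] by (simp add: blocks_eq)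
  have meas: "(\<lambda>q. ?f (- q ones, ?T q)) \<in> borel_measurable (\<Pi>\<^sub>M \<beta>\<in>nonleads. std_gauss)"
  proof (rule measurable_compose[OF _ fm])
    have "pair_index ` block_idx \<subseteq> nonleads" using pair_index_mem by auto
    then show "(\<lambda>q. (- q ones, ?T q)) \<in> measurable (\<Pi>\<^sub>M \<beta>\<in>nonleads. std_gauss) (borel \<Otimes>\<^sub>M (\<Pi>\<^sub>M k\<in>block_idx. borel))"
      using comp[of ones nonleads, OF ones_NL] by (intro measurable_Pair T borel_measurable_uminus)
  qed
  have meas': "(\<lambda>q. ?f (- q ones, ?T q)) \<in> borel_measurable (\<Pi>\<^sub>M \<beta>\<in>insert ones ?NL'. std_gauss)"
    using meas by (simp only: nonleads[symmetric])
  have "(\<integral>\<^sup>+q. ?f (- q ones, blocks q) \<partial>(\<Pi>\<^sub>M \<beta>\<in>nonleads. std_gauss)) =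
      (\<integral>\<^sup>+q. ?f (- q ones, ?T q) \<partial>(\<Pi>\<^sub>M \<beta>\<in>insert ones ?NL'. std_gauss))"
    unfolding restr nonleads[symmetric] ..
  also have "\<dots> = (\<integral>\<^sup>+y. (\<integral>\<^sup>+x. ?f (- (x(ones := y)) ones, ?T (x(ones := y))) \<partial>(\<Pi>\<^sub>M \<beta>\<in>?NL'. std_gauss)) \<partial>std_gauss)"
    by (rule gauss_product.product_nn_integral_insert_rev[OF fin _ meas']) simp
  also have "\<dots> = (\<integral>\<^sup>+y. (\<integral>\<^sup>+x. ?f (- y, ?T x) \<partial>(\<Pi>\<^sub>M \<beta>\<in>?NL'. std_gauss)) \<partial>std_gauss)"
  proof -
    have "?T (x(ones := y)) = ?T x" for x :: tensor and y
    proof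
      fix k
      have "k \<in> block_idx \<Longrightarrow> pair_index k \<noteq> ones" using pair_index_mem[of k] by simp
      then show "?T (x(ones := y)) k = ?T x k" by simp
    qed
    then show ?thesis by simp
  qed
  also have "\<dots> = (\<integral>\<^sup>+y. (\<integral>\<^sup>+c. ?f (- y, c) \<partial>?B) \<partial>std_gauss)"
  proof (rule nn_integral_cong)
    fix y
    have fy: "(\<lambda>c. ?f (- y, c)) \<in> borel_measurable ?B"
      using measurable_compose[OF measurable_Pair1'[of "- y" borel "\<Pi>\<^sub>M k\<in>block_idx. borel"] fm]
        measurable_cong_sets[OF setsB refl] by simp
    have "distr (\<Pi>\<^sub>M \<beta>\<in>?NL'. std_gauss) ?B ?T = ?B"
      using distr_PiM_reindex[of ?NL' "\<lambda>_. std_gauss" pair_index block_idx] prob_std_gauss inj_pair_index pair_index_mem by auto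
    moreover have "?T \<in> measurable (\<Pi>\<^sub>M \<beta>\<in>?NL'. std_gauss) ?B"
      unfolding measurable_cong_sets[OF refl setsB] by (rule T) (use pair_index_mem in auto)
    ultimately show "(\<integral>\<^sup>+x. ?f (- y, ?T x) \<partial>(\<Pi>\<^sub>M \<beta>\<in>?NL'. std_gauss)) = (\<integral>\<^sup>+c. ?f (- y, c) \<partial>?B)"
      using nn_integral_distr[of ?T "\<Pi>\<^sub>M \<beta>\<in>?NL'. std_gauss" ?B "\<lambda>c. ?f (- y, c)"] fy by simp
  qed
  also have "\<dots> = (\<integral>\<^sup>+y. (\<integral>\<^sup>+c. ?f (y, c) \<partial>?B) \<partial>std_gauss)"
  proof (rule nn_integral_std_gauss_uminus)
    interpret P: sigma_finite_measure ?B by (rule gauss_product.sigma_finite[OF finite_block_entries])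
    have "(\<lambda>y. \<integral>\<^sup>+c. ?f (y, c) \<partial>?B) \<in> borel_measurable std_gauss"
      using P.borel_measurable_nn_integral_fst[OF fm'] .
    then show "(\<lambda>y. \<integral>\<^sup>+c. ?f (y, c) \<partial>?B) \<in> borel_measurable borel" by simp
  qed
  also have "\<dots> = (\<integral>\<^sup>+w. ?f w \<partial>mu_W1 p n)"
  proof -
    interpret P: sigma_finite_measure ?B by (rule gauss_product.sigma_finite[OF finite_block_entries])
    show ?thesis unfolding mu_W1_def by (rule P.nn_integral_fst[OF fm'])
  qed
  also have "\<dots> = ennreal (LINT w|mu_W1 p n. \<bar>Determinant.det (block_matrix p n w)\<bar>)"
    by (rule nn_integral_eq_integral[OF integrable_det_block_matrix]) simp
  finally show ?thesis .
qed

section \<open>The integral over the directions\<close>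

definition "leads_of S = {lead i a | i a. i \<in> S \<and> a \<in> {2..n i}}"

lemma measurable_inverse_frame_radius:
  assumes "leads_of {j} \<subseteq> K"
  shows "(\<lambda>q. ennreal (inverse (frame_radius (n j) (dirs q j)) ^ n j)) \<in> borel_measurable (\<Pi>\<^sub>M \<beta>\<in>K. lborel)"
proof -
  have "(\<lambda>q. dirs q j a) \<in> borel_measurable (\<Pi>\<^sub>M \<beta>\<in>K. lborel)" if "a \<in> {2..n j}" for a
  proof -
    have "lead j a \<in> K" using that assms by (auto simp: leads_of_def)
    from measurable_component_singleton[OF this, of "\<lambda>_. lborel"] show ?thesis by (simp add: dirs_def)
  qed
  then have [measurable]: "(\<lambda>q. \<Sum>a=2..n j. (dirs q j a)\<^sup>2) \<in> borel_measurable (\<Pi>\<^sub>M \<beta>\<in>K. lborel)"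
    by (intro borel_measurable_sum borel_measurable_power)
  show ?thesis unfolding inverse_frame_radius_power by measurable
qed

text \<open>The factors depend on disjoint sets of coordinates. Slot \<open>i\<close> has
  \<open>n i - 1\<close> coordinates, so the exponent \<open>n i / 2\<close> from
  \<open>inverse_frame_radius_power\<close> is exactly the one for which
  \<open>nn_integral_cauchy_PiM\<close> is stated.\<close>

lemma nn_integral_leads_of:
  assumes "finite S" "S \<subseteq> {1..p}"
  shows "(\<integral>\<^sup>+q. (\<Prod>i\<in>S. ennreal (inverse (frame_radius (n i) (dirs q i)) ^ n i)) \<partial>(\<Pi>\<^sub>M \<beta>\<in>leads_of S. lborel)) =
    (\<Prod>i\<in>S. ennreal (pi powr (real (n i) / 2) / Gamma (real (n i) / 2)))"
  using assms
proof (induction S rule: finite_induct)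
  case empty
  have "leads_of {} = {}" by (simp add: leads_of_def)
  then show ?case by (simp add: PiM_empty)
next
  case (insert i S)
  have i: "i \<in> {1..p}" and S: "S \<subseteq> {1..p}" using insert.prems by auto
  let ?g = "\<lambda>i q. ennreal (inverse (frame_radius (n i) (dirs q i)) ^ n i)"
  let ?I = "leads_of {i}" and ?J = "leads_of S"
  have finl: "finite (leads_of T)" if "T \<subseteq> {1..p}" for T
    using that leads_MI by (intro finite_subset[OF _ finite_MI]) (auto simp: leads_of_def intro!: subsetD[OF leads_MI] lead_leads)
  have dis: "?I \<inter> ?J = {}"
  proof (rule ccontr)
    assume "?I \<inter> ?J \<noteq> {}"
    then obtain a j b where "lead i a = lead j b" "a \<in> {2..n i}" "j \<in> S" by (auto simp: leads_of_def)
    then show False using lead_inj[of i j a b] i S insert.hyps(2) by auto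
  qed
  have un: "leads_of (insert i S) = ?I \<union> ?J" by (auto simp: leads_of_def)
  note meas = measurable_inverse_frame_radius
  have dI: "?g i (merge ?I ?J (x, y)) = ?g i x" for x y
  proof -
    have "lead i a \<in> ?I" if "a \<in> {2..n i}" for a using that by (auto simp: leads_of_def)
    then have "(\<Sum>a=2..n i. (dirs (merge ?I ?J (x, y)) i a)\<^sup>2) = (\<Sum>a=2..n i. (dirs x i a)\<^sup>2)"
      by (intro sum.cong refl) (simp add: dirs_def merge_def)
    then show ?thesis unfolding inverse_frame_radius_power by (simp only:)
  qed
  have dJ: "?g j (merge ?I ?J (x, y)) = ?g j y" if j: "j \<in> S" for x y j
  proof -
    have "lead j a \<in> ?J" "lead j a \<notin> ?I" if "a \<in> {2..n j}" for a
      using that j dis by (auto simp: leads_of_def)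
    then have "(\<Sum>a=2..n j. (dirs (merge ?I ?J (x, y)) j a)\<^sup>2) = (\<Sum>a=2..n j. (dirs y j a)\<^sup>2)"
      by (intro sum.cong refl) (simp add: dirs_def merge_def)
    then show ?thesis unfolding inverse_frame_radius_power by (simp only:)
  qed
  have sub: "leads_of {j} \<subseteq> leads_of T" if "j \<in> T" for j T using that by (auto simp: leads_of_def)
  have "(\<integral>\<^sup>+q. (\<Prod>j\<in>insert i S. ?g j q) \<partial>(\<Pi>\<^sub>M \<beta>\<in>leads_of (insert i S). lborel)) =
      (\<integral>\<^sup>+x. (\<integral>\<^sup>+y. (\<Prod>j\<in>insert i S. ?g j (merge ?I ?J (x, y))) \<partial>(\<Pi>\<^sub>M \<beta>\<in>?J. lborel)) \<partial>(\<Pi>\<^sub>M \<beta>\<in>?I. lborel))"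
    unfolding un
  proof (rule lborel_product.product_nn_integral_fold[OF dis])
    show "finite ?I" "finite ?J" using finl i S by auto
    show "(\<lambda>q. \<Prod>j\<in>insert i S. ?g j q) \<in> borel_measurable (\<Pi>\<^sub>M \<beta>\<in>?I \<union> ?J. lborel)"
      unfolding un[symmetric] by (intro borel_measurable_prod_ennreal meas sub) 
  qed
  also have "\<dots> = (\<integral>\<^sup>+x. (\<integral>\<^sup>+y. ?g i x * (\<Prod>j\<in>S. ?g j y) \<partial>(\<Pi>\<^sub>M \<beta>\<in>?J. lborel)) \<partial>(\<Pi>\<^sub>M \<beta>\<in>?I. lborel))"
    using insert.hyps dI dJ by (simp add: prod.insert del: ennreal_power cong: prod.cong)
  also have "\<dots> = (\<integral>\<^sup>+x. ?g i x \<partial>(\<Pi>\<^sub>M \<beta>\<in>?I. lborel)) * (\<integral>\<^sup>+y. (\<Prod>j\<in>S. ?g j y) \<partial>(\<Pi>\<^sub>M \<beta>\<in>?J. lborel))"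
  proof -
    have "(\<lambda>y. \<Prod>j\<in>S. ?g j y) \<in> borel_measurable (\<Pi>\<^sub>M \<beta>\<in>?J. lborel)" by (intro borel_measurable_prod_ennreal meas sub)
    then show ?thesis using meas[of i ?I] by (simp only: nn_integral_cmult nn_integral_multc order_refl)
  qed
  also have "(\<integral>\<^sup>+x. ?g i x \<partial>(\<Pi>\<^sub>M \<beta>\<in>?I. lborel)) = ennreal (pi powr (real (n i) / 2) / Gamma (real (n i) / 2))"
  proof -
    have inj: "inj_on (lead i) {2..n i}" using lead_inj[OF i i] by (auto intro!: inj_onI)
    have I: "?I = lead i ` {2..n i}" by (auto simp: leads_of_def)
    have card: "real (card ?I) + 1 = real (n i)" using card_image[OF inj] n_pos[OF i] by (simp add: I of_nat_diff)
    have "(\<Sum>a=2..n i. (dirs x i a)\<^sup>2) = (\<Sum>\<beta>\<in>?I. (x \<beta>)\<^sup>2)" for x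
      unfolding I by (subst sum.reindex[OF inj]) (simp add: dirs_def)
    then show ?thesis unfolding inverse_frame_radius_power
      using nn_integral_cauchy_PiM[OF finl[of "{i}"]] i card by simp
  qed
  also have "(\<integral>\<^sup>+y. (\<Prod>j\<in>S. ?g j y) \<partial>(\<Pi>\<^sub>M \<beta>\<in>?J. lborel)) = (\<Prod>i\<in>S. ennreal (pi powr (real (n i) / 2) / Gamma (real (n i) / 2)))"
    by (rule insert.IH[OF S])
  finally show ?case using insert.hyps by simp
qed

end

subsection \<open>All charts together\<close>

context tensor_format
begin

abbreviation "crit_pts v \<equiv> critical_points p n (rank_one_manifold p n) v"
abbreviation "gauss \<equiv> gaussian_density p n"
abbreviation "tensor_lborel \<equiv> \<Pi>\<^sub>M \<alpha>\<in>MI. (lborel :: real measure)"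

text \<open>The critical points that the chart at \<open>\<kappa>\<close> sees. The set
  \<open>Z\<close> will consist of the centres of earlier charts, so that nothing is counted
  twice.\<close>

definition "num_crit_at \<kappa> Z v = emeasure (count_space UNIV) {x \<in> crit_pts v. x \<kappa> \<noteq> 0 \<and> (\<forall>\<beta>\<in>Z. x \<beta> = 0)}"
definition "chart_params Z = {q \<in> tensor_space p n. q ones \<noteq> 0 \<and> (\<forall>\<beta>\<in>Z. crit_of q \<beta> = 0)}"
definition "chart_coords Z = {z \<in> Rn N. tensor_of z \<in> chart_params Z}"

lemma space_tensor_lborel: "space tensor_lborel = tensor_space p n"
  by (simp add: space_PiM tensor_space_def)

lemma Phi_space: "Phi q \<in> tensor_space p n" by (simp add: Phi_def tensor_space_def)

lemma continuous_crit_of: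
  assumes "\<beta> \<in> MI" shows "continuous_on UNIV (\<lambda>z. crit_of (tensor_of z) \<beta>)"
proof -
  have "crit_of (tensor_of z) \<beta> = tensor_of z ones * P (tensor_of z) \<beta> ones" for z
    using assms by (simp add: crit_of_def P_ones)
  then show ?thesis
    by (simp add: continuous_on_mult C1_fun_deriv(1)[OF C1_fun_tensor_of] C1_fun_deriv(1)[OF C1_fun_P])
qed

lemma sigma_compact_chart_coords:
  assumes "Z \<subseteq> MI" shows "sigma_compact (chart_coords Z)"
proof -
  have "chart_coords Z = Rn N \<inter> {z. tensor_of z ones \<noteq> 0} \<inter> (\<Inter>\<beta>\<in>Z. {z. crit_of (tensor_of z) \<beta> = 0})"
    by (auto simp: chart_coords_def chart_params_def tensor_of_space)
  moreover have "open {z. tensor_of z ones \<noteq> 0}"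
    by (intro open_Collect_neq C1_fun_deriv(1)[OF C1_fun_tensor_of] continuous_on_const)
  moreover have "closed (\<Inter>\<beta>\<in>Z. {z. crit_of (tensor_of z) \<beta> = 0})"
    using assms by (intro closed_INT ballI closed_Collect_eq continuous_crit_of continuous_on_const) auto
  ultimately show ?thesis
    using sigma_compact_Rn by (simp add: sigma_compact_Int_closed sigma_compact_Int_open)
qed

lemma num_crit_at_ones:
  assumes v: "v \<in> tensor_space p n"
  shows "num_crit_at ones Z v = count_preimages Phi_coords (chart_coords Z) (coords_of v)"
proof -
  have eq: "Phi_coords z = coords_of v \<longleftrightarrow> Phi (tensor_of z) = v" for z
    using tensor_of_coords_of[OF v] tensor_of_coords_of[OF Phi_space] unfolding Phi_coords_def by metis
  have "bij_betw tensor_of {z \<in> chart_coords Z. Phi_coords z = coords_of v} {q \<in> chart_params Z. Phi q = v}"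
  proof (rule bij_betw_byWitness[where f'=coords_of])
    show "\<forall>z\<in>{z \<in> chart_coords Z. Phi_coords z = coords_of v}. coords_of (tensor_of z) = z" by (auto simp: chart_coords_def coords_of_tensor_of)
    show "\<forall>q\<in>{q \<in> chart_params Z. Phi q = v}. tensor_of (coords_of q) = q" by (auto simp: chart_params_def tensor_of_coords_of)
    show "tensor_of ` {z \<in> chart_coords Z. Phi_coords z = coords_of v} \<subseteq> {q \<in> chart_params Z. Phi q = v}" by (auto simp: chart_coords_def eq)
    show "coords_of ` {q \<in> chart_params Z. Phi q = v} \<subseteq> {z \<in> chart_coords Z. Phi_coords z = coords_of v}"
      using tensor_of_coords_of by (auto simp: chart_coords_def eq coords_of_Rn chart_params_def)
  qed
  from emeasure_count_space_bij[OF this] emeasure_count_space_bij[OF bij_betw_crit_of[OF v, of "\<lambda>x. \<forall>\<beta>\<in>Z. x \<beta> = 0"]]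
  show ?thesis unfolding num_crit_at_def count_preimages_def chart_params_def by simp
qed

lemma continuous_Phi_coords: "continuous_on UNIV Phi_coords"
  by (rule continuous_on_coordinatewise_then_product) (rule C1_fun_deriv(1)[OF C1_fun_Phi_coords])

lemma measurable_coords_of: "coords_of \<in> measurable tensor_lborel (Leb N)"
  unfolding coords_of_def[abs_def] Leb_def
  by (intro measurable_restrict measurable_component_singleton idx_MI) simp

lemma nn_integral_coords_of:
  assumes "f \<in> borel_measurable (Leb N)"
  shows "(\<integral>\<^sup>+q. f (coords_of q) \<partial>tensor_lborel) = (\<integral>\<^sup>+z. f z \<partial>Leb N)"
  unfolding coords_of_def Leb_def
  by (rule nn_integral_PiM_bij[OF sigma_finite_lborel _ idx(1)]) (use assms in \<open>simp_all add: Leb_def\<close>)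

lemma measurable_num_crit_at_ones:
  assumes "Z \<subseteq> MI" shows "num_crit_at ones Z \<in> borel_measurable tensor_lborel"
proof -
  have "(\<lambda>v. count_preimages Phi_coords (chart_coords Z) (coords_of v)) \<in> borel_measurable tensor_lborel"
    by (rule measurable_compose[OF measurable_coords_of borel_measurable_count_Leb[OF sigma_compact_chart_coords[OF assms]]])
       (rule continuous_on_subset[OF continuous_Phi_coords], simp)
  then show ?thesis
    by (subst measurable_cong[where g="\<lambda>v. count_preimages Phi_coords (chart_coords Z) (coords_of v)"]) (simp_all add: space_tensor_lborel num_crit_at_ones)
qed

lemma continuous_gauss: "continuous_on UNIV (\<lambda>z. gauss (tensor_of z))"
  unfolding gaussian_density_def
  by (intro continuous_intros C1_fun_deriv(1)[OF C1_fun_tensor_of])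
    (auto intro: C1_fun_deriv(1)[OF C1_fun_tensor_of])

definition "jac_factor q = \<bar>Determinant.det (block_matrix p n (- q ones, blocks q))\<bar> *
     (\<Prod>i=1..p. inverse (frame_radius (n i) (dirs q i)) ^ n i)"

lemma integral_num_crit_at_ones:
  assumes Z: "Z \<subseteq> MI"
  shows "(\<integral>\<^sup>+v. num_crit_at ones Z v * ennreal (gauss v) \<partial>tensor_lborel) =
    (\<integral>\<^sup>+q. indicator (chart_params Z) q * ennreal (jac_factor q) * ennreal (gauss (Phi q)) \<partial>tensor_lborel)"
proof -
  let ?h = "\<lambda>z. gauss (tensor_of z)"
  have sc: "sigma_compact (chart_coords Z)" by (rule sigma_compact_chart_coords[OF Z])
  have sub: "chart_coords Z \<subseteq> Rn N" by (auto simp: chart_coords_def)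
  have hm: "?h \<in> borel_measurable borel" by (rule borel_measurable_continuous_onI[OF continuous_gauss])
  have Fm: "Phi_coords \<in> borel_measurable borel" by (rule borel_measurable_continuous_onI[OF continuous_Phi_coords])
  have cF: "continuous_on (chart_coords Z) Phi_coords" by (rule continuous_on_subset[OF continuous_Phi_coords]) simp
  have cm: "count_preimages Phi_coords (chart_coords Z) \<in> borel_measurable (Leb N)" by (rule borel_measurable_count_Leb[OF sc cF])
  have hm': "(\<lambda>z. ennreal (?h z)) \<in> borel_measurable (Leb N)"
    by (rule measurable_compose[OF borel_measurable_Leb[OF hm] measurable_ennreal])
  have hFm: "(\<lambda>z. ennreal (?h (Phi_coords z))) \<in> borel_measurable (Leb N)"
    by (rule measurable_compose[OF borel_measurable_Leb[OF measurable_compose[OF Fm hm]] measurable_ennreal])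
  have jm: "(\<lambda>z. indicator (chart_coords Z) z * ennreal \<bar>jacobian N dPhi z\<bar>) \<in> borel_measurable (Leb N)"
    by (rule measurable_indicator_jacobian[OF sc]) (rule continuous_on_subset[OF C1_mapD(5)[OF C1_map_Phi_coords] sub])
  have "(\<integral>\<^sup>+v. num_crit_at ones Z v * ennreal (gauss v) \<partial>tensor_lborel) =
      (\<integral>\<^sup>+v. count_preimages Phi_coords (chart_coords Z) (coords_of v) * ennreal (?h (coords_of v)) \<partial>tensor_lborel)"
    by (intro nn_integral_cong) (simp add: space_tensor_lborel num_crit_at_ones tensor_of_coords_of)
  also have "\<dots> = (\<integral>\<^sup>+z. count_preimages Phi_coords (chart_coords Z) z * ennreal (?h z) \<partial>Leb N)"
    by (rule nn_integral_coords_of) (intro borel_measurable_times_ennreal cm hm')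
  also have "\<dots> = (\<integral>\<^sup>+z. indicator (chart_coords Z) z * ennreal \<bar>jacobian N dPhi z\<bar> * ennreal (?h (Phi_coords z)) \<partial>Leb N)"
    by (rule area_formula_weighted[OF C1_map_Phi_coords sc sub continuous_gauss])
  also have "\<dots> = (\<integral>\<^sup>+q. indicator (chart_coords Z) (coords_of q) * ennreal \<bar>jacobian N dPhi (coords_of q)\<bar> * ennreal (?h (Phi_coords (coords_of q))) \<partial>tensor_lborel)"
    by (rule nn_integral_coords_of[symmetric]) (intro borel_measurable_times_ennreal jm hFm)
  also have "\<dots> = (\<integral>\<^sup>+q. indicator (chart_params Z) q * ennreal (jac_factor q) * ennreal (gauss (Phi q)) \<partial>tensor_lborel)"
  proof (rule nn_integral_cong)
    fix q assume "q \<in> space tensor_lborel"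
    then have q: "tensor_of (coords_of q) = q" by (simp add: space_tensor_lborel tensor_of_coords_of)
    have "tensor_of (Phi_coords (coords_of q)) = Phi q" unfolding Phi_coords_def q by (rule tensor_of_coords_of[OF Phi_space])
    moreover have "indicator (chart_coords Z) (coords_of q) = (indicator (chart_params Z) q :: ennreal)"
      by (simp add: indicator_def chart_coords_def q coords_of_Rn)
    moreover have "\<bar>jacobian N dPhi (coords_of q)\<bar> = jac_factor q" unfolding jacobian_Phi_coords q jac_factor_def ..
    ultimately show "indicator (chart_coords Z) (coords_of q) * ennreal \<bar>jacobian N dPhi (coords_of q)\<bar> * ennreal (?h (Phi_coords (coords_of q))) =
      indicator (chart_params Z) q * ennreal (jac_factor q) * ennreal (gauss (Phi q))" by simp
  qed
  finally show ?thesis .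
qed

lemma AE_coord_nz:
  assumes l: "l \<in> MI" shows "AE q in tensor_lborel. q l \<noteq> 0"
proof (rule AE_I)
  let ?A = "Pi\<^sub>E MI (\<lambda>k. if k = l then {0::real} else UNIV)"
  show "{q \<in> space tensor_lborel. \<not> q l \<noteq> 0} \<subseteq> ?A" by (auto simp: space_PiM PiE_def)
  have "emeasure tensor_lborel ?A = (\<Prod>k\<in>MI. emeasure lborel (if k = l then {0::real} else UNIV))"
    by (rule lborel_product.emeasure_PiM[OF finite_MI]) auto
  also have "\<dots> = 0" using finite_MI l by (intro prod_zero) auto
  finally show "emeasure tensor_lborel ?A = 0" .
  show "?A \<in> sets tensor_lborel" by (intro sets_PiM_I_finite finite_MI) auto
qed

text \<open>A coordinate of \<open>crit_of q\<close> is \<open>q ones\<close> times a product of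
  coordinates of the vectors \<open>axes q i\<close>. By \<open>axes_1_nz\<close> and
  \<open>axes_other\<close> such a factor vanishes only if an entry of \<open>q\<close> at a lead
  does, and almost every \<open>q\<close> has no zero there.\<close>

lemma integral_num_crit_at_ones_null:
  assumes Z: "Z \<subseteq> MI" and \<beta>: "\<beta> \<in> Z"
  shows "(\<integral>\<^sup>+v. num_crit_at ones Z v * ennreal (gauss v) \<partial>tensor_lborel) = 0"
proof -
  have "finite leads" using finite_subset[OF leads_MI finite_MI] .
  then have "AE q in tensor_lborel. \<forall>l\<in>leads. q l \<noteq> 0"
    using AE_coord_nz leads_MI by (simp add: AE_finite_all subset_iff)
  then have "AE q in tensor_lborel. indicator (chart_params Z) q * ennreal (jac_factor q) * ennreal (gauss (Phi q)) = 0"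
  proof (rule AE_mp, intro AE_I2 impI)
    fix q :: tensor assume nz: "\<forall>l\<in>leads. q l \<noteq> 0"
    have "q \<notin> chart_params Z"
    proof
      assume "q \<in> chart_params Z"
      then have q: "q ones \<noteq> 0" "crit_of q \<beta> = 0" using \<beta> by (auto simp: chart_params_def)
      have \<beta>M: "\<beta> \<in> MI" using Z \<beta> by auto
      have "(\<Prod>i=1..p. axes q i (\<beta> i)) = 0" using q \<beta>M by (simp add: crit_of_def rank_one_apply)
      then obtain i where i: "i \<in> {1..p}" "axes q i (\<beta> i) = 0" by (auto simp: prod_zero_iff)
      show False
      proof (cases "\<beta> i = 1")
        case True
        then show False using i(2) axes_1_nz by simp
      next
        case False
        then have "lead i (\<beta> i) \<in> leads" using multi_indexD[OF \<beta>M i(1)] i(1) by (intro lead_leads) auto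
        then show False using i(2) nz frame_radius_pos[of "n i" "dirs q i"] by (simp add: axes_other[OF False])
      qed
    qed
    then show "indicator (chart_params Z) q * ennreal (jac_factor q) * ennreal (gauss (Phi q)) = 0" by simp
  qed
  then have "(\<integral>\<^sup>+q. indicator (chart_params Z) q * ennreal (jac_factor q) * ennreal (gauss (Phi q)) \<partial>tensor_lborel) = (\<integral>\<^sup>+q. 0 \<partial>tensor_lborel)"
    by (rule nn_integral_cong_AE)
  then show ?thesis by (simp add: integral_num_crit_at_ones[OF Z])
qed

lemma card_MI: "real N = real (\<Prod>i=1..p. n i)"
  by (simp add: multi_index_def card_PiE)

text \<open>As \<open>Phi\<close> is isometric in the entries outside the leads,
  \<open>N - m\<close> of the \<open>N\<close> normalising factors are absorbed by their normal
  densities; the other \<open>m\<close> remain as a power of \<open>2 * pi\<close>.\<close>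

lemma gauss_Phi: "gauss (Phi q) = (2 * pi) powr - (real m / 2) * (\<Prod>\<beta>\<in>nonleads. std_normal_density (q \<beta>))"
proof -
  have cNL: "card nonleads = N - m"
    using card_Diff_subset[OF finite_subset[OF leads_MI finite_MI] leads_MI] by (simp add: card_leads)
  have fNL: "finite nonleads" using finite_MI by simp
  have "(\<Sum>\<alpha>\<in>MI. (Phi q \<alpha>)\<^sup>2) = (\<Sum>\<beta>\<in>nonleads. (q \<beta>)\<^sup>2)"
    unfolding sum_Phi_sq by (rule sum.mono_neutral_cong_right) (auto simp: finite_MI wt_def)
  then have "gauss (Phi q) = (2 * pi) powr - (real N / 2) * exp (- (\<Sum>\<beta>\<in>nonleads. (q \<beta>)\<^sup>2) / 2)"
    by (simp add: gaussian_density_def card_MI powr_minus_divide)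
  also have "exp (- (\<Sum>\<beta>\<in>nonleads. (q \<beta>)\<^sup>2) / 2) = (\<Prod>\<beta>\<in>nonleads. exp (- (q \<beta>)\<^sup>2 / 2))"
    using fNL by (simp add: exp_sum[symmetric] sum_negf sum_divide_distrib)
  also have "(2 * pi) powr - (real N / 2) = (2 * pi) powr - (real m / 2) * (1 / sqrt (2 * pi)) ^ (N - m)"
  proof -
    have "(1 / sqrt (2 * pi)) ^ (N - m) = (2 * pi) powr - (real (N - m) / 2)"
      by (simp add: powr_half_sqrt[symmetric] powr_minus_divide[symmetric] powr_realpow[symmetric] powr_powr)
    moreover have "- (real N / 2) = - (real m / 2) + - (real (N - m) / 2)"
      using m_le_N by (simp add: of_nat_diff field_simps)
    ultimately show ?thesis by (simp only: powr_add)
  qed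
  also have "(2 * pi) powr - (real m / 2) * (1 / sqrt (2 * pi)) ^ (N - m) * (\<Prod>\<beta>\<in>nonleads. exp (- (q \<beta>)\<^sup>2 / 2)) =
      (2 * pi) powr - (real m / 2) * (\<Prod>\<beta>\<in>nonleads. std_normal_density (q \<beta>))"
    unfolding std_normal_density_def prod.distrib by (simp add: cNL)
  finally show ?thesis .
qed

lemma measurable_det_blocks:
  assumes "ones \<in> K" "pair_index ` block_idx \<subseteq> K"
  shows "(\<lambda>q. \<bar>Determinant.det (block_matrix p n (- q ones, blocks q))\<bar>) \<in> borel_measurable (\<Pi>\<^sub>M \<beta>\<in>K. lborel)"
proof -
  have comp: "(\<lambda>x. x i) \<in> borel_measurable (\<Pi>\<^sub>M \<beta>\<in>K. lborel)" if "i \<in> K" for i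
    using measurable_component_singleton[OF that, of "\<lambda>_. lborel"] by simp
  let ?T = "\<lambda>x. \<lambda>k\<in>block_idx. x (pair_index k)"
  have T: "?T \<in> measurable (\<Pi>\<^sub>M \<beta>\<in>K. lborel) (\<Pi>\<^sub>M k\<in>block_idx. borel)"
    using assms(2) by (intro measurable_restrict comp) auto
  have "block_matrix p n (- q ones, blocks q) = block_matrix p n (- q ones, ?T q)" for q
    by (rule block_matrix_cong) (simp add: blocks_eq)
  moreover have "(\<lambda>q. Determinant.det (block_matrix p n (- q ones, ?T q))) \<in> borel_measurable (\<Pi>\<^sub>M \<beta>\<in>K. lborel)"
    by (rule measurable_compose[OF measurable_Pair[OF borel_measurable_uminus[OF comp[OF assms(1)]] T] borel_measurable_det_block_matrix])
  ultimately show ?thesis by simp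
qed

text \<open>The integrand is a constant times a function of the leads, the product of radii, times a
  function of the other entries, the Gaussian density times the determinant. So the integral splits
  into the two that have been computed.\<close>

lemma integral_num_crit_at_ones_empty:
  "(\<integral>\<^sup>+v. num_crit_at ones {} v * ennreal (gauss v) \<partial>tensor_lborel) =
    ennreal ((2 * pi) powr - (real m / 2) * (\<Prod>i=1..p. pi powr (real (n i) / 2) / Gamma (real (n i) / 2)) *
      (LINT w|mu_W1 p n. \<bar>Determinant.det (block_matrix p n w)\<bar>))"
proof -
  let ?A = "\<lambda>q. \<Prod>i=1..p. ennreal (inverse (frame_radius (n i) (dirs q i)) ^ n i)"
  let ?d = "\<lambda>q. ennreal \<bar>Determinant.det (block_matrix p n (- q ones, blocks q))\<bar>"
  let ?B = "\<lambda>q. (\<Prod>\<beta>\<in>nonleads. ennreal (std_normal_density (q \<beta>))) * ?d q"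
  let ?c = "(2 * pi) powr - (real m / 2)"
  have fin: "finite leads" "finite nonleads" using finite_subset[OF leads_MI finite_MI] finite_MI by auto
  have MI: "leads \<union> nonleads = MI" using leads_MI by auto
  have pi: "pair_index ` block_idx \<subseteq> nonleads" using pair_index_mem by auto
  have o: "ones \<in> nonleads" using ones_MI ones_notin_leads by simp
  have Gpos: "0 \<le> Gamma (real (n i) / 2)" if "i \<in> {1..p}" for i
    using n_pos[OF that] by (intro less_imp_le Gamma_real_pos) simp
  have lo: "leads_of {1..p} = leads" by (auto simp: leads_of_def leads_def)
  have frpos: "0 \<le> inverse (frame_radius (n i) (dirs q i)) ^ n i" for i q
    using frame_radius_pos[of "n i" "dirs q i"] by simp
  have mA: "?A \<in> borel_measurable (\<Pi>\<^sub>M \<beta>\<in>K. lborel)" if "leads \<subseteq> K" for K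
  proof (intro borel_measurable_prod_ennreal measurable_inverse_frame_radius)
    show "leads_of {i} \<subseteq> K" if "i \<in> {1..p}" for i
      using that \<open>leads \<subseteq> K\<close> by (auto simp: leads_of_def leads_def)
  qed
  have comp: "(\<lambda>x. x i) \<in> borel_measurable (\<Pi>\<^sub>M \<beta>\<in>K. lborel)" if "i \<in> K" for i and K :: "(nat \<Rightarrow> nat) set"
    using measurable_component_singleton[OF that, of "\<lambda>_. lborel"] by simp
  have md: "?d \<in> borel_measurable (\<Pi>\<^sub>M \<beta>\<in>K. lborel)" if "nonleads \<subseteq> K" for K
    using that o pi by (intro measurable_compose[OF _ measurable_ennreal] measurable_det_blocks) auto
  have mp: "(\<lambda>q. \<Prod>\<beta>\<in>nonleads. ennreal (std_normal_density (q \<beta>))) \<in> borel_measurable (\<Pi>\<^sub>M \<beta>\<in>K. lborel)" if "nonleads \<subseteq> K" for K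
    using that by (intro borel_measurable_prod_ennreal measurable_compose[OF _ measurable_ennreal]
      measurable_compose[OF comp borel_measurable_normal_density]) auto
  have mB: "?B \<in> borel_measurable (\<Pi>\<^sub>M \<beta>\<in>K. lborel)" if "nonleads \<subseteq> K" for K
    by (intro borel_measurable_times_ennreal mp md that)
  have "AE q in tensor_lborel. indicator (chart_params {}) q * ennreal (jac_factor q) * ennreal (gauss (Phi q)) = ennreal ?c * (?A q * ?B q)"
  proof (rule AE_mp[OF AE_coord_nz[OF ones_MI]], intro AE_I2 impI)
    fix q assume "q \<in> space tensor_lborel" "q ones \<noteq> 0"
    then have "q \<in> chart_params {}" by (simp add: chart_params_def space_tensor_lborel)
    moreover have "ennreal (jac_factor q) = ?d q * ?A q"
      unfolding jac_factor_def using frpos by (simp add: ennreal_mult prod_nonneg prod_ennreal)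
    moreover have "ennreal (gauss (Phi q)) = ennreal ?c * (\<Prod>\<beta>\<in>nonleads. ennreal (std_normal_density (q \<beta>)))"
      unfolding gauss_Phi by (simp add: ennreal_mult prod_nonneg prod_ennreal)
    ultimately show "indicator (chart_params {}) q * ennreal (jac_factor q) * ennreal (gauss (Phi q)) = ennreal ?c * (?A q * ?B q)"
      by (simp add: mult_ac)
  qed
  then have "(\<integral>\<^sup>+v. num_crit_at ones {} v * ennreal (gauss v) \<partial>tensor_lborel) = (\<integral>\<^sup>+q. ennreal ?c * (?A q * ?B q) \<partial>tensor_lborel)"
    unfolding integral_num_crit_at_ones[OF empty_subsetI] by (rule nn_integral_cong_AE)
  also have "\<dots> = ennreal ?c * (\<integral>\<^sup>+q. ?A q * ?B q \<partial>tensor_lborel)"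
    by (rule nn_integral_cmult) (intro borel_measurable_times_ennreal[of ?A tensor_lborel ?B] mA mB leads_MI Diff_subset)
  also have "(\<integral>\<^sup>+q. ?A q * ?B q \<partial>tensor_lborel) = (\<integral>\<^sup>+x. ?A x \<partial>(\<Pi>\<^sub>M \<beta>\<in>leads. lborel)) * (\<integral>\<^sup>+y. ?B y \<partial>(\<Pi>\<^sub>M \<beta>\<in>nonleads. lborel))"
  proof -
    have "(\<integral>\<^sup>+q. ?A q * ?B q \<partial>(\<Pi>\<^sub>M \<beta>\<in>leads \<union> nonleads. lborel)) =
        (\<integral>\<^sup>+x. (\<integral>\<^sup>+y. ?A (merge leads nonleads (x, y)) * ?B (merge leads nonleads (x, y)) \<partial>(\<Pi>\<^sub>M \<beta>\<in>nonleads. lborel)) \<partial>(\<Pi>\<^sub>M \<beta>\<in>leads. lborel))"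
    proof (rule lborel_product.product_nn_integral_fold[OF _ fin])
      show "(\<lambda>q. ?A q * ?B q) \<in> borel_measurable (\<Pi>\<^sub>M \<beta>\<in>leads \<union> nonleads. lborel)"
        by (intro borel_measurable_times_ennreal[of ?A _ ?B] mA mB) auto
    qed auto
    also have "\<dots> = (\<integral>\<^sup>+x. (\<integral>\<^sup>+y. ?A x * ?B y \<partial>(\<Pi>\<^sub>M \<beta>\<in>nonleads. lborel)) \<partial>(\<Pi>\<^sub>M \<beta>\<in>leads. lborel))"
    proof (intro nn_integral_cong arg_cong2[where f="(*)"])
      fix x y :: tensor
      let ?q = "merge leads nonleads (x, y)"
      have l: "?q (lead i a) = x (lead i a)" if "i \<in> {1..p}" "a \<in> {2..n i}" for i a
        using lead_leads[OF that] by (simp add: merge_def)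
      have nl: "?q \<beta> = y \<beta>" if "\<beta> \<in> nonleads" for \<beta> using that by (simp add: merge_def)
      show "?A ?q = ?A x"
      proof (rule prod.cong[OF refl])
        fix i assume i: "i \<in> {1..p}"
        have "(\<Sum>a=2..n i. (dirs ?q i a)\<^sup>2) = (\<Sum>a=2..n i. (dirs x i a)\<^sup>2)"
          using l[OF i] by (intro sum.cong refl) (simp add: dirs_def)
        then show "ennreal (inverse (frame_radius (n i) (dirs ?q i)) ^ n i) = ennreal (inverse (frame_radius (n i) (dirs x i)) ^ n i)"
          unfolding inverse_frame_radius_power by (simp only:)
      qed
      show "(\<Prod>\<beta>\<in>nonleads. ennreal (std_normal_density (?q \<beta>))) = (\<Prod>\<beta>\<in>nonleads. ennreal (std_normal_density (y \<beta>)))"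
        using nl by (intro prod.cong refl) simp
      have "block_matrix p n (- ?q ones, blocks ?q) = block_matrix p n (- ?q ones, blocks y)"
        using nl pi by (intro block_matrix_cong) (simp add: blocks_eq image_subset_iff)
      then show "?d ?q = ?d y" using nl[OF o] by simp
    qed
    also have "\<dots> = (\<integral>\<^sup>+x. ?A x \<partial>(\<Pi>\<^sub>M \<beta>\<in>leads. lborel)) * (\<integral>\<^sup>+y. ?B y \<partial>(\<Pi>\<^sub>M \<beta>\<in>nonleads. lborel))"
      by (simp only: nn_integral_cmult[OF mB[OF order_refl]] nn_integral_multc[OF mA[OF order_refl]])
    finally show ?thesis unfolding MI .
  qed
  also have "(\<integral>\<^sup>+x. ?A x \<partial>(\<Pi>\<^sub>M \<beta>\<in>leads. lborel)) = (\<Prod>i=1..p. ennreal (pi powr (real (n i) / 2) / Gamma (real (n i) / 2)))"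
    using nn_integral_leads_of[of "{1..p}"] by (simp add: lo)
  also have "(\<integral>\<^sup>+y. ?B y \<partial>(\<Pi>\<^sub>M \<beta>\<in>nonleads. lborel)) = (\<integral>\<^sup>+q. ?d q \<partial>(\<Pi>\<^sub>M \<beta>\<in>nonleads. std_gauss))"
    unfolding PiM_density_lborel[OF fin(2) borel_measurable_normal_density sigma_finite_std_gauss, symmetric]
    by (rule nn_integral_density[symmetric]) (intro mp md order_refl)+
  also have "\<dots> = ennreal (LINT w|mu_W1 p n. \<bar>Determinant.det (block_matrix p n w)\<bar>)"
    by (rule nn_integral_det_nonleads)
  also have "(\<Prod>i=1..p. ennreal (pi powr (real (n i) / 2) / Gamma (real (n i) / 2))) =
      ennreal (\<Prod>i=1..p. pi powr (real (n i) / 2) / Gamma (real (n i) / 2))"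
    using Gpos by (intro prod_ennreal divide_nonneg_nonneg) auto
  finally have *: "(\<integral>\<^sup>+v. num_crit_at ones {} v * ennreal (gauss v) \<partial>tensor_lborel) =
      ennreal ?c * (ennreal (\<Prod>i=1..p. pi powr (real (n i) / 2) / Gamma (real (n i) / 2)) *
        ennreal (LINT w|mu_W1 p n. \<bar>Determinant.det (block_matrix p n w)\<bar>))" .
  have X: "0 \<le> (\<Prod>i=1..p. pi powr (real (n i) / 2) / Gamma (real (n i) / 2))"
    using Gpos by (intro prod_nonneg divide_nonneg_nonneg) auto
  have c: "0 \<le> ?c" by simp
  show ?thesis
    unfolding * ennreal_mult'[OF mult_nonneg_nonneg[OF c X]] ennreal_mult'[OF c] by (simp only: mult.assoc)
qed

section \<open>Exchanging the charts\<close>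

definition "swap_slots \<kappa> \<alpha> = (\<lambda>i\<in>{1..p}. Transposition.transpose 1 (\<kappa> i) (\<alpha> i))"
text \<open>An involution that permutes the basis vectors within each slot. It preserves rank-one
  tensors, the inner product and the Gaussian density, hence critical points and expectations, and
  it carries the coordinate at \<open>\<kappa>\<close> to the one at \<open>ones\<close>.\<close>

definition "relabel \<kappa> v = (\<lambda>\<alpha>\<in>MI. v (swap_slots \<kappa> \<alpha>))" for v :: tensor

lemma swap_slots_MI:
  assumes "\<kappa> \<in> MI" "\<alpha> \<in> MI" shows "swap_slots \<kappa> \<alpha> \<in> MI"
proof -
  have "Transposition.transpose 1 (\<kappa> i) (\<alpha> i) \<in> {1..n i}" if "i \<in> {1..p}" for i
    using multi_indexD[OF assms(1) that] multi_indexD[OF assms(2) that]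
    by (cases "\<alpha> i = 1"; cases "\<alpha> i = \<kappa> i") auto
  then show ?thesis by (auto simp: multi_index_def swap_slots_def)
qed

lemma swap_slots_involution: "\<alpha> \<in> MI \<Longrightarrow> swap_slots \<kappa> (swap_slots \<kappa> \<alpha>) = \<alpha>"
  by (auto simp: multi_index_def swap_slots_def fun_eq_iff PiE_iff extensional_def)

lemma swap_slots_ones: "\<kappa> \<in> MI \<Longrightarrow> swap_slots \<kappa> ones = \<kappa>"
  by (auto simp: multi_index_def swap_slots_def ones_def fun_eq_iff PiE_iff extensional_def)

lemma bij_betw_swap_slots: "\<kappa> \<in> MI \<Longrightarrow> bij_betw (swap_slots \<kappa>) MI MI"
  by (rule bij_betw_byWitness[where f'="swap_slots \<kappa>"]) (auto simp: swap_slots_involution swap_slots_MI)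

lemma relabel_involution: "\<kappa> \<in> MI \<Longrightarrow> v \<in> tensor_space p n \<Longrightarrow> relabel \<kappa> (relabel \<kappa> v) = v"
  by (auto simp: relabel_def fun_eq_iff swap_slots_MI swap_slots_involution tensor_space_def PiE_iff extensional_def)

lemma relabel_swap_slots: "\<kappa> \<in> MI \<Longrightarrow> \<alpha> \<in> MI \<Longrightarrow> relabel \<kappa> v (swap_slots \<kappa> \<alpha>) = v \<alpha>"
  by (simp add: relabel_def swap_slots_MI swap_slots_involution)

lemma crit_pts_space: "x \<in> crit_pts v \<Longrightarrow> x \<in> tensor_space p n"
  by (auto simp: critical_points_def rank_one_manifold_def rank_one_def tensor_space_def)

lemma crit_pts_nonzero: "x \<in> crit_pts v \<Longrightarrow> \<exists>\<alpha>\<in>MI. x \<alpha> \<noteq> 0"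
proof (rule ccontr)
  assume x: "x \<in> crit_pts v" and "\<not> (\<exists>\<alpha>\<in>MI. x \<alpha> \<noteq> 0)"
  then have "x = (\<lambda>\<alpha>\<in>MI. 0)"
    using crit_pts_space[OF x] by (auto simp: tensor_space_def fun_eq_iff PiE_iff extensional_def)
  then show False using x by (simp add: critical_points_def rank_one_manifold_def)
qed

lemma relabel_crit_pts:
  assumes \<kappa>: "\<kappa> \<in> MI" and x: "x \<in> crit_pts v"
  shows "relabel \<kappa> x \<in> crit_pts (relabel \<kappa> v)"
proof -
  obtain X where X: "x = rank_one p n X" using x by (auto simp: critical_points_def rank_one_manifold_def)
  obtain \<alpha> where \<alpha>: "\<alpha> \<in> MI" "x \<alpha> \<noteq> 0" using crit_pts_nonzero[OF x] by blast
  let ?t = "\<lambda>i. Transposition.transpose 1 (\<kappa> i)"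
  define X' where "X' i a = X i (?t i a)" for i a
  have x1: "x = (\<lambda>\<alpha>\<in>MI. 1 * rank_one p n X \<alpha>)" unfolding X rank_one_def by (rule ext) simp
  have swap_slots: "rank_one p n Y (swap_slots \<kappa> \<beta>) = rank_one p n (\<lambda>i a. Y i (?t i a)) \<beta>" if "\<beta> \<in> MI" for Y \<beta>
    using that by (simp add: rank_one_apply swap_slots_MI \<kappa>) (simp add: swap_slots_def)
  have x2: "relabel \<kappa> x = (\<lambda>\<alpha>\<in>MI. 1 * rank_one p n X' \<alpha>)"
    by (simp add: relabel_def X swap_slots X'_def[abs_def] cong: restrict_cong)
  have nz: "swap_slots \<kappa> \<alpha> \<in> MI" "relabel \<kappa> x (swap_slots \<kappa> \<alpha>) \<noteq> 0"
    using \<alpha> by (simp_all add: swap_slots_MI \<kappa> relabel_swap_slots)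
  have "tensor_inner p n (\<lambda>\<alpha>. relabel \<kappa> v \<alpha> - relabel \<kappa> x \<alpha>) (rank_one p n (X'(i := w))) = 0" if i: "i \<in> {1..p}" for i w
  proof -
    have "tensor_inner p n (\<lambda>\<alpha>. relabel \<kappa> v \<alpha> - relabel \<kappa> x \<alpha>) (rank_one p n (X'(i := w))) =
        (\<Sum>\<beta>\<in>MI. (relabel \<kappa> v (swap_slots \<kappa> \<beta>) - relabel \<kappa> x (swap_slots \<kappa> \<beta>)) * rank_one p n (X'(i := w)) (swap_slots \<kappa> \<beta>))"
      unfolding tensor_inner_def by (rule sum.reindex_bij_betw[OF bij_betw_swap_slots[OF \<kappa>], symmetric])
    also have "\<dots> = tensor_inner p n (\<lambda>\<alpha>. v \<alpha> - x \<alpha>) (rank_one p n (X(i := \<lambda>a. w (?t i a))))"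
      unfolding tensor_inner_def
    proof (rule sum.cong[OF refl])
      fix \<beta> assume \<beta>: "\<beta> \<in> MI"
      have "(\<lambda>j a. (X'(i := w)) j (?t j a)) = X(i := \<lambda>a. w (?t i a))"
        by (auto simp: fun_eq_iff X'_def)
      then show "(relabel \<kappa> v (swap_slots \<kappa> \<beta>) - relabel \<kappa> x (swap_slots \<kappa> \<beta>)) * rank_one p n (X'(i := w)) (swap_slots \<kappa> \<beta>) =
          (v \<beta> - x \<beta>) * rank_one p n (X(i := \<lambda>a. w (?t i a))) \<beta>"
        using \<beta> by (simp add: relabel_swap_slots \<kappa> swap_slots)
    qed
    also have "\<dots> = 0"
      using critical_points_iff[where c=1 and X=X and x=x and \<alpha>=\<alpha> and v=v, OF p_pos one_neq_zero x1 \<alpha>] x i by blast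
    finally show ?thesis .
  qed
  then show ?thesis
    using critical_points_iff[where c=1 and X=X' and x="relabel \<kappa> x" and \<alpha>="swap_slots \<kappa> \<alpha>" and v="relabel \<kappa> v", OF p_pos one_neq_zero x2 nz]
    by blast
qed

lemma num_crit_at_relabel:
  assumes \<kappa>: "\<kappa> \<in> MI" and Z: "Z \<subseteq> MI" and v: "v \<in> tensor_space p n"
  shows "num_crit_at \<kappa> Z v = num_crit_at ones (swap_slots \<kappa> ` Z) (relabel \<kappa> v)"
  unfolding num_crit_at_def
proof (rule emeasure_count_space_bij[of "relabel \<kappa>"], rule bij_betw_byWitness[where f'="relabel \<kappa>"])
  have o: "relabel \<kappa> x ones = x \<kappa>" for x
    using ones_MI by (simp add: relabel_def swap_slots_ones \<kappa>)
  have k: "relabel \<kappa> x \<kappa> = x ones" for x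
    using relabel_swap_slots[OF \<kappa> ones_MI, of x] by (simp add: swap_slots_ones \<kappa>)
  have s: "relabel \<kappa> x (swap_slots \<kappa> \<beta>) = x \<beta>" if "\<beta> \<in> Z" for x \<beta> using relabel_swap_slots[OF \<kappa>] that Z by auto
  have s': "relabel \<kappa> x \<beta> = x (swap_slots \<kappa> \<beta>)" if "\<beta> \<in> Z" for x \<beta> using that Z by (auto simp: relabel_def)
  show "\<forall>x\<in>{x \<in> crit_pts v. x \<kappa> \<noteq> 0 \<and> (\<forall>\<beta>\<in>Z. x \<beta> = 0)}. relabel \<kappa> (relabel \<kappa> x) = x"
    using relabel_involution[OF \<kappa>] crit_pts_space by blast
  show "\<forall>x\<in>{x \<in> crit_pts (relabel \<kappa> v). x ones \<noteq> 0 \<and> (\<forall>\<beta>\<in>swap_slots \<kappa> ` Z. x \<beta> = 0)}. relabel \<kappa> (relabel \<kappa> x) = x"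
    using relabel_involution[OF \<kappa>] crit_pts_space by blast
  show "relabel \<kappa> ` {x \<in> crit_pts v. x \<kappa> \<noteq> 0 \<and> (\<forall>\<beta>\<in>Z. x \<beta> = 0)} \<subseteq>
      {x \<in> crit_pts (relabel \<kappa> v). x ones \<noteq> 0 \<and> (\<forall>\<beta>\<in>swap_slots \<kappa> ` Z. x \<beta> = 0)}"
    using relabel_crit_pts[OF \<kappa>] by (auto simp: o s)
  show "relabel \<kappa> ` {x \<in> crit_pts (relabel \<kappa> v). x ones \<noteq> 0 \<and> (\<forall>\<beta>\<in>swap_slots \<kappa> ` Z. x \<beta> = 0)} \<subseteq>
      {x \<in> crit_pts v. x \<kappa> \<noteq> 0 \<and> (\<forall>\<beta>\<in>Z. x \<beta> = 0)}"
    using relabel_crit_pts[OF \<kappa>, of _ "relabel \<kappa> v"] relabel_involution[OF \<kappa> v] by (auto simp: k s')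
qed

lemma measurable_relabel: "\<kappa> \<in> MI \<Longrightarrow> relabel \<kappa> \<in> measurable tensor_lborel tensor_lborel"
  unfolding relabel_def[abs_def] by (intro measurable_restrict measurable_component_singleton swap_slots_MI)

lemma measurable_num_crit_at:
  assumes "\<kappa> \<in> MI" "Z \<subseteq> MI" shows "num_crit_at \<kappa> Z \<in> borel_measurable tensor_lborel"
proof -
  have "swap_slots \<kappa> ` Z \<subseteq> MI" using assms swap_slots_MI by auto
  then have "(\<lambda>v. num_crit_at ones (swap_slots \<kappa> ` Z) (relabel \<kappa> v)) \<in> borel_measurable tensor_lborel"
    by (intro measurable_compose[OF measurable_relabel measurable_num_crit_at_ones] assms)
  then show ?thesis
    by (subst measurable_cong[where g="\<lambda>v. num_crit_at ones (swap_slots \<kappa> ` Z) (relabel \<kappa> v)"]) (simp_all add: space_tensor_lborel num_crit_at_relabel assms)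
qed

lemma measurable_gauss: "(\<lambda>v. ennreal (gauss v)) \<in> borel_measurable tensor_lborel"
proof -
  have "(\<lambda>v. ennreal (gauss (tensor_of (coords_of v)))) \<in> borel_measurable tensor_lborel"
    by (rule measurable_compose[OF measurable_compose[OF measurable_coords_of
          borel_measurable_Leb[OF borel_measurable_continuous_onI[OF continuous_gauss]]] measurable_ennreal])
  then show ?thesis
    by (subst measurable_cong[where g="\<lambda>v. ennreal (gauss (tensor_of (coords_of v)))"]) (simp_all add: space_tensor_lborel tensor_of_coords_of)
qed

lemma integral_num_crit_at_relabel:
  assumes \<kappa>: "\<kappa> \<in> MI" and Z: "Z \<subseteq> MI"
  shows "(\<integral>\<^sup>+v. num_crit_at \<kappa> Z v * ennreal (gauss v) \<partial>tensor_lborel) = (\<integral>\<^sup>+v. num_crit_at ones (swap_slots \<kappa> ` Z) v * ennreal (gauss v) \<partial>tensor_lborel)"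
proof -
  have Z': "swap_slots \<kappa> ` Z \<subseteq> MI" using \<kappa> Z swap_slots_MI by auto
  have gauss: "gauss (relabel \<kappa> v) = gauss v" for v
  proof -
    have "(\<Sum>\<alpha>\<in>MI. (relabel \<kappa> v \<alpha>)\<^sup>2) = (\<Sum>\<alpha>\<in>MI. (v (swap_slots \<kappa> \<alpha>))\<^sup>2)" by (simp add: relabel_def)
    also have "\<dots> = (\<Sum>\<alpha>\<in>MI. (v \<alpha>)\<^sup>2)" by (rule sum.reindex_bij_betw[OF bij_betw_swap_slots[OF \<kappa>]])
    finally show ?thesis by (simp add: gaussian_density_def)
  qed
  let ?f = "\<lambda>v. num_crit_at ones (swap_slots \<kappa> ` Z) v * ennreal (gauss v)"
  have fm: "?f \<in> borel_measurable tensor_lborel"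
    by (intro borel_measurable_times_ennreal measurable_num_crit_at_ones Z' measurable_gauss)
  have "(\<integral>\<^sup>+v. num_crit_at \<kappa> Z v * ennreal (gauss v) \<partial>tensor_lborel) = (\<integral>\<^sup>+v. ?f (relabel \<kappa> v) \<partial>tensor_lborel)"
    by (intro nn_integral_cong) (simp add: space_tensor_lborel num_crit_at_relabel[OF \<kappa> Z] gauss)
  also have "\<dots> = (\<integral>\<^sup>+v. ?f v \<partial>tensor_lborel)"
    unfolding relabel_def by (rule nn_integral_PiM_bij[OF sigma_finite_lborel finite_MI bij_betw_swap_slots[OF \<kappa>] fm])
  finally show ?thesis .
qed

text \<open>Listing \<open>ones\<close> first makes the leading summand of
  \<open>num_critical_points_eq_sum\<close> the one that has been computed.\<close>

lemma enumeration:
  obtains e where "bij_betw e {..<N} MI" "e 0 = ones" "N > 0"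
proof -
  have N0: "N > 0" using ones_MI finite_MI card_gt_0_iff by blast
  obtain k where k: "k < N" "ones = idx k" using MI_idx[OF ones_MI] by blast
  have "Transposition.transpose 0 k permutes {..<N}" using k N0 by (intro permutes_swap_id) auto
  then have "bij_betw (idx \<circ> Transposition.transpose 0 k) {..<N} MI"
    using bij_betw_trans[OF permutes_imp_bij idx(1)] by blast
  then show ?thesis using k N0 by (intro that[of "idx \<circ> Transposition.transpose 0 k"]) auto
qed

text \<open>Every critical point is counted at its first non-zero coordinate.\<close>

lemma num_critical_points_eq_sum:
  assumes e: "bij_betw e {..<N} MI"
  shows "num_critical_points p n v = (\<Sum>k<N. num_crit_at (e k) (e ` {..<k}) v)"
proof -
  define A where "A k = {x \<in> crit_pts v. x (e k) \<noteq> 0 \<and> (\<forall>\<beta>\<in>e ` {..<k}. x \<beta> = 0)}" for k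
  have "crit_pts v = (\<Union>k\<in>{..<N}. A k)"
  proof
    show "crit_pts v \<subseteq> (\<Union>k\<in>{..<N}. A k)"
    proof
      fix x assume x: "x \<in> crit_pts v"
      obtain \<alpha> where "\<alpha> \<in> MI" "x \<alpha> \<noteq> 0" using crit_pts_nonzero[OF x] by blast
      moreover from this have "\<alpha> \<in> e ` {..<N}" using e by (simp add: bij_betw_def)
      ultimately obtain k0 where k0: "k0 < N" "x (e k0) \<noteq> 0" by blast
      define k where "k = (LEAST k. x (e k) \<noteq> 0)"
      have "x (e k) \<noteq> 0" "k \<le> k0" "\<And>j. j < k \<Longrightarrow> x (e j) = 0"
        unfolding k_def using LeastI[of "\<lambda>k. x (e k) \<noteq> 0" k0] k0 by (auto intro: Least_le dest: not_less_Least)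
      then have "x \<in> A k" "k < N" using x k0 by (auto simp: A_def)
      then show "x \<in> (\<Union>k\<in>{..<N}. A k)" by blast
    qed
  qed (auto simp: A_def)
  moreover have "disjoint_family_on A {..<N}"
    unfolding disjoint_family_on_def
  proof safe
    fix i j x assume "i \<noteq> j" "x \<in> A i" "x \<in> A j"
    then show "x \<in> {}" by (cases i j rule: linorder_cases) (auto simp: A_def)
  qed
  then have "(\<Sum>k<N. emeasure (count_space UNIV) (A k)) = emeasure (count_space UNIV) (\<Union>k\<in>{..<N}. A k)"
    by (intro sum_emeasure) auto
  ultimately show ?thesis by (simp add: num_critical_points_def num_crit_at_def A_def)
qed

lemma num_critical_points_measurable: "num_critical_points p n \<in> borel_measurable tensor_lborel"
proof -
  obtain e where e: "bij_betw e {..<N} MI" using idx(1) by blast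
  have e1: "e k \<in> MI" if "k < N" for k using e that by (auto simp: bij_betw_def)
  have "(\<lambda>v. \<Sum>k<N. num_crit_at (e k) (e ` {..<k}) v) \<in> borel_measurable tensor_lborel"
    using e1 by (intro borel_measurable_sum measurable_num_crit_at) auto
  then show ?thesis by (simp add: num_critical_points_eq_sum[OF e, abs_def])
qed

text \<open>Only the summand with no vanishing conditions survives: a later chart counts critical
  points with a prescribed zero coordinate, and after relabelling
  \<open>integral_num_crit_at_ones_null\<close> applies to them.\<close>

lemma integral_num_critical_points:
  "(\<integral>\<^sup>+v. num_critical_points p n v * ennreal (gauss v) \<partial>tensor_lborel) = (\<integral>\<^sup>+v. num_crit_at ones {} v * ennreal (gauss v) \<partial>tensor_lborel)"
proof -
  obtain e where e: "bij_betw e {..<N} MI" "e 0 = ones" "N > 0" by (rule enumeration)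
  have e1: "e k \<in> MI" if "k < N" for k using e(1) that by (auto simp: bij_betw_def)
  have e2: "e ` {..<k} \<subseteq> MI" if "k < N" for k using e1 that by auto
  have "(\<integral>\<^sup>+v. num_critical_points p n v * ennreal (gauss v) \<partial>tensor_lborel) =
      (\<integral>\<^sup>+v. (\<Sum>k<N. num_crit_at (e k) (e ` {..<k}) v * ennreal (gauss v)) \<partial>tensor_lborel)"
    by (simp add: num_critical_points_eq_sum[OF e(1)] sum_distrib_right)
  also have "\<dots> = (\<Sum>k<N. \<integral>\<^sup>+v. num_crit_at (e k) (e ` {..<k}) v * ennreal (gauss v) \<partial>tensor_lborel)"
    using e1 e2 by (intro nn_integral_sum borel_measurable_times_ennreal measurable_num_crit_at measurable_gauss) auto
  also have "\<dots> = (\<Sum>k<N. if k = 0 then \<integral>\<^sup>+v. num_crit_at ones {} v * ennreal (gauss v) \<partial>tensor_lborel else 0)"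
  proof (rule sum.cong[OF refl])
    fix k assume k: "k \<in> {..<N}"
    show "(\<integral>\<^sup>+v. num_crit_at (e k) (e ` {..<k}) v * ennreal (gauss v) \<partial>tensor_lborel) =
      (if k = 0 then \<integral>\<^sup>+v. num_crit_at ones {} v * ennreal (gauss v) \<partial>tensor_lborel else 0)"
    proof (cases "k = 0")
      case True
      then show ?thesis by (simp add: e(2))
    next
      case False
      have "swap_slots (e k) ` e ` {..<k} \<subseteq> MI" using swap_slots_MI e1 k by auto
      \<comment> \<open>For \<open>k > 0\<close> the first centre \<open>ones\<close> is among the
        coordinates required to vanish; its image is the element of \<open>Z\<close> that makes the
        integral 0.\<close>
      moreover have "swap_slots (e k) ones \<in> swap_slots (e k) ` e ` {..<k}" using False e(2) by (auto intro!: imageI image_eqI[of _ e 0])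
      ultimately show ?thesis
        using False k integral_num_crit_at_relabel[OF e1 e2, of k k] integral_num_crit_at_ones_null by simp
    qed
  qed
  also have "\<dots> = (\<integral>\<^sup>+v. num_crit_at ones {} v * ennreal (gauss v) \<partial>tensor_lborel)" using e(3) by simp
  finally show ?thesis .
qed

text \<open>With \<open>m = n - p\<close>, where \<open>n\<close> is the sum of the
  \<open>n i\<close>, the constant is \<open>(2 * pi) powr (p / 2) * (2 * pi) powr - (n / 2) * pi
  powr (n / 2)\<close> divided by the Gamma values, and the powers of \<open>pi\<close> with
  exponent \<open>n / 2\<close> cancel.\<close>

lemma constant_eq:
  "(2 * pi) powr - (real m / 2) * (\<Prod>i=1..p. pi powr (real (n i) / 2) / Gamma (real (n i) / 2)) =
    (2 * pi) powr (real p / 2) / 2 powr (real (\<Sum>i=1..p. n i) / 2) * (1 / (\<Prod>i=1..p. Gamma (real (n i) / 2)))"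
proof -
  let ?n = "real (\<Sum>i=1..p. n i)"
  have "p \<le> (\<Sum>i=1..p. n i)"
    using sum_bounded_below[of "{1..p}" 1 n] n_pos by simp
  then have m: "real m = ?n - real p" by (simp add: m_eq of_nat_diff)
  have prod: "(\<Prod>i=1..p. pi powr (real (n i) / 2)) = pi powr (?n / 2)"
    by (simp add: powr_sum[symmetric] sum_divide_distrib)
  have "(2 * pi) powr - (real m / 2) = (2 * pi) powr (real p / 2) * (2 * pi) powr - (?n / 2)"
    unfolding m by (simp add: powr_add[symmetric] diff_divide_distrib)
  also have "(2 * pi) powr - (?n / 2) = 1 / (2 powr (?n / 2) * pi powr (?n / 2))"
    by (simp only: powr_minus_divide powr_mult)
  finally show ?thesis unfolding prod_dividef prod by simp
qed

end

theorem theorem1p1: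
  fixes p :: nat and n :: "nat \<Rightarrow> nat"
  assumes "p \<ge> 1" and "\<And>i. i \<in> {1..p} \<Longrightarrow> n i \<ge> 1"
  shows "num_critical_points p n \<in> borel_measurable (gaussian_tensor p n) \<and>
    integrable (mu_W1 p n) (\<lambda>w. \<bar>Determinant.det (block_matrix p n w)\<bar>) \<and>
    (\<integral>\<^sup>+ v. num_critical_points p n v \<partial>gaussian_tensor p n) =
      ennreal ((2 * pi) powr (real p / 2) / 2 powr (real (\<Sum>i=1..p. n i) / 2) *
        (1 / (\<Prod>i=1..p. Gamma (real (n i) / 2))) *
        (LINT w|mu_W1 p n. \<bar>Determinant.det (block_matrix p n w)\<bar>))"
proof -
  interpret tensor_format p n by unfold_locales (rule assms)+
  have "(\<integral>\<^sup>+ v. num_critical_points p n v \<partial>gaussian_tensor p n) =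
      (\<integral>\<^sup>+v. num_critical_points p n v * ennreal (gaussian_density p n v) \<partial>(\<Pi>\<^sub>M \<alpha>\<in>multi_index p n. lborel))"
    unfolding gaussian_tensor_def
    by (subst nn_integral_density[OF measurable_gauss num_critical_points_measurable]) (simp add: mult.commute)
  then have "(\<integral>\<^sup>+ v. num_critical_points p n v \<partial>gaussian_tensor p n) =
      ennreal ((2 * pi) powr (real p / 2) / 2 powr (real (\<Sum>i=1..p. n i) / 2) *
        (1 / (\<Prod>i=1..p. Gamma (real (n i) / 2))) *
        (LINT w|mu_W1 p n. \<bar>Determinant.det (block_matrix p n w)\<bar>))"
    unfolding integral_num_critical_points integral_num_crit_at_ones_empty constant_eq .
  moreover have "num_critical_points p n \<in> borel_measurable (gaussian_tensor p n)"
    using num_critical_points_measurable by (simp add: gaussian_tensor_def)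
  ultimately show ?thesis using integrable_det_block_matrix by blast
qed

end
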